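(* Let $L$ be a finite geometric lattice of rank $\ell\ge2$ with bottom $\hat 0$ and totally ordered atoms $a_1,\dots,a_n$, let $P=L\setminus\{\hat 0\}$, and let $p>0$. Let $\mathscr{OS}^p$ be the degree $p$ Orlik--Solomon sheaf over $\mathbb{Z}$ on $L$, restricted to $P$, and for $z\in L_p=\{x\in L\mid\operatorname{rank}(x)=p\}$ let $Q_z=\{x\in P\mid z\not\le x\}$. Let $\Lambda_z$, $\mathrm{NBC}^p(L_{\le z})$, $\beta\mathrm{NBC}(\Lambda_z)$ and the cycles $\omega_B$ be as defined in the context. Then \[ H_{\ell-1}(P;\mathscr{OS}^p)\cong\bigoplus_{z\in L_p}\mathrm{OS}^p(L_{\le z})\otimes_{\mathbb{Z}}\widetilde H_{\ell-2}(\Delta Q_z;\mathbb{Z}) \] is a free abelian group with basis \[ \{\overline{e_I}\otimes[\omega_B]\ \mid\ z\in L_p,\ A_I\in\mathrm{NBC}^p(L_{\le z}),\ B\in\beta\mathrm{NBC}(\Lambda_z)\}. \]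
   Context: All posets are finite. A geometric lattice is a ranked lattice that is atomic and semimodular. Write $L_{\le x}=\{y\in L\mid y\le x\}$, $L_{\ge x}=\{y\in L\mid y\ge x\}$. $\Delta Q$ denotes the order complex of a poset $Q$ (simplices are the nonempty finite chains), and $\widetilde H_*$ is reduced simplicial homology. Orlik--Solomon algebra: let $K$ be a geometric lattice with totally ordered atoms, and let $\bigwedge^\bullet E$ be the exterior algebra over $\mathbb{Z}$ on degree 1 generators $e_i$, one for each atom $a_i$. For $I=\{i_1<\cdots<i_k\}$ put $A_I=\{a_{i_1},\dots,a_{i_k}\}$, $e_I=e_{i_1}\cdots e_{i_k}$ and $\partial e_I=\sum_{j=1}^k(-1)^{j-1}e_{i_1}\cdots\widehat{e_{i_j}}\cdots e_{i_k}$. A set of atoms is independent if the rank of its join equals its cardinality; a circuit is a minimal dependent set of atoms. Then $\mathrm{OS}^\bullet(K)=\bigwedge^\bullet E/\langle \partial e_I\mid A_I\text{ is a circuit}\rangle$, with degree $p$ piece $\mathrm{OS}^p(K)$; $\overline{e_I}$ is the class of $e_I$. A broken circuit is a circuit with its smallest atom removed; a set of atoms is NBC if it contains no broken circuit; $\mathrm{NBC}^p(K)$ is the set of NBC sets of $p$ atoms of $K$. Orlik--Solomon sheaf: a sheaf on a poset is a contravariant functor to abelian groups. Set $\mathscr{OS}^p(x)=\mathrm{OS}^p(L_{\le x})$ for $x\in L$ (with the induced order on the atoms of $L_{\le x}$); for $x\le y$ the structure map $\mathscr{OS}^p(y)\to\mathscr{OS}^p(x)$ is the degree $p$ part of the (well-defined)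 surjective algebra homomorphism sending $e_i\mapsto e_i$ if $a_i\le x$ and $e_i\mapsto 0$ otherwise. Sheaf homology: for a sheaf $\mathscr{F}$ on $P$ with structure maps $\mathscr{F}^y_x:\mathscr{F}(y)\to\mathscr{F}(x)$ ($x\le y$), $H_*(P;\mathscr{F})$ denotes the left derived functors of the colimit; equivalently it is the homology of the complex $T_n(P;\mathscr{F})=\bigoplus_{x_n<\cdots<x_0}\mathscr{F}(x_0)$ with $d(s_\sigma)=\mathscr{F}^{x_0}_{x_1}(s)_{d_0\sigma}+\sum_{i=1}^n(-1)^i s_{d_i\sigma}$, where $s_\sigma$ is $s\in\mathscr F(x_0)$ placed in the summand of $\sigma=(x_n<\cdots<x_0)$ and $d_i\sigma$ deletes $x_i$. Completion: for $z\in L_p$ put $I_z=Q_z\cup\{\hat 0\}=L\setminus L_{\ge z}$. This is a geometric semilattice of rank $\ell-1$, and by a theorem of Wachs and Walker there is a geometric lattice $\Lambda_z$ (of rank $\ell$) and an atom $\gamma_z$ of $\Lambda_z$, unique up to isomorphism, with $I_z\cong\{u\in\Lambda_z\mid\gamma_z\not\le u\}$; identify $I_z$ with this subposet. The atoms of $\Lambda_z$ are $\gamma_z$ and the atoms of $I_z$; order them by putting $\gamma_z$ first, followed by the atoms of $I_z$ in the order inherited from $L$. $\beta$-NBC bases: a basis of $\Lambda_z$ is an independent set $B$ of $\ell$ atoms. An atom $a\notin B$ is externally active if $a$ is the minimum of the unique circuit contained in $B\cup\{a\}$. An atom $b\in B$ is internally active if $b$ is the minimum of $\{a \text{ an atom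 of }\Lambda_z\mid (B\setminus\{b\})\cup\{a\}\text{ is a basis}\}$. $\beta\mathrm{NBC}(\Lambda_z)$ is the set of bases $B$ with no externally active atoms and with $\gamma_z$ as the only internally active atom. Cycles $\omega_B$: for $B=\{b_1,\dots,b_{\ell-1},\gamma_z\}\in\beta\mathrm{NBC}(\Lambda_z)$ with $b_1>b_2>\cdots>b_{\ell-1}$ in the atom order, let $c_B$ be the maximal chain $b_1<b_1\vee b_2<\cdots<b_1\vee\cdots\vee b_{\ell-1}$ of $Q_z$, an $(\ell-2)$-simplex of $\Delta Q_z$ oriented by the order of the chain. By results of Ziegler and Björner, $\Delta Q_z$ has a shelling whose homology facets are exactly the $c_B$, $B\in\beta\mathrm{NBC}(\Lambda_z)$; $\{\omega_B\}$ is the associated family of basic cycles: $\omega_B$ is the unique (reduced) simplicial $(\ell-2)$-cycle of $\Delta Q_z$ over $\mathbb{Z}$ whose coefficient at $c_B$ is $1$ and whose coefficient at $c_{B'}$ is $0$ for all $B'\in\beta\mathrm{NBC}(\Lambda_z)$, $B'\ne B$. *)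

theory Defs
  imports "HOL-Algebra.Algebra"
begin

section \<open>Geometric lattices\<close>

text \<open>
  A poset is a \<open>'a gorder\<close>; a subposet is obtained by shrinking the carrier.
\<close>

definition chain_in :: "'a gorder \<Rightarrow> 'a set \<Rightarrow> bool"
  where "chain_in L C \<longleftrightarrow>
    C \<subseteq> carrier L \<and> (\<forall>x\<in>C. \<forall>y\<in>C. x \<sqsubseteq>\<^bsub>L\<^esub> y \<or> y \<sqsubseteq>\<^bsub>L\<^esub> x)"

definition covered_by :: "'a gorder \<Rightarrow> 'a \<Rightarrow> 'a \<Rightarrow> bool"
  where "covered_by L x y \<longleftrightarrow> x \<in> carrier L \<and> y \<in> carrier L \<and> x \<sqsubset>\<^bsub>L\<^esub> y \<and>
    \<not> (\<exists>u\<in>carrier L. x \<sqsubset>\<^bsub>L\<^esub> u \<and> u \<sqsubset>\<^bsub>L\<^esub> y)"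

text \<open>
  The rank of \<open>x\<close> is the maximal length \<open>k\<close> of a chain \<open>x\<^sub>0 < \<dots> < x\<^sub>k = x\<close>;
  below, \<open>C\<close> is such a chain without its top element.
\<close>

definition rank_of :: "'a gorder \<Rightarrow> 'a \<Rightarrow> nat"
  where "rank_of L x = Max {card C | C. chain_in L C \<and> (\<forall>y\<in>C. y \<sqsubset>\<^bsub>L\<^esub> x)}"

definition rank_poset :: "'a gorder \<Rightarrow> nat"
  where "rank_poset L = rank_of L \<top>\<^bsub>L\<^esub>"

definition rank_level :: "'a gorder \<Rightarrow> nat \<Rightarrow> 'a set"
  where "rank_level L p = {x \<in> carrier L. rank_of L x = p}"

definition atoms :: "'a gorder \<Rightarrow> 'a set"
  where "atoms L = {a. covered_by L \<bottom>\<^bsub>L\<^esub> a}"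

definition geometric_lattice :: "'a gorder \<Rightarrow> bool"
  where "geometric_lattice L \<longleftrightarrow>
    lattice L \<and> finite (carrier L) \<and> carrier L \<noteq> {} \<and>
    (\<forall>x y. covered_by L x y \<longrightarrow> rank_of L y = Suc (rank_of L x)) \<and>
    (\<forall>x\<in>carrier L. \<exists>A \<subseteq> atoms L. x = \<Squnion>\<^bsub>L\<^esub>A) \<and>
    (\<forall>x\<in>carrier L. \<forall>y\<in>carrier L.
       rank_of L (x \<squnion>\<^bsub>L\<^esub> y) + rank_of L (x \<sqinter>\<^bsub>L\<^esub> y) \<le> rank_of L x + rank_of L y)"

definition below :: "'a gorder \<Rightarrow> 'a \<Rightarrow> 'a gorder"
  where "below L x = L\<lparr>carrier := {y \<in> carrier L. y \<sqsubseteq>\<^bsub>L\<^esub> x}\<rparr>"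

definition without_bottom :: "'a gorder \<Rightarrow> 'a gorder"
  where "without_bottom L = L\<lparr>carrier := carrier L - {\<bottom>\<^bsub>L\<^esub>}\<rparr>"

definition not_above :: "'a gorder \<Rightarrow> 'a \<Rightarrow> 'a gorder"
  where "not_above L z = L\<lparr>carrier := {x \<in> carrier L. \<not> z \<sqsubseteq>\<^bsub>L\<^esub> x}\<rparr>"


section \<open>Independent sets, circuits, NBC sets\<close>

text \<open>
  A total order on the atoms is given by the list \<open>as\<close> of all atoms in increasing order.
\<close>

definition atom_order :: "'a gorder \<Rightarrow> 'a list \<Rightarrow> bool"
  where "atom_order L as \<longleftrightarrow> distinct as \<and> set as = atoms L"

definition list_min :: "'a list \<Rightarrow> 'a set \<Rightarrow> 'a"
  where "list_min as A = hd (filter (\<lambda>a. a \<in> A) as)"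

definition independent :: "'a gorder \<Rightarrow> 'a set \<Rightarrow> bool"
  where "independent L A \<longleftrightarrow> A \<subseteq> atoms L \<and> rank_of L (\<Squnion>\<^bsub>L\<^esub>A) = card A"

definition circuit :: "'a gorder \<Rightarrow> 'a set \<Rightarrow> bool"
  where "circuit L C \<longleftrightarrow>
    C \<subseteq> atoms L \<and> \<not> independent L C \<and> (\<forall>D. D \<subset> C \<longrightarrow> independent L D)"

definition broken_circuit :: "'a gorder \<Rightarrow> 'a list \<Rightarrow> 'a set \<Rightarrow> bool"
  where "broken_circuit L as D \<longleftrightarrow> (\<exists>C. circuit L C \<and> D = C - {list_min as C})"

definition NBC :: "'a gorder \<Rightarrow> 'a list \<Rightarrow> nat \<Rightarrow> 'a set set"
  where "NBC L as p =
    {A. A \<subseteq> atoms L \<and> card A = p \<and> \<not> (\<exists>D. broken_circuit L as D \<and> D \<subseteq> A)}"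

definition lattice_basis :: "'a gorder \<Rightarrow> 'a set \<Rightarrow> bool"
  where "lattice_basis L B \<longleftrightarrow> independent L B \<and> card B = rank_poset L"

definition externally_active :: "'a gorder \<Rightarrow> 'a list \<Rightarrow> 'a set \<Rightarrow> 'a \<Rightarrow> bool"
  where "externally_active L as B a \<longleftrightarrow>
    a \<in> atoms L \<and> a \<notin> B \<and> a = list_min as (THE C. circuit L C \<and> C \<subseteq> insert a B)"

definition internally_active :: "'a gorder \<Rightarrow> 'a list \<Rightarrow> 'a set \<Rightarrow> 'a \<Rightarrow> bool"
  where "internally_active L as B b \<longleftrightarrow>
    b \<in> B \<and> b = list_min as {a \<in> atoms L. lattice_basis L (insert a (B - {b}))}"

definition betaNBC :: "'a gorder \<Rightarrow> 'a list \<Rightarrow> 'a \<Rightarrow> 'a set set"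
  where "betaNBC L as g =
    {B. lattice_basis L B \<and> \<not> (\<exists>a. externally_active L as B a) \<and>
        {b. internally_active L as B b} = {g}}"


section \<open>The Orlik--Solomon algebra\<close>

text \<open>
  The exterior algebra over the integers on generators indexed by \<open>as\<close> is realised on its
  standard basis: \<open>frag_of I\<close> is the increasing product \<open>e\<^sub>I\<close>, and \<open>e\<^sub>I e\<^sub>J\<close> is \<open>0\<close> if
  \<open>I\<close> and \<open>J\<close> meet, and otherwise \<open>e\<close> of the union, with the sign given by the number of
  pairs that have to be interchanged to sort the product.
\<close>

definition before :: "'a list \<Rightarrow> 'a \<Rightarrow> 'a \<Rightarrow> bool"
  where "before as a b \<longleftrightarrow> (\<exists>i j. i < j \<and> j < length as \<and> as ! i = a \<and> as ! j = b)"

definition ext_mult :: "'a list \<Rightarrow> ('a set \<Rightarrow>\<^sub>0 int) \<Rightarrow> ('a set \<Rightarrow>\<^sub>0 int) \<Rightarrow> ('a set \<Rightarrow>\<^sub>0 int)"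
  where "ext_mult as x y =
    frag_extend (\<lambda>I. frag_extend (\<lambda>J.
      if I \<inter> J = {}
      then frag_cmul ((-1) ^ card {(a, b). a \<in> I \<and> b \<in> J \<and> before as b a}) (frag_of (I \<union> J))
      else 0) y) x"

definition exterior_algebra :: "'a list \<Rightarrow> ('a set \<Rightarrow>\<^sub>0 int) ring"
  where "exterior_algebra as =
    \<lparr>carrier = {x. Poly_Mapping.keys x \<subseteq> Pow (set as)},
     monoid.mult = ext_mult as, one = frag_of {}, ring.zero = 0, ring.add = (+)\<rparr>"

definition ext_boundary :: "'a list \<Rightarrow> 'a set \<Rightarrow> ('a set \<Rightarrow>\<^sub>0 int)"
  where "ext_boundary as I =
    (let xs = filter (\<lambda>a. a \<in> I) as
     in \<Sum>j<length xs. frag_cmul ((-1) ^ j) (frag_of (I - {xs ! j})))"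

definition OS_ideal :: "'a gorder \<Rightarrow> 'a list \<Rightarrow> ('a set \<Rightarrow>\<^sub>0 int) set"
  where "OS_ideal L as = Idl\<^bsub>exterior_algebra as\<^esub> {ext_boundary as C | C. circuit L C}"

definition OS_algebra :: "'a gorder \<Rightarrow> 'a list \<Rightarrow> ('a set \<Rightarrow>\<^sub>0 int) set ring"
  where "OS_algebra L as = exterior_algebra as Quot OS_ideal L as"

definition OS_class :: "'a gorder \<Rightarrow> 'a list \<Rightarrow> ('a set \<Rightarrow>\<^sub>0 int) \<Rightarrow> ('a set \<Rightarrow>\<^sub>0 int) set"
  where "OS_class L as x = OS_ideal L as +>\<^bsub>exterior_algebra as\<^esub> x"

definition OS_degree :: "'a gorder \<Rightarrow> 'a list \<Rightarrow> nat \<Rightarrow> ('a set \<Rightarrow>\<^sub>0 int) set monoid"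
  where "OS_degree L as p =
    (add_monoid (OS_algebra L as))
      \<lparr>carrier := OS_class L as ` {x \<in> carrier (exterior_algebra as).
                                    \<forall>I\<in>Poly_Mapping.keys x. card I = p}\<rparr>"


section \<open>Sheaves on posets and their homology\<close>

text \<open>
  A sheaf is given by groups \<open>F x\<close> and structure maps \<open>r y x :: F y \<rightarrow> F x\<close> for \<open>x \<le> y\<close>.
  Abelian groups are written multiplicatively, as elsewhere in \<open>HOL-Algebra\<close>.
\<close>

definition OS_sheaf :: "'a gorder \<Rightarrow> 'a list \<Rightarrow> nat \<Rightarrow> 'a \<Rightarrow> ('a set \<Rightarrow>\<^sub>0 int) set monoid"
  where "OS_sheaf L as p x = OS_degree (below L x) (filter (\<lambda>a. a \<sqsubseteq>\<^bsub>L\<^esub> x) as) p"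

text \<open>
  On exterior algebras the homomorphism killing the generators not below \<open>x\<close> keeps the
  monomials \<open>e\<^sub>I\<close> all of whose factors are below \<open>x\<close> and kills the others; on a coset \<open>U\<close>
  all representatives have the same image.
\<close>

definition OS_restrict ::
  "'a gorder \<Rightarrow> 'a list \<Rightarrow> 'a \<Rightarrow> 'a \<Rightarrow> ('a set \<Rightarrow>\<^sub>0 int) set \<Rightarrow> ('a set \<Rightarrow>\<^sub>0 int) set"
  where "OS_restrict L as y x U =
    the_elem ((\<lambda>w. OS_class (below L x) (filter (\<lambda>a. a \<sqsubseteq>\<^bsub>L\<^esub> x) as)
                     (frag_extend (\<lambda>I. if \<forall>a\<in>I. a \<sqsubseteq>\<^bsub>L\<^esub> x then frag_of I else 0) w)) ` U)"

definition delete_nth :: "nat \<Rightarrow> 'a list \<Rightarrow> 'a list"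
  where "delete_nth i xs = take i xs @ drop (Suc i) xs"

definition sum_inj :: "'i set \<Rightarrow> ('i \<Rightarrow> 'g monoid) \<Rightarrow> 'i \<Rightarrow> 'g \<Rightarrow> ('i \<Rightarrow> 'g)"
  where "sum_inj I G i g = (\<lambda>j\<in>I. if j = i then g else \<one>\<^bsub>G j\<^esub>)"

text \<open>Lists \<open>[x\<^sub>0, \<dots>, x\<^sub>n]\<close> with \<open>x\<^sub>n < \<dots> < x\<^sub>0\<close>.\<close>

definition decreasing_chains :: "'a gorder \<Rightarrow> nat \<Rightarrow> 'a list set"
  where "decreasing_chains P n =
    {xs. length xs = Suc n \<and> set xs \<subseteq> carrier P \<and> sorted_wrt (\<lambda>x y. y \<sqsubset>\<^bsub>P\<^esub> x) xs}"

definition sheaf_chain_group :: "'a gorder \<Rightarrow> ('a \<Rightarrow> 'g monoid) \<Rightarrow> nat \<Rightarrow> ('a list \<Rightarrow> 'g) monoid"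
  where "sheaf_chain_group P F n = sum_group (decreasing_chains P n) (\<lambda>xs. F (hd xs))"

text \<open>The differential from degree \<open>n\<close> to degree \<open>n - 1\<close>, for \<open>n > 0\<close>.\<close>

definition sheaf_differential ::
  "'a gorder \<Rightarrow> ('a \<Rightarrow> 'g monoid) \<Rightarrow> ('a \<Rightarrow> 'a \<Rightarrow> 'g \<Rightarrow> 'g) \<Rightarrow> nat \<Rightarrow> ('a list \<Rightarrow> 'g) \<Rightarrow> ('a list \<Rightarrow> 'g)"
  where "sheaf_differential P F r n s =
    (let T = sheaf_chain_group P F (n - 1);
         inj = sum_inj (decreasing_chains P (n - 1)) (\<lambda>xs. F (hd xs))
     in \<Otimes>\<^bsub>T\<^esub>xs\<in>decreasing_chains P n.
          inj (delete_nth 0 xs) (r (xs ! 0) (xs ! 1) (s xs)) \<otimes>\<^bsub>T\<^esub>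
          (\<Otimes>\<^bsub>T\<^esub>i\<in>{1..n}. inj (delete_nth i xs) (s xs [^]\<^bsub>F (xs ! 0)\<^esub> ((-1) ^ i :: int))))"

definition sheaf_cycles ::
  "'a gorder \<Rightarrow> ('a \<Rightarrow> 'g monoid) \<Rightarrow> ('a \<Rightarrow> 'a \<Rightarrow> 'g \<Rightarrow> 'g) \<Rightarrow> nat \<Rightarrow> ('a list \<Rightarrow> 'g) monoid"
  where "sheaf_cycles P F r n =
    (sheaf_chain_group P F n)
      \<lparr>carrier := (if n = 0 then carrier (sheaf_chain_group P F 0)
                   else kernel (sheaf_chain_group P F n) (sheaf_chain_group P F (n - 1))
                          (sheaf_differential P F r n))\<rparr>"

definition sheaf_homology ::
  "'a gorder \<Rightarrow> ('a \<Rightarrow> 'g monoid) \<Rightarrow> ('a \<Rightarrow> 'a \<Rightarrow> 'g \<Rightarrow> 'g) \<Rightarrow> nat \<Rightarrow> ('a list \<Rightarrow> 'g) set monoid"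
  where "sheaf_homology P F r n =
    sheaf_cycles P F r n Mod
      (sheaf_differential P F r (Suc n) ` carrier (sheaf_chain_group P F (Suc n)))"


section \<open>Reduced homology of the order complex\<close>

text \<open>
  A simplex of the order complex is a finite chain, oriented by the order: a strictly increasing
  list. The index \<open>m\<close> is the number of vertices, so that \<open>m = 0\<close> is the augmentation term and
  homological degree \<open>k \<ge> 0\<close> corresponds to \<open>m = k + 1\<close>.
\<close>

definition increasing_chains :: "'a gorder \<Rightarrow> nat \<Rightarrow> 'a list set"
  where "increasing_chains Q m =
    {xs. length xs = m \<and> set xs \<subseteq> carrier Q \<and> sorted_wrt (\<lambda>x y. x \<sqsubset>\<^bsub>Q\<^esub> y) xs}"

definition order_complex_chains :: "'a gorder \<Rightarrow> nat \<Rightarrow> ('a list \<Rightarrow>\<^sub>0 int) monoid"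
  where "order_complex_chains Q m = free_Abelian_group (increasing_chains Q m)"

definition simplicial_boundary :: "('a list \<Rightarrow>\<^sub>0 int) \<Rightarrow> ('a list \<Rightarrow>\<^sub>0 int)"
  where "simplicial_boundary =
    frag_extend (\<lambda>xs. \<Sum>i<length xs. frag_cmul ((-1) ^ i) (frag_of (delete_nth i xs)))"

definition reduced_cycles :: "'a gorder \<Rightarrow> nat \<Rightarrow> ('a list \<Rightarrow>\<^sub>0 int) monoid"
  where "reduced_cycles Q k =
    (order_complex_chains Q (k + 1))
      \<lparr>carrier := kernel (order_complex_chains Q (k + 1)) (order_complex_chains Q k)
                    simplicial_boundary\<rparr>"

definition reduced_boundaries :: "'a gorder \<Rightarrow> nat \<Rightarrow> ('a list \<Rightarrow>\<^sub>0 int) set"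
  where "reduced_boundaries Q k =
    simplicial_boundary ` carrier (order_complex_chains Q (k + 2))"

definition reduced_homology :: "'a gorder \<Rightarrow> nat \<Rightarrow> ('a list \<Rightarrow>\<^sub>0 int) set monoid"
  where "reduced_homology Q k = reduced_cycles Q k Mod reduced_boundaries Q k"

definition homology_class :: "'a gorder \<Rightarrow> nat \<Rightarrow> ('a list \<Rightarrow>\<^sub>0 int) \<Rightarrow> ('a list \<Rightarrow>\<^sub>0 int) set"
  where "homology_class Q k c = reduced_boundaries Q k #>\<^bsub>reduced_cycles Q k\<^esub> c"


section \<open>Tensor products and bases of abelian groups\<close>

definition tensor_relations ::
  "'g monoid \<Rightarrow> 'h monoid \<Rightarrow> ('g \<times> 'h \<Rightarrow>\<^sub>0 int) set"
  where "tensor_relations G H =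
    {frag_of (x \<otimes>\<^bsub>G\<^esub> x', y) - frag_of (x, y) - frag_of (x', y) | x x' y.
       x \<in> carrier G \<and> x' \<in> carrier G \<and> y \<in> carrier H} \<union>
    {frag_of (x, y \<otimes>\<^bsub>H\<^esub> y') - frag_of (x, y) - frag_of (x, y') | x y y'.
       x \<in> carrier G \<and> y \<in> carrier H \<and> y' \<in> carrier H}"

definition tensor_kernel :: "'g monoid \<Rightarrow> 'h monoid \<Rightarrow> ('g \<times> 'h \<Rightarrow>\<^sub>0 int) set"
  where "tensor_kernel G H =
    generate (free_Abelian_group (carrier G \<times> carrier H)) (tensor_relations G H)"

definition tensor_group :: "'g monoid \<Rightarrow> 'h monoid \<Rightarrow> ('g \<times> 'h \<Rightarrow>\<^sub>0 int) set monoid"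
  where "tensor_group G H =
    free_Abelian_group (carrier G \<times> carrier H) Mod tensor_kernel G H"

definition pure_tensor :: "'g monoid \<Rightarrow> 'h monoid \<Rightarrow> 'g \<Rightarrow> 'h \<Rightarrow> ('g \<times> 'h \<Rightarrow>\<^sub>0 int) set"
  where "pure_tensor G H x y =
    tensor_kernel G H #>\<^bsub>free_Abelian_group (carrier G \<times> carrier H)\<^esub> frag_of (x, y)"

text \<open>\<open>G\<close> is free abelian with basis the family \<open>b i\<close>, \<open>i \<in> U\<close>.\<close>

definition free_with_basis :: "'g monoid \<Rightarrow> 'i set \<Rightarrow> ('i \<Rightarrow> 'g) \<Rightarrow> bool"
  where "free_with_basis G U b \<longleftrightarrow>
    (\<exists>h\<in>iso (free_Abelian_group U) G. \<forall>i\<in>U. h (frag_of i) = b i)"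


section \<open>Completions and the cycles omega\<close>

text \<open>
  By Wachs and Walker a completion of the geometric semilattice \<open>not_above L z\<close> exists and is
  unique up to isomorphism. The identification of \<open>not_above L z\<close> with a subposet of
  the completion \<open>M\<close> is the order isomorphism \<open>f\<close>; \<open>g\<close> is the additional atom.
  A model is the lattice of flats of the principal extension of the matroid of \<open>L\<close> by \<open>z\<close>:
  in the product order, all \<open>(x, False)\<close> with \<open>\<not> z \<le> x\<close> together with all
  \<open>(x, True)\<close> such that \<open>z \<le> x\<close> or no element covering \<open>x\<close> is above \<open>z\<close>.
\<close>

definition is_completion :: "'a gorder \<Rightarrow> 'a \<Rightarrow> 'b gorder \<Rightarrow> 'b \<Rightarrow> ('a \<Rightarrow> 'b) \<Rightarrow> bool"
  where "is_completion L z M g f \<longleftrightarrow>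
    geometric_lattice M \<and> rank_poset M = rank_poset L \<and> g \<in> atoms M \<and>
    bij_betw f (carrier (not_above L z)) {u \<in> carrier M. \<not> g \<sqsubseteq>\<^bsub>M\<^esub> u} \<and>
    (\<forall>x\<in>carrier (not_above L z). \<forall>y\<in>carrier (not_above L z).
       x \<sqsubseteq>\<^bsub>L\<^esub> y \<longleftrightarrow> f x \<sqsubseteq>\<^bsub>M\<^esub> f y)"

definition completion_atom_order ::
  "'a gorder \<Rightarrow> 'a list \<Rightarrow> 'a \<Rightarrow> 'b \<Rightarrow> ('a \<Rightarrow> 'b) \<Rightarrow> 'b list"
  where "completion_atom_order L as z g f = g # map f (filter (\<lambda>a. \<not> z \<sqsubseteq>\<^bsub>L\<^esub> a) as)"

text \<open>
  The chain \<open>b\<^sub>1 < b\<^sub>1 \<squnion> b\<^sub>2 < \<dots>\<close> for \<open>b\<^sub>1, b\<^sub>2, \<dots>\<close> the atoms of \<open>B\<close> other than \<open>g\<close>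
  in decreasing order.
\<close>

definition facet_chain :: "'a gorder \<Rightarrow> 'a list \<Rightarrow> 'a \<Rightarrow> ('a \<Rightarrow> 'b) \<Rightarrow> 'b set \<Rightarrow> 'a list"
  where "facet_chain L as z f B =
    (let bs = rev (filter (\<lambda>a. \<not> z \<sqsubseteq>\<^bsub>L\<^esub> a \<and> f a \<in> B) as)
     in map (\<lambda>k. \<Squnion>\<^bsub>L\<^esub>(set (take (Suc k) bs))) [0..<length bs])"

definition Q_poset :: "'a gorder \<Rightarrow> 'a \<Rightarrow> 'a gorder"
  where "Q_poset L z = not_above (without_bottom L) z"

definition omega_cycle ::
  "'a gorder \<Rightarrow> 'a list \<Rightarrow> 'a \<Rightarrow> 'b gorder \<Rightarrow> 'b \<Rightarrow> ('a \<Rightarrow> 'b) \<Rightarrow> 'b set \<Rightarrow> ('a list \<Rightarrow>\<^sub>0 int)"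
  where "omega_cycle L as z M g f B =
    (THE c. c \<in> carrier (reduced_cycles (Q_poset L z) (rank_poset L - 2)) \<and>
       (\<forall>B'\<in>betaNBC M (completion_atom_order L as z g f) g.
          Poly_Mapping.lookup c (facet_chain L as z f B') = (if B' = B then 1 else 0)))"


section \<open>The direct sum and its basis\<close>

definition OS_tensor_summand ::
  "'a gorder \<Rightarrow> 'a list \<Rightarrow> nat \<Rightarrow> 'a \<Rightarrow> (('a set \<Rightarrow>\<^sub>0 int) set \<times> ('a list \<Rightarrow>\<^sub>0 int) set \<Rightarrow>\<^sub>0 int) set monoid"
  where "OS_tensor_summand L as p z =
    tensor_group (OS_sheaf L as p z) (reduced_homology (Q_poset L z) (rank_poset L - 2))"

definition basis_index ::
  "'a gorder \<Rightarrow> 'a list \<Rightarrow> nat \<Rightarrow> ('a \<Rightarrow> 'b gorder) \<Rightarrow> ('a \<Rightarrow> 'b) \<Rightarrow> ('a \<Rightarrow> 'a \<Rightarrow> 'b) \<Rightarrow>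
   ('a \<times> 'a set \<times> 'b set) set"
  where "basis_index L as p M g f =
    (SIGMA z : rank_level L p.
       NBC (below L z) (filter (\<lambda>a. a \<sqsubseteq>\<^bsub>L\<^esub> z) as) p \<times>
       betaNBC (M z) (completion_atom_order L as z (g z) (f z)) (g z))"

definition basis_tensor ::
  "'a gorder \<Rightarrow> 'a list \<Rightarrow> nat \<Rightarrow> ('a \<Rightarrow> 'b gorder) \<Rightarrow> ('a \<Rightarrow> 'b) \<Rightarrow> ('a \<Rightarrow> 'a \<Rightarrow> 'b) \<Rightarrow>
   'a \<times> 'a set \<times> 'b set \<Rightarrow>
   ('a \<Rightarrow> (('a set \<Rightarrow>\<^sub>0 int) set \<times> ('a list \<Rightarrow>\<^sub>0 int) set \<Rightarrow>\<^sub>0 int) set)"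
  where "basis_tensor L as p M g f = (\<lambda>(z, I, B).
    sum_inj (rank_level L p) (OS_tensor_summand L as p) z
      (pure_tensor (OS_sheaf L as p z) (reduced_homology (Q_poset L z) (rank_poset L - 2))
         (OS_class (below L z) (filter (\<lambda>a. a \<sqsubseteq>\<^bsub>L\<^esub> z) as) (frag_of I))
         (homology_class (Q_poset L z) (rank_poset L - 2)
            (omega_cycle L as z (M z) (g z) (f z) B))))"

end

theory Submission
  imports Defs "HOL-Library.List_Lexorder"
begin

text \<open>
  Write a sheaf chain of top degree in the NBC basis of \<open>OS\<^sup>p(L)\<close>: its coefficient at \<open>e\<^sub>I\<close> is an
  integral combination of flags below the top element. Deleting the top element of a flag
  restricts to a lower interval, which kills \<open>e\<^sub>I\<close> exactly outside the filter of \<open>z = \<Squnion>I\<close>; so this part of the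
  differential vanishes iff the coefficients are supported on \<open>Q\<^sub>z\<close>, and the rest vanishes iff they are
  cycles there. As there are no chains above top degree, the homology is the sum over \<open>z\<close> and the NBC sets
  of \<open>z\<close> of the top cycles of \<open>Q\<^sub>z\<close>.

  NBC monomials span since broken circuits can be rewritten; they are independent since for every NBC
  set \<open>I\<close> the homomorphism identifying atoms that appear at the same step of the flag of \<open>I\<close> kills
  the Orlik--Solomon ideal and separates \<open>e\<^sub>I\<close> from the other NBC monomials. Finally, \<open>Q\<^sub>z\<close>
  is the set of nonzero elements not above an atom of the completion. A lexicographic order of its
  maximal chains is a shelling whose homology facets are the chains \<open>c\<^sub>B\<close>, and a top cycle
  is determined by arbitrarily prescribed values on the homology facets.
\<close>

section \<open>Geometric lattices\<close>

text \<open>Three points shape the argument. In top degree every chain starts at the top element, so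
  all coefficients lie in the single group OS^p(L), where one NBC basis serves throughout; and the
  two parts of the differential land in disjoint sets of chains, those that still start at the top
  and those that do not, so they have to vanish separately. Over the integers a count of ranks would
  not produce a basis. The shelling is therefore used algebraically: a cycle on the ridges of an
  initial segment is filled without any homology facet, each coefficient being solved for with a
  sign and never by division. This yields integral cycles dual to the homology facets, which is how
  the cycles omega are specified. The completion is arbitrary and enters only through an order
  isomorphism between complements of filters. Hence the shelling is built in any geometric lattice
  with a distinguished first atom and pulled back; joins in the two lattices correspond only as long
  as they stay inside these complements.\<close>

locale geometric =
  fixes L :: "'a gorder" (structure)
  assumes geo: "geometric_lattice L"

sublocale geometric \<subseteq> lattice L
  using geo by (simp add: geometric_lattice_def)

sublocale geometric \<subseteq> bounded_lattice L
proof unfold_locales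
  have fin: "finite (carrier L)" and ne: "carrier L \<noteq> {}"
    using geo by (auto simp: geometric_lattice_def)
  have "greatest L (\<Sqinter>carrier L) (Lower L (carrier L))"
    by (rule finite_inf_greatest) (use fin ne in auto)
  then have "least L (\<Sqinter>carrier L) (carrier L)"
    unfolding greatest_def least_def Lower_def by blast
  then show "\<exists>x. least L x (carrier L)" ..
  have "least L (\<Squnion>carrier L) (Upper L (carrier L))"
    by (rule finite_sup_least) (use fin ne in auto)
  then have "greatest L (\<Squnion>carrier L) (carrier L)"
    unfolding greatest_def least_def Upper_def by blast
  then show "\<exists>x. greatest L x (carrier L)" ..
qed

context geometric
begin

declare le_antisym [rule del] weak_le_antisym [rule del] le_cong_l [rule del] le_cong_r [rule del]
  weak_refl [rule del]

lemma finite_carrier: "finite (carrier L)"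
  using geo by (simp add: geometric_lattice_def)

lemma less_iff: "x \<sqsubset> y \<longleftrightarrow> x \<sqsubseteq> y \<and> x \<noteq> y"
  by (simp add: lless_eq)

text \<open>Finite nonempty sets have joins in any lattice. The empty set is bounded by every
  element, so \<open>\<bottom>\<close> is a least upper bound of it, and this is all that the choice
  of a join needs.\<close>

lemma sup_is_lub: "A \<subseteq> carrier L \<Longrightarrow> least L (\<Squnion>A) (Upper L A)"
proof (cases "A = {}")
  case True
  have "least L \<bottom> (Upper L {})"
    by (simp add: bottom_least)
  then have "least L (SOME x. least L x (Upper L {})) (Upper L {})"
    by (rule someI)
  then show ?thesis
    using True by (simp add: sup_def)
next
  case False
  assume "A \<subseteq> carrier L"
  with False show ?thesis
    by (intro finite_sup_least) (auto intro: finite_subset[OF _ finite_carrier])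
qed

lemma sup_in [simp, intro]: "A \<subseteq> carrier L \<Longrightarrow> \<Squnion>A \<in> carrier L"
  by (rule least_closed[OF sup_is_lub])

lemma sup_ge: "A \<subseteq> carrier L \<Longrightarrow> a \<in> A \<Longrightarrow> a \<sqsubseteq> \<Squnion>A"
  by (rule least_Upper_above[OF sup_is_lub])

lemma sup_le: "A \<subseteq> carrier L \<Longrightarrow> u \<in> carrier L \<Longrightarrow> (\<And>a. a \<in> A \<Longrightarrow> a \<sqsubseteq> u) \<Longrightarrow> \<Squnion>A \<sqsubseteq> u"
  using sup_is_lub[of A] least_le[of L "\<Squnion>A" "Upper L A" u] by (auto simp: Upper_def)

lemma sup_le_iff:
  assumes "A \<subseteq> carrier L" "u \<in> carrier L"
  shows "\<Squnion>A \<sqsubseteq> u \<longleftrightarrow> (\<forall>a\<in>A. a \<sqsubseteq> u)"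
proof
  assume le: "\<Squnion>A \<sqsubseteq> u"
  show "\<forall>a\<in>A. a \<sqsubseteq> u"
  proof
    fix a assume "a \<in> A"
    then show "a \<sqsubseteq> u"
      using le_trans[OF sup_ge[OF assms(1) \<open>a \<in> A\<close>] le] assms sup_in[of A] by blast
  qed
qed (use assms sup_le[of A u] in auto)

lemma sup_mono: "A \<subseteq> B \<Longrightarrow> B \<subseteq> carrier L \<Longrightarrow> \<Squnion>A \<sqsubseteq> \<Squnion>B"
  by (rule sup_le) (auto intro: sup_ge)

lemma sup_empty: "\<Squnion>{} = \<bottom>"
  by (rule le_antisym) (auto intro: sup_le)

lemma sup_Un:
  assumes "A \<subseteq> carrier L" "B \<subseteq> carrier L"
  shows "\<Squnion>(A \<union> B) = \<Squnion>A \<squnion> \<Squnion>B"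
proof (rule le_antisym)
  have c: "\<Squnion>A \<in> carrier L" "\<Squnion>B \<in> carrier L" "\<Squnion>A \<squnion> \<Squnion>B \<in> carrier L" "A \<union> B \<subseteq> carrier L"
    using assms by auto
  show "\<Squnion>(A \<union> B) \<sqsubseteq> \<Squnion>A \<squnion> \<Squnion>B"
  proof (rule sup_le)
    fix x assume "x \<in> A \<union> B"
    then show "x \<sqsubseteq> \<Squnion>A \<squnion> \<Squnion>B"
    proof
      assume "x \<in> A"
      then show ?thesis
        using le_trans[OF sup_ge[OF assms(1)] join_left[OF c(1,2)]] assms c by blast
    next
      assume "x \<in> B"
      then show ?thesis
        using le_trans[OF sup_ge[OF assms(2)] join_right[OF c(1,2)]] assms c by blast
    qed
  qed (use c in auto)
  have "\<Squnion>A \<sqsubseteq> \<Squnion>(A \<union> B)" "\<Squnion>B \<sqsubseteq> \<Squnion>(A \<union> B)"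
    by (rule sup_mono, use c in auto)+
  then show "\<Squnion>A \<squnion> \<Squnion>B \<sqsubseteq> \<Squnion>(A \<union> B)"
    using c join_le[of "\<Squnion>A" "\<Squnion>(A \<union> B)" "\<Squnion>B"] by auto
qed (use assms in auto)

lemma sup_singleton: "a \<in> carrier L \<Longrightarrow> \<Squnion>{a} = a"
  using le_antisym[of "\<Squnion>{a}" a] sup_le[of "{a}" a] sup_ge[of "{a}" a] by auto

lemma sup_insert: "A \<subseteq> carrier L \<Longrightarrow> a \<in> carrier L \<Longrightarrow> \<Squnion>(insert a A) = \<Squnion>A \<squnion> a"
  using sup_Un[of A "{a}"] sup_singleton[of a] by simp


subsection \<open>Rank\<close>

abbreviation r :: "'a \<Rightarrow> nat" where "r \<equiv> rank_of L"

lemma finite_rank_set: "finite {card C | C. chain_in L C \<and> (\<forall>y\<in>C. y \<sqsubset> x)}"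
proof -
  have "{card C | C. chain_in L C \<and> (\<forall>y\<in>C. y \<sqsubset> x)} \<subseteq> card ` Pow (carrier L)"
    by (auto simp: chain_in_def)
  then show ?thesis
    using finite_carrier by (meson finite_subset finite_imageI finite_Pow_iff)
qed

lemma rank_ge_card: "chain_in L C \<Longrightarrow> (\<And>y. y \<in> C \<Longrightarrow> y \<sqsubset> x) \<Longrightarrow> card C \<le> r x"
  unfolding rank_of_def by (rule Max_ge[OF finite_rank_set]) auto

lemma rank_witness: "\<exists>C. chain_in L C \<and> (\<forall>y\<in>C. y \<sqsubset> x) \<and> card C = r x"
proof -
  have "{card C | C. chain_in L C \<and> (\<forall>y\<in>C. y \<sqsubset> x)} \<noteq> {}"
    by (auto simp: chain_in_def intro!: exI[of _ "{}"])
  from Max_in[OF finite_rank_set this] show ?thesis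
    unfolding rank_of_def by auto
qed

text \<open>A longest chain strictly below x can be prolonged by x itself and still lies strictly
  below y.\<close>

lemma rank_strict_mono: "x \<in> carrier L \<Longrightarrow> y \<in> carrier L \<Longrightarrow> x \<sqsubset> y \<Longrightarrow> r x < r y"
proof -
  assume xy: "x \<in> carrier L" "y \<in> carrier L" "x \<sqsubset> y"
  obtain C where C: "chain_in L C" "\<forall>z\<in>C. z \<sqsubset> x" "card C = r x"
    using rank_witness by blast
  have sub: "C \<subseteq> carrier L" using C by (simp add: chain_in_def)
  then have fin: "finite C" using finite_carrier finite_subset by blast
  have "x \<notin> C" using C by (auto simp: less_iff)
  moreover have "card (insert x C) \<le> r y"
  proof (rule rank_ge_card)
    show "chain_in L (insert x C)"
      using C xy sub by (auto simp: chain_in_def less_iff)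
    show "z \<sqsubset> y" if "z \<in> insert x C" for z
      using that C xy sub le_trans[of z x y] le_antisym[of x y] by (auto simp: less_iff)
  qed
  ultimately show ?thesis
    using C fin by simp
qed

lemma rank_mono: "x \<in> carrier L \<Longrightarrow> y \<in> carrier L \<Longrightarrow> x \<sqsubseteq> y \<Longrightarrow> r x \<le> r y"
  using rank_strict_mono[of x y] by (cases "x = y") (auto simp: less_iff)

lemma rank_eq_imp_eq: "x \<in> carrier L \<Longrightarrow> y \<in> carrier L \<Longrightarrow> x \<sqsubseteq> y \<Longrightarrow> r y \<le> r x \<Longrightarrow> x = y"
  using rank_strict_mono[of x y] by (cases "x = y") (auto simp: less_iff)

lemma rank_bottom: "r \<bottom> = 0"
proof -
  obtain C where C: "chain_in L C" "\<forall>z\<in>C. z \<sqsubset> \<bottom>" "card C = r \<bottom>"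
    using rank_witness by blast
  have "C = {}"
  proof (rule ccontr)
    assume "C \<noteq> {}"
    then obtain z where z: "z \<in> C" by auto
    then have "z \<in> carrier L" using C by (auto simp: chain_in_def)
    then show False using C z le_antisym[of z \<bottom>] by (auto simp: less_iff)
  qed
  then show ?thesis using C by simp
qed

lemma rank_eq_0_iff: "x \<in> carrier L \<Longrightarrow> r x = 0 \<longleftrightarrow> x = \<bottom>"
  using rank_eq_imp_eq[of \<bottom> x] rank_bottom by auto

lemma rank_covered_by: "covered_by L x y \<Longrightarrow> r y = Suc (r x)"
  using geo by (simp add: geometric_lattice_def)

lemma semimodular: "x \<in> carrier L \<Longrightarrow> y \<in> carrier L \<Longrightarrow> r (x \<squnion> y) + r (x \<sqinter> y) \<le> r x + r y"
  using geo by (simp add: geometric_lattice_def)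

lemma atom_in [simp]: "a \<in> atoms L \<Longrightarrow> a \<in> carrier L"
  by (simp add: atoms_def covered_by_def)

lemma atoms_sub: "atoms L \<subseteq> carrier L"
  by auto

lemma finite_atoms: "finite (atoms L)"
  using finite_subset[OF atoms_sub finite_carrier] .

lemma atom_rank: "a \<in> atoms L \<Longrightarrow> r a = 1"
  using rank_covered_by[of \<bottom> a] rank_bottom by (simp add: atoms_def)

lemma atom_le_atom: "a \<in> atoms L \<Longrightarrow> b \<in> atoms L \<Longrightarrow> a \<sqsubseteq> b \<Longrightarrow> a = b"
  using rank_eq_imp_eq[of a b] atom_rank[of a] atom_rank[of b] by auto

lemma sup_atoms_below:
  assumes x: "x \<in> carrier L"
  shows "x = \<Squnion>{a \<in> atoms L. a \<sqsubseteq> x}"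
proof -
  let ?B = "{a \<in> atoms L. a \<sqsubseteq> x}"
  have B: "?B \<subseteq> carrier L" using atoms_sub by blast
  obtain A where A: "A \<subseteq> atoms L" "x = \<Squnion>A"
    using geo x unfolding geometric_lattice_def by blast
  have "a \<sqsubseteq> x" if "a \<in> A" for a
    using sup_ge[of A a] that A atoms_sub by simp
  then have "A \<subseteq> ?B" using A by blast
  then have "x \<sqsubseteq> \<Squnion>?B"
    using A(2) sup_mono[of A ?B] B by simp
  moreover have "\<Squnion>?B \<sqsubseteq> x"
    by (rule sup_le[OF B x]) simp
  ultimately show ?thesis
    using le_antisym[of x "\<Squnion>?B"] x sup_in[OF B] by simp
qed

lemma le_iff_atoms:
  assumes "u \<in> carrier L" "v \<in> carrier L"
  shows "v \<sqsubseteq> u \<longleftrightarrow> (\<forall>a\<in>atoms L. a \<sqsubseteq> v \<longrightarrow> a \<sqsubseteq> u)"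
proof
  assume u: "\<forall>a\<in>atoms L. a \<sqsubseteq> v \<longrightarrow> a \<sqsubseteq> u"
  let ?B = "{a \<in> atoms L. a \<sqsubseteq> v}"
  have B: "?B \<subseteq> carrier L" using atoms_sub by blast
  have "\<Squnion>?B \<sqsubseteq> u"
    by (rule sup_le[OF B assms(1)]) (use u in simp)
  then show "v \<sqsubseteq> u" using sup_atoms_below[OF assms(2)] by simp
next
  assume vu: "v \<sqsubseteq> u"
  show "\<forall>a\<in>atoms L. a \<sqsubseteq> v \<longrightarrow> a \<sqsubseteq> u"
    using le_trans[OF _ vu] assms by simp
qed

lemma ex_atom: "u \<in> carrier L \<Longrightarrow> v \<in> carrier L \<Longrightarrow> \<not> v \<sqsubseteq> u \<Longrightarrow> \<exists>a\<in>atoms L. a \<sqsubseteq> v \<and> \<not> a \<sqsubseteq> u"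
  using le_iff_atoms[of u v] by blast

text \<open>Strict monotonicity makes the rank grow by at least one, semimodularity by at most the
  rank of an atom.\<close>

lemma rank_join_atom:
  assumes "a \<in> atoms L" "u \<in> carrier L" "\<not> a \<sqsubseteq> u"
  shows "r (u \<squnion> a) = Suc (r u)"
proof -
  have c: "a \<in> carrier L" "u \<squnion> a \<in> carrier L" using assms by auto
  have "u \<squnion> a \<noteq> u" using join_right[of u a] assms c by auto
  then have "u \<sqsubset> u \<squnion> a"
    using assms(2) c join_left[of u a] by (simp add: less_iff)
  then have "r u < r (u \<squnion> a)" using rank_strict_mono[of u "u \<squnion> a"] assms(2) c by simp
  moreover have "r (u \<squnion> a) \<le> r u + 1"
    using semimodular[of u a] assms atom_rank[of a] by auto
  ultimately show ?thesis by simp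
qed

lemma rank_join_atom_le: "a \<in> atoms L \<Longrightarrow> u \<in> carrier L \<Longrightarrow> r (u \<squnion> a) \<le> Suc (r u)"
  using semimodular[of u a] atom_rank[of a] by auto

lemma join_absorb: "a \<in> carrier L \<Longrightarrow> u \<in> carrier L \<Longrightarrow> a \<sqsubseteq> u \<Longrightarrow> u \<squnion> a = u"
  using le_antisym[of "u \<squnion> a" u] join_le[of u u a] join_left[of u a] by simp

text \<open>The join lies between u and v and already has the rank of v. Any one new atom thus
  determines a cover, which makes edge labels injective later.\<close>

lemma join_atom_eq:
  assumes "a \<in> atoms L" "u \<in> carrier L" "v \<in> carrier L" "u \<sqsubseteq> v" "r v = Suc (r u)" "a \<sqsubseteq> v" "\<not> a \<sqsubseteq> u"
  shows "u \<squnion> a = v"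
  using rank_eq_imp_eq[of "u \<squnion> a" v] assms rank_join_atom[of a u] join_le[of u v a] by simp


subsection \<open>Independence and circuits\<close>

lemma subset_atoms_carrier: "A \<subseteq> atoms L \<Longrightarrow> A \<subseteq> carrier L"
  using atoms_sub by blast

lemma rank_sup_insert:
  assumes "A \<subseteq> atoms L" "a \<in> atoms L"
  shows "r (\<Squnion>(insert a A)) = (if a \<sqsubseteq> \<Squnion>A then r (\<Squnion>A) else Suc (r (\<Squnion>A)))"
  using assms sup_insert[of A a] rank_join_atom[of a "\<Squnion>A"] join_absorb[of a "\<Squnion>A"]
    subset_atoms_carrier[OF assms(1)] by auto

lemma finite_atom_set: "A \<subseteq> atoms L \<Longrightarrow> finite A"
  using finite_atoms finite_subset by blast

lemma rank_sup_le_card: "A \<subseteq> atoms L \<Longrightarrow> r (\<Squnion>A) \<le> card A"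
proof -
  assume A: "A \<subseteq> atoms L"
  then have "finite A" by (rule finite_atom_set)
  then show ?thesis using A
  proof induction
    case (insert a A)
    then show ?case using rank_sup_insert[of A a] by auto
  qed (simp add: sup_empty rank_bottom)
qed

lemma independent_empty: "independent L {}"
  by (simp add: independent_def sup_empty rank_bottom)

lemma independent_insert:
  assumes "A \<subseteq> atoms L" "a \<in> atoms L" "a \<notin> A"
  shows "independent L (insert a A) \<longleftrightarrow> independent L A \<and> \<not> a \<sqsubseteq> \<Squnion>A"
  using assms rank_sup_insert[of A a] rank_sup_le_card[of A] finite_atom_set[of A]
  by (auto simp: independent_def)

lemma independent_subset:
  assumes "independent L B" "A \<subseteq> B"
  shows "independent L A"
proof -
  have "finite (B - A)" using assms finite_atom_set by (auto simp: independent_def)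
  then show ?thesis using assms
  proof (induction "B - A" arbitrary: A rule: finite_induct)
    case empty
    then have "A = B" by auto
    then show ?case using empty by simp
  next
    case (insert x F)
    have "F = B - insert x A" using insert by auto
    moreover have x: "x \<in> B" "x \<notin> A" using insert by auto
    ultimately have "independent L (insert x A)" using insert by auto
    then show ?case
      using independent_insert[of A x] x insert.prems by (auto simp: independent_def)
  qed
qed

lemma independent_not_le: "independent L B \<Longrightarrow> b \<in> B \<Longrightarrow> \<not> b \<sqsubseteq> \<Squnion>(B - {b})"
  using independent_insert[of "B - {b}" b] by (auto simp: independent_def insert_absorb)

lemma independent_atoms: "independent L B \<Longrightarrow> B \<subseteq> atoms L"
  by (simp add: independent_def)

lemma circuit_atoms: "circuit L C \<Longrightarrow> C \<subseteq> atoms L"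
  by (simp add: circuit_def)

lemma circuit_le:
  assumes "circuit L C" "c \<in> C"
  shows "c \<sqsubseteq> \<Squnion>(C - {c})"
proof (rule ccontr)
  assume "\<not> ?thesis"
  moreover have "independent L (C - {c})" using assms by (auto simp: circuit_def)
  ultimately have "independent L (insert c (C - {c}))"
    using independent_insert[of "C - {c}" c] assms circuit_atoms[of C] by auto
  then show False using assms by (auto simp: circuit_def insert_absorb)
qed

lemma ex_circuit:
  assumes "A \<subseteq> atoms L" "\<not> independent L A"
  shows "\<exists>C\<subseteq>A. circuit L C"
proof -
  have "finite A" using assms finite_atom_set by blast
  then show ?thesis using assms
  proof (induction A rule: finite_psubset_induct)
    case (psubset A)
    show ?case
    proof (cases "circuit L A")
      case False
      then obtain D where "D \<subset> A" "\<not> independent L D"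
        using psubset by (auto simp: circuit_def)
      then show ?thesis using psubset by (meson dual_order.trans psubset_imp_subset)
    qed auto
  qed
qed

lemma circuit_not_independent: "circuit L C \<Longrightarrow> independent L A \<Longrightarrow> \<not> C \<subseteq> A"
  using independent_subset[of A C] by (auto simp: circuit_def)

lemma circuit_nonempty: "circuit L C \<Longrightarrow> C \<noteq> {}"
  using independent_empty by (auto simp: circuit_def)

text \<open>In a circuit each element lies under the join of the others, so a flat cannot miss
  exactly one of them. The vanishing arguments for circuit boundaries rest on this: a circuit that
  leaves a flat does so at least twice.\<close>

lemma circuit_two:
  assumes "circuit L C" "u \<in> carrier L" "c \<in> C" "\<And>a. a \<in> C \<Longrightarrow> a \<noteq> c \<Longrightarrow> a \<sqsubseteq> u"
  shows "c \<sqsubseteq> u"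
proof -
  have "C \<subseteq> carrier L" using circuit_atoms[OF assms(1)] atoms_sub by blast
  moreover from this have "\<Squnion>(C - {c}) \<sqsubseteq> u" using assms by (intro sup_le) auto
  ultimately show ?thesis
    using le_trans[OF circuit_le[OF assms(1,3)], of u] assms sup_in[of "C - {c}"] by blast
qed

lemma ex_circuit_insert:
  assumes "independent L A" "a \<in> atoms L" "a \<notin> A" "a \<sqsubseteq> \<Squnion>A"
  shows "\<exists>C. circuit L C \<and> C \<subseteq> insert a A \<and> a \<in> C"
proof -
  have A: "A \<subseteq> atoms L" using assms independent_atoms by blast
  have "\<not> independent L (insert a A)"
    using independent_insert[OF A] assms by blast
  then obtain C where C: "C \<subseteq> insert a A" "circuit L C"
    using ex_circuit[of "insert a A"] A assms by auto
  moreover have "a \<in> C" using circuit_not_independent[OF C(2) assms(1)] C(1) by blast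
  ultimately show ?thesis by blast
qed

end

section \<open>Shellings of pure order complexes\<close>

lemma length_delete_nth [simp]: "i < length xs \<Longrightarrow> length (delete_nth i xs) = length xs - 1"
  by (simp add: delete_nth_def)

lemma nth_delete_nth:
  "i < length xs \<Longrightarrow> k < length xs - 1 \<Longrightarrow> delete_nth i xs ! k = xs ! (if k < i then k else Suc k)"
  by (auto simp: delete_nth_def nth_append)

lemma delete_nth_commute:
  assumes "j < i" "i < length xs"
  shows "delete_nth j (delete_nth i xs) = delete_nth (i - 1) (delete_nth j xs)"
  by (rule nth_equalityI) (use assms in \<open>auto simp: nth_delete_nth\<close>)

lemma set_delete_nth:
  assumes "i < length xs"
  shows "set (delete_nth i xs) = {xs ! k | k. k < length xs \<and> k \<noteq> i}"
proof (intro equalityI subsetI)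
  fix x assume "x \<in> set (delete_nth i xs)"
  then obtain k where "k < length xs - 1" "x = delete_nth i xs ! k"
    using assms by (auto simp: in_set_conv_nth)
  then show "x \<in> {xs ! k | k. k < length xs \<and> k \<noteq> i}"
    using assms by (auto simp: nth_delete_nth intro!: exI[of _ "if k < i then k else Suc k"])
next
  fix x assume "x \<in> {xs ! k | k. k < length xs \<and> k \<noteq> i}"
  then obtain k where k: "k < length xs" "k \<noteq> i" "x = xs ! k" by auto
  define m where "m = (if k < i then k else k - 1)"
  have "m < length xs - 1" "x = delete_nth i xs ! m"
    using assms k by (auto simp: m_def nth_delete_nth)
  then show "x \<in> set (delete_nth i xs)"
    using assms by (auto simp: in_set_conv_nth intro!: exI[of _ m])
qed

lemma delete_nth_eq_iff:
  assumes "length xs = length ys" "i < length xs"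
  shows "delete_nth i xs = delete_nth i ys \<longleftrightarrow> (\<forall>k<length xs. k \<noteq> i \<longrightarrow> xs ! k = ys ! k)"
proof
  assume eq: "delete_nth i xs = delete_nth i ys"
  show "\<forall>k<length xs. k \<noteq> i \<longrightarrow> xs ! k = ys ! k"
  proof (intro allI impI)
    fix k assume k: "k < length xs" "k \<noteq> i"
    define m where "m = (if k < i then k else k - 1)"
    have "m < length xs - 1" "k = (if m < i then m else Suc m)" using k assms by (auto simp: m_def)
    then show "xs ! k = ys ! k"
      using arg_cong[OF eq, of "\<lambda>z. z ! m"] assms by (simp add: nth_delete_nth split: if_splits)
  qed
next
  assume "\<forall>k<length xs. k \<noteq> i \<longrightarrow> xs ! k = ys ! k"
  then show "delete_nth i xs = delete_nth i ys"
    by (intro nth_equalityI) (use assms in \<open>auto simp: nth_delete_nth\<close>)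
qed

lemma delete_nth_inj_index:
  assumes "distinct xs" "i < length xs" "j < length xs" "delete_nth i xs = delete_nth j xs"
  shows "i = j"
proof (rule ccontr)
  assume "i \<noteq> j"
  then have "xs ! i \<in> set (delete_nth j xs)" using assms by (auto simp: set_delete_nth)
  then have "xs ! i \<in> set (delete_nth i xs)" using assms by simp
  then obtain k where "k < length xs" "k \<noteq> i" "xs ! i = xs ! k"
    using assms(2) by (auto simp: set_delete_nth)
  then show False using nth_eq_iff_index_eq[OF assms(1,2), of k] by simp
qed

lemma simplicial_boundary_of:
  "simplicial_boundary (frag_of xs) = (\<Sum>i<length xs. frag_cmul ((-1) ^ i) (frag_of (delete_nth i xs)))"
  by (simp add: simplicial_boundary_def)

lemma simplicial_boundary_add: "simplicial_boundary (a + b) = simplicial_boundary a + simplicial_boundary b"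
  by (simp add: simplicial_boundary_def frag_extend_add)

lemma simplicial_boundary_diff: "simplicial_boundary (a - b) = simplicial_boundary a - simplicial_boundary b"
  by (simp add: simplicial_boundary_def frag_extend_diff)

lemma simplicial_boundary_cmul: "simplicial_boundary (frag_cmul k a) = frag_cmul k (simplicial_boundary a)"
  by (simp add: simplicial_boundary_def frag_extend_cmul)

lemma simplicial_boundary_0 [simp]: "simplicial_boundary 0 = 0"
  by (simp add: simplicial_boundary_def)

lemma simplicial_boundary_sum:
  "finite I \<Longrightarrow> simplicial_boundary (\<Sum>i\<in>I. g i) = (\<Sum>i\<in>I. simplicial_boundary (g i))"
  by (simp add: simplicial_boundary_def frag_extend_sum)

lemma lookup_simplicial_boundary:
  "poly_mapping.lookup (simplicial_boundary c) ys =
     (\<Sum>xs\<in>Poly_Mapping.keys c. \<Sum>i<length xs.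
        if delete_nth i xs = ys then (-1) ^ i * poly_mapping.lookup c xs else 0)"
  unfolding simplicial_boundary_def frag_extend_def
  by (simp add: lookup_sum sum_distrib_left if_distrib cong: if_cong)
     (intro sum.cong refl, auto)

lemma simplicial_boundary_boundary_of: "simplicial_boundary (simplicial_boundary (frag_of xs)) = 0"
proof -
  define n where "n = length xs"
  let ?t = "\<lambda>(i, j). frag_cmul ((-1) ^ (i + j)) (frag_of (delete_nth j (delete_nth i xs)))"
  have "simplicial_boundary (simplicial_boundary (frag_of xs)) =
      (\<Sum>i<n. \<Sum>j<n - 1. ?t (i, j))"
    unfolding simplicial_boundary_of
    by (simp add: simplicial_boundary_sum simplicial_boundary_cmul simplicial_boundary_of frag_cmul_sum power_add n_def)
  also have "\<dots> = (\<Sum>p\<in>{..<n} \<times> {..<n - 1}. ?t p)"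
    by (simp add: sum.cartesian_product)
  also have "{..<n} \<times> {..<n - 1} = {(i, j). j < i \<and> i < n} \<union> {(i, j). i \<le> j \<and> j < n - 1}"
    by auto
  also have "(\<Sum>p\<in>\<dots>. ?t p) = (\<Sum>p\<in>{(i, j). j < i \<and> i < n}. ?t p) + (\<Sum>p\<in>{(i, j). i \<le> j \<and> j < n - 1}. ?t p)"
  proof (rule sum.union_disjoint)
    show "finite {(i, j). j < i \<and> i < n}"
      by (rule finite_subset[of _ "{..<n} \<times> {..<n}"]) auto
    show "finite {(i, j). i \<le> j \<and> j < n - 1}"
      by (rule finite_subset[of _ "{..<n} \<times> {..<n}"]) auto
  qed auto
  \<comment> \<open>Deleting i and then j with i \<le> j is the same as deleting j + 1 and then i,
    and the exponents differ by one.\<close>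
  also have "(\<Sum>p\<in>{(i, j). i \<le> j \<and> j < n - 1}. ?t p) = (\<Sum>p\<in>{(i, j). j < i \<and> i < n}. - ?t p)"
  proof (rule sum.reindex_bij_witness[of _ "\<lambda>(i, j). (j, i - 1)" "\<lambda>(i, j). (Suc j, i)"])
    fix p assume "p \<in> {(i, j). i \<le> j \<and> j < n - 1}"
    then obtain i j where p: "p = (i, j)" "i \<le> j" "j < n - 1" by auto
    then have "delete_nth i (delete_nth (Suc j) xs) = delete_nth j (delete_nth i xs)"
      using delete_nth_commute[of i "Suc j" xs] by (simp add: n_def)
    then show "- (case (case p of (i, j) \<Rightarrow> (Suc j, i)) of (i, j) \<Rightarrow> frag_cmul ((- 1) ^ (i + j)) (frag_of (delete_nth j (delete_nth i xs)))) =
         (case p of (i, j) \<Rightarrow> frag_cmul ((- 1) ^ (i + j)) (frag_of (delete_nth j (delete_nth i xs))))"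
      using p by (simp add: add.commute)
  qed auto
  also have "(\<Sum>p\<in>{(i, j). j < i \<and> i < n}. ?t p) + (\<Sum>p\<in>{(i, j). j < i \<and> i < n}. - ?t p) = 0"
    unfolding sum_negf by (rule add.right_inverse)
  finally show ?thesis .
qed

lemma simplicial_boundary_boundary: "simplicial_boundary (simplicial_boundary c) = 0"
  by (rule frag_induction[of c UNIV])
     (auto simp: simplicial_boundary_diff simplicial_boundary_boundary_of)

text \<open>
  A shelling of a set \<open>S\<close> of facets, all of them lists of length \<open>n\<close> in which the position of an
  element is determined by its rank. The facets are ordered by \<open>key\<close>, and \<open>R F\<close> is the
  restriction face of \<open>F\<close>, given by the set of its positions.
\<close>

locale shelling =
  fixes S :: "'a list set" and n :: nat and rk :: "'a \<Rightarrow> nat" and key :: "'a list \<Rightarrow> 'k::linorder"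
  assumes finite_X: "finite S"
    and length_X: "F \<in> S \<Longrightarrow> length F = n"
    and rk_X: "F \<in> S \<Longrightarrow> k < n \<Longrightarrow> rk (F ! k) = k"
    and key_inj: "inj_on key S"
    and shell: "E \<in> S \<Longrightarrow> F \<in> S \<Longrightarrow> key E < key F \<Longrightarrow>
      \<exists>j<n. E ! j \<noteq> F ! j \<and> (\<exists>G\<in>S. key G < key F \<and> (\<forall>k<n. k \<noteq> j \<longrightarrow> G ! k = F ! k))"
begin

definition R :: "'a list \<Rightarrow> nat set" where
  "R F = {j. j < n \<and> (\<exists>G\<in>S. key G < key F \<and> (\<forall>k<n. k \<noteq> j \<longrightarrow> G ! k = F ! k))}"

definition homology_facets :: "'a list set" where
  "homology_facets = {F \<in> S. R F = {..<n}}"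

lemma distinct_X: "F \<in> S \<Longrightarrow> distinct F"
  using length_X[of F] rk_X[of F] unfolding distinct_conv_nth by metis

text \<open>The position of an element is its rank, so a ridge remembers which position was deleted.
  Hence all facets around a ridge enter its boundary coefficient with the same sign.\<close>

lemma delete_same_position:
  assumes "F \<in> S" "G \<in> S" "i < n" "j < n" "delete_nth i F = delete_nth j G"
  shows "i = j"
proof (rule ccontr)
  assume "i \<noteq> j"
  then have "G ! i \<in> set (delete_nth j G)"
    using assms length_X[of G] by (auto simp: set_delete_nth)
  then have "G ! i \<in> set (delete_nth i F)" using assms by simp
  then obtain k where "k < n" "k \<noteq> i" "G ! i = F ! k"
    using assms(1,3) length_X[of F] by (auto simp: set_delete_nth)
  then show False using rk_X[of G i] rk_X[of F k] assms by auto
qed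

definition ridges :: "'a list set \<Rightarrow> 'a list set" where
  "ridges A = {delete_nth i F | i F. F \<in> A \<and> i < n}"

lemma ridgesI: "F \<in> A \<Longrightarrow> i < n \<Longrightarrow> delete_nth i F \<in> ridges A"
  by (auto simp: ridges_def)

lemma lookup_boundary_ridge:
  assumes "Poly_Mapping.keys c \<subseteq> S" "F \<in> S" "i < n"
  shows "poly_mapping.lookup (simplicial_boundary c) (delete_nth i F) =
    (-1) ^ i * (\<Sum>G | G \<in> S \<and> delete_nth i G = delete_nth i F. poly_mapping.lookup c G)"
proof -
  have inner: "(\<Sum>j<length G. if delete_nth j G = delete_nth i F then (-1) ^ j * poly_mapping.lookup c G else 0)
      = (if delete_nth i G = delete_nth i F then (-1) ^ i * poly_mapping.lookup c G else 0)"
    if "G \<in> S" for G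
  proof -
    have "(\<Sum>j<length G. if delete_nth j G = delete_nth i F then (-1) ^ j * poly_mapping.lookup c G else 0)
      = (\<Sum>j<n. if j = i then (if delete_nth i G = delete_nth i F then (-1) ^ i * poly_mapping.lookup c G else 0) else 0)"
      using delete_same_position[OF that assms(2) _ assms(3)] length_X[OF that]
      by (intro sum.cong) auto
    then show ?thesis using assms by simp
  qed
  have "poly_mapping.lookup (simplicial_boundary c) (delete_nth i F) =
    (\<Sum>G\<in>Poly_Mapping.keys c. if delete_nth i G = delete_nth i F then (-1) ^ i * poly_mapping.lookup c G else 0)"
    unfolding lookup_simplicial_boundary using inner assms by (intro sum.cong) auto
  also have "\<dots> = (\<Sum>G\<in>S. if delete_nth i G = delete_nth i F then (-1) ^ i * poly_mapping.lookup c G else 0)"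
    using assms finite_X by (intro sum.mono_neutral_left) (auto simp: in_keys_iff)
  finally show ?thesis
    using finite_X by (simp add: sum.inter_filter[symmetric] sum_distrib_left)
qed

text \<open>Take the last facet F of the support. If F is not a homology facet, one of its ridges
  lies in no earlier facet; later facets do not occur in c, so the boundary has the coefficient of
  F, up to sign, at this ridge and cannot vanish.\<close>

lemma cycle_zero:
  assumes c: "Poly_Mapping.keys c \<subseteq> S" "simplicial_boundary c = 0"
    and zero: "\<And>F. F \<in> homology_facets \<Longrightarrow> poly_mapping.lookup c F = 0"
  shows "c = 0"
proof (rule ccontr)
  assume "c \<noteq> 0"
  define K where "K = Poly_Mapping.keys c"
  have K: "finite K" "K \<noteq> {}" using \<open>c \<noteq> 0\<close> by (auto simp: K_def)
  define F where "F = arg_max_on key K"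
  have FK: "F \<in> K" and Fmax: "\<And>G. G \<in> K \<Longrightarrow> key G \<le> key F"
  proof -
    have "Max (key ` K) \<in> key ` K" using K by simp
    then obtain G where G: "G \<in> K" "key G = Max (key ` K)" by auto
    have "is_arg_max key (\<lambda>x. x \<in> K) G"
      using K G by (auto simp: is_arg_max_linorder)
    then have "is_arg_max key (\<lambda>x. x \<in> K) F"
      unfolding F_def arg_max_on_def arg_max_def by (rule someI)
    then show "F \<in> K" "\<And>G. G \<in> K \<Longrightarrow> key G \<le> key F"
      by (auto simp: is_arg_max_linorder)
  qed
  have FX: "F \<in> S" using FK c by (auto simp: K_def)
  have nz: "poly_mapping.lookup c F \<noteq> 0" using FK by (simp add: K_def in_keys_iff)
  then have "F \<notin> homology_facets" using zero by auto
  moreover have "R F \<subseteq> {..<n}" by (auto simp: R_def)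
  ultimately obtain i where i: "i < n" "i \<notin> R F"
    using FX unfolding homology_facets_def by blast
  have "poly_mapping.lookup c G = 0"
    if "G \<in> S" "delete_nth i G = delete_nth i F" "G \<noteq> F" for G
  proof (rule ccontr)
    assume "poly_mapping.lookup c G \<noteq> 0"
    then have "key G \<le> key F" using Fmax by (simp add: K_def in_keys_iff)
    moreover have "key G \<noteq> key F" using that FX key_inj by (auto simp: inj_on_def)
    ultimately have "key G < key F" by simp
    moreover have "\<forall>k<n. k \<noteq> i \<longrightarrow> G ! k = F ! k"
      using that i FX length_X by (auto simp: delete_nth_eq_iff)
    ultimately show False using i that by (auto simp: R_def)
  qed
  then have "(\<Sum>G | G \<in> S \<and> delete_nth i G = delete_nth i F. poly_mapping.lookup c G)
      = (\<Sum>G\<in>{F}. poly_mapping.lookup c G)"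
    using FX finite_X by (intro sum.mono_neutral_right) auto
  then show False
    using lookup_boundary_ridge[OF c(1) FX i(1)] c(2) nz by simp
qed

lemma keys_boundary:
  assumes "Poly_Mapping.keys c \<subseteq> A" "A \<subseteq> S"
  shows "Poly_Mapping.keys (simplicial_boundary c) \<subseteq> ridges A"
proof
  fix y assume "y \<in> Poly_Mapping.keys (simplicial_boundary c)"
  then have "poly_mapping.lookup (simplicial_boundary c) y \<noteq> 0" by (simp add: in_keys_iff)
  then obtain F where F: "F \<in> Poly_Mapping.keys c"
    "(\<Sum>i<length F. if delete_nth i F = y then (-1) ^ i * poly_mapping.lookup c F else 0) \<noteq> 0"
    unfolding lookup_simplicial_boundary by (rule sum.not_neutral_contains_not_neutral)
  from F(2) obtain i where i: "i \<in> {..<length F}"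
    "(if delete_nth i F = y then (-1) ^ i * poly_mapping.lookup c F else 0) \<noteq> 0"
    by (rule sum.not_neutral_contains_not_neutral)
  have "F \<in> A" using F(1) assms(1) by blast
  moreover from this have "length F = n" using assms(2) length_X[of F] by blast
  ultimately show "y \<in> ridges A"
    using i ridgesI[of F A i] by (simp split: if_splits)
qed

text \<open>A is an initial segment of the shelling, and the induction removes its last facet F. If
  F is a homology facet, all its ridges are old and d already lives on the smaller segment.
  Otherwise F has a new ridge, and a multiple of the boundary of F clears the coefficient of d
  there; the cycle condition then clears the other new ridges of F as well. Filling without homology
  facets is what makes dual cycles vanish at the other homology facets.\<close>

lemma fill_ridge_cycle:
  assumes "A \<subseteq> S" "\<And>F G. F \<in> A \<Longrightarrow> G \<in> S \<Longrightarrow> key G < key F \<Longrightarrow> G \<in> A"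
    and "Poly_Mapping.keys d \<subseteq> ridges A" "simplicial_boundary d = 0"
  shows "\<exists>s. Poly_Mapping.keys s \<subseteq> A - homology_facets \<and> simplicial_boundary s = d"
  using assms
proof (induction "card A" arbitrary: A d)
  case 0
  then have "A = {}" using finite_X finite_subset by (metis card_0_eq)
  then show ?case using 0 by (auto simp: ridges_def intro!: exI[of _ 0])
next
  case (Suc m)
  have finA: "finite A" "A \<noteq> {}" using Suc finite_X finite_subset by fastforce+
  then have "Max (key ` A) \<in> key ` A" by simp
  then obtain F where F: "F \<in> A" "key F = Max (key ` A)" by auto
  then have Fmax: "key G \<le> key F" if "G \<in> A" for G using finA that by simp
  have FX: "F \<in> S" using F Suc by auto
  have lenF: "length F = n" using FX length_X by auto
  define A' where "A' = A - {F}"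
  have A': "A' \<subseteq> S" "card A' = m" using Suc F finA by (auto simp: A'_def)
  have lower: "G \<in> A'" if "E \<in> A'" "G \<in> S" "key G < key E" for E G
  proof -
    have "G \<in> A" using that Suc by (auto simp: A'_def)
    moreover have "G \<noteq> F" using that Fmax[of E] by (auto simp: A'_def)
    ultimately show ?thesis by (simp add: A'_def)
  qed
  have old: "delete_nth y F \<in> ridges A'" if yR: "y \<in> R F" for y
  proof -
    obtain G where G: "G \<in> S" "key G < key F" "\<forall>k<n. k \<noteq> y \<longrightarrow> G ! k = F ! k" and y: "y < n"
      using yR by (auto simp: R_def)
    then have "G \<in> A'" using Suc.prems(2)[OF F(1), of G] by (auto simp: A'_def)
    moreover have "delete_nth y G = delete_nth y F"
      using G y length_X[of G] lenF by (subst delete_nth_eq_iff) auto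
    ultimately show ?thesis using y ridgesI[of G A' y] by simp
  qed
  have split: "ridges A \<subseteq> ridges A' \<union> {delete_nth y F | y. y < n}"
    by (auto simp: ridges_def A'_def)
  have IH: "\<exists>s. Poly_Mapping.keys s \<subseteq> A' - homology_facets \<and> simplicial_boundary s = d"
    if "Poly_Mapping.keys d \<subseteq> ridges A'" "simplicial_boundary d = 0" for d
  proof (rule Suc.hyps(1))
    show "m = card A'" by (simp add: A'(2))
    show "G \<in> A'" if "E \<in> A'" "G \<in> S" "key G < key E" for E G
      by (rule lower[OF that])
  qed (use A'(1) that in blast)+
  show ?case
  proof (cases "F \<in> homology_facets")
    case True
    then have "Poly_Mapping.keys d \<subseteq> ridges A'"
      using Suc.prems(3) split old by (force simp: homology_facets_def)
    from IH[OF this Suc.prems(4)] obtain s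
      where "Poly_Mapping.keys s \<subseteq> A' - homology_facets" "simplicial_boundary s = d"
      by (elim exE conjE)
    then show ?thesis unfolding A'_def by (intro exI[of _ s]) blast
  next
    case False
    moreover have "R F \<subseteq> {..<n}" by (auto simp: R_def)
    ultimately obtain x where x: "x < n" "x \<notin> R F"
      using FX unfolding homology_facets_def by blast
    \<comment> \<open>The boundary of F has coefficient (-1)^x at the ridge opposite x. This is a
      unit, so the required multiple exists over the integers.\<close>
    define a where "a = (-1) ^ x * poly_mapping.lookup d (delete_nth x F)"
    define d' where "d' = d - frag_cmul a (simplicial_boundary (frag_of F))"
    have bF: "poly_mapping.lookup (simplicial_boundary (frag_of F)) (delete_nth x F) = (-1) ^ x"
    proof -
      have "(\<Sum>G | G \<in> S \<and> delete_nth x G = delete_nth x F. poly_mapping.lookup (frag_of F) G) = 1"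
        using FX finite_X by simp
      then show ?thesis using lookup_boundary_ridge[of "frag_of F" F x] FX x by simp
    qed
    have d'x: "poly_mapping.lookup d' (delete_nth x F) = 0"
      by (simp add: d'_def lookup_minus bF a_def)
    have bd': "simplicial_boundary d' = 0"
      using Suc.prems by (simp add: d'_def simplicial_boundary_diff simplicial_boundary_cmul simplicial_boundary_boundary)
    have keysd': "Poly_Mapping.keys d' \<subseteq> ridges A"
    proof -
      have "Poly_Mapping.keys (simplicial_boundary (frag_of F)) \<subseteq> ridges A"
        using keys_boundary[of "frag_of F" A] F Suc.prems by simp
      then show ?thesis
        using Suc.prems(3) keys_diff[of d "frag_cmul a (simplicial_boundary (frag_of F))"]
          keys_cmul[of a "simplicial_boundary (frag_of F)"] unfolding d'_def by blast
    qed
    have zero: "poly_mapping.lookup d' (delete_nth y F) = 0" if y: "y < n" "y \<notin> R F" for y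
    proof (cases "y = x")
      case True then show ?thesis using d'x by simp
    next
      case False
      \<comment> \<open>Once position y is gone, the element from position x sits at x'; the face z
        of codimension two omits both.\<close>
      define x' where "x' = (if x < y then x else x - 1)"
      define z where "z = delete_nth x' (delete_nth y F)"
      have x': "x' < n - 1" using False x y by (auto simp: x'_def)
      have dF: "distinct F" using FX distinct_X by auto
      have setz: "set z = {F ! k | k. k < n \<and> k \<noteq> x \<and> k \<noteq> y}"
      proof -
        have "set z = {delete_nth y F ! k | k. k < n - 1 \<and> k \<noteq> x'}"
          using x' y lenF by (simp add: z_def set_delete_nth)
        also have "\<dots> = set (delete_nth y F) - {F ! x}"
        proof -
          have nx: "delete_nth y F ! x' = F ! x"
            using x' y lenF False x by (auto simp: x'_def nth_delete_nth)
          have "distinct (delete_nth y F)"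
            using dF y lenF by (auto simp: distinct_conv_nth nth_delete_nth)
          then have "{delete_nth y F ! k | k. k < n - 1 \<and> k \<noteq> x'} = set (delete_nth y F) - {delete_nth y F ! x'}"
            using x' y lenF by (auto simp: in_set_conv_nth nth_eq_iff_index_eq)
          then show ?thesis using nx by simp
        qed
        also have "\<dots> = {F ! k | k. k < n \<and> k \<noteq> x \<and> k \<noteq> y}"
          using y x lenF dF by (auto simp: set_delete_nth nth_eq_iff_index_eq)
        finally show ?thesis .
      qed
      \<comment> \<open>Among the facets of A only F contains z. Any other one is earlier and would
        differ from F at a position of \<open>R F\<close>; but containing z it agrees with F except
        at x and y, and neither of these lies in \<open>R F\<close>.\<close>
      have only: "E = F \<and> (i = x \<or> i = y)"
        if E: "E \<in> A" and i: "i < n" and j: "j < n - 1" and eq: "delete_nth j (delete_nth i E) = z" for E i j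
      proof -
        have EX: "E \<in> S" "length E = n" using E Suc.prems length_X by auto
        have "set z \<subseteq> set (delete_nth i E)"
          unfolding eq[symmetric] using EX i j by (auto simp: set_delete_nth[of j])
        then have sub: "set z \<subseteq> {E ! k | k. k < n \<and> k \<noteq> i}"
          using EX i by (simp add: set_delete_nth)
        have agree: "E ! k = F ! k \<and> k \<noteq> i" if "k < n" "k \<noteq> x" "k \<noteq> y" for k
        proof -
          have "F ! k \<in> set z" using setz that by auto
          then obtain l where "l < n" "l \<noteq> i" "F ! k = E ! l" using sub by auto
          then show ?thesis using rk_X[OF FX that(1)] rk_X[OF EX(1), of l] by simp
        qed
        have "E = F"
        proof (rule ccontr)
          assume "E \<noteq> F"
          then have "key E < key F"
            using Fmax[OF E] EX FX key_inj by (metis inj_onD order_le_less)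
          then obtain j where j: "j < n" "E ! j \<noteq> F ! j" "j \<in> R F"
            using shell[OF EX(1) FX] by (auto simp: R_def)
          then have "j = x \<or> j = y" using agree by blast
          then show False using j x y that by auto
        qed
        then show ?thesis using agree i by blast
      qed
      have contrib: "(\<Sum>j<length ys. if delete_nth j ys = z then (-1) ^ j * poly_mapping.lookup d' ys else 0)
          = (if ys = delete_nth y F then (-1) ^ x' * poly_mapping.lookup d' ys else 0)"
        if ys: "ys \<in> Poly_Mapping.keys d'" for ys
      proof -
        obtain i E where Ei: "ys = delete_nth i E" "E \<in> A" "i < n" using ys keysd' by (auto simp: ridges_def)
        have lenys: "length ys = n - 1" using Ei Suc.prems length_X by auto
        show ?thesis
        proof (cases "ys = delete_nth y F")
          case True
          have "distinct ys" unfolding True using dF y lenF by (auto simp: distinct_conv_nth nth_delete_nth)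
          then have "delete_nth j ys = z \<longleftrightarrow> j = x'" if "j < n - 1" for j
            using that x' delete_nth_inj_index[of ys j x'] lenys by (auto simp: True z_def)
          then have "(\<Sum>j<length ys. if delete_nth j ys = z then (-1) ^ j * poly_mapping.lookup d' ys else 0)
            = (\<Sum>j<n - 1. if j = x' then (-1) ^ x' * poly_mapping.lookup d' ys else 0)"
            using lenys by (intro sum.cong) auto
          then show ?thesis using True x' by simp
        next
          case ne: False
          have "delete_nth j ys \<noteq> z" if "j < n - 1" for j
          proof
            assume "delete_nth j ys = z"
            then have "E = F \<and> (i = x \<or> i = y)" using only[OF Ei(2,3) that] Ei by simp
            then have "ys = delete_nth x F" using Ei ne by auto
            then show False using d'x ys by (simp add: in_keys_iff)
          qed
          then show ?thesis using lenys ne by (simp add: sum.neutral)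
        qed
      qed
      \<comment> \<open>Only two ridges of A contain z, and d' vanishes at one of them, so the cycle
        condition at z makes it vanish at the other.\<close>
      have "0 = poly_mapping.lookup (simplicial_boundary d') z" using bd' by simp
      also have "\<dots> = (\<Sum>ys\<in>Poly_Mapping.keys d'. if ys = delete_nth y F then (-1) ^ x' * poly_mapping.lookup d' ys else 0)"
        unfolding lookup_simplicial_boundary by (intro sum.cong contrib refl)
      also have "\<dots> = (-1) ^ x' * poly_mapping.lookup d' (delete_nth y F)"
        by (auto simp: in_keys_iff)
      finally show ?thesis by simp
    qed
    have "Poly_Mapping.keys d' \<subseteq> ridges A'"
    proof
      fix ys assume ys: "ys \<in> Poly_Mapping.keys d'"
      show "ys \<in> ridges A'"
      proof (rule ccontr)
        assume "ys \<notin> ridges A'"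
        then obtain y where "y < n" "ys = delete_nth y F" "y \<notin> R F"
          using ys keysd' split old by blast
        then show False using zero ys by (simp add: in_keys_iff)
      qed
    qed
    from IH[OF this bd']
    obtain s where s: "Poly_Mapping.keys s \<subseteq> A' - homology_facets" "simplicial_boundary s = d'"
      by (elim exE conjE)
    have "Poly_Mapping.keys (s + frag_cmul a (frag_of F)) \<subseteq> A - homology_facets"
      using s(1) keys_add[of s "frag_cmul a (frag_of F)"] keys_cmul[of a "frag_of F"] F False
      by (auto simp: A'_def)
    moreover have "simplicial_boundary (s + frag_cmul a (frag_of F)) = d"
      using s(2) by (simp add: simplicial_boundary_add simplicial_boundary_cmul d'_def)
    ultimately show ?thesis by blast
  qed
qed

text \<open>Every ridge of a homology facet lies in an earlier facet, so its boundary can be filled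
  among the earlier facets without homology facets. Subtracting the filling leaves a cycle that
  meets the homology facets in F alone.\<close>

lemma ex_dual_cycle:
  assumes "F \<in> homology_facets"
  shows "\<exists>c. Poly_Mapping.keys c \<subseteq> S \<and> simplicial_boundary c = 0 \<and> poly_mapping.lookup c F = 1 \<and>
    (\<forall>G\<in>homology_facets. G \<noteq> F \<longrightarrow> poly_mapping.lookup c G = 0)"
proof -
  have FX: "F \<in> S" using assms by (simp add: homology_facets_def)
  define A where "A = {G \<in> S. key G < key F}"
  have lower: "H \<in> A" if "G \<in> A" "H \<in> S" "key H < key G" for G H
    using that by (auto simp: A_def)
  have "Poly_Mapping.keys (simplicial_boundary (frag_of F)) \<subseteq> ridges A"
  proof -
    have "delete_nth i F \<in> ridges A" if i: "i < n" for i
    proof -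
      have "i \<in> R F" using assms i by (simp add: homology_facets_def)
      then obtain G where G: "G \<in> S" "key G < key F" "\<forall>k<n. k \<noteq> i \<longrightarrow> G ! k = F ! k"
        by (auto simp: R_def)
      then have "delete_nth i G = delete_nth i F"
        using i length_X[of G] length_X[OF FX] by (subst delete_nth_eq_iff) auto
      moreover have "G \<in> A" using G by (simp add: A_def)
      ultimately show ?thesis using i ridgesI[of G A i] by simp
    qed
    then have "ridges {F} \<subseteq> ridges A" by (auto simp: ridges_def)
    then show ?thesis using keys_boundary[of "frag_of F" "{F}"] FX by auto
  qed
  then have "\<exists>s. Poly_Mapping.keys s \<subseteq> A - homology_facets \<and>
    simplicial_boundary s = simplicial_boundary (frag_of F)"
    by (rule fill_ridge_cycle[rotated 2])
       (use lower in \<open>auto simp: A_def simplicial_boundary_boundary\<close>)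
  then obtain s where s: "Poly_Mapping.keys s \<subseteq> A - homology_facets"
    "simplicial_boundary s = simplicial_boundary (frag_of F)"
    by (elim exE conjE)
  have zero: "poly_mapping.lookup s G = 0" if "G \<in> homology_facets" for G
    using s that by (auto simp: in_keys_iff)
  show ?thesis
  proof (intro exI[of _ "frag_of F - s"] conjI ballI impI)
    show "Poly_Mapping.keys (frag_of F - s) \<subseteq> S"
      using keys_diff[of "frag_of F" s] s FX by (auto simp: A_def)
    show "simplicial_boundary (frag_of F - s) = 0"
      using s by (simp add: simplicial_boundary_diff)
    show "poly_mapping.lookup (frag_of F - s) F = 1"
      using zero[OF assms] by (simp add: lookup_minus)
    show "poly_mapping.lookup (frag_of F - s) G = 0" if "G \<in> homology_facets" "G \<noteq> F" for G
      using zero[OF that(1)] that by (simp add: lookup_minus)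
  qed
qed

end

section \<open>Positions in a list\<close>

text \<open>For an element that does not occur the value is the length of the list.\<close>

definition pos :: "'a list \<Rightarrow> 'a \<Rightarrow> nat" where
  "pos xs a = length (takeWhile (\<lambda>x. x \<noteq> a) xs)"

lemma pos_less: "a \<in> set xs \<Longrightarrow> pos xs a < length xs"
  unfolding pos_def by (induction xs) auto

lemma nth_pos: "a \<in> set xs \<Longrightarrow> xs ! pos xs a = a"
  unfolding pos_def by (induction xs) auto

lemma pos_nth:
  assumes "distinct xs" "i < length xs"
  shows "pos xs (xs ! i) = i"
proof -
  have "xs ! i \<in> set xs" using assms(2) by (rule nth_mem)
  from nth_pos[OF this] pos_less[OF this] show ?thesis
    using nth_eq_iff_index_eq[OF assms(1) _ assms(2), of "pos xs (xs ! i)"] by (simp only:)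
qed

lemma pos_inj:
  assumes "a \<in> set xs" "b \<in> set xs" "pos xs a = pos xs b"
  shows "a = b"
proof -
  have "a = xs ! pos xs a" by (rule nth_pos[OF assms(1), symmetric])
  also have "\<dots> = b" unfolding assms(3) by (rule nth_pos[OF assms(2)])
  finally show ?thesis .
qed

lemma pos_less_iff_before:
  assumes "distinct xs" "a \<in> set xs" "b \<in> set xs"
  shows "before xs a b \<longleftrightarrow> pos xs a < pos xs b"
proof
  assume "before xs a b"
  then obtain i j where "i < j" "j < length xs" "xs ! i = a" "xs ! j = b"
    unfolding before_def by (elim exE conjE)
  then show "pos xs a < pos xs b" using pos_nth[OF assms(1), of i] pos_nth[OF assms(1), of j] by force
next
  assume "pos xs a < pos xs b"
  then show "before xs a b"
    unfolding before_def using nth_pos[of a xs] nth_pos[of b xs] pos_less[of b xs] assms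
    by (intro exI[of _ "pos xs a"] exI[of _ "pos xs b"]) simp
qed

lemma pos_filter_less_iff:
  assumes "distinct xs" "a \<in> set xs" "b \<in> set xs" "P a" "P b"
  shows "pos (filter P xs) a < pos (filter P xs) b \<longleftrightarrow> pos xs a < pos xs b"
  using assms
proof (induction xs)
  case (Cons x xs)
  consider "x = a" "x = b" | "x = a" "x \<noteq> b" | "x \<noteq> a" "x = b" | "x \<noteq> a" "x \<noteq> b" by blast
  then show ?case
    by cases (use Cons in \<open>auto simp: pos_def\<close>)
qed simp

lemma list_min_cases:
  assumes "A \<inter> set xs \<noteq> {}"
  shows "list_min xs A \<in> A \<inter> set xs \<and> (\<forall>a\<in>A \<inter> set xs. pos xs (list_min xs A) \<le> pos xs a)"
  using assms
proof (induction xs)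
  case (Cons x xs)
  show ?case
  proof (cases "x \<in> A")
    case True
    then show ?thesis by (simp add: list_min_def pos_def)
  next
    case False
    then have ne: "A \<inter> set xs \<noteq> {}" using Cons by auto
    have eq: "list_min (x # xs) A = list_min xs A" using False by (simp add: list_min_def)
    have shift: "pos (x # xs) a = Suc (pos xs a)" if "a \<in> A" for a
      using that False by (auto simp: pos_def)
    show ?thesis
      using Cons.IH[OF ne] False by (auto simp: eq shift)
  qed
qed simp

lemma list_min_in: "A \<subseteq> set xs \<Longrightarrow> A \<noteq> {} \<Longrightarrow> list_min xs A \<in> A"
  using list_min_cases[of A xs] by blast

lemma list_min_le: "A \<subseteq> set xs \<Longrightarrow> a \<in> A \<Longrightarrow> pos xs (list_min xs A) \<le> pos xs a"
  using list_min_cases[of A xs] by blast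

lemma list_min_eqI:
  assumes "A \<subseteq> set xs" "a \<in> A" "\<And>b. b \<in> A \<Longrightarrow> pos xs a \<le> pos xs b"
  shows "list_min xs A = a"
proof (rule pos_inj)
  have "list_min xs A \<in> A" using list_min_in[of A xs] assms by auto
  then show "list_min xs A \<in> set xs" "pos xs (list_min xs A) = pos xs a"
    using assms list_min_le[of A xs a] by (auto intro: le_antisym)
qed (use assms in auto)

lemma less_list_same_length:
  fixes xs ys :: "'b::linorder list"
  assumes "length xs = length ys"
  shows "xs < ys \<longleftrightarrow> (\<exists>i<length ys. (\<forall>j<i. xs ! j = ys ! j) \<and> xs ! i < ys ! i)"
proof -
  have "take i xs = take i ys \<longleftrightarrow> (\<forall>j<i. xs ! j = ys ! j)" if "i < length ys" for i
    using that assms nth_take_lemma[of i xs ys] nth_take[of _ i xs] nth_take[of _ i ys] by (metis less_imp_le)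
  then show ?thesis
    using assms unfolding list_less_def lexord_take_index_conv by auto
qed


section \<open>The complement of a principal filter of an atom\<close>

text \<open>
  \<open>lab u v\<close> is the usual edge label of a cover, the index of the first atom below \<open>v\<close> but not below \<open>u\<close>.
  The cover of \<open>u\<close> labelled \<open>x0 u\<close>, where \<open>x0 u\<close> completes \<open>u\<close> together with the preceding atoms
  to a spanning set, is moved to the front: with the plain label order the order complex of the
  elements not above \<open>g\<close> would not be shelled.
\<close>

locale pointed_geometric = geometric +
  fixes as :: "'a list" and g :: 'a
  assumes distinct_as: "distinct as" and set_as: "set as = atoms L"
    and as_nonempty: "as \<noteq> []" and g_first: "as ! 0 = g"
begin

definition "l = rank_poset L"

definition lab :: "'a \<Rightarrow> 'a \<Rightarrow> nat" where
  "lab u v = (LEAST i. i < length as \<and> as ! i \<sqsubseteq> v \<and> \<not> as ! i \<sqsubseteq> u)"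

definition S :: "'a \<Rightarrow> nat \<Rightarrow> 'a" where
  "S u i = \<Squnion>(insert u {as ! j | j. j < i \<and> j < length as})"

text \<open>Index of the last atom of the greedy basis of the interval above u, found by running
  through the atoms in order; at \<open>\<top>\<close> it is 0.\<close>

definition x0 :: "'a \<Rightarrow> nat" where
  "x0 u = (LEAST i. S u (Suc i) = \<top>)"

text \<open>The shift by one frees the value 0 for the special cover, so that the key stays
  injective on the covers of u.\<close>

definition ckey :: "'a \<Rightarrow> 'a \<Rightarrow> nat" where
  "ckey u v = (if lab u v = x0 u then 0 else Suc (lab u v))"

text \<open>Covers inside the complement of the filter of g; in a ranked lattice a cover is a step
  of rank one.\<close>

definition cov :: "'a \<Rightarrow> 'a \<Rightarrow> bool" where
  "cov u v \<longleftrightarrow> u \<in> carrier L \<and> v \<in> carrier L \<and> u \<sqsubseteq> v \<and> r v = Suc (r u) \<and> \<not> g \<sqsubseteq> v"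

lemma as_atom: "i < length as \<Longrightarrow> as ! i \<in> atoms L"
  using set_as nth_mem by blast

lemma as_in [simp]: "i < length as \<Longrightarrow> as ! i \<in> carrier L"
  using as_atom[of i] by simp

lemma atom_index: "a \<in> atoms L \<Longrightarrow> \<exists>i<length as. as ! i = a"
  using set_as by (metis in_set_conv_nth)

lemma g_atom: "g \<in> atoms L"
  using as_atom[of 0] as_nonempty g_first by simp

lemma g_in [simp]: "g \<in> carrier L"
  using g_atom by simp

lemma rank_top: "r \<top> = l"
  by (simp add: l_def rank_poset_def)

lemma rank_le: "u \<in> carrier L \<Longrightarrow> r u \<le> l"
  using rank_mono[of u \<top>] rank_top by simp

lemma rank_eq_l: "u \<in> carrier L \<Longrightarrow> r u = l \<longleftrightarrow> u = \<top>"
  using rank_eq_imp_eq[of u \<top>] rank_top by auto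

lemma lab_props:
  assumes "u \<in> carrier L" "v \<in> carrier L" "\<not> v \<sqsubseteq> u"
  shows "lab u v < length as" "as ! lab u v \<sqsubseteq> v" "\<not> as ! lab u v \<sqsubseteq> u"
proof -
  obtain a where "a \<in> atoms L" "a \<sqsubseteq> v" "\<not> a \<sqsubseteq> u" using ex_atom[OF assms] by blast
  then obtain i where "i < length as \<and> as ! i \<sqsubseteq> v \<and> \<not> as ! i \<sqsubseteq> u"
    using atom_index[of a] by auto
  from LeastI[of "\<lambda>i. i < length as \<and> as ! i \<sqsubseteq> v \<and> \<not> as ! i \<sqsubseteq> u", OF this]
  show "lab u v < length as" "as ! lab u v \<sqsubseteq> v" "\<not> as ! lab u v \<sqsubseteq> u"
    unfolding lab_def by auto
qed

lemma lab_least: "i < length as \<Longrightarrow> as ! i \<sqsubseteq> v \<Longrightarrow> \<not> as ! i \<sqsubseteq> u \<Longrightarrow> lab u v \<le> i"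
  unfolding lab_def by (rule Least_le) simp

lemma cov_not_le: "cov u v \<Longrightarrow> \<not> v \<sqsubseteq> u"
  using rank_mono[of v u] by (auto simp: cov_def)

lemma covD: "cov u v \<Longrightarrow> u \<in> carrier L" "cov u v \<Longrightarrow> v \<in> carrier L" "cov u v \<Longrightarrow> u \<sqsubseteq> v"
  "cov u v \<Longrightarrow> r v = Suc (r u)" "cov u v \<Longrightarrow> \<not> g \<sqsubseteq> v"
  by (auto simp: cov_def)

lemma cov_lab:
  assumes "cov u v"
  shows "lab u v < length as" "as ! lab u v \<sqsubseteq> v" "\<not> as ! lab u v \<sqsubseteq> u"
  using lab_props[of u v] cov_not_le[OF assms] covD[OF assms] by auto

lemma cov_join: "cov u v \<Longrightarrow> i < length as \<Longrightarrow> as ! i \<sqsubseteq> v \<Longrightarrow> \<not> as ! i \<sqsubseteq> u \<Longrightarrow> u \<squnion> as ! i = v"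
  using join_atom_eq[of "as ! i" u v] covD[of u v] as_atom[of i] by simp

lemma cov_join_lab: "cov u v \<Longrightarrow> u \<squnion> as ! lab u v = v"
  using cov_join[of u v "lab u v"] cov_lab[of u v] by simp

lemma cov_not_g_bottom:
  assumes "cov u v"
  shows "\<not> g \<sqsubseteq> u"
  using le_trans[of g u v] covD[OF assms] g_in by blast

lemma lab_inj:
  assumes "cov u v" "cov u w" "lab u v = lab u w"
  shows "v = w"
proof -
  have "v = u \<squnion> as ! lab u v" by (rule cov_join_lab[OF assms(1), symmetric])
  also have "\<dots> = w" unfolding assms(3) by (rule cov_join_lab[OF assms(2)])
  finally show ?thesis .
qed

lemma ckey_inj:
  assumes "cov u v" "cov u w" "ckey u v = ckey u w"
  shows "v = w"
  using lab_inj[OF assms(1,2)] assms(3) by (simp add: ckey_def split: if_splits)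

lemma covI:
  assumes "u \<in> carrier L" "i < length as" "\<not> as ! i \<sqsubseteq> u" "w \<in> carrier L" "u \<sqsubseteq> w" "as ! i \<sqsubseteq> w" "\<not> g \<sqsubseteq> w"
  shows "cov u (u \<squnion> as ! i)" "u \<squnion> as ! i \<sqsubseteq> w"
proof -
  show le: "u \<squnion> as ! i \<sqsubseteq> w"
    using join_le[of u w "as ! i"] assms by simp
  then have "\<not> g \<sqsubseteq> u \<squnion> as ! i"
    using le_trans[of g "u \<squnion> as ! i" w] assms by auto
  then show "cov u (u \<squnion> as ! i)"
    using rank_join_atom[of "as ! i" u] as_atom[of i] join_left[of u "as ! i"] assms by (simp add: cov_def)
qed

lemma S_sub: "u \<in> carrier L \<Longrightarrow> insert u {as ! j | j. j < i \<and> j < length as} \<subseteq> carrier L"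
  by auto

lemma S_in [simp]: "u \<in> carrier L \<Longrightarrow> S u i \<in> carrier L"
  unfolding S_def by (rule sup_in[OF S_sub])

lemma S_0: "u \<in> carrier L \<Longrightarrow> S u 0 = u"
  by (simp add: S_def sup_singleton)

lemma le_S: "u \<in> carrier L \<Longrightarrow> u \<sqsubseteq> S u i"
  unfolding S_def by (rule sup_ge[OF S_sub]) auto

lemma as_le_S: "u \<in> carrier L \<Longrightarrow> j < i \<Longrightarrow> j < length as \<Longrightarrow> as ! j \<sqsubseteq> S u i"
  unfolding S_def by (rule sup_ge[OF S_sub]) auto

lemma S_le:
  assumes "u \<in> carrier L" "w \<in> carrier L" "u \<sqsubseteq> w" "\<And>j. j < i \<Longrightarrow> j < length as \<Longrightarrow> as ! j \<sqsubseteq> w"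
  shows "S u i \<sqsubseteq> w"
  unfolding S_def by (rule sup_le[OF S_sub]) (use assms in auto)

lemma S_mono:
  assumes "u \<in> carrier L" "v \<in> carrier L" "u \<sqsubseteq> S v j" "i \<le> j"
  shows "S u i \<sqsubseteq> S v j"
  by (rule S_le) (use assms as_le_S[of v _ j] in auto)

lemma S_all: "u \<in> carrier L \<Longrightarrow> S u (length as) = \<top>"
proof -
  assume u: "u \<in> carrier L"
  have "\<top> \<sqsubseteq> S u (length as)"
    unfolding le_iff_atoms[OF S_in[OF u] top_closed]
  proof (intro ballI impI)
    fix a assume "a \<in> atoms L"
    then obtain i where "i < length as" "as ! i = a" using atom_index[of a] by blast
    then show "a \<sqsubseteq> S u (length as)" using as_le_S[OF u, of i "length as"] by simp
  qed
  then show ?thesis using le_antisym[of \<top> "S u (length as)"] u by simp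
qed

lemma x0_top: "u \<in> carrier L \<Longrightarrow> S u (Suc (x0 u)) = \<top>"
  and x0_less: "u \<in> carrier L \<Longrightarrow> x0 u < length as"
proof -
  assume u: "u \<in> carrier L"
  have ex: "S u (Suc (length as - 1)) = \<top>"
    using S_all[OF u] as_nonempty by simp
  from LeastI[of "\<lambda>i. S u (Suc i) = \<top>", OF ex] show "S u (Suc (x0 u)) = \<top>"
    by (simp add: x0_def)
  have "x0 u \<le> length as - 1"
    unfolding x0_def by (rule Least_le) (rule ex)
  then show "x0 u < length as" using as_nonempty by (cases as) auto
qed

lemma S_x0: "u \<in> carrier L \<Longrightarrow> u \<noteq> \<top> \<Longrightarrow> S u (x0 u) \<noteq> \<top>"
proof (cases "x0 u")
  case (Suc k)
  show ?thesis
  proof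
    assume "S u (x0 u) = \<top>"
    then have "S u (Suc k) = \<top>" by (simp only: Suc)
    then have "x0 u \<le> k" unfolding x0_def by (rule Least_le)
    then show False using Suc by linarith
  qed
qed (simp add: S_0)

lemma x0_le:
  assumes "u \<in> carrier L" "S u (Suc i) = \<top>"
  shows "x0 u \<le> i"
  unfolding x0_def by (rule Least_le) (rule assms)

lemma top_le_eq: "u \<in> carrier L \<Longrightarrow> \<top> \<sqsubseteq> u \<Longrightarrow> u = \<top>"
  using le_antisym[of u \<top>] by simp

lemma S_top_mono:
  assumes "u \<in> carrier L" "v \<in> carrier L" "S u i = \<top>" "u \<sqsubseteq> S v j" "i \<le> j"
  shows "S v j = \<top>"
  using S_mono[OF assms(1,2,4,5)] top_le_eq[of "S v j"] assms by simp

lemma x0_not_le_S: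
  assumes "u \<in> carrier L" "u \<noteq> \<top>"
  shows "\<not> as ! x0 u \<sqsubseteq> S u (x0 u)"
proof
  assume le: "as ! x0 u \<sqsubseteq> S u (x0 u)"
  have "S u (Suc (x0 u)) \<sqsubseteq> S u (x0 u)"
    by (rule S_le) (use assms le_S[of u "x0 u"] as_le_S[of u _ "x0 u"] le in \<open>auto simp: less_Suc_eq\<close>)
  then show False
    using S_x0[OF assms] x0_top[OF assms(1)] top_le_eq[of "S u (x0 u)"] assms by simp
qed

lemma x0_not_le:
  assumes "u \<in> carrier L" "u \<noteq> \<top>"
  shows "\<not> as ! x0 u \<sqsubseteq> u"
  using x0_not_le_S[OF assms] le_trans[of "as ! x0 u" u "S u (x0 u)"] le_S[of u "x0 u"] x0_less[of u] assms
  by auto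

lemma x0_antimono:
  assumes "u \<in> carrier L" "v \<in> carrier L" "u \<sqsubseteq> v"
  shows "x0 v \<le> x0 u"
proof (rule x0_le[OF assms(2)])
  show "S v (Suc (x0 u)) = \<top>"
    by (rule S_top_mono[of u v "Suc (x0 u)"])
       (use assms x0_top[of u] le_S[of v "Suc (x0 u)"] le_trans[of u v "S v (Suc (x0 u))"] in auto)
qed

text \<open>The first atom is g, so the value 0 would mean that u and g already span, which forces
  corank at most one.\<close>

lemma x0_pos:
  assumes "u \<in> carrier L" "Suc (r u) < l"
  shows "0 < x0 u"
proof (rule ccontr)
  assume "\<not> 0 < x0 u"
  then have "S u (Suc 0) = \<top>" using x0_top[OF assms(1)] by simp
  moreover have "S u (Suc 0) \<sqsubseteq> u \<squnion> g"
    by (rule S_le) (use assms join_left[of u g] join_right[of u g] g_first in auto)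
  ultimately have "u \<squnion> g = \<top>" using top_le_eq[of "u \<squnion> g"] assms by simp
  then show False using rank_join_atom_le[OF g_atom assms(1)] rank_top assms by simp
qed

text \<open>The special atom lies outside \<open>S u (x0 u)\<close>, whereas g is among the atoms
  that span this flat; corank at least two ensures that g comes strictly before the special atom. If
  g were below the special cover, exchange would identify this cover with
  \<open>u \<squnion> g\<close> and place the special atom inside \<open>S u (x0 u)\<close>.\<close>

lemma special_cov:
  assumes "u \<in> carrier L" "\<not> g \<sqsubseteq> u" "Suc (r u) < l"
  shows "cov u (u \<squnion> as ! x0 u)"
proof -
  have ut: "u \<noteq> \<top>" using assms rank_top by auto
  have x: "x0 u < length as" "\<not> as ! x0 u \<sqsubseteq> u" using x0_less[of u] x0_not_le[of u] assms ut by auto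
  have "\<not> g \<sqsubseteq> u \<squnion> as ! x0 u"
  proof
    assume g: "g \<sqsubseteq> u \<squnion> as ! x0 u"
    have "u \<squnion> g = u \<squnion> as ! x0 u"
      by (rule join_atom_eq[OF g_atom])
         (use g assms x rank_join_atom[of "as ! x0 u" u] as_atom[of "x0 u"] join_left[of u "as ! x0 u"] in auto)
    moreover have "g \<sqsubseteq> S u (x0 u)"
      using as_le_S[of u 0 "x0 u"] x0_pos[of u] assms as_nonempty g_first by simp
    ultimately have "u \<squnion> as ! x0 u \<sqsubseteq> S u (x0 u)"
      using join_le[of u "S u (x0 u)" g] le_S[of u "x0 u"] assms by simp
    then have "as ! x0 u \<sqsubseteq> S u (x0 u)"
      using le_trans[of "as ! x0 u" "u \<squnion> as ! x0 u" "S u (x0 u)"] join_right[of u "as ! x0 u"] x assms by simp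
    then show False using x0_not_le_S[of u] assms ut by simp
  qed
  then show ?thesis
    using covI[of u "x0 u" "u \<squnion> as ! x0 u"] x assms join_left[of u "as ! x0 u"] join_right[of u "as ! x0 u"]
    by simp
qed

text \<open>A smaller label would place the whole cover inside \<open>S u (x0 u)\<close>, which
  misses the special atom. So being the special cover can be tested on one atom.\<close>

lemma lab_special:
  assumes "u \<in> carrier L" "\<not> g \<sqsubseteq> u" "u \<noteq> \<top>" "cov u v" "as ! x0 u \<sqsubseteq> v"
  shows "lab u v = x0 u"
proof (rule ccontr)
  assume ne: "lab u v \<noteq> x0 u"
  have x: "x0 u < length as" "\<not> as ! x0 u \<sqsubseteq> u" using x0_less[of u] x0_not_le[of u] assms by auto
  then have "lab u v < x0 u" using ne lab_least[of "x0 u" v u] assms by simp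
  then have "as ! lab u v \<sqsubseteq> S u (x0 u)" using as_le_S[of u "lab u v" "x0 u"] cov_lab[OF assms(4)] assms by simp
  then have "v \<sqsubseteq> S u (x0 u)"
    using join_le[of u "S u (x0 u)" "as ! lab u v"] cov_join_lab[OF assms(4)] le_S[of u "x0 u"] cov_lab[OF assms(4)] assms
    by simp
  then have "as ! x0 u \<sqsubseteq> S u (x0 u)"
    using le_trans[of "as ! x0 u" v "S u (x0 u)"] assms x covD[OF assms(4)] by simp
  then show False using x0_not_le_S[of u] assms by simp
qed

text \<open>The cover of u by the smaller atom is special, with key 0, or has a label at most i;
  either way it comes before v. Staying under w keeps it off the filter of g.\<close>

lemma ckey_less:
  assumes "cov u v" "lab u v \<noteq> x0 u" "i < lab u v" "\<not> as ! i \<sqsubseteq> u" "as ! i \<sqsubseteq> w" "u \<sqsubseteq> w" "w \<in> carrier L" "\<not> g \<sqsubseteq> w"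
  shows "\<exists>v'. cov u v' \<and> ckey u v' < ckey u v \<and> v' \<sqsubseteq> w"
proof -
  have i: "i < length as" using assms cov_lab[of u v] by simp
  note c = covI[of u i w]
  have "lab u (u \<squnion> as ! i) \<le> i"
    using lab_least[of i "u \<squnion> as ! i" u] i assms covD[of u v] join_right[of u "as ! i"] by simp
  then have "ckey u (u \<squnion> as ! i) < ckey u v" using assms by (simp add: ckey_def)
  then show ?thesis using c i assms covD[of u v] by blast
qed

lemma ckey_special_less:
  assumes "cov u v" "lab u v \<noteq> x0 u" "as ! x0 u \<sqsubseteq> w" "u \<sqsubseteq> w" "w \<in> carrier L" "\<not> g \<sqsubseteq> w"
  shows "\<exists>v'. cov u v' \<and> ckey u v' < ckey u v \<and> v' \<sqsubseteq> w"
proof -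
  have u: "u \<in> carrier L" "\<not> g \<sqsubseteq> u" using cov_not_g_bottom[of u v] covD[of u v] assms by auto
  have "u \<noteq> \<top>" using u g_in by auto
  note x = x0_less[OF u(1)] x0_not_le[OF u(1) this]
  note c = covI[OF u(1) x assms(5) assms(4) assms(3) assms(6)]
  have "lab u (u \<squnion> as ! x0 u) = x0 u"
    by (rule lab_special) (use u \<open>u \<noteq> \<top>\<close> c join_right[of u "as ! x0 u"] x in auto)
  then have "ckey u (u \<squnion> as ! x0 u) < ckey u v" using assms by (simp add: ckey_def)
  then show ?thesis using c by blast
qed

lemma smaller_atom:
  assumes "cov u v" "cov u v'" "ckey u v' < ckey u v"
  shows "lab u v \<noteq> x0 u"
    "lab u v' < lab u v \<or> (lab u v' = x0 u \<and> lab u v < x0 u)"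
proof -
  show ne: "lab u v \<noteq> x0 u" using assms by (auto simp: ckey_def)
  show "lab u v' < lab u v \<or> (lab u v' = x0 u \<and> lab u v < x0 u)"
    using assms ne by (auto simp: ckey_def split: if_splits)
qed

text \<open>An atom before the special one keeps v inside \<open>S u (x0 u)\<close>, so v together
  with the atoms before \<open>x0 u\<close> still does not span.\<close>

lemma x0_cov_small:
  assumes "cov u v" "lab u v < x0 u" "v \<noteq> \<top>"
  shows "x0 v = x0 u"
proof (rule antisym)
  show "x0 v \<le> x0 u" using x0_antimono[of u v] covD[OF assms(1)] by simp
  show "x0 u \<le> x0 v"
  proof (rule ccontr)
    assume "\<not> ?thesis"
    then have lt: "Suc (x0 v) \<le> x0 u" by simp
    have u: "u \<in> carrier L" and v: "v \<in> carrier L" using covD[OF assms(1)] by auto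
    have "v \<sqsubseteq> S u (x0 u)"
      using join_le[of u "S u (x0 u)" "as ! lab u v"] cov_join_lab[OF assms(1)] le_S[OF u, of "x0 u"]
        as_le_S[OF u assms(2)] cov_lab[OF assms(1)] u by simp
    then have "S u (x0 u) = \<top>"
      using S_top_mono[OF v u x0_top[OF v] _ lt] by simp
    moreover have "u \<noteq> \<top>" using cov_not_g_bottom[OF assms(1)] by auto
    ultimately show False using S_x0[OF u] by simp
  qed
qed

text \<open>This carries an advantage one step up a chain. Under w' no cover of u comes before v, so
  the label of w' over v is neither special nor smaller than that of v over u. In contrast w
  contains the atom of v', which is new over v, so that w is special or has a smaller label.\<close>

lemma earlier_covers_first:
  assumes uv: "cov u v" and uv': "cov u v'" and less: "ckey u v' < ckey u v"
    and vw: "cov v w" and "v' \<sqsubseteq> w" and vw': "cov v w'"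
    and none: "\<And>v''. cov u v'' \<Longrightarrow> ckey u v'' < ckey u v \<Longrightarrow> \<not> v'' \<sqsubseteq> w'"
  shows "ckey v w < ckey v w'"
proof -
  note c = covD[OF uv] covD[OF uv'] covD[OF vw] covD[OF vw']
  have ug: "\<not> g \<sqsubseteq> u" "\<not> g \<sqsubseteq> v" using cov_not_g_bottom[OF uv] cov_not_g_bottom[OF vw] .
  have ut: "u \<noteq> \<top>" "v \<noteq> \<top>" using ug by auto
  have uw': "u \<sqsubseteq> w'" using le_trans[of u v w'] c by simp
  note ns = smaller_atom(1)[OF uv uv' less]
  have lab'_ge: "lab u v \<le> lab v w'"
  proof (rule ccontr)
    assume "\<not> ?thesis"
    then have lt: "lab v w' < lab u v" by simp
    have "\<not> as ! lab v w' \<sqsubseteq> u"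
      using cov_lab[OF vw'] le_trans[of "as ! lab v w'" u v] c by auto
    from ckey_less[OF uv ns lt this] show False
      using none cov_lab[OF vw'] uw' c by blast
  qed
  have not_special: "lab v w' \<noteq> x0 v"
  proof
    assume eq: "lab v w' = x0 v"
    have nu: "\<not> as ! x0 v \<sqsubseteq> u"
      using x0_not_le[of v] le_trans[of "as ! x0 v" u v] c ut x0_less[of v] by auto
    show False
    \<comment> \<open>Covering by an atom before the special one keeps the special index; otherwise
      the special atom of v already precedes the label of v over u. Either way it yields an earlier
      cover of u under w'.\<close>
    proof (cases "lab u v < x0 u")
      case True
      then have "x0 v = x0 u" using x0_cov_small[OF uv] ut by simp
      from ckey_special_less[OF uv ns] show False
        using none cov_lab[OF vw'] eq \<open>x0 v = x0 u\<close> uw' c by auto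
    next
      case False
      then have "x0 v < lab u v" using ns x0_antimono[of u v] c by simp
      from ckey_less[OF uv ns this nu] show False
        using none cov_lab[OF vw'] eq uw' c by auto
    qed
  qed
  show ?thesis
  proof (cases "lab v w = x0 v")
    case True
    then show ?thesis using not_special by (simp add: ckey_def)
  next
    case False
    let ?x = "lab u v'"
    have x: "?x < length as" "as ! ?x \<sqsubseteq> v'" "\<not> as ! ?x \<sqsubseteq> u" using cov_lab[OF uv'] .
    have "\<not> v' \<sqsubseteq> v"
    proof
      assume "v' \<sqsubseteq> v"
      then have "v' = v" using rank_eq_imp_eq[of v' v] c by simp
      then show False using less by simp
    qed
    have nx: "\<not> as ! ?x \<sqsubseteq> v"
    proof
      assume "as ! ?x \<sqsubseteq> v"
      then have "v' \<sqsubseteq> v" using join_le[of u v "as ! ?x"] cov_join_lab[OF uv'] c x by simp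
      then show False using \<open>\<not> v' \<sqsubseteq> v\<close> by simp
    qed
    have xw: "as ! ?x \<sqsubseteq> w" using le_trans[of "as ! ?x" v' w] x c assms by simp
    \<comment> \<open>The one way to be earlier without a smaller label is to be special; then the
      same atom is special for v, which would make w special.\<close>
    have "?x < lab u v"
    proof (rule ccontr)
      assume "\<not> ?thesis"
      then have sp: "?x = x0 u" "lab u v < x0 u" using smaller_atom(2)[OF uv uv' less] by auto
      then have "x0 v = x0 u" using x0_cov_small[OF uv] ut by simp
      then have "lab v w = x0 v" using lab_special[of v w] xw sp c ug ut vw by simp
      then show False using False by simp
    qed
    moreover have "lab v w \<le> ?x" using lab_least[of ?x w v] x xw nx by simp
    ultimately have "lab v w < lab v w'" using lab'_ge by simp
    then show ?thesis using False not_special by (simp add: ckey_def)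
  qed
qed

text \<open>The join of v and v' may lie above g, so w need not contain v' itself. If the label of v
  precedes the special atom, the special cover of v contains the special cover of u. Otherwise u and
  the atoms before the label of v span, so one of these atoms lies outside
  \<open>v \<squnion> g\<close>; its join with v avoids g and contains an earlier cover of
  u.\<close>

lemma ex_cover_above_earlier:
  assumes uv: "cov u v" and uv': "cov u v'" and less: "ckey u v' < ckey u v" and rv: "Suc (r v) < l"
  shows "\<exists>w v''. cov v w \<and> cov u v'' \<and> ckey u v'' < ckey u v \<and> v'' \<sqsubseteq> w"
proof -
  note c = covD[OF uv]
  have ug: "\<not> g \<sqsubseteq> u" using cov_not_g_bottom[OF uv] .
  have ut: "u \<noteq> \<top>" "v \<noteq> \<top>" using ug c by auto
  note ns = smaller_atom(1)[OF uv uv' less]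
  show ?thesis
  proof (cases "lab u v < x0 u")
    case True
    then have eq: "x0 v = x0 u" using x0_cov_small[OF uv] ut by simp
    note sp = special_cov[OF c(2,5) rv]
    have x: "x0 u < length as" using x0_less[OF c(1)] .
    have "as ! x0 u \<sqsubseteq> v \<squnion> as ! x0 v" "u \<sqsubseteq> v \<squnion> as ! x0 v"
      using join_right[of v "as ! x0 v"] le_trans[of u v "v \<squnion> as ! x0 v"] join_left[of v "as ! x0 v"] c eq x by auto
    from ckey_special_less[OF uv ns this] sp show ?thesis using covD[OF sp] by blast
  next
    case False
    then have gt: "x0 u < lab u v" using ns by simp
    let ?y = "lab u v"
    have vg: "v \<squnion> g \<in> carrier L" using c by simp
    \<comment> \<open>Here the corank of v enters: v and g do not span.\<close>
    have "v \<squnion> g \<noteq> \<top>" using rank_join_atom_le[OF g_atom c(2)] rank_top rv by auto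
    then have "\<not> S u ?y \<sqsubseteq> v \<squnion> g"
      using S_top_mono[of u u "Suc (x0 u)" ?y] x0_top[OF c(1)] gt c le_S[of u ?y] top_le_eq[OF vg] by auto
    then obtain j where j: "j < ?y" "j < length as" "\<not> as ! j \<sqsubseteq> v \<squnion> g"
      using S_le[of u "v \<squnion> g" ?y] c vg le_trans[of u v "v \<squnion> g"] join_left[of v g] by auto
    have jv: "\<not> as ! j \<sqsubseteq> v" using j le_trans[of "as ! j" v "v \<squnion> g"] join_left[of v g] c by auto
    have ju: "\<not> as ! j \<sqsubseteq> u" using jv le_trans[of "as ! j" u v] c j by auto
    have "\<not> g \<sqsubseteq> v \<squnion> as ! j"
    proof
      assume "g \<sqsubseteq> v \<squnion> as ! j"
      then have "v \<squnion> g = v \<squnion> as ! j"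
        using join_atom_eq[OF g_atom, of v "v \<squnion> as ! j"] c j jv as_atom[of j]
          rank_join_atom[of "as ! j" v] join_left[of v "as ! j"] by simp
      then show False using j join_right[of v "as ! j"] c by simp
    qed
    then have cw: "cov v (v \<squnion> as ! j)"
      using covI[of v j "v \<squnion> as ! j"] c j jv join_left[of v "as ! j"] join_right[of v "as ! j"] by simp
    have "u \<sqsubseteq> v \<squnion> as ! j" "as ! j \<sqsubseteq> v \<squnion> as ! j"
      using le_trans[of u v "v \<squnion> as ! j"] join_left[of v "as ! j"] join_right[of v "as ! j"] c j by auto
    from ckey_less[OF uv ns j(1) ju this(2,1)] cw show ?thesis using covD[OF cw] by blast
  qed
qed

end

section \<open>The lexicographic shelling of the maximal chains avoiding the filter of g\<close>

context pointed_geometric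
begin

definition n :: nat where "n = l - 1"

definition facets :: "'a list set" where
  "facets = {F. length F = n \<and> set F \<subseteq> {u \<in> carrier L. u \<noteq> \<bottom> \<and> \<not> g \<sqsubseteq> u} \<and> sorted_wrt (\<lambda>x y. x \<sqsubset> y) F}"

text \<open>With \<open>\<bottom>\<close> put in front, the first step of a chain is a cover like
  all others.\<close>

definition ext :: "'a list \<Rightarrow> nat \<Rightarrow> 'a" where
  "ext F k = (\<bottom> # F) ! k"

definition fkey :: "'a list \<Rightarrow> nat list" where
  "fkey F = map (\<lambda>k. ckey (ext F k) (F ! k)) [0..<n]"

lemma l_pos: "0 < l"
  using rank_le[of g] atom_rank[OF g_atom] by simp

lemma l_eq: "l = Suc n"
  using l_pos by (simp add: n_def)

lemma ext_0 [simp]: "ext F 0 = \<bottom>" and ext_Suc [simp]: "ext F (Suc k) = F ! k"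
  by (simp_all add: ext_def)

lemma facets_length: "F \<in> facets \<Longrightarrow> length F = n"
  by (simp add: facets_def)

lemma facets_nth:
  assumes "F \<in> facets" "k < n"
  shows "F ! k \<in> carrier L" "F ! k \<noteq> \<bottom>" "\<not> g \<sqsubseteq> F ! k"
proof -
  have "F ! k \<in> set F" using assms by (simp add: facets_def)
  then show "F ! k \<in> carrier L" "F ! k \<noteq> \<bottom>" "\<not> g \<sqsubseteq> F ! k"
    using assms(1) unfolding facets_def by blast+
qed

lemma facets_less:
  assumes "F \<in> facets" "i < j" "j < n"
  shows "F ! i \<sqsubset> F ! j"
proof -
  have "sorted_wrt (\<lambda>x y. x \<sqsubset> y) F" "length F = n" using assms(1) by (simp_all add: facets_def)
  then show ?thesis using sorted_wrt_nth_less[of "\<lambda>x y. x \<sqsubset> y" F i j] assms(2,3) by simp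
qed

text \<open>There are n elements of strictly increasing rank; the first is nonzero and the last is
  not \<open>\<top>\<close>, which lies above g. This leaves exactly the ranks 1 to n.\<close>

lemma facets_rank:
  assumes F: "F \<in> facets" and k: "k < n"
  shows "r (F ! k) = Suc k"
proof (rule antisym)
  have step: "r (F ! i) < r (F ! Suc i)" if "Suc i < n" for i
    using rank_strict_mono[OF facets_nth(1)[OF F] facets_nth(1)[OF F that] facets_less[OF F _ that]] that
    by simp
  have up: "r (F ! i) + d \<le> r (F ! (i + d))" if "i + d < n" for i d
    using that
  proof (induction d)
    case (Suc d)
    then show ?case using step[of "i + d"] by simp
  qed simp
  have "0 < r (F ! 0)" using facets_nth[OF F, of 0] k rank_eq_0_iff[of "F ! 0"] by simp
  then show "Suc k \<le> r (F ! k)" using up[of 0 k] k by simp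
  have "r (F ! (n - 1)) \<noteq> l"
  proof
    assume "r (F ! (n - 1)) = l"
    then have "F ! (n - 1) = \<top>" using rank_eq_l[of "F ! (n - 1)"] facets_nth(1)[OF F, of "n - 1"] k by simp
    then show False using facets_nth(3)[OF F, of "n - 1"] k by simp
  qed
  then have "r (F ! (n - 1)) \<le> n"
    using rank_le[OF facets_nth(1)[OF F], of "n - 1"] k l_eq by simp
  then show "r (F ! k) \<le> Suc k" using up[of k "n - 1 - k"] k by simp
qed

lemma facets_cov:
  assumes F: "F \<in> facets" and k: "k < n"
  shows "cov (ext F k) (F ! k)"
proof (cases k)
  case 0
  then show ?thesis using facets_nth[OF F k] facets_rank[OF F k] rank_bottom by (simp add: cov_def)
next
  case (Suc j)
  then show ?thesis
    using facets_nth[OF F k] facets_rank[OF F k] facets_nth[OF F, of j] facets_rank[OF F, of j]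
      facets_less[OF F, of j k] k by (simp add: cov_def less_iff)
qed

lemma ext_in: "F \<in> facets \<Longrightarrow> k \<le> n \<Longrightarrow> ext F k \<in> carrier L"
  using facets_nth(1)[of F "k - 1"] by (cases k) auto

lemma ext_rank: "F \<in> facets \<Longrightarrow> k \<le> n \<Longrightarrow> r (ext F k) = k"
  using facets_rank[of F "k - 1"] rank_bottom by (cases k) auto

lemma cov_chain_mono:
  assumes "\<And>k. k < m \<Longrightarrow> cov (ext F k) (F ! k)" "i \<le> j" "j < m"
  shows "F ! i \<sqsubseteq> F ! j"
  using assms(2,3)
proof (induction j)
  case 0
  then show ?case using covD(2)[OF assms(1)[of 0]] by simp
next
  case (Suc j)
  note c = covD[OF assms(1)[OF Suc.prems(2)]]
  show ?case
  proof (cases "i = Suc j")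
    case True
    then show ?thesis using c by simp
  next
    case False
    then have "F ! i \<sqsubseteq> F ! j" using Suc by simp
    then show ?thesis
      using le_trans[of "F ! i" "F ! j" "F ! Suc j"] c covD(2)[OF assms(1)[of i]] Suc.prems by simp
  qed
qed

lemma facetsI:
  assumes len: "length F = n" and cov: "\<And>k. k < n \<Longrightarrow> cov (ext F k) (F ! k)"
  shows "F \<in> facets"
proof -
  have rk: "r (F ! k) = Suc k" if "k < n" for k
    using that
  proof (induction k)
    case 0
    then show ?case using covD(4)[OF cov[of 0]] rank_bottom by simp
  next
    case (Suc k)
    then show ?case using covD(4)[OF cov[of "Suc k"]] by simp
  qed
  have els: "x \<in> carrier L \<and> x \<noteq> \<bottom> \<and> \<not> g \<sqsubseteq> x" if xF: "x \<in> set F" for x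
  proof -
    obtain k where k: "k < n" "x = F ! k" using xF len by (auto simp: in_set_conv_nth)
    then show ?thesis using covD[OF cov[OF k(1)]] rk[OF k(1)] rank_bottom by force
  qed
  have "F ! i \<sqsubset> F ! j" if "i < j" "j < n" for i j
  proof -
    have "F ! i \<sqsubseteq> F ! j" using cov_chain_mono[of n F i j] cov that by simp
    moreover have "F ! i \<noteq> F ! j" using rk[of i] rk[of j] that by auto
    ultimately show ?thesis by (simp add: less_iff)
  qed
  then have "sorted_wrt (\<lambda>x y. x \<sqsubset> y) F" using len by (simp add: sorted_wrt_iff_nth_less)
  then show ?thesis using len els unfolding facets_def by blast
qed

lemma ext_list_update: "k \<noteq> Suc j \<Longrightarrow> ext (F[j := v]) k = ext F k"
  by (cases k) auto

lemma facets_update: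
  assumes F: "F \<in> facets" and j: "j < n" and v: "cov (ext F j) v" "Suc j < n \<Longrightarrow> v \<sqsubseteq> F ! Suc j"
  shows "F[j := v] \<in> facets"
proof (rule facetsI)
  show "length (F[j := v]) = n" using facets_length[OF F] by simp
  fix k assume k: "k < n"
  consider "k = j" | "k = Suc j" | "k \<noteq> j" "k \<noteq> Suc j" by blast
  then show "cov (ext (F[j := v]) k) (F[j := v] ! k)"
  proof cases
    case 1
    then show ?thesis using v(1) facets_length[OF F] j by (simp add: ext_list_update)
  next
    case 2
    have "r v = r (F ! j)" using covD(4)[OF v(1)] covD(4)[OF facets_cov[OF F j]] by simp
    then show ?thesis
      using 2 v k facets_length[OF F] covD[OF v(1)] covD[OF facets_cov[OF F k]] by (simp add: cov_def)
  next
    case 3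
    then show ?thesis using facets_cov[OF F k] by (simp add: ext_list_update)
  qed
qed

text \<open>Keys of covers are comparable only over a common lower element. As \<open>ckey\<close>
  is injective there, equal keys up to some position mean equal elements, so the lexicographic
  comparison is decided at the first element where the chains differ.\<close>

lemma fkey_less_iff:
  assumes E: "E \<in> facets" and F: "F \<in> facets"
  shows "fkey E < fkey F \<longleftrightarrow>
    (\<exists>k<n. (\<forall>j<k. E ! j = F ! j) \<and> ckey (ext E k) (E ! k) < ckey (ext F k) (F ! k))"
proof -
  have agree: "(\<forall>j<k. ckey (ext E j) (E ! j) = ckey (ext F j) (F ! j)) \<longleftrightarrow> (\<forall>j<k. E ! j = F ! j)"
    if "k \<le> n" for k
    using that
  proof (induction k)
    case (Suc k)
    have ee: "ext E k = ext F k" if "\<forall>j<k. E ! j = F ! j" using that by (cases k) auto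
    have "ckey (ext E k) (E ! k) = ckey (ext F k) (F ! k) \<longleftrightarrow> E ! k = F ! k" if "\<forall>j<k. E ! j = F ! j"
      using ckey_inj[of "ext F k" "E ! k" "F ! k"] facets_cov[OF E, of k] facets_cov[OF F, of k] Suc.prems ee[OF that]
      by auto
    then show ?case using Suc by (auto simp: less_Suc_eq)
  qed simp
  have "fkey E < fkey F \<longleftrightarrow> (\<exists>k<n. (\<forall>j<k. ckey (ext E j) (E ! j) = ckey (ext F j) (F ! j)) \<and>
      ckey (ext E k) (E ! k) < ckey (ext F k) (F ! k))"
    by (subst less_list_same_length) (auto simp: fkey_def)
  also have "\<dots> \<longleftrightarrow> (\<exists>k<n. (\<forall>j<k. E ! j = F ! j) \<and> ckey (ext E k) (E ! k) < ckey (ext F k) (F ! k))"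
    using agree by (metis less_imp_le)
  finally show ?thesis .
qed

lemma fkey_inj: "inj_on fkey facets"
proof (rule inj_onI)
  fix E F assume EF: "E \<in> facets" "F \<in> facets" "fkey E = fkey F"
  have eq: "ckey (ext E k) (E ! k) = ckey (ext F k) (F ! k)" if "k < n" for k
    using arg_cong[OF EF(3), of "\<lambda>x. x ! k"] that by (simp add: fkey_def)
  have "E ! k = F ! k" if "k < n" for k
    using that
  proof (induction k rule: less_induct)
    case (less k)
    then have "ext E k = ext F k" by (cases k) auto
    then show ?case
      using ckey_inj[of "ext F k" "E ! k" "F ! k"] facets_cov[OF EF(1) less(2)] facets_cov[OF EF(2) less(2)]
        eq[OF less(2)] by simp
  qed
  then show "E = F"
    using facets_length[OF EF(1)] facets_length[OF EF(2)] by (auto intro: nth_equalityI)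
qed

text \<open>Local form of membership in the restriction face; at the last position the chain puts no
  upper bound on the new element.\<close>

definition earlier :: "'a list \<Rightarrow> nat \<Rightarrow> bool" where
  "earlier F j \<longleftrightarrow> (\<exists>v. cov (ext F j) v \<and> ckey (ext F j) v < ckey (ext F j) (F ! j) \<and> (Suc j < n \<longrightarrow> v \<sqsubseteq> F ! Suc j))"

text \<open>Chains that differ at one position are compared there, since all keys before it agree;
  the next key may change as well, but without effect on the comparison.\<close>

lemma earlier_iff:
  assumes F: "F \<in> facets" and j: "j < n"
  shows "(\<exists>G\<in>facets. fkey G < fkey F \<and> (\<forall>k<n. k \<noteq> j \<longrightarrow> G ! k = F ! k)) \<longleftrightarrow> earlier F j"
proof
  assume "\<exists>G\<in>facets. fkey G < fkey F \<and> (\<forall>k<n. k \<noteq> j \<longrightarrow> G ! k = F ! k)"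
  then obtain G where G: "G \<in> facets" "fkey G < fkey F" "\<forall>k<n. k \<noteq> j \<longrightarrow> G ! k = F ! k" by blast
  then obtain k where k: "k < n" "\<forall>i<k. G ! i = F ! i" "ckey (ext G k) (G ! k) < ckey (ext F k) (F ! k)"
    using fkey_less_iff[OF G(1) F] by blast
  have e: "ext G k = ext F k" using k(2) by (cases k) auto
  have "k = j"
  proof (rule ccontr)
    assume "k \<noteq> j"
    then have "G ! k = F ! k" using G k by blast
    then show False using k e by simp
  qed
  then show "earlier F j"
    unfolding earlier_def
    using k e facets_cov[OF G(1) k(1)] G(3) facets_less[OF G(1), of j "Suc j"] unfolding less_iff
    by (intro exI[of _ "G ! j"]) force
next
  assume "earlier F j"
  then obtain v where v: "cov (ext F j) v" "ckey (ext F j) v < ckey (ext F j) (F ! j)" "Suc j < n \<Longrightarrow> v \<sqsubseteq> F ! Suc j"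
    unfolding earlier_def by blast
  have G: "F[j := v] \<in> facets" by (rule facets_update[OF F j v(1,3)])
  have "fkey (F[j := v]) < fkey F"
    unfolding fkey_less_iff[OF G F]
    by (intro exI[of _ j]) (use j v facets_length[OF F] in \<open>simp add: ext_list_update\<close>)
  then show "\<exists>G\<in>facets. fkey G < fkey F \<and> (\<forall>k<n. k \<noteq> j \<longrightarrow> G ! k = F ! k)"
    using G by (intro bexI[of _ "F[j := v]"]) auto
qed

lemma facets_mono: "F \<in> facets \<Longrightarrow> i \<le> j \<Longrightarrow> j < n \<Longrightarrow> F ! i \<sqsubseteq> F ! j"
  using cov_chain_mono[of n F i j] facets_cov[of F] by blast

lemma ext_le: "F \<in> facets \<Longrightarrow> i \<le> j \<Longrightarrow> j < n \<Longrightarrow> ext F i \<sqsubseteq> F ! j"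
  using facets_mono[of F "i - 1" j] facets_nth(1)[of F j] by (cases i) auto

text \<open>Let the chains part at k, and let v' be the element of E there. As long as F is not
  above v' the chains differ, so if the claim fails no exchange is possible at these positions, and
  \<open>earlier_covers_first\<close> carries an earlier cover from each element of F to the next.
  Where F first gets above v', or else at its end, this cover fits into F and gives an exchange
  after all.\<close>

lemma facets_shell:
  assumes E: "E \<in> facets" and F: "F \<in> facets" and less: "fkey E < fkey F"
  shows "\<exists>j<n. E ! j \<noteq> F ! j \<and> earlier F j"
proof (rule ccontr)
  assume neg: "\<not> ?thesis"
  obtain k where k: "k < n" "\<forall>i<k. E ! i = F ! i" "ckey (ext E k) (E ! k) < ckey (ext F k) (F ! k)"
    using fkey_less_iff[OF E F] less by blast
  define u where "u = ext F k"
  define v' where "v' = E ! k"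
  have eu: "ext E k = u" using k(2) by (cases k) (auto simp: u_def)
  have uv': "cov u v'" and uv: "cov u (F ! k)" and lt: "ckey u v' < ckey u (F ! k)"
    using facets_cov[OF E k(1)] facets_cov[OF F k(1)] k(3) eu by (auto simp: u_def v'_def)
  note cu = covD[OF uv']
  have nle_k: "\<not> v' \<sqsubseteq> F ! k"
  proof
    assume "v' \<sqsubseteq> F ! k"
    then have "v' = F ! k" using rank_eq_imp_eq[of v' "F ! k"] covD[OF uv] cu by simp
    then show False using lt by simp
  qed
  have ne: "E ! j \<noteq> F ! j" if "k \<le> j" "j < n" "\<not> v' \<sqsubseteq> F ! j" for j
    using facets_mono[OF E that(1,2)] that(3) by (auto simp: v'_def)
  show False
  proof (cases "\<exists>i<n. v' \<sqsubseteq> F ! i")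
    case True
    define i0 where "i0 = (LEAST i. i < n \<and> v' \<sqsubseteq> F ! i)"
    have i0: "i0 < n" "v' \<sqsubseteq> F ! i0"
      using LeastI_ex[of "\<lambda>i. i < n \<and> v' \<sqsubseteq> F ! i"] True unfolding i0_def by blast+
    have below: "\<not> v' \<sqsubseteq> F ! i" if "i < i0" for i
      using not_less_Least[of i "\<lambda>i. i < n \<and> v' \<sqsubseteq> F ! i"] that i0 unfolding i0_def[symmetric] by auto
    have ki0: "k < i0"
    proof (rule ccontr)
      assume "\<not> ?thesis"
      then have "F ! i0 \<sqsubseteq> F ! k" using facets_mono[OF F, of i0 k] k by simp
      then show False using le_trans[OF i0(2)] nle_k facets_nth(1)[OF F] i0 k cu by blast
    qed
    define x where "x = lab u v'"
    have x: "x < length as" "as ! x \<sqsubseteq> v'" "\<not> as ! x \<sqsubseteq> u" using cov_lab[OF uv'] by (auto simp: x_def)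
    have xi0: "as ! x \<sqsubseteq> F ! i0" using le_trans[OF x(2) i0(2)] x facets_nth(1)[OF F i0(1)] cu by simp
    have nx: "\<not> as ! x \<sqsubseteq> F ! i" if "k \<le> i" "i < i0" for i
    proof
      assume "as ! x \<sqsubseteq> F ! i"
      then have "v' \<sqsubseteq> F ! i"
        using join_le[of u "F ! i" "as ! x"] cov_join_lab[OF uv'] ext_le[OF F, of k i] that i0 x cu
          facets_nth(1)[OF F, of i] by (simp add: x_def u_def)
      then show False using below that by simp
    qed
    have nearlier: "\<not> earlier F i" if "k \<le> i" "i < i0" for i
    proof -
      have "i < n" using that i0 by simp
      then show ?thesis using neg ne[OF that(1) _ below[OF that(2)]] by blast
    qed
    \<comment> \<open>In this case the same atom serves at every step, because joining it stays
      under \<open>F ! i0\<close> and hence off the filter of g.\<close>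
    have chain: "cov (ext F i) (ext F i \<squnion> as ! x) \<and> ckey (ext F i) (ext F i \<squnion> as ! x) < ckey (ext F i) (F ! i)"
      if "k \<le> i" "i < i0" for i
      using that
    proof (induction i)
      case 0
      then have "k = 0" by simp
      then show ?case using uv' lt cov_join_lab[OF uv'] by (simp add: x_def u_def)
    next
      case (Suc i)
      show ?case
      proof (cases "k = Suc i")
        case True
        then show ?thesis using uv' lt cov_join_lab[OF uv'] by (simp add: x_def u_def)
      next
        case False
        then have ki: "k \<le> i" "i < i0" "Suc i < n" using Suc.prems i0 by auto
        have IH: "cov (ext F i) (ext F i \<squnion> as ! x)" "ckey (ext F i) (ext F i \<squnion> as ! x) < ckey (ext F i) (F ! i)"
          using Suc.IH ki by auto
        have Fi: "F ! i \<in> carrier L" using facets_nth(1)[OF F, of i] ki by simp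
        have c: "cov (F ! i) (F ! i \<squnion> as ! x)"
          using covI(1)[OF Fi x(1) nx[OF ki(1,2)] facets_nth(1)[OF F i0(1)] _ xi0 facets_nth(3)[OF F i0(1)]]
            facets_mono[OF F, of i i0] ki i0 by simp
        have le: "ext F i \<squnion> as ! x \<sqsubseteq> F ! i \<squnion> as ! x"
          using join_le[of "ext F i" "F ! i \<squnion> as ! x" "as ! x"] join_left[of "F ! i" "as ! x"] join_right[of "F ! i" "as ! x"]
            le_trans[of "ext F i" "F ! i" "F ! i \<squnion> as ! x"] ext_le[OF F, of i i] ext_in[OF F, of i] ki x(1) Fi by simp
        have ne': "\<And>v''. cov (ext F i) v'' \<Longrightarrow> ckey (ext F i) v'' < ckey (ext F i) (F ! i) \<Longrightarrow> \<not> v'' \<sqsubseteq> F ! Suc i"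
          using nearlier[OF ki(1,2)] unfolding earlier_def by blast
        have "ckey (F ! i) (F ! i \<squnion> as ! x) < ckey (F ! i) (F ! Suc i)"
          by (rule earlier_covers_first[OF facets_cov[OF F] IH c le facets_cov[OF F ki(3), simplified] ne'])
             (use ki in simp_all)
        then show ?thesis using c by simp
      qed
    qed
    define i where "i = i0 - 1"
    have i: "k \<le> i" "i < i0" "Suc i = i0" using ki0 by (auto simp: i_def)
    have "ext F i \<squnion> as ! x \<sqsubseteq> F ! Suc i"
      using join_le[of "ext F i" "F ! i0" "as ! x"] xi0 ext_le[OF F, of i i0] ext_in[OF F, of i] i i0 x(1)
        facets_nth(1)[OF F i0(1)] by simp
    then have "earlier F i" unfolding earlier_def using chain[OF i(1,2)] by blast
    then show False using nearlier[OF i(1,2)] by simp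
  next
    case False
    then have nearlier: "\<not> earlier F i" if "k \<le> i" "i < n" for i
      using neg ne[OF that] False that by blast
    \<comment> \<open>Without a bound from F the cover has to be found afresh at each step by
      \<open>ex_cover_above_earlier\<close>. This applies because a further element of F follows, so
      the corank is at least two.\<close>
    have chain: "\<exists>v. cov (ext F i) v \<and> ckey (ext F i) v < ckey (ext F i) (F ! i)" if "k \<le> i" "i < n" for i
      using that
    proof (induction i)
      case 0
      then show ?case using uv' lt by (auto simp: u_def)
    next
      case (Suc i)
      show ?case
      proof (cases "k = Suc i")
        case True
        then show ?thesis using uv' lt by (auto simp: u_def)
      next
        case False
        then have ki: "k \<le> i" "i < n" "Suc i < n" using Suc.prems by auto
        obtain v where v: "cov (ext F i) v" "ckey (ext F i) v < ckey (ext F i) (F ! i)"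
          using Suc.IH ki by auto
        have "Suc (r (F ! i)) < l" using facets_rank[OF F ki(2)] ki(3) l_eq by simp
        from ex_cover_above_earlier[OF facets_cov[OF F ki(2)] v this]
        obtain w v'' where w: "cov (F ! i) w" "cov (ext F i) v''" "ckey (ext F i) v'' < ckey (ext F i) (F ! i)" "v'' \<sqsubseteq> w"
          by (elim exE conjE)
        have ne': "\<And>v''. cov (ext F i) v'' \<Longrightarrow> ckey (ext F i) v'' < ckey (ext F i) (F ! i) \<Longrightarrow> \<not> v'' \<sqsubseteq> F ! Suc i"
          using nearlier[OF ki(1,2)] unfolding earlier_def by blast
        have "ckey (F ! i) w < ckey (F ! i) (F ! Suc i)"
          by (rule earlier_covers_first[OF facets_cov[OF F ki(2)] w(2,3,1,4) facets_cov[OF F ki(3), simplified] ne'])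
        then show ?thesis using w(1) by auto
      qed
    qed
    \<comment> \<open>At the last position any earlier cover is an exchange.\<close>
    have "k \<le> n - 1" "n - 1 < n" using k by auto
    from chain[OF this] nearlier[OF this] show False unfolding earlier_def by auto
  qed
qed

lemma finite_facets: "finite facets"
proof (rule finite_subset)
  show "facets \<subseteq> {F. set F \<subseteq> carrier L \<and> length F = n}" by (auto simp: facets_def)
qed (rule finite_lists_length_eq[OF finite_carrier])

text \<open>Positions count from 0 while the first element of a chain has rank one, hence the
  shifted rank.\<close>

sublocale facets: shelling facets n "\<lambda>u. r u - 1" fkey
proof
  fix E F assume EF: "E \<in> facets" "F \<in> facets" "fkey E < fkey F"
  from facets_shell[OF this] obtain j where "j < n" "E ! j \<noteq> F ! j" "earlier F j" by blast
  then show "\<exists>j<n. E ! j \<noteq> F ! j \<and> (\<exists>G\<in>facets. fkey G < fkey F \<and> (\<forall>k<n. k \<noteq> j \<longrightarrow> G ! k = F ! k))"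
    using earlier_iff[OF EF(2), of j] by blast
qed (use finite_facets facets_length facets_rank fkey_inj in auto)

lemma homology_facets_iff: "F \<in> facets.homology_facets \<longleftrightarrow> F \<in> facets \<and> (\<forall>j<n. earlier F j)"
proof -
  have "facets.R F = {..<n} \<longleftrightarrow> (\<forall>j<n. earlier F j)" if "F \<in> facets"
  proof -
    have "facets.R F = {j. j < n \<and> earlier F j}"
      unfolding facets.R_def by (rule Collect_cong, rule conj_cong, rule HOL.refl, rule earlier_iff[OF that])
    then show ?thesis by auto
  qed
  then show ?thesis unfolding facets.homology_facets_def by blast
qed

end

section \<open>Activities\<close>

locale ordered_geometric = geometric +
  fixes as :: "'a list"
  assumes distinct_as: "distinct as" and set_as: "set as = atoms L"
begin

lemma pos_as_inj: "a \<in> atoms L \<Longrightarrow> b \<in> atoms L \<Longrightarrow> pos as a = pos as b \<Longrightarrow> a = b"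
  using pos_inj[of a as b] set_as by simp

text \<open>The right side involves only B and a, so the fundamental circuit is unique, as the
  definite description in \<open>externally_active\<close> demands. That an element b belongs to it
  exactly when a depends on b follows from \<open>circuit_two\<close> for the flat spanned by the
  rest of B.\<close>

lemma fundamental_circuit:
  assumes B: "independent L B" and a: "a \<in> atoms L" "a \<notin> B" and C: "circuit L C" "C \<subseteq> insert a B"
  shows "C = insert a {b \<in> B. \<not> a \<sqsubseteq> \<Squnion>(B - {b})}"
proof -
  have Bc: "B \<subseteq> carrier L" "\<And>A. A \<subseteq> B \<Longrightarrow> A \<subseteq> carrier L"
    using independent_atoms[OF B] atoms_sub by blast+
  have aC: "a \<in> C" using circuit_not_independent[OF C(1) B] C(2) by blast
  have "b \<in> C \<longleftrightarrow> \<not> a \<sqsubseteq> \<Squnion>(B - {b})" if b: "b \<in> B" for b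
  proof
    assume bC: "b \<in> C"
    show "\<not> a \<sqsubseteq> \<Squnion>(B - {b})"
    proof
      assume le: "a \<sqsubseteq> \<Squnion>(B - {b})"
      have "b \<sqsubseteq> \<Squnion>(B - {b})"
      proof (rule circuit_two[OF C(1) sup_in[OF Bc(2)] bC])
        fix c assume "c \<in> C" "c \<noteq> b"
        then have "c = a \<or> c \<in> B - {b}" using C(2) by blast
        then show "c \<sqsubseteq> \<Squnion>(B - {b})" using le sup_ge[OF Bc(2), of "B - {b}" c] by blast
      qed blast
      then show False using independent_not_le[OF B b] by simp
    qed
  next
    assume n: "\<not> a \<sqsubseteq> \<Squnion>(B - {b})"
    show "b \<in> C"
    proof (rule ccontr)
      assume "b \<notin> C"
      have "a \<sqsubseteq> \<Squnion>(B - {b})"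
      proof (rule circuit_two[OF C(1) sup_in[OF Bc(2)] aC])
        fix c assume "c \<in> C" "c \<noteq> a"
        then have "c \<in> B - {b}" using C(2) \<open>b \<notin> C\<close> by blast
        then show "c \<sqsubseteq> \<Squnion>(B - {b})" using sup_ge[OF Bc(2), of "B - {b}" c] by blast
      qed blast
      then show False using n by simp
    qed
  qed
  then show ?thesis using aC C(2) by blast
qed

lemma the_circuit:
  assumes "independent L B" "a \<in> atoms L" "a \<notin> B" "circuit L C" "C \<subseteq> insert a B"
  shows "(THE C. circuit L C \<and> C \<subseteq> insert a B) = C"
proof (rule the_equality)
  fix C' assume "circuit L C' \<and> C' \<subseteq> insert a B"
  then have "C' = insert a {b \<in> B. \<not> a \<sqsubseteq> \<Squnion>(B - {b})}"
    using fundamental_circuit[OF assms(1-3)] by blast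
  also have "\<dots> = C" by (rule fundamental_circuit[OF assms, symmetric])
  finally show "C' = C" .
qed (use assms(4,5) in blast)

text \<open>Minimality of a in its fundamental circuit says that the rest of the circuit consists of
  larger elements of B. The resulting closure condition can be tested against the elements of a
  chain, which a circuit cannot.\<close>

lemma externally_active_iff:
  assumes B: "lattice_basis L B"
  shows "externally_active L as B a \<longleftrightarrow> a \<in> atoms L \<and> a \<notin> B \<and> a \<sqsubseteq> \<Squnion>{b \<in> B. pos as a < pos as b}"
proof -
  have iB: "independent L B" using B by (simp add: lattice_basis_def)
  have BA: "B \<subseteq> atoms L" using independent_atoms[OF iB] .
  let ?D = "{b \<in> B. pos as a < pos as b}"
  have Dc: "?D \<subseteq> carrier L" using BA atoms_sub by blast
  show ?thesis
  proof
    assume ea: "externally_active L as B a"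
    then have a: "a \<in> atoms L" "a \<notin> B" by (auto simp: externally_active_def)
    have "r (\<Squnion>B) = rank_of L \<top>" using B by (simp add: lattice_basis_def independent_def rank_poset_def)
    then have "\<Squnion>B = \<top>" using rank_eq_imp_eq[of "\<Squnion>B" \<top>] subset_atoms_carrier[OF BA] by simp
    then have "a \<sqsubseteq> \<Squnion>B" using a by simp
    then obtain C where C: "circuit L C" "C \<subseteq> insert a B" "a \<in> C"
      using ex_circuit_insert[OF iB a] by blast
    then have min: "a = list_min as C"
      using the_circuit[OF iB a C(1,2)] ea by (simp add: externally_active_def)
    have Cas: "C \<subseteq> set as" using circuit_atoms[OF C(1)] set_as by simp
    have "a \<sqsubseteq> \<Squnion>?D"
    proof (rule circuit_two[OF C(1) sup_in[OF Dc] C(3)])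
      fix c assume c: "c \<in> C" "c \<noteq> a"
      have "pos as a \<le> pos as c" using list_min_le[OF Cas c(1)] min by simp
      moreover have "pos as a \<noteq> pos as c" using pos_as_inj[OF a(1)] c Cas set_as by blast
      ultimately have "c \<in> ?D" using c C(2) by auto
      then show "c \<sqsubseteq> \<Squnion>?D" by (rule sup_ge[OF Dc])
    qed
    then show "a \<in> atoms L \<and> a \<notin> B \<and> a \<sqsubseteq> \<Squnion>?D" using a by blast
  next
    assume "a \<in> atoms L \<and> a \<notin> B \<and> a \<sqsubseteq> \<Squnion>?D"
    then have a: "a \<in> atoms L" "a \<notin> B" "a \<sqsubseteq> \<Squnion>?D" by auto
    have "independent L ?D" by (rule independent_subset[OF iB]) blast
    then obtain C where C: "circuit L C" "C \<subseteq> insert a ?D" "a \<in> C"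
      using ex_circuit_insert[of ?D a] a by blast
    have "(THE C. circuit L C \<and> C \<subseteq> insert a B) = C"
      using the_circuit[OF iB a(1,2) C(1)] C(2) by blast
    moreover have "list_min as C = a"
    proof (rule list_min_eqI)
      show "C \<subseteq> set as" using circuit_atoms[OF C(1)] set_as by simp
      show "pos as a \<le> pos as c" if "c \<in> C" for c
        using that C(2) by force
    qed (rule C(3))
    ultimately show "externally_active L as B a"
      using a by (simp add: externally_active_def)
  qed
qed

text \<open>The atoms that can replace b are those off the hyperplane spanned by the rest of B, so b
  is the least of them when all smaller atoms lie on this hyperplane.\<close>

lemma internally_active_iff:
  assumes B: "lattice_basis L B"
  shows "internally_active L as B b \<longleftrightarrow> b \<in> B \<and> (\<forall>a\<in>atoms L. pos as a < pos as b \<longrightarrow> a \<sqsubseteq> \<Squnion>(B - {b}))"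
proof (cases "b \<in> B")
  case True
  have iB: "independent L B" and cB: "card B = rank_poset L" using B by (auto simp: lattice_basis_def)
  have BA: "B \<subseteq> atoms L" using independent_atoms[OF iB] .
  have finB: "finite B" using finite_atom_set[OF BA] .
  let ?B = "B - {b}"
  have iB': "independent L ?B" by (rule independent_subset[OF iB]) blast
  have Bc: "?B \<subseteq> carrier L" using BA atoms_sub by blast
  have ex: "lattice_basis L (insert a ?B) \<longleftrightarrow> \<not> a \<sqsubseteq> \<Squnion>?B" if a: "a \<in> atoms L" for a
  proof (cases "a \<in> ?B")
    \<comment> \<open>Then the set has one element too few to be a basis.\<close>
    case aB: True
    then have "a \<sqsubseteq> \<Squnion>?B" by (rule sup_ge[OF Bc])
    moreover have "card (insert a ?B) < card B"
      using aB card_Diff1_less[OF finB True] by (simp only: insert_absorb)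
    ultimately show ?thesis using cB by (simp add: lattice_basis_def)
  next
    case False
    have "card (insert a ?B) = card B" using False True finB card_Suc_Diff1[of B b] by simp
    then show ?thesis
      using independent_insert[of ?B a] False a iB' BA cB by (auto simp: lattice_basis_def)
  qed
  let ?A = "{a \<in> atoms L. lattice_basis L (insert a ?B)}"
  have A: "?A = {a \<in> atoms L. \<not> a \<sqsubseteq> \<Squnion>?B}" using ex by blast
  have bA: "b \<in> ?A" unfolding A using independent_not_le[OF iB True] True BA by blast
  have sub: "?A \<subseteq> set as" using set_as by auto
  have "b = list_min as ?A \<longleftrightarrow> (\<forall>a\<in>?A. pos as b \<le> pos as a)"
  proof
    assume "b = list_min as ?A"
    then show "\<forall>a\<in>?A. pos as b \<le> pos as a" using list_min_le[OF sub] by simp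
  next
    assume "\<forall>a\<in>?A. pos as b \<le> pos as a"
    then show "b = list_min as ?A" using list_min_eqI[OF sub bA] by simp
  qed
  also have "\<dots> \<longleftrightarrow> (\<forall>a\<in>atoms L. pos as a < pos as b \<longrightarrow> a \<sqsubseteq> \<Squnion>?B)"
    unfolding A using not_le by blast
  finally show ?thesis using True by (simp add: internally_active_def)
next
  case False
  then show ?thesis by (simp add: internally_active_def)
qed

end

sublocale pointed_geometric \<subseteq> ordered_geometric
  by unfold_locales (rule distinct_as, rule set_as)

lemma sorted_wrt_pos_filter:
  assumes "distinct as"
  shows "sorted_wrt (\<lambda>a b. pos as a < pos as b) (filter P as)"
proof -
  have "sorted_wrt (\<lambda>a b. pos as a < pos as b) as"
    unfolding sorted_wrt_iff_nth_less using pos_nth[OF assms] by simp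
  then show ?thesis by (rule sorted_wrt_filter)
qed

lemma filter_eqI:
  assumes "distinct as" "set zs \<subseteq> set as" "sorted_wrt (\<lambda>a b. pos as a < pos as b) zs"
  shows "filter (\<lambda>a. a \<in> set zs) as = zs"
proof -
  let ?f = "filter (\<lambda>a. a \<in> set zs) as"
  have s: "sorted_wrt (<) (map (pos as) ?f)" "sorted_wrt (<) (map (pos as) zs)"
    using sorted_wrt_pos_filter[OF assms(1)] assms(3) by (simp_all add: sorted_wrt_map)
  have set: "set ?f = set zs" using assms(2) by auto
  then have "map (pos as) ?f = map (pos as) zs"
    using s by (intro sorted_distinct_set_unique) (simp_all add: strict_sorted_iff)
  moreover have "inj_on (pos as) (set ?f \<union> set zs)"
    using assms(2) pos_inj[of _ as] by (intro inj_onI) auto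
  ultimately show ?thesis by (rule map_inj_on)
qed

section \<open>Beta-NBC bases and homology facets\<close>

context pointed_geometric
begin

lemma atom_le_S:
  assumes "u \<in> carrier L" "a \<in> atoms L" "pos as a < i"
  shows "a \<sqsubseteq> S u i"
proof -
  have "a \<in> set as" using assms(2) set_as by simp
  then have "pos as a < length as" "as ! pos as a = a" by (rule pos_less, rule nth_pos)
  then show ?thesis using as_le_S[OF assms(1,3)] by (simp only:)
qed

lemma pos_g: "pos as g = 0"
  using pos_nth[OF distinct_as, of 0] as_nonempty g_first by simp

lemma pos_atom: "a \<in> atoms L \<Longrightarrow> pos as a < length as" "a \<in> atoms L \<Longrightarrow> as ! pos as a = a"
  using pos_less[of a as] nth_pos[of a as] set_as by auto

definition other_atoms :: "'a set \<Rightarrow> 'a list" where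
  "other_atoms B = rev (filter (\<lambda>a. a \<in> B - {g}) as)"

definition flag :: "'a list \<Rightarrow> 'a list" where
  "flag bs = map (\<lambda>k. \<Squnion>(set (take (Suc k) bs))) [0..<length bs]"

definition basis_facet :: "'a set \<Rightarrow> 'a list" where
  "basis_facet B = flag (other_atoms B)"

lemma basis_top:
  assumes "lattice_basis L B"
  shows "\<Squnion>B = \<top>"
proof -
  have "r (\<Squnion>B) = r \<top>" and BA: "B \<subseteq> atoms L"
    using assms by (auto simp: lattice_basis_def independent_def rank_poset_def)
  then show ?thesis using rank_eq_imp_eq[of "\<Squnion>B" \<top>] subset_atoms_carrier[OF BA] by simp
qed

lemma betaNBC_D:
  assumes "B \<in> betaNBC L as g"
  shows "lattice_basis L B" "g \<in> B"
    "\<And>a. a \<in> atoms L \<Longrightarrow> a \<notin> B \<Longrightarrow> \<not> a \<sqsubseteq> \<Squnion>{b \<in> B. pos as a < pos as b}"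
    "\<And>b. b \<in> B \<Longrightarrow> b \<noteq> g \<Longrightarrow> \<exists>a\<in>atoms L. pos as a < pos as b \<and> \<not> a \<sqsubseteq> \<Squnion>(B - {b})"
proof -
  show B: "lattice_basis L B" using assms by (simp add: betaNBC_def)
  have act: "{b. internally_active L as B b} = {g}" and noext: "\<And>a. \<not> externally_active L as B a"
    using assms by (auto simp: betaNBC_def)
  have "internally_active L as B g" using act by blast
  then show "g \<in> B" by (simp add: internally_active_def)
  show "\<And>a. a \<in> atoms L \<Longrightarrow> a \<notin> B \<Longrightarrow> \<not> a \<sqsubseteq> \<Squnion>{b \<in> B. pos as a < pos as b}"
    using noext externally_active_iff[OF B] by blast
  fix b assume b: "b \<in> B" "b \<noteq> g"
  then have "\<not> internally_active L as B b" using act by blast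
  then show "\<exists>a\<in>atoms L. pos as a < pos as b \<and> \<not> a \<sqsubseteq> \<Squnion>(B - {b})"
    using b(1) unfolding internally_active_iff[OF B] by blast
qed

lemma other_atoms_props:
  assumes B: "B \<subseteq> atoms L"
  shows "set (other_atoms B) = B - {g}" "distinct (other_atoms B)"
    "\<And>i j. i < j \<Longrightarrow> j < length (other_atoms B) \<Longrightarrow> pos as (other_atoms B ! j) < pos as (other_atoms B ! i)"
proof -
  show "set (other_atoms B) = B - {g}" using B set_as by (auto simp: other_atoms_def)
  show "distinct (other_atoms B)" using distinct_as by (simp add: other_atoms_def)
  have "sorted_wrt (\<lambda>a b. pos as b < pos as a) (other_atoms B)"
    unfolding other_atoms_def sorted_wrt_rev by (rule sorted_wrt_pos_filter[OF distinct_as])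
  then show "\<And>i j. i < j \<Longrightarrow> j < length (other_atoms B) \<Longrightarrow> pos as (other_atoms B ! j) < pos as (other_atoms B ! i)"
    using sorted_wrt_nth_less[of "\<lambda>a b. pos as b < pos as a" "other_atoms B"] by blast
qed

lemma flag_ext: "k \<le> length bs \<Longrightarrow> ext (flag bs) k = \<Squnion>(set (take k bs))"
  by (cases k) (simp_all add: flag_def sup_empty)

lemma flag_nth: "k < length bs \<Longrightarrow> flag bs ! k = \<Squnion>(set (take (Suc k) bs))"
  by (simp add: flag_def)

lemma length_flag [simp]: "length (flag bs) = length bs"
  by (simp add: flag_def)

lemma length_other_atoms:
  assumes "lattice_basis L B" "g \<in> B"
  shows "length (other_atoms B) = n"
proof -
  have BA: "B \<subseteq> atoms L" and cB: "card B = l" using assms by (auto simp: lattice_basis_def independent_def l_def)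
  have "length (other_atoms B) = card (B - {g})"
    using other_atoms_props(1,2)[OF BA] distinct_card[of "other_atoms B"] by simp
  then show ?thesis using assms(2) cB finite_atom_set[OF BA] by (simp add: n_def)
qed

text \<open>Independence makes each new atom raise the rank by one, and independence of g from the
  rest of B keeps all joins off its filter.\<close>

lemma basis_facet_in:
  assumes B: "lattice_basis L B" and gB: "g \<in> B"
  shows "basis_facet B \<in> facets"
proof -
  have iB: "independent L B" using B by (simp add: lattice_basis_def)
  have BA: "B \<subseteq> atoms L" using independent_atoms[OF iB] .
  define bs where "bs = other_atoms B"
  note bs = other_atoms_props[OF BA, folded bs_def]
  have len: "length bs = n" using length_other_atoms[OF B gB] by (simp add: bs_def)
  have "flag bs \<in> facets"
  proof (rule facetsI)
    show "length (flag bs) = n" using len by simp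
    fix k assume k: "k < n"
    define T where "T = set (take k bs)"
    define b where "b = bs ! k"
    have T: "T \<subseteq> B" "b \<in> B" "b \<notin> T" "set (take (Suc k) bs) = insert b T" "g \<notin> insert b T"
    proof -
      show tk: "set (take (Suc k) bs) = insert b T"
        using k len by (simp add: T_def b_def take_Suc_conv_app_nth)
      have "set (take (Suc k) bs) \<subseteq> set bs" by (rule set_take_subset)
      then show "T \<subseteq> B" "b \<in> B" "g \<notin> insert b T" using tk bs(1) by blast+
      have "distinct (take (Suc k) bs)" using bs(2) by simp
      then show "b \<notin> T" using k len by (simp add: T_def b_def take_Suc_conv_app_nth)
    qed
    have TA: "T \<subseteq> atoms L" "b \<in> atoms L" "insert b T \<subseteq> carrier L" using T BA atoms_sub by blast+
    have ind: "independent L (insert b T)" by (rule independent_subset[OF iB]) (use T in blast)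
    have nb: "\<not> b \<sqsubseteq> \<Squnion>T" using independent_insert[OF TA(1,2) T(3)] ind by simp
    have ng: "\<not> g \<sqsubseteq> \<Squnion>(insert b T)"
    proof
      assume le: "g \<sqsubseteq> \<Squnion>(insert b T)"
      have Bg: "B - {g} \<subseteq> carrier L" using BA atoms_sub by blast
      have "\<Squnion>(insert b T) \<sqsubseteq> \<Squnion>(B - {g})" by (rule sup_mono[OF _ Bg]) (use T in blast)
      then have "g \<sqsubseteq> \<Squnion>(B - {g})" using le_trans[OF le] TA(3) Bg by simp
      then show False using independent_not_le[OF iB gB] by simp
    qed
    have "ext (flag bs) k = \<Squnion>T" "flag bs ! k = \<Squnion>(insert b T)"
      using k len flag_ext[of k bs] flag_nth[of k bs] T(4) by (simp_all add: T_def)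
    then show "cov (ext (flag bs) k) (flag bs ! k)"
      using rank_sup_insert[OF TA(1,2)] nb ng TA(3) sup_mono[of T "insert b T"] unfolding cov_def by auto
  qed
  then show ?thesis by (simp add: basis_facet_def bs_def)
qed

text \<open>The atoms enter in decreasing order, so the newest one is the smallest so far. A still
  smaller atom under the same join would be externally active or, if it belongs to B, would
  contradict independence.\<close>

lemma basis_facet_lab:
  assumes B: "B \<in> betaNBC L as g" and k: "k < n"
  shows "lab (ext (basis_facet B) k) (basis_facet B ! k) = pos as (other_atoms B ! k)"
proof -
  note D = betaNBC_D[OF B]
  have iB: "independent L B" using D(1) by (simp add: lattice_basis_def)
  have BA: "B \<subseteq> atoms L" using independent_atoms[OF iB] .
  define bs where "bs = other_atoms B"
  note bs = other_atoms_props[OF BA, folded bs_def]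
  have len: "length bs = n" using length_other_atoms[OF D(1,2)] by (simp add: bs_def)
  have F: "flag bs \<in> facets" using basis_facet_in[OF D(1,2)] by (simp add: basis_facet_def bs_def)
  define b where "b = bs ! k"
  have bB: "b \<in> B" "b \<in> atoms L" using bs(1) k len nth_mem[of k bs] BA by (auto simp: b_def)
  define T where "T = set (take (Suc k) bs)"
  have TB: "T \<subseteq> B" using bs(1) set_take_subset[of "Suc k" bs] by (auto simp: T_def)
  have Tc: "T \<subseteq> carrier L" using TB BA atoms_sub by blast
  have Fk: "flag bs ! k = \<Squnion>T" using k len flag_nth[of k bs] by (simp add: T_def)
  have Tpos: "pos as b \<le> pos as c" if cT: "c \<in> T" for c
  proof -
    obtain i where "i < length (take (Suc k) bs)" "take (Suc k) bs ! i = c"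
      using cT unfolding T_def in_set_conv_nth by blast
    then have i: "i \<le> k" "c = bs ! i" by auto
    then show ?thesis using bs(3)[of i k] k len by (cases "i = k") (auto simp: b_def)
  qed
  have bT: "b \<in> T" using k len by (simp add: b_def T_def take_Suc_conv_app_nth)
  have bF: "b \<sqsubseteq> flag bs ! k" using sup_ge[OF Tc bT] Fk by simp
  note cv = facets_cov[OF F k]
  have none: "\<not> a \<sqsubseteq> flag bs ! k" if a: "a \<in> atoms L" "pos as a < pos as b" for a
  proof
    assume le: "a \<sqsubseteq> flag bs ! k"
    have aT: "a \<notin> T" using Tpos[of a] a by auto
    show False
    proof (cases "a \<in> B")
      case True
      have Bc: "B - {a} \<subseteq> carrier L" using BA atoms_sub by blast
      have "\<Squnion>T \<sqsubseteq> \<Squnion>(B - {a})" by (rule sup_mono[OF _ Bc]) (use TB aT in blast)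
      then have "a \<sqsubseteq> \<Squnion>(B - {a})" using le_trans[of a "\<Squnion>T" "\<Squnion>(B - {a})"] le Fk Tc Bc a by simp
      then show False using independent_not_le[OF iB True] by simp
    next
      case False
      let ?D = "{c \<in> B. pos as a < pos as c}"
      have Dc: "?D \<subseteq> carrier L" using BA atoms_sub by blast
      have "T \<subseteq> ?D" using TB Tpos a(2) by (auto dest: less_le_trans)
      then have "\<Squnion>T \<sqsubseteq> \<Squnion>?D" by (rule sup_mono[OF _ Dc])
      then have "a \<sqsubseteq> \<Squnion>?D" using le_trans[of a "\<Squnion>T" "\<Squnion>?D"] le Fk Tc Dc a by simp
      then show False using D(3)[OF a(1) False] by simp
    qed
  qed
  have "lab (ext (flag bs) k) (flag bs ! k) = pos as b"
  proof (rule antisym)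
    have "\<not> b \<sqsubseteq> ext (flag bs) k"
    proof
      assume le: "b \<sqsubseteq> ext (flag bs) k"
      define T' where "T' = set (take k bs)"
      have "b \<notin> T'"
      proof -
        have "distinct (take (Suc k) bs)" using bs(2) by simp
        then show ?thesis using k len by (simp add: T'_def b_def take_Suc_conv_app_nth)
      qed
      moreover have "T' \<subseteq> B" using bs(1) set_take_subset[of k bs] by (auto simp: T'_def)
      ultimately have "T' \<subseteq> B - {b}" by blast
      moreover have Bc: "B - {b} \<subseteq> carrier L" using BA atoms_sub by blast
      ultimately have "\<Squnion>T' \<sqsubseteq> \<Squnion>(B - {b})" by (intro sup_mono)
      moreover have "ext (flag bs) k = \<Squnion>T'" using k len flag_ext[of k bs] by (simp add: T'_def)
      ultimately have "b \<sqsubseteq> \<Squnion>(B - {b})"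
        using le_trans[of b "\<Squnion>T'" "\<Squnion>(B - {b})"] le Bc \<open>T' \<subseteq> B - {b}\<close> bB by auto
      then show False using independent_not_le[OF iB bB(1)] by simp
    qed
    then show "lab (ext (flag bs) k) (flag bs ! k) \<le> pos as b"
      using lab_least[of "pos as b"] pos_atom[OF bB(2)] bF by simp
    show "pos as b \<le> lab (ext (flag bs) k) (flag bs ! k)"
      using none[OF as_atom[OF cov_lab(1)[OF cv]]] cov_lab(2)[OF cv] pos_nth[OF distinct_as cov_lab(1)[OF cv]]
      by (auto simp: not_less[symmetric])
  qed
  then show ?thesis by (simp add: basis_facet_def bs_def b_def)
qed

text \<open>The labels along the chain give back the atoms of the basis.\<close>

lemma basis_facet_inj: "inj_on basis_facet (betaNBC L as g)"
proof (rule inj_onI)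
  fix B B' assume B: "B \<in> betaNBC L as g" and B': "B' \<in> betaNBC L as g" and eq: "basis_facet B = basis_facet B'"
  note D = betaNBC_D(1,2)[OF B] and D' = betaNBC_D(1,2)[OF B']
  have BA: "B \<subseteq> atoms L" "B' \<subseteq> atoms L" using D D' by (auto simp: lattice_basis_def independent_def)
  have len: "length (other_atoms B) = n" "length (other_atoms B') = n"
    using length_other_atoms D D' by auto
  have "other_atoms B = other_atoms B'"
  proof (rule nth_equalityI)
    fix k assume "k < length (other_atoms B)"
    then have k: "k < n" using len by simp
    have "pos as (other_atoms B ! k) = pos as (other_atoms B' ! k)"
      using basis_facet_lab[OF B k] basis_facet_lab[OF B' k] eq by simp
    moreover have "other_atoms B ! k \<in> atoms L" "other_atoms B' ! k \<in> atoms L"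
      using nth_mem[of k "other_atoms B"] nth_mem[of k "other_atoms B'"] len k
        other_atoms_props(1)[OF BA(1)] other_atoms_props(1)[OF BA(2)] BA by auto
    ultimately show "other_atoms B ! k = other_atoms B' ! k" using pos_as_inj by blast
  qed (use len in simp)
  then have "B - {g} = B' - {g}"
    using other_atoms_props(1)[OF BA(1)] other_atoms_props(1)[OF BA(2)] by simp
  then show "B = B'" using D(2) D'(2) by blast
qed

text \<open>Before the last position the next atom is smaller than the current label and gives an
  earlier cover; at the last position the special cover does. Both need the current label not to be
  special, and this is where internal inactivity enters.\<close>

lemma basis_facet_homology:
  assumes B: "B \<in> betaNBC L as g"
  shows "basis_facet B \<in> facets.homology_facets"
  unfolding homology_facets_iff
proof (intro conjI allI impI)
  note D = betaNBC_D[OF B]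
  have iB: "independent L B" using D(1) by (simp add: lattice_basis_def)
  have BA: "B \<subseteq> atoms L" using independent_atoms[OF iB] .
  define bs where "bs = other_atoms B"
  note bs = other_atoms_props[OF BA, folded bs_def]
  have len: "length bs = n" using length_other_atoms[OF D(1,2)] by (simp add: bs_def)
  define F where "F = basis_facet B"
  have Fbs: "F = flag bs" by (simp add: F_def basis_facet_def bs_def)
  show F: "basis_facet B \<in> facets" by (rule basis_facet_in[OF D(1,2)])
  note F = F[folded F_def]
  have lab: "lab (ext F k) (F ! k) = pos as (bs ! k)" if "k < n" for k
    using basis_facet_lab[OF B that] by (simp add: F_def bs_def)
  fix k assume k: "k < n"
  define u where "u = ext F k"
  define b where "b = bs ! k"
  have bB: "b \<in> B" "b \<noteq> g" using bs(1) k len nth_mem[of k bs] by (auto simp: b_def)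
  have bA: "b \<in> atoms L" using bB BA by blast
  note cv = facets_cov[OF F k, folded u_def]
  have uc: "u \<in> carrier L" using covD(1)[OF cv] .
  have ug: "\<not> g \<sqsubseteq> u" using cov_not_g_bottom[OF cv] .
  then have ut: "u \<noteq> \<top>" by auto
  have lu: "lab u (F ! k) = pos as b" using lab[OF k] by (simp add: u_def b_def)
  have Bc: "B - {b} \<subseteq> carrier L" using BA atoms_sub by blast
  \<comment> \<open>Otherwise all other atoms of B lie in \<open>S u (x0 u)\<close>, the larger ones
    because they are already below u and the smaller ones by their position. So does an atom a
    witnessing that b is internally inactive; but a and the rest of B span.\<close>
  have nonspecial: "lab u (F ! k) \<noteq> x0 u"
  proof
    assume eq: "lab u (F ! k) = x0 u"
    obtain a where a: "a \<in> atoms L" "pos as a < pos as b" "\<not> a \<sqsubseteq> \<Squnion>(B - {b})"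
      using D(4)[OF bB] by blast
    let ?H = "\<Squnion>(B - {b})"
    have Sc: "S u (x0 u) \<in> carrier L" using uc by simp
    have "?H \<sqsubseteq> S u (x0 u)"
    proof (rule sup_le[OF Bc Sc])
      fix c assume c: "c \<in> B - {b}"
      then have cA: "c \<in> atoms L" using BA by blast
      show "c \<sqsubseteq> S u (x0 u)"
      proof (cases "pos as c < pos as b")
        case True
        then have "pos as c < x0 u" using eq lu by linarith
        then show ?thesis by (rule atom_le_S[OF uc cA])
      next
        case False
        moreover have "pos as b \<noteq> pos as c"
        proof
          assume "pos as b = pos as c"
          then have "b = c" by (rule pos_as_inj[OF bA cA])
          then show False using c by simp
        qed
        ultimately have gt: "pos as b < pos as c" by linarith
        have "c \<noteq> g" using gt pos_g by auto
        then have "c \<in> set bs" using c bs(1) by blast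
        then obtain i where i: "i < length bs" "bs ! i = c" by (auto simp: in_set_conv_nth)
        have "i < k"
        proof (rule ccontr)
          assume "\<not> i < k"
          then have "i = k \<or> k < i" by auto
          then show False using bs(3)[of k i] i gt by (auto simp: b_def)
        qed
        then have "c \<in> set (take k bs)" using i by (auto simp: in_set_conv_nth)
        moreover have "set (take k bs) \<subseteq> carrier L"
          using bs(1) set_take_subset[of k bs] BA atoms_sub by blast
        ultimately have "c \<sqsubseteq> u" using sup_ge flag_ext[of k bs] k len by (simp add: u_def Fbs)
        then show ?thesis using le_trans[of c u "S u (x0 u)"] le_S[OF uc] uc cA by simp
      qed
    qed
    moreover have "a \<sqsubseteq> S u (x0 u)"
    proof (rule atom_le_S[OF uc a(1)])
      show "pos as a < x0 u" using eq lu a(2) by linarith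
    qed
    ultimately have le: "?H \<squnion> a \<sqsubseteq> S u (x0 u)" using join_le[of ?H "S u (x0 u)" a] Bc Sc a(1) by simp
    have "independent L (B - {b})" by (rule independent_subset[OF iB]) blast
    then have "r ?H = card (B - {b})" by (simp add: independent_def)
    moreover have "card B = l" using D(1) by (simp add: lattice_basis_def l_def)
    ultimately have "r (?H \<squnion> a) = l"
      using rank_join_atom[OF a(1) sup_in[OF Bc] a(3)] bB(1) finite_atom_set[OF BA] l_pos by simp
    then have "?H \<squnion> a = \<top>" using rank_eq_l[of "?H \<squnion> a"] Bc a(1) by simp
    then show False using S_x0[OF uc ut] top_le_eq[OF Sc] le by simp
  qed
  show "earlier (basis_facet B) k"
    unfolding F_def[symmetric]
  proof (cases "Suc k < n")
    case True
    define i where "i = pos as (bs ! Suc k)"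
    have iA: "bs ! Suc k \<in> atoms L" using nth_mem[of "Suc k" bs] True len bs(1) BA by auto
    have i: "i < lab u (F ! k)" using bs(3)[of k "Suc k"] True len lu by (simp add: i_def b_def)
    have asi: "as ! i = bs ! Suc k" using pos_atom[OF iA] by (simp add: i_def)
    note cv' = facets_cov[OF F True, simplified]
    have li: "lab (F ! k) (F ! Suc k) = i" using lab[OF True] by (simp add: i_def)
    have c: "as ! i \<sqsubseteq> F ! Suc k" "\<not> as ! i \<sqsubseteq> F ! k" using cov_lab[OF cv'] li by auto
    have "\<not> as ! i \<sqsubseteq> u"
      using le_trans[of "as ! i" u "F ! k"] covD[OF cv] c(2) asi iA by auto
    from ckey_less[OF cv nonspecial i this c(1) _ covD(2)[OF cv'] covD(5)[OF cv']]
    show "earlier F k"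
      using ext_le[OF F, of k "Suc k"] True unfolding earlier_def u_def by auto
  next
    \<comment> \<open>At the last position nothing bounds the exchange from above, and u has corank
      two, so the special cover is available.\<close>
    case False
    then have "Suc (r u) < l" using ext_rank[OF F, of k] k l_eq by (simp add: u_def)
    note sp = special_cov[OF uc ug this]
    have "as ! x0 u \<sqsubseteq> u \<squnion> as ! x0 u" using join_right[of u "as ! x0 u"] uc x0_less[OF uc] by simp
    from ckey_special_less[OF cv nonspecial this covD(3)[OF sp] covD(2)[OF sp] covD(5)[OF sp]]
    show "earlier F k" using False unfolding earlier_def u_def by blast
  qed
qed

text \<open>The basis consists of g and the atoms labelling the steps of F. Exchanges at all
  positions make the labels nonspecial and decreasing; the decrease excludes external activity, and
  nonspecial labels exclude internal activity of atoms other than g.\<close>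

lemma homology_facet_basis:
  assumes "F \<in> facets.homology_facets"
  shows "\<exists>B\<in>betaNBC L as g. F = basis_facet B"
proof -
  have F: "F \<in> facets" and earlier: "\<And>j. j < n \<Longrightarrow> earlier F j"
    using assms unfolding homology_facets_iff by blast+
  define lb where "lb k = lab (ext F k) (F ! k)" for k
  note cv = facets_cov[OF F]
  have lb: "lb k < length as" "as ! lb k \<sqsubseteq> F ! k" "\<not> as ! lb k \<sqsubseteq> ext F k" if "k < n" for k
    using cov_lab[OF cv[OF that]] by (auto simp: lb_def)
  have nonspecial: "lb k \<noteq> x0 (ext F k)" if k: "k < n" for k
  proof -
    obtain v where "cov (ext F k) v" "ckey (ext F k) v < ckey (ext F k) (F ! k)"
      using earlier[OF k] unfolding earlier_def by blast
    then show ?thesis using smaller_atom(1)[OF cv[OF k]] by (simp add: lb_def)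
  qed
  \<comment> \<open>The label atom of an earlier cover under \<open>F ! Suc k\<close> is new over
    \<open>F ! k\<close>, so it bounds the next label. It is smaller than the present label, as
    otherwise it would be the special atom of both elements and the next label would be
    special.\<close>
  have decr: "lb (Suc k) < lb k" if k: "Suc k < n" for k
  proof -
    have k': "k < n" using k by simp
    obtain v where v: "cov (ext F k) v" "ckey (ext F k) v < ckey (ext F k) (F ! k)" "v \<sqsubseteq> F ! Suc k"
      using earlier[OF k'] k unfolding earlier_def by blast
    let ?u = "ext F k"
    let ?x = "lab ?u v"
    have x: "?x < length as" "as ! ?x \<sqsubseteq> v" "\<not> as ! ?x \<sqsubseteq> ?u" using cov_lab[OF v(1)] by auto
    note c = covD[OF v(1)] covD[OF cv[OF k']]
    note cS = covD[OF cv[OF k]]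
    have nx: "\<not> as ! ?x \<sqsubseteq> F ! k"
    proof
      assume "as ! ?x \<sqsubseteq> F ! k"
      then have "v \<sqsubseteq> F ! k" using join_le[of ?u "F ! k" "as ! ?x"] cov_join_lab[OF v(1)] c x by simp
      then have "v = F ! k" using rank_eq_imp_eq[of v "F ! k"] c by simp
      then show False using v(2) by simp
    qed
    have xS: "as ! ?x \<sqsubseteq> F ! Suc k" using le_trans[OF x(2) v(3)] x c cS by simp
    have lbS: "lb (Suc k) = lab (F ! k) (F ! Suc k)" by (simp add: lb_def)
    have "lb (Suc k) \<le> ?x" using lab_least[OF x(1) xS nx] lbS by simp
    moreover have "?x < lb k"
    proof (rule ccontr)
      assume "\<not> ?thesis"
      then have sp: "?x = x0 ?u" "lb k < x0 ?u"
        using smaller_atom(2)[OF cv[OF k'] v(1,2)] by (auto simp: lb_def)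
      have Ft: "F ! k \<noteq> \<top>" using c(10) by auto
      have "x0 (F ! k) = x0 ?u" using x0_cov_small[OF cv[OF k'] _ Ft] sp(2) by (simp add: lb_def)
      then have "lab (F ! k) (F ! Suc k) = x0 (F ! k)"
        using lab_special[OF c(7,10) Ft cv[OF k, simplified]] xS sp(1) by simp
      then show False using nonspecial[OF k] lbS by simp
    qed
    ultimately show ?thesis by simp
  qed
  have decr': "lb j < lb i" if "i < j" "j < n" for i j
    using that
  proof (induction j)
    case (Suc j)
    then show ?case using decr[of j] by (cases "i = j") auto
  qed simp
  define ys where "ys = map (\<lambda>k. as ! lb k) [0..<n]"
  have leny: "length ys = n" by (simp add: ys_def)
  have ysn: "ys ! k = as ! lb k" if "k < n" for k using that by (simp add: ys_def)
  have posy: "pos as (ys ! k) = lb k" if "k < n" for k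
    using pos_nth[OF distinct_as lb(1)[OF that]] ysn[OF that] by simp
  have setys: "set ys = {as ! lb k | k. k < n}" by (auto simp: ys_def)
  have ysA: "set ys \<subseteq> atoms L" using as_atom lb(1) unfolding setys by blast
  have ys_c: "set ys \<subseteq> carrier L" using ysA atoms_sub by blast
  have extF: "ext F k = \<Squnion>(set (take k ys))" if "k \<le> n" for k
    using that
  proof (induction k)
    case 0
    then show ?case by (simp add: sup_empty)
  next
    case (Suc k)
    then have k: "k < n" by simp
    have "set (take (Suc k) ys) = insert (as ! lb k) (set (take k ys))"
      using k leny ysn by (simp add: take_Suc_conv_app_nth)
    moreover have "set (take k ys) \<subseteq> carrier L" using ys_c set_take_subset[of k ys] by blast
    ultimately have "\<Squnion>(set (take (Suc k) ys)) = ext F k \<squnion> as ! lb k"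
      using sup_insert[of "set (take k ys)" "as ! lb k"] lb(1)[OF k] Suc k by simp
    also have "\<dots> = F ! k" using cov_join_lab[OF cv[OF k]] by (simp add: lb_def)
    finally show ?case by simp
  qed
  have Fflag: "F = flag ys"
    by (rule nth_equalityI) (use extF[of "Suc _"] flag_nth leny facets_length[OF F] in simp_all)
  define e where "e = ext F n"
  have e: "e = \<Squnion>(set ys)" using extF[of n] leny by (simp add: e_def)
  have re: "r e = n" using ext_rank[OF F, of n] by (simp add: e_def)
  have ge: "\<not> g \<sqsubseteq> e"
  proof (cases n)
    case 0
    have "\<not> g \<sqsubseteq> \<bottom>" using rank_mono[of g \<bottom>] atom_rank[OF g_atom] rank_bottom by auto
    then show ?thesis using 0 by (simp add: e_def)
  next
    case (Suc m)
    then show ?thesis using facets_nth(3)[OF F, of m] by (simp add: e_def)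
  qed
  have gys: "g \<notin> set ys" using ge sup_ge[OF ys_c, of g] e by auto
  have disty: "distinct ys"
    unfolding distinct_conv_nth
  proof (intro allI impI)
    fix i j assume ij: "i < length ys" "j < length ys" "i \<noteq> j"
    then have "lb i \<noteq> lb j" using decr'[of i j] decr'[of j i] leny by (cases "i < j") auto
    then show "ys ! i \<noteq> ys ! j" using posy[of i] posy[of j] ij leny by auto
  qed
  define B where "B = insert g (set ys)"
  have BA: "B \<subseteq> atoms L" using ysA g_atom by (simp add: B_def)
  have iy: "independent L (set ys)"
    using ysA re e distinct_card[OF disty] leny by (simp add: independent_def)
  have iB: "independent L B"
    unfolding B_def using independent_insert[OF ysA g_atom gys] iy ge e by simp
  have cB: "card B = l" using gys distinct_card[OF disty] leny l_eq by (simp add: B_def)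
  have basis: "lattice_basis L B" using iB cB by (simp add: lattice_basis_def l_def)
  have other: "other_atoms B = ys"
  proof -
    have "B - {g} = set (rev ys)" using gys by (auto simp: B_def)
    moreover have "sorted_wrt (\<lambda>a b. pos as b < pos as a) ys"
      unfolding sorted_wrt_iff_nth_less
    proof (intro allI impI)
      fix i j assume "i < j" "j < length ys"
      then show "pos as (ys ! j) < pos as (ys ! i)" using posy[of i] posy[of j] decr'[of i j] leny by simp
    qed
    then have "sorted_wrt (\<lambda>a b. pos as a < pos as b) (rev ys)"
      by (simp add: sorted_wrt_rev)
    with calculation have "filter (\<lambda>a. a \<in> B - {g}) as = rev ys"
      using filter_eqI[OF distinct_as, of "rev ys"] ysA set_as by simp
    then show ?thesis by (simp add: other_atoms_def)
  qed
  \<comment> \<open>Labels decrease, so an atom before the current label was not below the previous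
    element either; if it were below the current one, the label would be smaller.\<close>
  have noless: "\<not> as ! i \<sqsubseteq> F ! k" if "k < n" "i < lb k" for i k
    using that
  proof (induction k)
    case 0
    have i: "i < length as" using lb(1)[OF 0(1)] 0(2) by simp
    show ?case
    proof
      assume le: "as ! i \<sqsubseteq> F ! 0"
      have "\<not> as ! i \<sqsubseteq> \<bottom>" using rank_mono[of "as ! i" \<bottom>] atom_rank[OF as_atom[OF i]] rank_bottom i by auto
      then show False using lab_least[OF i le, of \<bottom>] 0(2) by (simp add: lb_def)
    qed
  next
    case (Suc k)
    have i: "i < length as" using lb(1)[OF Suc(2)] Suc(3) by simp
    have "\<not> as ! i \<sqsubseteq> F ! k" using Suc.IH Suc.prems decr[OF Suc.prems(1)] by simp
    then show ?case
      using lab_least[OF i, of "F ! Suc k" "F ! k"] Suc.prems(2) by (auto simp: lb_def)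
  qed
  have noext: "\<not> externally_active L as B a" for a
  proof
    assume "externally_active L as B a"
    then have a: "a \<in> atoms L" "a \<notin> B" "a \<sqsubseteq> \<Squnion>{b \<in> B. pos as a < pos as b}"
      using externally_active_iff[OF basis] by blast+
    let ?D = "{b \<in> B. pos as a < pos as b}"
    have Dys: "?D \<subseteq> set ys" using pos_g by (auto simp: B_def)
    show False
    proof (cases "?D = {}")
      case True
      then have "a \<sqsubseteq> \<bottom>" using a(3) by (simp only: True sup_empty)
      then show False using rank_mono[of a \<bottom>] atom_rank[OF a(1)] rank_bottom a(1) by simp
    next
      case False
      let ?I = "{k. k < n \<and> pos as a < lb k}"
      have D_I: "?D \<subseteq> {ys ! k | k. k \<in> ?I}"
      proof
        fix d assume d: "d \<in> ?D"
        then have "d \<in> set ys" using Dys by blast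
        then obtain k where "k < n" "d = ys ! k" using leny by (auto simp: in_set_conv_nth)
        then show "d \<in> {ys ! k | k. k \<in> ?I}" using d posy by auto
      qed
      have "?I \<noteq> {}" using D_I False by blast
      then have "Max ?I \<in> ?I" by (intro Max_in) auto
      \<comment> \<open>By the decrease of labels the elements of B after a form a beginning of
        \<open>ys\<close>; k is the index of the last of them, so their join is at most
        \<open>F ! k\<close>.\<close>
      define k where "k = Max ?I"
      have k: "k < n" "pos as a < lb k" using \<open>Max ?I \<in> ?I\<close> by (auto simp: k_def)
      have kmax: "j \<le> k" if "j \<in> ?I" for j using that unfolding k_def by (intro Max_ge) auto
      have "?D \<subseteq> set (take (Suc k) ys)"
      proof
        fix d assume "d \<in> ?D"
        then obtain j where j: "d = ys ! j" "j \<in> ?I" using D_I by blast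
        then have "j < Suc k" "j < length ys" using kmax leny by (auto simp: le_imp_less_Suc)
        then have "take (Suc k) ys ! j \<in> set (take (Suc k) ys)" by (intro nth_mem) simp
        then show "d \<in> set (take (Suc k) ys)" using j \<open>j < Suc k\<close> by simp
      qed
      moreover have tc: "set (take (Suc k) ys) \<subseteq> carrier L" using ys_c set_take_subset[of "Suc k" ys] by blast
      ultimately have "\<Squnion>?D \<sqsubseteq> \<Squnion>(set (take (Suc k) ys))" by (rule sup_mono)
      then have "\<Squnion>?D \<sqsubseteq> F ! k" using extF[of "Suc k"] k by simp
      moreover have "\<Squnion>?D \<in> carrier L" using Dys ys_c by (intro sup_in) blast
      ultimately have "a \<sqsubseteq> F ! k" using le_trans[OF a(3)] a(1) facets_nth(1)[OF F k(1)] by simp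
      then show False using noless[OF k] pos_atom[OF a(1)] by simp
    qed
  qed
  have act: "internally_active L as B b \<longleftrightarrow> b = g" for b
  proof
    assume "b = g"
    then show "internally_active L as B b"
      unfolding internally_active_iff[OF basis] using pos_g by (simp add: B_def)
  next
    assume ia: "internally_active L as B b"
    then have bB: "b \<in> B" and small: "\<And>a. a \<in> atoms L \<Longrightarrow> pos as a < pos as b \<Longrightarrow> a \<sqsubseteq> \<Squnion>(B - {b})"
      unfolding internally_active_iff[OF basis] by blast+
    show "b = g"
    proof (rule ccontr)
      assume "b \<noteq> g"
      then obtain k where k: "k < n" "b = ys ! k" using bB leny by (auto simp: B_def in_set_conv_nth)
      define u where "u = ext F k"
      have uc: "u \<in> carrier L" using ext_in[OF F, of k] k by (simp add: u_def)
      have BBc: "B \<subseteq> carrier L" "B - {b} \<subseteq> carrier L" using BA atoms_sub by blast+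
      have posb: "pos as b = lb k" using posy[OF k(1)] k(2) by simp
      have tk: "set (take k ys) \<subseteq> carrier L" using ys_c set_take_subset[of k ys] by blast
      have uk: "u = \<Squnion>(set (take k ys))" using extF[of k] k by (simp add: u_def)
      have Sc: "S u (Suc (lb k)) \<in> carrier L" using uc by simp
      have "\<Squnion>B \<sqsubseteq> S u (Suc (lb k))"
      proof (rule sup_le[OF BBc(1) Sc])
        fix c assume c: "c \<in> B"
        then have cA: "c \<in> atoms L" using BA by blast
        show "c \<sqsubseteq> S u (Suc (lb k))"
        proof (cases "pos as c \<le> lb k")
          case True
          then have "pos as c < Suc (lb k)" by simp
          then show ?thesis by (rule atom_le_S[OF uc cA])
        next
          case False
          then have "c \<noteq> g" using pos_g by auto
          then obtain j where j: "j < n" "c = ys ! j" using c leny by (auto simp: B_def in_set_conv_nth)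
          have "\<not> k < j" "j \<noteq> k" using False decr'[of k j] posy[OF j(1)] j by auto
          then have "j < k" by linarith
          then have "take k ys ! j \<in> set (take k ys)" using j leny by (intro nth_mem) simp
          then have "c \<in> set (take k ys)" using j \<open>j < k\<close> by simp
          then have "c \<sqsubseteq> u" unfolding uk by (rule sup_ge[OF tk])
          then show ?thesis using le_trans[of c u "S u (Suc (lb k))"] le_S[OF uc] uc cA Sc by simp
        qed
      qed
      then have "S u (Suc (lb k)) = \<top>" using basis_top[OF basis] top_le_eq[OF Sc] by simp
      \<comment> \<open>u contains the atoms of B after b, so u and the atoms up to b span; as the
        label of b is not special, those strictly before b suffice. If b were internally active,
        these would lie on the hyperplane spanned by the rest of B, which also contains u.\<close>
      then have "x0 u \<le> lb k" by (rule x0_le[OF uc])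
      then have lt: "x0 u < lb k" using nonspecial[OF k(1)] by (simp add: u_def)
      let ?H = "\<Squnion>(B - {b})"
      have Hc: "?H \<in> carrier L" using BBc by simp
      have "S u (Suc (x0 u)) \<sqsubseteq> ?H"
      proof (rule S_le[OF uc Hc])
        have "set (take k ys) \<subseteq> B - {b}"
        proof
          fix c assume "c \<in> set (take k ys)"
          then obtain j where j: "j < k" "c = ys ! j" using leny k(1) by (auto simp: in_set_conv_nth)
          then have "c \<noteq> b" using disty k leny by (simp add: nth_eq_iff_index_eq)
          moreover have "c \<in> set ys" using j k leny by simp
          ultimately show "c \<in> B - {b}" by (simp add: B_def)
        qed
        then show "u \<sqsubseteq> ?H" unfolding uk by (rule sup_mono[OF _ BBc(2)])
        fix j assume "j < Suc (x0 u)" "j < length as"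
        then show "as ! j \<sqsubseteq> ?H"
          using small[OF as_atom] pos_nth[OF distinct_as] lt posb by simp
      qed
      then have "?H = \<top>" using x0_top[OF uc] top_le_eq[OF Hc] by simp
      then have "b \<sqsubseteq> ?H" using bB BBc by auto
      then show False using independent_not_le[OF iB bB] by simp
    qed
  qed
  have "B \<in> betaNBC L as g"
    using basis noext act by (auto simp: betaNBC_def)
  moreover have "F = basis_facet B" using Fflag other by (simp add: basis_facet_def)
  ultimately show ?thesis by blast
qed

end

section \<open>Completions\<close>

locale completed = geometric +
  fixes as :: "'a list" and z :: 'a and M :: "'b gorder" and g :: 'b and f :: "'a \<Rightarrow> 'b"
  assumes order: "atom_order L as" and z_in: "z \<in> carrier L" and z_bottom: "z \<noteq> \<bottom>"
    and compl: "is_completion L z M g f"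
begin

abbreviation "as' \<equiv> completion_atom_order L as z g f"

definition "I = {x \<in> carrier L. \<not> z \<sqsubseteq> x}"

lemma I_in: "x \<in> I \<Longrightarrow> x \<in> carrier L"
  by (simp add: I_def)

lemma carrier_not_above: "carrier (not_above L z) = I"
  by (simp add: not_above_def I_def)

lemmas compl' = compl[unfolded is_completion_def carrier_not_above]

lemma bij: "bij_betw f I {u \<in> carrier M. \<not> g \<sqsubseteq>\<^bsub>M\<^esub> u}"
  using compl' by (elim conjE)

lemma f_in: "x \<in> I \<Longrightarrow> f x \<in> carrier M" "x \<in> I \<Longrightarrow> \<not> g \<sqsubseteq>\<^bsub>M\<^esub> f x"
  using bij_betwE[OF bij] by auto

lemma f_onto: "u \<in> carrier M \<Longrightarrow> \<not> g \<sqsubseteq>\<^bsub>M\<^esub> u \<Longrightarrow> \<exists>x\<in>I. f x = u"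
proof -
  assume "u \<in> carrier M" "\<not> g \<sqsubseteq>\<^bsub>M\<^esub> u"
  then have "u \<in> f ` I" unfolding bij_betw_imp_surj_on[OF bij] by (simp only: mem_Collect_eq simp_thms)
  then show ?thesis by (elim imageE) auto
qed

lemma f_inj: "x \<in> I \<Longrightarrow> y \<in> I \<Longrightarrow> f x = f y \<longleftrightarrow> x = y"
  using bij_betw_imp_inj_on[OF bij] by (auto dest: inj_onD)

lemma f_le: "x \<in> I \<Longrightarrow> y \<in> I \<Longrightarrow> f x \<sqsubseteq>\<^bsub>M\<^esub> f y \<longleftrightarrow> x \<sqsubseteq> y"
  using compl' by blast

lemma I_down:
  assumes "y \<in> I" "x \<in> carrier L" "x \<sqsubseteq> y"
  shows "x \<in> I"
  using assms le_trans[of z x y] z_in unfolding I_def by blast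

lemma geometric_M: "geometric_lattice M"
  using compl' by (elim conjE)

end

sublocale completed \<subseteq> M0: geometric M
  by (rule geometric.intro[OF geometric_M])

context completed
begin

lemma g_atom: "g \<in> atoms M"
  using compl' by (elim conjE)

lemma rank_M: "rank_poset M = rank_poset L"
  using compl' by (elim conjE)

lemma f_less: "x \<in> I \<Longrightarrow> y \<in> I \<Longrightarrow> f x \<sqsubset>\<^bsub>M\<^esub> f y \<longleftrightarrow> x \<sqsubset> y"
  using f_le[of x y] f_inj[of x y] by (simp add: less_iff M0.less_iff)

lemma g_not_le_bottom: "\<not> g \<sqsubseteq>\<^bsub>M\<^esub> \<bottom>\<^bsub>M\<^esub>"
  using M0.rank_mono[of g "\<bottom>\<^bsub>M\<^esub>"] M0.atom_rank[OF g_atom] M0.rank_bottom g_atom by auto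

lemma g_not_le_atom: "a \<in> atoms M \<Longrightarrow> a \<noteq> g \<Longrightarrow> \<not> g \<sqsubseteq>\<^bsub>M\<^esub> a"
  using M0.atom_le_atom[of g a] g_atom by auto

lemma bottom_I: "\<bottom> \<in> I"
proof -
  have "\<not> z \<sqsubseteq> \<bottom>"
  proof
    assume "z \<sqsubseteq> \<bottom>"
    then have "z = \<bottom>" using le_antisym[of z \<bottom>] z_in by simp
    then show False using z_bottom by simp
  qed
  then show ?thesis by (simp add: I_def)
qed

lemma f_bottom: "f \<bottom> = \<bottom>\<^bsub>M\<^esub>"
proof -
  obtain x where x: "x \<in> I" "f x = \<bottom>\<^bsub>M\<^esub>" using f_onto[OF M0.bottom_closed g_not_le_bottom] by blast
  have "f \<bottom> \<sqsubseteq>\<^bsub>M\<^esub> \<bottom>\<^bsub>M\<^esub>" using f_le[OF bottom_I x(1)] x I_in[OF x(1)] by simp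
  then show ?thesis using M0.le_antisym[of "f \<bottom>" "\<bottom>\<^bsub>M\<^esub>"] f_in[OF bottom_I] by simp
qed

text \<open>Both complements of filters are closed downwards, so nothing strictly between the bottom
  and an element is lost in passing from one lattice to the other.\<close>

lemma atoms_f:
  assumes x: "x \<in> I"
  shows "f x \<in> atoms M \<longleftrightarrow> x \<in> atoms L"
proof
  assume "f x \<in> atoms M"
  then have c: "\<bottom>\<^bsub>M\<^esub> \<sqsubset>\<^bsub>M\<^esub> f x" "\<not> (\<exists>u\<in>carrier M. \<bottom>\<^bsub>M\<^esub> \<sqsubset>\<^bsub>M\<^esub> u \<and> u \<sqsubset>\<^bsub>M\<^esub> f x)"
    unfolding atoms_def covered_by_def by blast+
  have "\<bottom> \<sqsubset> x" using c(1) f_less[OF bottom_I x] f_bottom by simp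
  moreover have "\<not> (\<exists>u\<in>carrier L. \<bottom> \<sqsubset> u \<and> u \<sqsubset> x)"
  proof
    assume "\<exists>u\<in>carrier L. \<bottom> \<sqsubset> u \<and> u \<sqsubset> x"
    then obtain u where u: "u \<in> carrier L" "\<bottom> \<sqsubset> u" "u \<sqsubset> x" by (elim bexE conjE)
    have uI: "u \<in> I" by (rule I_down[OF x u(1)]) (use u(3) in \<open>simp add: less_iff\<close>)
    have "\<bottom>\<^bsub>M\<^esub> \<sqsubset>\<^bsub>M\<^esub> f u" "f u \<sqsubset>\<^bsub>M\<^esub> f x"
      using f_less[OF bottom_I uI] f_less[OF uI x] f_bottom u by simp_all
    then show False using c(2) f_in[OF uI] by blast
  qed
  ultimately show "x \<in> atoms L"
    unfolding atoms_def covered_by_def using I_in[OF x] by (simp only: mem_Collect_eq bottom_closed simp_thms)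
next
  assume "x \<in> atoms L"
  then have c: "\<bottom> \<sqsubset> x" "\<not> (\<exists>u\<in>carrier L. \<bottom> \<sqsubset> u \<and> u \<sqsubset> x)"
    unfolding atoms_def covered_by_def by blast+
  have "\<bottom>\<^bsub>M\<^esub> \<sqsubset>\<^bsub>M\<^esub> f x" using c(1) f_less[OF bottom_I x] f_bottom by simp
  moreover have "\<not> (\<exists>u\<in>carrier M. \<bottom>\<^bsub>M\<^esub> \<sqsubset>\<^bsub>M\<^esub> u \<and> u \<sqsubset>\<^bsub>M\<^esub> f x)"
  proof
    assume "\<exists>u\<in>carrier M. \<bottom>\<^bsub>M\<^esub> \<sqsubset>\<^bsub>M\<^esub> u \<and> u \<sqsubset>\<^bsub>M\<^esub> f x"
    then obtain v where v: "v \<in> carrier M" "\<bottom>\<^bsub>M\<^esub> \<sqsubset>\<^bsub>M\<^esub> v" "v \<sqsubset>\<^bsub>M\<^esub> f x" by (elim bexE conjE)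
    have "\<not> g \<sqsubseteq>\<^bsub>M\<^esub> v"
    proof
      assume "g \<sqsubseteq>\<^bsub>M\<^esub> v"
      then have "g \<sqsubseteq>\<^bsub>M\<^esub> f x" using M0.le_trans[of g v "f x"] v g_atom f_in[OF x] by (simp add: M0.less_iff)
      then show False using f_in[OF x] by simp
    qed
    then obtain u where u: "u \<in> I" "f u = v" using f_onto[OF v(1)] by blast
    have "\<bottom> \<sqsubset> u" "u \<sqsubset> x"
      using f_less[OF bottom_I u(1)] f_less[OF u(1) x] f_bottom v u by simp_all
    then show False using c(2) I_in[OF u(1)] by blast
  qed
  ultimately show "f x \<in> atoms M"
    unfolding atoms_def covered_by_def using f_in[OF x] by (simp only: mem_Collect_eq M0.bottom_closed simp_thms)
qed

lemma set_as: "set as = atoms L" and distinct_as: "distinct as"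
  using order by (auto simp: atom_order_def)

lemma filter_I: "a \<in> set (filter (\<lambda>a. \<not> z \<sqsubseteq> a) as) \<longleftrightarrow> a \<in> I \<and> a \<in> atoms L"
  using set_as by (auto simp: I_def)

lemma set_as': "set as' = atoms M"
proof
  show "set as' \<subseteq> atoms M"
  proof
    fix b assume "b \<in> set as'"
    then consider "b = g" | a where "b = f a" "a \<in> set (filter (\<lambda>a. \<not> z \<sqsubseteq> a) as)"
      by (auto simp: completion_atom_order_def)
    then show "b \<in> atoms M"
    proof cases
      case 1 then show ?thesis using g_atom by simp
    next
      case 2 then show ?thesis using filter_I[of a] atoms_f[of a] by simp
    qed
  qed
  show "atoms M \<subseteq> set as'"
  proof
    fix b assume b: "b \<in> atoms M"
    show "b \<in> set as'"
    proof (cases "b = g")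
      case False
      obtain a where a: "a \<in> I" "f a = b"
        using f_onto[OF M0.atom_in[OF b] g_not_le_atom[OF b False]] by blast
      then have "a \<in> set (filter (\<lambda>a. \<not> z \<sqsubseteq> a) as)" using atoms_f[of a] b filter_I[of a] by simp
      then show ?thesis using a(2) unfolding completion_atom_order_def by auto
    qed (simp add: completion_atom_order_def)
  qed
qed

lemma distinct_as': "distinct as'"
proof -
  let ?as = "filter (\<lambda>a. \<not> z \<sqsubseteq> a) as"
  have "inj_on f (set ?as)"
    by (rule inj_onI) (use f_inj filter_I in blast)
  moreover have "g \<notin> f ` set ?as"
  proof
    assume "g \<in> f ` set ?as"
    then obtain a where "a \<in> set ?as" "f a = g" by auto
    then show False using f_in(2)[of a] filter_I[of a] g_atom by simp
  qed
  ultimately show ?thesis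
    using distinct_as by (simp add: completion_atom_order_def distinct_map)
qed

end

sublocale completed \<subseteq> M: pointed_geometric M as' g
  by unfold_locales (use distinct_as' set_as' in \<open>simp_all add: completion_atom_order_def\<close>)

section \<open>Transport of the shelling to the maximal chains of \<open>Q_poset L z\<close>\<close>

context completed
begin

lemma M_n: "M.n = rank_poset L - 1"
  by (simp add: M.n_def M.l_def rank_M)

text \<open>The join in M has a preimage, which bounds A in L; hence the join in L stays off the
  filter of z by downward closure, and f identifies the two joins. A join that reaches the filter of
  g has no counterpart under f.\<close>

lemma sup_f:
  assumes A: "A \<subseteq> I" and ng: "\<not> g \<sqsubseteq>\<^bsub>M\<^esub> \<Squnion>\<^bsub>M\<^esub>(f ` A)"
  shows "\<Squnion>A \<in> I" "f (\<Squnion>A) = \<Squnion>\<^bsub>M\<^esub>(f ` A)"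
proof -
  have fA: "f ` A \<subseteq> carrier M" using A f_in(1) by blast
  have Ac: "A \<subseteq> carrier L" using A I_in by blast
  obtain h where h: "h \<in> I" "f h = \<Squnion>\<^bsub>M\<^esub>(f ` A)" using f_onto[OF M0.sup_in[OF fA] ng] by blast
  have "\<Squnion>A \<sqsubseteq> h"
  proof (rule sup_le[OF Ac])
    fix a assume a: "a \<in> A"
    have "f a \<sqsubseteq>\<^bsub>M\<^esub> f h" unfolding h(2) by (rule M0.sup_ge[OF fA]) (use a in simp)
    then show "a \<sqsubseteq> h" using f_le[of a h] a A h(1) by blast
  qed (rule I_in[OF h(1)])
  then show sI: "\<Squnion>A \<in> I" using I_down[OF h(1) sup_in[OF Ac]] by simp
  have "f h \<sqsubseteq>\<^bsub>M\<^esub> f (\<Squnion>A)"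
    unfolding h(2)
  proof (rule M0.sup_le[OF fA f_in(1)[OF sI]])
    fix b assume "b \<in> f ` A"
    then obtain a where "a \<in> A" "b = f a" by auto
    then show "b \<sqsubseteq>\<^bsub>M\<^esub> f (\<Squnion>A)" using f_le[OF _ sI, of a] sup_ge[OF Ac, of a] A by auto
  qed
  moreover have "f (\<Squnion>A) \<sqsubseteq>\<^bsub>M\<^esub> f h" using f_le[OF sI h(1)] \<open>\<Squnion>A \<sqsubseteq> h\<close> by simp
  ultimately have "f (\<Squnion>A) = f h" using M0.le_antisym[of "f (\<Squnion>A)" "f h"] f_in(1) sI h(1) by simp
  then show "f (\<Squnion>A) = \<Squnion>\<^bsub>M\<^esub>(f ` A)" using h(2) by simp
qed

lemma carrier_Q: "carrier (Q_poset L z) = I - {\<bottom>}"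
  by (auto simp: Q_poset_def not_above_def without_bottom_def I_def)

lemma less_Q: "x \<sqsubset>\<^bsub>Q_poset L z\<^esub> y \<longleftrightarrow> x \<sqsubset> y"
  by (simp add: Q_poset_def not_above_def without_bottom_def lless_def)

definition "maxchains = increasing_chains (Q_poset L z) M.n"

lemma chains_iff: "F \<in> maxchains \<longleftrightarrow> length F = M.n \<and> set F \<subseteq> I - {\<bottom>} \<and> sorted_wrt (\<lambda>x y. x \<sqsubset> y) F"
  by (simp add: maxchains_def increasing_chains_def carrier_Q less_Q)

lemma map_f_facets:
  assumes "set F \<subseteq> I"
  shows "map f F \<in> M.facets \<longleftrightarrow> F \<in> maxchains"
proof -
  have "set (map f F) \<subseteq> {u \<in> carrier M. u \<noteq> \<bottom>\<^bsub>M\<^esub> \<and> \<not> g \<sqsubseteq>\<^bsub>M\<^esub> u} \<longleftrightarrow> set F \<subseteq> I - {\<bottom>}"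
  proof -
    have "f x \<in> carrier M \<and> f x \<noteq> \<bottom>\<^bsub>M\<^esub> \<and> \<not> g \<sqsubseteq>\<^bsub>M\<^esub> f x \<longleftrightarrow> x \<noteq> \<bottom>" if "x \<in> set F" for x
      using that assms f_in[of x] f_inj[OF _ bottom_I, of x] f_bottom by auto
    then show ?thesis using assms by auto
  qed
  moreover have "sorted_wrt (\<lambda>x y. x \<sqsubset>\<^bsub>M\<^esub> y) (map f F) \<longleftrightarrow> sorted_wrt (\<lambda>x y. x \<sqsubset> y) F"
    unfolding sorted_wrt_map
  proof -
    have "f x \<sqsubset>\<^bsub>M\<^esub> f y \<longleftrightarrow> x \<sqsubset> y" if "x \<in> set F" "y \<in> set F" for x y
      using that assms f_less[of x y] by blast
    then show "sorted_wrt (\<lambda>x y. f x \<sqsubset>\<^bsub>M\<^esub> f y) F \<longleftrightarrow> sorted_wrt (\<lambda>x y. x \<sqsubset> y) F"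
      using sorted_wrt_mono_rel[of F "\<lambda>x y. f x \<sqsubset>\<^bsub>M\<^esub> f y" "\<lambda>x y. x \<sqsubset> y"]
        sorted_wrt_mono_rel[of F "\<lambda>x y. x \<sqsubset> y" "\<lambda>x y. f x \<sqsubset>\<^bsub>M\<^esub> f y"] by blast
  qed
  ultimately show ?thesis
    unfolding M.facets_def chains_iff by simp
qed

lemma chains_I: "F \<in> maxchains \<Longrightarrow> set F \<subseteq> I"
  by (auto simp: chains_iff)

lemma chains_facets: "F \<in> maxchains \<Longrightarrow> map f F \<in> M.facets"
  using map_f_facets[OF chains_I] by simp

lemma facets_chains:
  assumes "H \<in> M.facets"
  shows "\<exists>F\<in>maxchains. map f F = H"
proof -
  have "set H \<subseteq> f ` I"
  proof
    fix u assume "u \<in> set H"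
    then have "u \<in> carrier M" "\<not> g \<sqsubseteq>\<^bsub>M\<^esub> u" using assms by (auto simp: M.facets_def)
    then show "u \<in> f ` I" using f_onto[of u] by blast
  qed
  then have "H \<in> map f ` lists I" unfolding lists_image[symmetric] by blast
  then obtain F where "set F \<subseteq> I" "map f F = H" by auto
  then show ?thesis using map_f_facets[of F] assms by blast
qed

lemma map_f_inj: "inj_on (map f) maxchains"
proof (rule inj_onI)
  fix E F assume EF: "E \<in> maxchains" "F \<in> maxchains" "map f E = map f F"
  have "inj_on f (set E \<union> set F)"
    using inj_on_subset[OF bij_betw_imp_inj_on[OF bij]] chains_I[OF EF(1)] chains_I[OF EF(2)] by blast
  then show "E = F" by (rule map_inj_on[OF EF(3)])
qed

lemma nth_map_f_eq:
  assumes "E \<in> maxchains" "F \<in> maxchains" "k < M.n"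
  shows "map f E ! k = map f F ! k \<longleftrightarrow> E ! k = F ! k"
proof -
  have len: "length E = M.n" "length F = M.n" using assms by (auto simp: chains_iff)
  have "E ! k \<in> I" "F ! k \<in> I"
    using chains_I[OF assms(1)] chains_I[OF assms(2)] nth_mem[of k E] nth_mem[of k F] len assms(3) by auto
  then show ?thesis using f_inj[of "E ! k" "F ! k"] len assms(3) by simp
qed

end

text \<open>The order of the facets and the rank function are pulled back along f, which matches the
  maximal chains of the two sides position by position.\<close>

sublocale completed \<subseteq> maxchains: shelling maxchains M.n "\<lambda>u. rank_of M (f u) - 1" "\<lambda>F. M.fkey (map f F)"
proof
  show "finite maxchains"
    using M.finite_facets chains_facets map_f_inj by (meson finite_subset image_subsetI inj_on_finite)
  show "inj_on (\<lambda>F. M.fkey (map f F)) maxchains"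
  proof (rule inj_onI)
    fix E F assume EF: "E \<in> maxchains" "F \<in> maxchains" "M.fkey (map f E) = M.fkey (map f F)"
    then have "map f E = map f F" using inj_onD[OF M.fkey_inj EF(3)] chains_facets by blast
    then show "E = F" using inj_onD[OF map_f_inj] EF by blast
  qed
  fix F assume F: "F \<in> maxchains"
  show len: "length F = M.n" using F by (simp add: chains_iff)
  show "rank_of M (f (F ! k)) - 1 = k" if "k < M.n" for k
    using M.facets_rank[OF chains_facets[OF F] that] len that by simp
  fix E assume E: "E \<in> maxchains" and less: "M.fkey (map f E) < M.fkey (map f F)"
  from M.facets.shell[OF chains_facets[OF E] chains_facets[OF F] less]
  obtain j H where j: "j < M.n" "map f E ! j \<noteq> map f F ! j" and H: "H \<in> M.facets" "M.fkey H < M.fkey (map f F)"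
    "\<forall>k<M.n. k \<noteq> j \<longrightarrow> H ! k = map f F ! k"
    by (elim exE conjE bexE)
  obtain G where G: "G \<in> maxchains" "map f G = H" using facets_chains[OF H(1)] by blast
  show "\<exists>j<M.n. E ! j \<noteq> F ! j \<and> (\<exists>G\<in>maxchains. M.fkey (map f G) < M.fkey (map f F) \<and> (\<forall>k<M.n. k \<noteq> j \<longrightarrow> G ! k = F ! k))"
  proof (intro exI[of _ j] conjI bexI[of _ G] allI impI)
    show "E ! j \<noteq> F ! j" using nth_map_f_eq[OF E F j(1)] j(2) by blast
    show "G ! k = F ! k" if "k < M.n" "k \<noteq> j" for k
      using nth_map_f_eq[OF G(1) F that(1)] H(3) that G(2) by blast
  qed (use j G H in auto)
qed

context completed
begin

lemma homology_chains_iff: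
  assumes F: "F \<in> maxchains"
  shows "F \<in> maxchains.homology_facets \<longleftrightarrow> map f F \<in> M.facets.homology_facets"
proof -
  have "maxchains.R F = M.facets.R (map f F)"
  proof -
    have "(\<exists>G\<in>maxchains. M.fkey (map f G) < M.fkey (map f F) \<and> (\<forall>k<M.n. k \<noteq> j \<longrightarrow> G ! k = F ! k)) \<longleftrightarrow>
      (\<exists>H\<in>M.facets. M.fkey H < M.fkey (map f F) \<and> (\<forall>k<M.n. k \<noteq> j \<longrightarrow> H ! k = map f F ! k))" for j
    proof
      assume "\<exists>G\<in>maxchains. M.fkey (map f G) < M.fkey (map f F) \<and> (\<forall>k<M.n. k \<noteq> j \<longrightarrow> G ! k = F ! k)"
      then obtain G where G: "G \<in> maxchains" "M.fkey (map f G) < M.fkey (map f F)" "\<forall>k<M.n. k \<noteq> j \<longrightarrow> G ! k = F ! k"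
        by blast
      then show "\<exists>H\<in>M.facets. M.fkey H < M.fkey (map f F) \<and> (\<forall>k<M.n. k \<noteq> j \<longrightarrow> H ! k = map f F ! k)"
        using chains_facets[OF G(1)] nth_map_f_eq[OF G(1) F] by blast
    next
      assume "\<exists>H\<in>M.facets. M.fkey H < M.fkey (map f F) \<and> (\<forall>k<M.n. k \<noteq> j \<longrightarrow> H ! k = map f F ! k)"
      then obtain H where H: "H \<in> M.facets" "M.fkey H < M.fkey (map f F)" "\<forall>k<M.n. k \<noteq> j \<longrightarrow> H ! k = map f F ! k"
        by blast
      obtain G where G: "G \<in> maxchains" "map f G = H" using facets_chains[OF H(1)] by blast
      then show "\<exists>G\<in>maxchains. M.fkey (map f G) < M.fkey (map f F) \<and> (\<forall>k<M.n. k \<noteq> j \<longrightarrow> G ! k = F ! k)"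
        using H(2,3) nth_map_f_eq[OF G(1) F] by blast
    qed
    then show ?thesis unfolding maxchains.R_def M.facets.R_def by simp
  qed
  then show ?thesis
    using F chains_facets[OF F] by (simp add: maxchains.homology_facets_def M.facets.homology_facets_def)
qed

text \<open>The atoms are selected in M but joined in L. As each partial join avoids g,
  \<open>sup_f\<close> reconciles the two.\<close>

lemma facet_chain_basis_facet:
  assumes B: "B \<in> betaNBC M as' g"
  shows "facet_chain L as z f B \<in> maxchains" "map f (facet_chain L as z f B) = M.basis_facet B"
proof -
  define bs where "bs = rev (filter (\<lambda>a. \<not> z \<sqsubseteq> a \<and> f a \<in> B) as)"
  have bsI: "set bs \<subseteq> I" using set_as by (auto simp: bs_def I_def)
  have other: "M.other_atoms B = map f bs"
  proof -
    have fg: "f a \<noteq> g" if "a \<in> atoms L" "\<not> z \<sqsubseteq> a" for a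
      using f_in(2)[of a] that g_atom by (auto simp: I_def)
    have "filter (\<lambda>b. b \<in> B - {g}) as' = map f (filter (\<lambda>a. f a \<in> B - {g}) (filter (\<lambda>a. \<not> z \<sqsubseteq> a) as))"
      by (simp add: completion_atom_order_def filter_map o_def)
    also have "filter (\<lambda>a. f a \<in> B - {g}) (filter (\<lambda>a. \<not> z \<sqsubseteq> a) as) = filter (\<lambda>a. \<not> z \<sqsubseteq> a \<and> f a \<in> B) as"
      unfolding filter_filter by (rule filter_cong[OF HOL.refl]) (use fg set_as in auto)
    finally show ?thesis by (simp add: M.other_atoms_def bs_def rev_map)
  qed
  have fc: "facet_chain L as z f B = map (\<lambda>k. \<Squnion>(set (take (Suc k) bs))) [0..<length bs]"
    by (simp add: facet_chain_def bs_def Let_def)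
  have H: "M.basis_facet B \<in> M.facets" by (rule M.basis_facet_in[OF M.betaNBC_D(1,2)[OF B]])
  have len: "length bs = M.n"
    using M.facets_length[OF H] other by (simp add: M.basis_facet_def)
  have el: "\<Squnion>(set (take (Suc k) bs)) \<in> I \<and> f (\<Squnion>(set (take (Suc k) bs))) = M.basis_facet B ! k" if k: "k < M.n" for k
  proof -
    have "M.basis_facet B ! k = \<Squnion>\<^bsub>M\<^esub>(f ` set (take (Suc k) bs))"
      using k len M.flag_nth[of k "map f bs"] other by (simp add: M.basis_facet_def take_map)
    moreover have "set (take (Suc k) bs) \<subseteq> I" using bsI set_take_subset[of "Suc k" bs] by blast
    ultimately show ?thesis
      using sup_f[of "set (take (Suc k) bs)"] M.facets_nth(3)[OF H k] by simp
  qed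
  show eq: "map f (facet_chain L as z f B) = M.basis_facet B"
    by (rule nth_equalityI) (use el len M.facets_length[OF H] in \<open>simp_all add: fc\<close>)
  have "set (facet_chain L as z f B) \<subseteq> I" using el len by (auto simp: fc)
  from map_f_facets[OF this] show "facet_chain L as z f B \<in> maxchains" using eq H by simp
qed

lemma homology_chains: "maxchains.homology_facets = facet_chain L as z f ` betaNBC M as' g"
proof
  show "facet_chain L as z f ` betaNBC M as' g \<subseteq> maxchains.homology_facets"
  proof
    fix F assume "F \<in> facet_chain L as z f ` betaNBC M as' g"
    then obtain B where B: "B \<in> betaNBC M as' g" "F = facet_chain L as z f B" by auto
    then show "F \<in> maxchains.homology_facets"
      using homology_chains_iff[OF facet_chain_basis_facet(1)[OF B(1)]] facet_chain_basis_facet(2)[OF B(1)]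
        M.basis_facet_homology[OF B(1)] by simp
  qed
  show "maxchains.homology_facets \<subseteq> facet_chain L as z f ` betaNBC M as' g"
  proof
    fix F assume F: "F \<in> maxchains.homology_facets"
    then have FC: "F \<in> maxchains" by (simp add: maxchains.homology_facets_def)
    then have "map f F \<in> M.facets.homology_facets" using homology_chains_iff F by blast
    then obtain B where B: "B \<in> betaNBC M as' g" "map f F = M.basis_facet B" using M.homology_facet_basis by blast
    then have "F = facet_chain L as z f B"
      using inj_onD[OF map_f_inj _ FC facet_chain_basis_facet(1)[OF B(1)]] facet_chain_basis_facet(2)[OF B(1)] by simp
    then show "F \<in> facet_chain L as z f ` betaNBC M as' g" using B(1) by blast
  qed
qed

lemma facet_chain_inj:
  assumes "B \<in> betaNBC M as' g" "B' \<in> betaNBC M as' g" "facet_chain L as z f B = facet_chain L as z f B'"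
  shows "B = B'"
  using facet_chain_basis_facet(2)[OF assms(1)] facet_chain_basis_facet(2)[OF assms(2)] assms(3)
    inj_onD[OF M.basis_facet_inj _ assms(1,2)] by simp

lemma finite_betaNBC: "finite (betaNBC M as' g)"
proof (rule finite_subset)
  show "betaNBC M as' g \<subseteq> Pow (atoms M)"
    by (auto simp: betaNBC_def lattice_basis_def independent_def)
qed (simp add: M0.finite_atoms)

definition top_cycles :: "('a list \<Rightarrow>\<^sub>0 int) set" where
  "top_cycles = {c. Poly_Mapping.keys c \<subseteq> maxchains \<and> simplicial_boundary c = 0}"

lemma top_cycle_zero:
  assumes "c \<in> top_cycles" "\<And>B. B \<in> betaNBC M as' g \<Longrightarrow> poly_mapping.lookup c (facet_chain L as z f B) = 0"
  shows "c = 0"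
proof (rule maxchains.cycle_zero)
  fix F assume "F \<in> maxchains.homology_facets"
  then show "poly_mapping.lookup c F = 0" using assms(2) unfolding homology_chains by blast
qed (use assms(1) in \<open>simp_all add: top_cycles_def\<close>)

lemma top_cycle_unique:
  assumes "c \<in> top_cycles" "d \<in> top_cycles"
    "\<And>B. B \<in> betaNBC M as' g \<Longrightarrow>
      poly_mapping.lookup c (facet_chain L as z f B) = poly_mapping.lookup d (facet_chain L as z f B)"
  shows "c = d"
proof -
  have "c - d \<in> top_cycles"
    using assms(1,2) keys_diff[of c d] by (auto simp: top_cycles_def simplicial_boundary_diff)
  then have "c - d = 0"
    by (rule top_cycle_zero) (simp add: lookup_minus assms(3))
  then show ?thesis by simp
qed

text \<open>Existence comes from the dual cycle of a homology facet and uniqueness from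
  \<open>top_cycle_unique\<close>, so the definite description denotes. Because of truncated
  subtraction the dimensions are matched by a hypothesis, which holds from rank two on.\<close>

lemma omega_cycle:
  assumes dim: "rank_poset L - 2 + 1 = M.n" and B: "B \<in> betaNBC M as' g"
  shows "omega_cycle L as z M g f B \<in> top_cycles"
    "B' \<in> betaNBC M as' g \<Longrightarrow>
      poly_mapping.lookup (omega_cycle L as z M g f B) (facet_chain L as z f B') = (if B' = B then 1 else 0)"
proof -
  have carr: "carrier (reduced_cycles (Q_poset L z) (rank_poset L - 2)) = top_cycles"
  proof -
    have "maxchains = increasing_chains (Q_poset L z) (rank_poset L - 2 + 1)"
      unfolding maxchains_def dim ..
    then show ?thesis
      by (simp add: reduced_cycles_def order_complex_chains_def kernel_def top_cycles_def)
  qed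
  let ?P = "\<lambda>c. c \<in> carrier (reduced_cycles (Q_poset L z) (rank_poset L - 2)) \<and>
       (\<forall>B'\<in>betaNBC M as' g. poly_mapping.lookup c (facet_chain L as z f B') = (if B' = B then 1 else 0))"
  have "facet_chain L as z f B \<in> maxchains.homology_facets" using B homology_chains by blast
  from maxchains.ex_dual_cycle[OF this] obtain c where c: "Poly_Mapping.keys c \<subseteq> maxchains" "simplicial_boundary c = 0"
    "poly_mapping.lookup c (facet_chain L as z f B) = 1"
    "\<forall>G\<in>maxchains.homology_facets. G \<noteq> facet_chain L as z f B \<longrightarrow> poly_mapping.lookup c G = 0"
    by (elim exE conjE)
  have ct: "c \<in> top_cycles" using c(1,2) by (simp add: top_cycles_def)
  have val: "poly_mapping.lookup c (facet_chain L as z f B') = (if B' = B then 1 else 0)"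
    if "B' \<in> betaNBC M as' g" for B'
  proof (cases "B' = B")
    case False
    then have "facet_chain L as z f B' \<noteq> facet_chain L as z f B" using facet_chain_inj[OF that B] by blast
    moreover have "facet_chain L as z f B' \<in> maxchains.homology_facets" using that homology_chains by blast
    ultimately show ?thesis using c(4) False by simp
  qed (use c(3) in simp)
  have "?P (omega_cycle L as z M g f B)"
    unfolding omega_cycle_def
  proof (rule theI)
    show "?P c" using ct val carr by simp
    show "d = c" if "?P d" for d
      by (rule top_cycle_unique) (use that ct val carr in simp_all)
  qed
  then show "omega_cycle L as z M g f B \<in> top_cycles"
    "B' \<in> betaNBC M as' g \<Longrightarrow>
      poly_mapping.lookup (omega_cycle L as z M g f B) (facet_chain L as z f B') = (if B' = B then 1 else 0)"
    using carr by auto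
qed

end

section \<open>The exterior algebra\<close>

lemma frag_cmul_diff_distrib2: "frag_cmul k (a - b) = frag_cmul k a - frag_cmul k b"
  by (rule poly_mapping_eqI) (simp add: lookup_minus algebra_simps)

lemma frag_extend_fun_diff: "frag_extend (\<lambda>i. f i - g i) x = frag_extend f x - frag_extend g x"
  by (simp add: frag_extend_def frag_cmul_diff_distrib2 sum_subtractf)

lemma frag_extend_fun_add: "frag_extend (\<lambda>i. f i + g i) x = frag_extend f x + frag_extend g x"
  by (simp add: frag_extend_def frag_cmul_distrib2 sum.distrib)

lemma ext_mult_diff_left: "ext_mult as (x - y) w = ext_mult as x w - ext_mult as y w"
  by (simp add: ext_mult_def frag_extend_diff)

lemma ext_mult_add_left: "ext_mult as (x + y) w = ext_mult as x w + ext_mult as y w"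
  by (simp add: ext_mult_def frag_extend_add)

lemma ext_mult_diff_right: "ext_mult as w (x - y) = ext_mult as w x - ext_mult as w y"
  unfolding ext_mult_def frag_extend_diff frag_extend_fun_diff ..

lemma ext_mult_add_right: "ext_mult as w (x + y) = ext_mult as w x + ext_mult as w y"
  unfolding ext_mult_def frag_extend_add frag_extend_fun_add ..

lemma ext_mult_0_left [simp]: "ext_mult as 0 x = 0"
  by (simp add: ext_mult_def)

lemma ext_mult_0_right [simp]: "ext_mult as x 0 = 0"
  by (simp add: ext_mult_def frag_extend_def)

lemma ext_mult_cmul_left: "ext_mult as (frag_cmul k x) w = frag_cmul k (ext_mult as x w)"
  by (simp add: ext_mult_def frag_extend_cmul)

lemma ext_mult_cmul_right: "ext_mult as w (frag_cmul k x) = frag_cmul k (ext_mult as w x)"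
  by (simp add: ext_mult_def frag_extend_cmul) (simp add: frag_extend_def frag_cmul_sum mult.left_commute)

text \<open>Signs are kept as products over pairs instead of parities of counts, since products
  split over disjoint unions in either argument.\<close>

definition psgn :: "('a \<Rightarrow> 'b \<Rightarrow> bool) \<Rightarrow> 'a set \<Rightarrow> 'b set \<Rightarrow> int" where
  "psgn P I J = (\<Prod>a\<in>I. \<Prod>b\<in>J. if P a b then -1 else 1)"

lemma psgn_card:
  assumes "finite I" "finite J"
  shows "(-1) ^ card {(a, b). a \<in> I \<and> b \<in> J \<and> P a b} = psgn P I J"
proof -
  have "psgn P I J = (\<Prod>p\<in>I \<times> J. if P (fst p) (snd p) then -1 else 1)"
    by (simp add: psgn_def prod.cartesian_product case_prod_beta)
  also have "\<dots> = (\<Prod>p\<in>{p \<in> I \<times> J. P (fst p) (snd p)}. -1)"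
    using assms by (subst prod.inter_filter) auto
  also have "{p \<in> I \<times> J. P (fst p) (snd p)} = {(a, b). a \<in> I \<and> b \<in> J \<and> P a b}"
    by auto
  finally show ?thesis by simp
qed

lemma psgn_Un_left: "finite I \<Longrightarrow> finite J \<Longrightarrow> I \<inter> J = {} \<Longrightarrow> psgn P (I \<union> J) K = psgn P I K * psgn P J K"
  by (simp add: psgn_def prod.union_disjoint)

lemma psgn_Un_right: "finite J \<Longrightarrow> finite K \<Longrightarrow> J \<inter> K = {} \<Longrightarrow> psgn P I (J \<union> K) = psgn P I J * psgn P I K"
  by (simp add: psgn_def prod.union_disjoint prod.distrib)

lemma psgn_swap: "psgn P I J = psgn (\<lambda>b a. P a b) J I"
  unfolding psgn_def by (rule prod.swap)

lemma psgn_mult: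
  assumes "\<And>a b. a \<in> I \<Longrightarrow> b \<in> J \<Longrightarrow>
    (if P a b then -1 else 1::int) * (if Q a b then -1 else 1) = (if R a b then -1 else 1)"
  shows "psgn P I J * psgn Q I J = psgn R I J"
  unfolding psgn_def prod.distrib[symmetric]
  by (rule prod.cong[OF HOL.refl], rule prod.cong[OF HOL.refl]) (rule assms)

lemma prod_unit:
  assumes "\<And>i. i \<in> A \<Longrightarrow> f i = 1 \<or> f i = (-1::int)"
  shows "prod f A = 1 \<or> prod f A = -1"
  using assms
proof (induction A rule: infinite_finite_induct)
  case (insert x F)
  then have "f x = 1 \<or> f x = -1" "prod f F = 1 \<or> prod f F = -1" by simp_all
  then show ?case using insert(1,2) by auto
qed simp_all

lemma psgn_unit: "psgn P I J = 1 \<or> psgn P I J = -1"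
  unfolding psgn_def by (intro prod_unit) simp

lemma ext_mult_of:
  assumes "finite I" "finite J"
  shows "ext_mult as (frag_of I) (frag_of J) =
    (if I \<inter> J = {} then frag_cmul (psgn (\<lambda>a b. before as b a) I J) (frag_of (I \<union> J)) else 0)"
  by (simp add: ext_mult_def psgn_card[OF assms])

definition ext_carrier :: "'a list \<Rightarrow> ('a set \<Rightarrow>\<^sub>0 int) set" where
  "ext_carrier as = {x. Poly_Mapping.keys x \<subseteq> Pow (set as)}"

lemma carrier_exterior [simp]: "carrier (exterior_algebra as) = ext_carrier as"
  and mult_exterior [simp]: "monoid.mult (exterior_algebra as) = ext_mult as"
  and one_exterior [simp]: "one (exterior_algebra as) = frag_of {}"
  and zero_exterior [simp]: "ring.zero (exterior_algebra as) = 0"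
  and add_exterior [simp]: "ring.add (exterior_algebra as) = (+)"
  by (simp_all add: exterior_algebra_def ext_carrier_def)

lemma ext_carrier_0 [simp]: "0 \<in> ext_carrier as"
  and ext_carrier_add: "x \<in> ext_carrier as \<Longrightarrow> y \<in> ext_carrier as \<Longrightarrow> x + y \<in> ext_carrier as"
  and ext_carrier_diff: "x \<in> ext_carrier as \<Longrightarrow> y \<in> ext_carrier as \<Longrightarrow> x - y \<in> ext_carrier as"
  and ext_carrier_minus: "x \<in> ext_carrier as \<Longrightarrow> - x \<in> ext_carrier as"
  and ext_carrier_cmul: "x \<in> ext_carrier as \<Longrightarrow> frag_cmul k x \<in> ext_carrier as"
  and ext_carrier_of: "frag_of I \<in> ext_carrier as \<longleftrightarrow> I \<subseteq> set as"
  using keys_add[of x y] keys_diff[of x y] keys_cmul[of k x]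
  by (auto simp: ext_carrier_def)

lemma ext_carrier_sum: "(\<And>i. i \<in> A \<Longrightarrow> g i \<in> ext_carrier as) \<Longrightarrow> sum g A \<in> ext_carrier as"
  by (induction A rule: infinite_finite_induct) (auto intro: ext_carrier_add)

lemma ext_induct [consumes 1, case_names zero basis diff]:
  assumes "x \<in> ext_carrier as" "P 0" "\<And>I. I \<subseteq> set as \<Longrightarrow> P (frag_of I)" "\<And>x y. P x \<Longrightarrow> P y \<Longrightarrow> P (x - y)"
  shows "P x"
  by (rule frag_induction[of x "Pow (set as)"]) (use assms in \<open>auto simp: ext_carrier_def\<close>)

lemma finite_sub: "I \<subseteq> set as \<Longrightarrow> finite I"
  using finite_subset by blast

lemma ext_mult_closed:
  assumes "x \<in> ext_carrier as" "y \<in> ext_carrier as"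
  shows "ext_mult as x y \<in> ext_carrier as"
  using assms(1)
proof (induction rule: ext_induct)
  case (basis I)
  show ?case using assms(2)
  proof (induction rule: ext_induct)
    case (basis J)
    then show ?case using \<open>I \<subseteq> set as\<close>
      by (simp add: ext_mult_of finite_sub ext_carrier_cmul ext_carrier_of)
  qed (simp_all add: ext_mult_diff_right ext_carrier_diff)
qed (simp_all add: ext_mult_diff_left ext_carrier_diff)

text \<open>Both sides carry the product of the three pairwise signs, or vanish as soon as two of
  the sets meet.\<close>

lemma ext_mult_assoc_of:
  assumes "I \<subseteq> set as" "J \<subseteq> set as" "K \<subseteq> set as"
  shows "ext_mult as (ext_mult as (frag_of I) (frag_of J)) (frag_of K) =
    ext_mult as (frag_of I) (ext_mult as (frag_of J) (frag_of K))"
proof -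
  note fin = finite_sub[OF assms(1)] finite_sub[OF assms(2)] finite_sub[OF assms(3)]
  show ?thesis
  proof (cases "I \<inter> J = {} \<and> J \<inter> K = {} \<and> I \<inter> K = {}")
    case True
    then have "(I \<union> J) \<inter> K = {}" "I \<inter> (J \<union> K) = {}" by auto
    with True show ?thesis using fin
      by (simp add: ext_mult_of ext_mult_cmul_left ext_mult_cmul_right psgn_Un_left psgn_Un_right Un_assoc mult.commute mult.left_commute)
  next
    case False
    then consider "I \<inter> J \<noteq> {}" | "J \<inter> K \<noteq> {}" "I \<inter> J = {}" | "I \<inter> J = {}" "J \<inter> K = {}" "I \<inter> K \<noteq> {}" by blast
    then show ?thesis
    proof cases
      case 1
      then have "I \<inter> (J \<union> K) \<noteq> {}" by blast
      then show ?thesis using 1 fin by (simp add: ext_mult_of ext_mult_cmul_right)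
    next
      case 2
      then have "(I \<union> J) \<inter> K \<noteq> {}" by blast
      then show ?thesis using 2 fin by (simp add: ext_mult_of ext_mult_cmul_left)
    next
      case 3
      then have "(I \<union> J) \<inter> K \<noteq> {}" "I \<inter> (J \<union> K) \<noteq> {}" by blast+
      then show ?thesis using 3 fin by (simp add: ext_mult_of ext_mult_cmul_left ext_mult_cmul_right)
    qed
  qed
qed

lemma ext_mult_assoc:
  assumes "x \<in> ext_carrier as" "y \<in> ext_carrier as" "w \<in> ext_carrier as"
  shows "ext_mult as (ext_mult as x y) w = ext_mult as x (ext_mult as y w)"
  using assms(1)
proof (induction rule: ext_induct)
  case (basis I)
  show ?case using assms(2)
  proof (induction rule: ext_induct)
    case (basis J)
    show ?case using assms(3)
    proof (induction rule: ext_induct)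
      case (basis K)
      then show ?case using ext_mult_assoc_of \<open>I \<subseteq> set as\<close> \<open>J \<subseteq> set as\<close> by blast
    qed (simp_all add: ext_mult_diff_right)
  qed (simp_all add: ext_mult_diff_right ext_mult_diff_left)
qed (simp_all add: ext_mult_diff_left)

lemma ext_mult_one:
  assumes "x \<in> ext_carrier as"
  shows "ext_mult as (frag_of {}) x = x" "ext_mult as x (frag_of {}) = x"
proof -
  show "ext_mult as (frag_of {}) x = x" using assms
  proof (induction rule: ext_induct)
    case (basis I)
    then show ?case by (simp add: ext_mult_of finite_sub psgn_def)
  qed (simp_all add: ext_mult_diff_right)
  show "ext_mult as x (frag_of {}) = x" using assms
  proof (induction rule: ext_induct)
    case (basis I)
    then show ?case by (simp add: ext_mult_of finite_sub psgn_def)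
  qed (simp_all add: ext_mult_diff_left)
qed

lemma ring_exterior: "ring (exterior_algebra as)"
proof (rule ringI)
  show "abelian_group (exterior_algebra as)"
  proof (rule abelian_groupI)
    fix x assume "x \<in> carrier (exterior_algebra as)"
    then show "\<exists>y\<in>carrier (exterior_algebra as). y \<oplus>\<^bsub>exterior_algebra as\<^esub> x = \<zero>\<^bsub>exterior_algebra as\<^esub>"
      by (intro bexI[of _ "- x"]) (simp_all add: ext_carrier_minus)
  qed (simp_all add: ext_carrier_add add.assoc add.commute)
  show "Group.monoid (exterior_algebra as)"
    by (rule monoidI) (simp_all add: ext_mult_closed ext_mult_assoc ext_mult_one ext_carrier_of)
qed (simp_all add: ext_mult_add_left ext_mult_add_right)

text \<open>The index of c in the sorted list counts the elements before it, so the alternating sign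
  is a product over pairs. In this form the boundary has no indices, and its signs combine with
  those of products.\<close>

lemma ext_boundary_eq:
  assumes "distinct as" "C \<subseteq> set as"
  shows "ext_boundary as C = (\<Sum>c\<in>C. frag_cmul (psgn (before as) C {c}) (frag_of (C - {c})))"
proof -
  define xs where "xs = filter (\<lambda>a. a \<in> C) as"
  have xs: "distinct xs" "set xs = C" using assms by (auto simp: xs_def)
  have finC: "finite C" using assms finite_sub by blast
  have sgn: "(-1) ^ j = psgn (before as) C {xs ! j}" if j: "j < length xs" for j
  proof -
    have bef: "before as (xs ! i) (xs ! j) \<longleftrightarrow> i < j" if "i < length xs" for i
    proof -
      have "pos xs (xs ! i) < pos xs (xs ! j) \<longleftrightarrow> pos as (xs ! i) < pos as (xs ! j)"
        unfolding xs_def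
        by (rule pos_filter_less_iff) (use that j assms nth_mem[of i xs] nth_mem[of j xs] in \<open>auto simp: xs_def\<close>)
      moreover have "xs ! i \<in> set as" "xs ! j \<in> set as"
        using nth_mem[OF that] nth_mem[OF j] xs(2) assms(2) by auto
      ultimately show ?thesis
        using pos_less_iff_before[OF assms(1)] pos_nth[OF xs(1) that] pos_nth[OF xs(1) j] by simp
    qed
    have "{(a, b). a \<in> C \<and> b \<in> {xs ! j} \<and> before as a b} = (\<lambda>i. (xs ! i, xs ! j)) ` {..<j}"
    proof (intro equalityI subsetI)
      fix p assume "p \<in> {(a, b). a \<in> C \<and> b \<in> {xs ! j} \<and> before as a b}"
      then obtain a where a: "p = (a, xs ! j)" "a \<in> C" "before as a (xs ! j)" by auto
      then obtain i where "i < length xs" "xs ! i = a" using xs(2) by (auto simp: in_set_conv_nth)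
      then show "p \<in> (\<lambda>i. (xs ! i, xs ! j)) ` {..<j}" using a bef[of i] by auto
    next
      fix p assume "p \<in> (\<lambda>i. (xs ! i, xs ! j)) ` {..<j}"
      then obtain i where "i < j" "p = (xs ! i, xs ! j)" by auto
      then show "p \<in> {(a, b). a \<in> C \<and> b \<in> {xs ! j} \<and> before as a b}"
        using bef[of i] j xs(2) nth_mem[of i xs] by auto
    qed
    moreover have "inj_on (\<lambda>i. (xs ! i, xs ! j)) {..<j}"
      using xs(1) j by (auto simp: inj_on_def nth_eq_iff_index_eq)
    ultimately have "card {(a, b). a \<in> C \<and> b \<in> {xs ! j} \<and> before as a b} = j"
      by (simp add: card_image)
    then show ?thesis using psgn_card[OF finC, of "{xs ! j}" "before as"] by simp
  qed
  have "ext_boundary as C = (\<Sum>j<length xs. frag_cmul (psgn (before as) C {xs ! j}) (frag_of (C - {xs ! j})))"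
    unfolding ext_boundary_def Let_def xs_def[symmetric] by (rule sum.cong) (simp_all add: sgn)
  also have "\<dots> = (\<Sum>c\<in>C. frag_cmul (psgn (before as) C {c}) (frag_of (C - {c})))"
    by (rule sum.reindex_bij_betw[OF bij_betw_nth[OF xs(1)]]) (simp_all add: xs(2))
  finally show ?thesis .
qed

lemma ext_boundary_carrier: "distinct as \<Longrightarrow> C \<subseteq> set as \<Longrightarrow> ext_boundary as C \<in> ext_carrier as"
  by (auto simp: ext_boundary_eq intro!: ext_carrier_sum ext_carrier_cmul simp: ext_carrier_of)


subsection \<open>Relabelling homomorphisms\<close>

text \<open>
  The algebra homomorphism \<open>e\<^sub>a \<mapsto> e\<^bsub>lam a\<^esub>\<close> for \<open>a \<in> D\<close> and \<open>e\<^sub>a \<mapsto> 0\<close> otherwise;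
  \<open>psgn crossing J J\<close> is the sign of sorting the image of \<open>e\<^sub>J\<close>.
\<close>

locale relabelling =
  fixes as bs :: "'a list" and D :: "'a set" and lam :: "'a \<Rightarrow> 'a"
  assumes das: "distinct as" and dbs: "distinct bs" and D: "D \<subseteq> set as" and lam: "lam ` D \<subseteq> set bs"
begin

abbreviation "crossing a b \<equiv> before as a b \<and> before bs (lam b) (lam a)"

definition "relabel = frag_extend (\<lambda>J. if J \<subseteq> D \<and> inj_on lam J then frag_cmul (psgn crossing J J) (frag_of (lam ` J)) else 0)"

lemma relabel_of:
  "relabel (frag_of J) = (if J \<subseteq> D \<and> inj_on lam J then frag_cmul (psgn crossing J J) (frag_of (lam ` J)) else 0)"
  by (simp add: relabel_def)

lemma relabel_0 [simp]: "relabel 0 = 0"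
  and relabel_add: "relabel (x + y) = relabel x + relabel y"
  and relabel_diff: "relabel (x - y) = relabel x - relabel y"
  and relabel_minus: "relabel (- x) = - relabel x"
  and relabel_cmul: "relabel (frag_cmul k x) = frag_cmul k (relabel x)"
  by (simp_all add: relabel_def frag_extend_add frag_extend_diff frag_extend_minus frag_extend_cmul)

lemma relabel_sum: "finite A \<Longrightarrow> relabel (sum g A) = (\<Sum>i\<in>A. relabel (g i))"
  by (simp add: relabel_def frag_extend_sum)

lemma relabel_carrier:
  assumes "x \<in> ext_carrier as"
  shows "relabel x \<in> ext_carrier bs"
  using assms
proof (induction rule: ext_induct)
  case (basis I)
  have "lam ` I \<subseteq> set bs" if "I \<subseteq> D" using that lam by blast
  then show ?case by (simp add: relabel_of ext_carrier_cmul ext_carrier_of)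
qed (simp_all add: relabel_diff ext_carrier_diff)

lemma before_cases:
  assumes "distinct xs" "a \<in> set xs" "b \<in> set xs" "a \<noteq> b"
  shows "before xs a b \<longleftrightarrow> \<not> before xs b a"
proof -
  have "pos xs a \<noteq> pos xs b" using pos_inj[OF assms(2,3)] assms(4) by blast
  then show ?thesis
    using pos_less_iff_before[OF assms(1-3)] pos_less_iff_before[OF assms(1,3,2)] by auto
qed

text \<open>A pair from I and J contributes the sign of its order in the product and then the sign
  of sorting its image. Pair by pair, both together equal the sign of the order of the
  images.\<close>

lemma relabel_mult_of:
  assumes "I \<subseteq> set as" "J \<subseteq> set as"
  shows "relabel (ext_mult as (frag_of I) (frag_of J)) = ext_mult bs (relabel (frag_of I)) (relabel (frag_of J))"
proof -
  note fin = finite_sub[OF assms(1)] finite_sub[OF assms(2)]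
  show ?thesis
  proof (cases "I \<inter> J = {}")
    case False
    then have "lam ` I \<inter> lam ` J \<noteq> {}" by blast
    then show ?thesis using False fin
      by (simp add: ext_mult_of relabel_of ext_mult_cmul_left ext_mult_cmul_right)
  next
    case True
    let ?ok = "I \<union> J \<subseteq> D \<and> inj_on lam (I \<union> J)"
    have ok: "?ok \<longleftrightarrow> (I \<subseteq> D \<and> inj_on lam I) \<and> (J \<subseteq> D \<and> inj_on lam J) \<and> lam ` I \<inter> lam ` J = {}"
      using True inj_on_Un[of lam I J] by (auto simp: Diff_triv Int_commute)
    show ?thesis
    proof (cases ?ok)
      case False
      then show ?thesis using ok True fin
        by (auto simp: ext_mult_of relabel_of ext_mult_cmul_left ext_mult_cmul_right relabel_cmul)
    next
      case ok': True
      then have c: "I \<subseteq> D" "inj_on lam I" "J \<subseteq> D" "inj_on lam J" "lam ` I \<inter> lam ` J = {}" using ok by auto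
      let ?b = "\<lambda>a b. before as b a"
      let ?lb = "\<lambda>a b. before bs (lam b) (lam a)"
      \<comment> \<open>A pair counts as crossing in the order that the list gives it, so for a from
        I and b from J both directions occur.\<close>
      have "psgn crossing (I \<union> J) (I \<union> J) =
          psgn crossing I I * psgn crossing J J * (psgn crossing I J * psgn (\<lambda>a b. crossing b a) I J)"
        using fin True by (simp add: psgn_Un_left psgn_Un_right psgn_swap[of crossing J I])
      moreover have "psgn ?b I J * (psgn crossing I J * psgn (\<lambda>a b. crossing b a) I J) = psgn ?lb I J"
      proof -
        have "psgn crossing I J * psgn (\<lambda>a b. crossing b a) I J = psgn (\<lambda>a b. crossing a b \<noteq> crossing b a) I J"
          by (rule psgn_mult) auto
        moreover have "psgn ?b I J * psgn (\<lambda>a b. crossing a b \<noteq> crossing b a) I J = psgn ?lb I J"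
        proof (rule psgn_mult)
          fix a b assume ab: "a \<in> I" "b \<in> J"
          have "a \<noteq> b" "lam a \<noteq> lam b" using ab True c(5) by auto
          moreover have "a \<in> set as" "b \<in> set as" using ab assms by blast+
          moreover have "lam a \<in> set bs" "lam b \<in> set bs" using ab c(1,3) lam by blast+
          ultimately have "before as a b \<longleftrightarrow> \<not> before as b a" "before bs (lam a) (lam b) \<longleftrightarrow> \<not> before bs (lam b) (lam a)"
            using before_cases[OF das, of a b] before_cases[OF dbs, of "lam a" "lam b"] by auto
          then show "(if before as b a then -1 else 1::int) * (if crossing a b \<noteq> crossing b a then -1 else 1) =
             (if before bs (lam b) (lam a) then -1 else 1)"
            by auto
        qed
        ultimately show ?thesis by simp
      qed
      ultimately have "psgn ?b I J * psgn crossing (I \<union> J) (I \<union> J) = psgn crossing I I * psgn crossing J J * psgn ?lb I J"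
        by (simp add: mult.commute mult.left_commute)
      moreover have "psgn (\<lambda>a b. before bs b a) (lam ` I) (lam ` J) = psgn ?lb I J"
        using c(2,4) by (simp add: psgn_def prod.reindex)
      ultimately show ?thesis using c ok' True fin
        by (simp add: ext_mult_of relabel_of ext_mult_cmul_left ext_mult_cmul_right relabel_cmul image_Un mult.assoc mult.commute mult.left_commute)
    qed
  qed
qed

lemma relabel_mult:
  assumes "x \<in> ext_carrier as" "y \<in> ext_carrier as"
  shows "relabel (ext_mult as x y) = ext_mult bs (relabel x) (relabel y)"
  using assms(1)
proof (induction rule: ext_induct)
  case (basis I)
  show ?case using assms(2)
  proof (induction rule: ext_induct)
    case (basis J)
    then show ?case using relabel_mult_of \<open>I \<subseteq> set as\<close> by blast
  qed (simp_all add: ext_mult_diff_right relabel_diff)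
qed (simp_all add: ext_mult_diff_left relabel_diff)

text \<open>This lets the image of the Orlik--Solomon ideal be controlled by its generators
  alone.\<close>

lemma relabel_preimage_ideal:
  assumes J: "ideal J (exterior_algebra bs)"
  shows "ideal {x \<in> ext_carrier as. relabel x \<in> J} (exterior_algebra as)"
proof (rule idealI[OF ring_exterior])
  interpret J: ideal J "exterior_algebra bs" by (rule J)
  have add: "x + y \<in> J" if "x \<in> J" "y \<in> J" for x y
    using additive_subgroup.a_closed[OF ideal.axioms(1)[OF J] that] by simp
  have zero: "0 \<in> J" using additive_subgroup.zero_closed[OF ideal.axioms(1)[OF J]] by simp
  have minus: "- x \<in> J" if "x \<in> J" for x
  proof -
    have xc: "x \<in> carrier (exterior_algebra bs)" using J.a_subset that by blast
    have "\<ominus>\<^bsub>exterior_algebra bs\<^esub> x = - x"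
      using xc by (intro J.minus_equality) (simp_all add: ext_carrier_minus)
    then show ?thesis using additive_subgroup.a_inv_closed[OF ideal.axioms(1)[OF J] that] by simp
  qed
  have inv: "inv\<^bsub>add_monoid (exterior_algebra as)\<^esub> x = - x" if "x \<in> ext_carrier as" for x
  proof -
    interpret R: ring "exterior_algebra as" by (rule ring_exterior)
    have "\<ominus>\<^bsub>exterior_algebra as\<^esub> x = - x"
      using that by (intro R.minus_equality) (simp_all add: ext_carrier_minus)
    then show ?thesis by (simp add: a_inv_def)
  qed
  show "subgroup {x \<in> ext_carrier as. relabel x \<in> J} (add_monoid (exterior_algebra as))"
  proof
    show "inv\<^bsub>add_monoid (exterior_algebra as)\<^esub> x \<in> {x \<in> ext_carrier as. relabel x \<in> J}"
      if "x \<in> {x \<in> ext_carrier as. relabel x \<in> J}" for x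
    proof -
      have x: "x \<in> ext_carrier as" "relabel x \<in> J" using that by auto
      show ?thesis unfolding inv[OF x(1)] using x by (simp add: ext_carrier_minus relabel_minus minus)
    qed
  qed (auto simp: ext_carrier_add relabel_add add zero)
  fix a x assume "a \<in> {x \<in> ext_carrier as. relabel x \<in> J}" "x \<in> carrier (exterior_algebra as)"
  then have a: "a \<in> ext_carrier as" "relabel a \<in> J" "x \<in> ext_carrier as" "relabel x \<in> ext_carrier bs"
    by (simp_all add: relabel_carrier)
  show "x \<otimes>\<^bsub>exterior_algebra as\<^esub> a \<in> {x \<in> ext_carrier as. relabel x \<in> J}"
    using a J.I_l_closed[OF a(2), of "relabel x"] by (simp add: ext_mult_closed relabel_mult)
  show "a \<otimes>\<^bsub>exterior_algebra as\<^esub> x \<in> {x \<in> ext_carrier as. relabel x \<in> J}"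
    using a J.I_r_closed[OF a(2), of "relabel x"] by (simp add: ext_mult_closed relabel_mult)
qed

text \<open>Each monomial of the boundary omits a single element, so at least one of the two killed
  atoms remains in it.\<close>

lemma relabel_boundary_outside:
  assumes C: "C \<subseteq> set as" and b: "b \<in> C" "b' \<in> C" "b \<noteq> b'" "b \<notin> D" "b' \<notin> D"
  shows "relabel (ext_boundary as C) = 0"
proof -
  have "relabel (frag_of (C - {c})) = 0" for c
  proof -
    have "b \<in> C - {c} \<or> b' \<in> C - {c}" using b by auto
    then have "\<not> C - {c} \<subseteq> D" using b by blast
    then show ?thesis unfolding relabel_of by simp
  qed
  then show ?thesis
    unfolding ext_boundary_eq[OF das C] by (simp add: relabel_sum relabel_cmul finite_sub[OF C])
qed

text \<open>Monomials that keep both b and b' die. The two that omit one of them have the same image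
  up to sign. As the common value is minimal among the images, sorting moves b or b' only past the
  elements standing before it, and with the signs of the boundary the two terms cancel.\<close>

lemma relabel_boundary_collision:
  assumes C: "C \<subseteq> D" and b: "b \<in> C" "b' \<in> C" "b \<noteq> b'" "lam b = lam b'"
    and min: "\<And>a. a \<in> C \<Longrightarrow> lam a = lam b \<or> before bs (lam b) (lam a)"
  shows "relabel (ext_boundary as C) = 0"
proof -
  have Cas: "C \<subseteq> set as" using C D by blast
  have fin: "finite C" using Cas finite_sub by blast
  define Q where "Q = C - {b, b'}"
  have Q: "finite Q" "b \<notin> Q" "b' \<notin> Q" using fin by (auto simp: Q_def)
  have Cb: "C - {b} = insert b' Q" "C - {b'} = insert b Q" "C = insert b (insert b' Q)"
    using b by (auto simp: Q_def)
  have lb: "lam b \<in> set bs" using b C lam by blast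
  have irr: "\<not> before bs x x" for x
    using dbs pos_less_iff_before[of bs x x]
    by (auto simp: before_def nth_eq_iff_index_eq)
  have irr': "\<not> before as x x" for x
    using das by (auto simp: before_def nth_eq_iff_index_eq)
  have other: "frag_cmul (psgn (before as) C {c}) (relabel (frag_of (C - {c}))) = 0" if "c \<in> Q" for c
  proof -
    have "b \<in> C - {c}" "b' \<in> C - {c}" using that b Q by auto
    then have "\<not> inj_on lam (C - {c})" using b by (auto dest: inj_onD)
    then show ?thesis by (simp add: relabel_of)
  qed
  let ?t = "\<lambda>c. frag_cmul (psgn (before as) C {c}) (relabel (frag_of (C - {c})))"
  have "relabel (ext_boundary as C) = (\<Sum>c\<in>C. ?t c)"
    unfolding ext_boundary_eq[OF das Cas] by (simp add: relabel_sum relabel_cmul fin)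
  also have "\<dots> = ?t b + (?t b' + (\<Sum>c\<in>Q. ?t c))"
    unfolding Cb(3) using Q b(3) by (simp add: insert_commute)
  also have "(\<Sum>c\<in>Q. ?t c) = 0" using other by (intro sum.neutral) blast
  also have "?t b + (?t b' + 0) = 0"
  proof (cases "inj_on lam (insert b Q)")
    case False
    then have "\<not> inj_on lam (insert b' Q)" using b(4) Q by (simp add: inj_on_insert)
    then have "relabel (frag_of (insert b Q)) = 0" "relabel (frag_of (insert b' Q)) = 0"
      using False unfolding relabel_of by (simp_all del: inj_on_insert)
    then show ?thesis unfolding Cb(1,2) by simp
  next
    case inj: True
    then have inj': "inj_on lam (insert b' Q)" using b(4) Q by (simp add: inj_on_insert)
    have lt: "before bs (lam b) (lam a)" "\<not> before bs (lam a) (lam b)" if a: "a \<in> Q" for a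
    proof -
      have "lam a \<noteq> lam b" using inj_onD[OF inj, of a b] a Q(2) by auto
      then show "before bs (lam b) (lam a)" using min[of a] a by (auto simp: Q_def)
      moreover have "lam a \<in> set bs" using a C lam by (auto simp: Q_def)
      ultimately show "\<not> before bs (lam a) (lam b)"
        using before_cases[OF dbs _ lb, of "lam a"] \<open>lam a \<noteq> lam b\<close> by blast
    qed
    \<comment> \<open>The value of x is the smallest, so x forms a crossing with just those members
      of Q that precede it.\<close>
    have sgn: "psgn crossing (insert x Q) (insert x Q) = psgn crossing Q Q * psgn (before as) Q {x}"
      if x: "x \<notin> Q" "lam x = lam b" for x
    proof -
      have "psgn crossing (insert x Q) (insert x Q) = psgn crossing ({x} \<union> Q) ({x} \<union> Q)" by simp
      also have "\<dots> = psgn crossing {x} {x} * psgn crossing {x} Q * (psgn crossing Q {x} * psgn crossing Q Q)"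
        using x(1) Q(1) by (simp only: psgn_Un_left psgn_Un_right finite.emptyI finite.insertI Int_insert_left Int_empty_left if_False)
          (simp add: mult.commute mult.left_commute)
      also have "psgn crossing {x} {x} = 1" using irr' by (simp add: psgn_def)
      also have "psgn crossing {x} Q = 1"
        unfolding psgn_def using lt(2) x(2) by (simp add: prod.neutral)
      also have "psgn crossing Q {x} = psgn (before as) Q {x}"
        unfolding psgn_def using lt(1) x(2) by (intro prod.cong HOL.refl) simp
      finally show ?thesis by simp
    qed
    have s: "psgn (before as) C {b} = (if before as b' b then -1 else 1) * psgn (before as) Q {b}"
      "psgn (before as) C {b'} = (if before as b b' then -1 else 1) * psgn (before as) Q {b'}"
      unfolding Cb(3) psgn_def using Q b(3) irr' by simp_all
    have bb: "before as b b' \<longleftrightarrow> \<not> before as b' b"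
      using before_cases[OF das, of b b'] b Cas by blast
    have im: "lam ` insert b' Q = lam ` insert b Q" using b(4) by simp
    have "insert b Q \<subseteq> D" "insert b' Q \<subseteq> D" using C b by (auto simp: Q_def)
    then show ?thesis
      unfolding Cb(1,2) relabel_of using inj inj' b(4) sgn[OF Q(2)] sgn[OF Q(3)]
      by (simp add: s im bb mult.commute mult.left_commute flip: frag_cmul_distrib)
  qed
  finally show ?thesis .
qed

end

section \<open>The Orlik--Solomon algebra\<close>

lemma ext_mult_sum_left: "finite A \<Longrightarrow> ext_mult as (sum u A) y = (\<Sum>c\<in>A. ext_mult as (u c) y)"
  by (induction A rule: finite_induct) (simp_all add: ext_mult_add_left)

context ordered_geometric
begin

lemma circuit_set_as: "circuit L C \<Longrightarrow> C \<subseteq> set as"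
  using circuit_atoms[of C] set_as by simp

lemma OS_ideal_ideal: "ideal (OS_ideal L as) (exterior_algebra as)"
  unfolding OS_ideal_def
  by (rule ring.genideal_ideal[OF ring_exterior]) (auto intro: ext_boundary_carrier[OF distinct_as circuit_set_as])

lemma OS_ideal_subset:
  assumes "ideal K (exterior_algebra as)" "\<And>C. circuit L C \<Longrightarrow> ext_boundary as C \<in> K"
  shows "OS_ideal L as \<subseteq> K"
  unfolding OS_ideal_def by (rule ring.genideal_minimal[OF ring_exterior assms(1)]) (use assms(2) in auto)

lemma boundary_in_OS_ideal: "circuit L C \<Longrightarrow> ext_boundary as C \<in> OS_ideal L as"
  unfolding OS_ideal_def genideal_def by blast

lemma OS_ideal_carrier: "x \<in> OS_ideal L as \<Longrightarrow> x \<in> ext_carrier as"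
  using additive_subgroup.a_subset[OF ideal.axioms(1)[OF OS_ideal_ideal]] by auto

lemma OS_ideal_0 [simp]: "0 \<in> OS_ideal L as"
  using additive_subgroup.zero_closed[OF ideal.axioms(1)[OF OS_ideal_ideal]] by simp

lemma OS_ideal_add: "x \<in> OS_ideal L as \<Longrightarrow> y \<in> OS_ideal L as \<Longrightarrow> x + y \<in> OS_ideal L as"
  using additive_subgroup.a_closed[OF ideal.axioms(1)[OF OS_ideal_ideal], of x y] by simp

lemma OS_ideal_minus:
  assumes "x \<in> OS_ideal L as"
  shows "- x \<in> OS_ideal L as"
proof -
  interpret R: ring "exterior_algebra as" by (rule ring_exterior)
  have "\<ominus>\<^bsub>exterior_algebra as\<^esub> x = - x"
    using OS_ideal_carrier[OF assms] by (intro R.minus_equality) (simp_all add: ext_carrier_minus)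
  then show ?thesis
    using additive_subgroup.a_inv_closed[OF ideal.axioms(1)[OF OS_ideal_ideal] assms] by simp
qed

lemma OS_ideal_diff: "x \<in> OS_ideal L as \<Longrightarrow> y \<in> OS_ideal L as \<Longrightarrow> x - y \<in> OS_ideal L as"
  using OS_ideal_add[of x "- y"] OS_ideal_minus[of y] by simp

lemma OS_ideal_cmul:
  assumes "x \<in> OS_ideal L as"
  shows "frag_cmul k x \<in> OS_ideal L as"
  by (rule frag_closure_minus_cmul[of "\<lambda>y. y \<in> OS_ideal L as"]) (use assms OS_ideal_diff in auto)

lemma OS_ideal_mult_right: "x \<in> OS_ideal L as \<Longrightarrow> y \<in> ext_carrier as \<Longrightarrow> ext_mult as x y \<in> OS_ideal L as"
  using ideal.I_r_closed[OF OS_ideal_ideal, of x y] by simp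

lemma relabel_OS_ideal:
  assumes rel: "relabelling as bs D lam" and J: "ideal J (exterior_algebra bs)"
    and gens: "\<And>C. circuit L C \<Longrightarrow> relabelling.relabel as bs D lam (ext_boundary as C) \<in> J"
    and x: "x \<in> OS_ideal L as"
  shows "relabelling.relabel as bs D lam x \<in> J"
proof -
  interpret relabelling as bs D lam by (rule rel)
  have "OS_ideal L as \<subseteq> {x \<in> ext_carrier as. relabel x \<in> J}"
    by (rule OS_ideal_subset[OF relabel_preimage_ideal[OF J]])
       (use gens ext_boundary_carrier[OF distinct_as circuit_set_as] in auto)
  then show ?thesis using x by auto
qed


subsection \<open>NBC sets\<close>

definition "nbc N \<longleftrightarrow> N \<subseteq> atoms L \<and> \<not> (\<exists>D. broken_circuit L as D \<and> D \<subseteq> N)"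

lemma NBC_iff: "N \<in> NBC L as p \<longleftrightarrow> nbc N \<and> card N = p"
  by (auto simp: NBC_def nbc_def)

lemma nbc_independent:
  assumes "nbc N"
  shows "independent L N"
proof (rule ccontr)
  assume "\<not> independent L N"
  then obtain C where "C \<subseteq> N" "circuit L C" using ex_circuit[of N] assms by (auto simp: nbc_def)
  then have "broken_circuit L as (C - {list_min as C})" "C - {list_min as C} \<subseteq> N"
    by (auto simp: broken_circuit_def)
  then show False using assms by (auto simp: nbc_def)
qed

text \<open>Such an atom would be the minimum of a circuit contained in T and itself, and would
  leave a broken circuit in N. The NBC property is used below in this closure form.\<close>

lemma nbc_no_smaller:
  assumes N: "nbc N" and T: "T \<subseteq> N" and a: "a \<in> atoms L" "a \<sqsubseteq> \<Squnion>T" and less: "\<And>t. t \<in> T \<Longrightarrow> pos as a < pos as t"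
  shows False
proof -
  have iT: "independent L T" by (rule independent_subset[OF nbc_independent[OF N] T])
  have "a \<notin> T" using less[of a] by auto
  then obtain C where C: "circuit L C" "C \<subseteq> insert a T" "a \<in> C"
    using ex_circuit_insert[OF iT a(1) _ a(2)] by blast
  have "list_min as C = a"
    by (rule list_min_eqI[OF circuit_set_as[OF C(1)] C(3)]) (use C(2) less in \<open>auto intro: less_imp_le\<close>)
  then have "broken_circuit L as (C - {a})" using C(1) unfolding broken_circuit_def by blast
  moreover have "C - {a} \<subseteq> N" using C(2) T by blast
  ultimately show False using N by (auto simp: nbc_def)
qed

definition upper :: "'a set \<Rightarrow> 'a \<Rightarrow> 'a set" where
  "upper I i = {j \<in> I. pos as i \<le> pos as j}"

text \<open>
  For an NBC set \<open>I\<close> the joins of its upper segments form a flag; \<open>layer I a\<close> names the step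
  of this flag at which the atom \<open>a\<close> appears.
\<close>

definition layer :: "'a set \<Rightarrow> 'a \<Rightarrow> 'a" where
  "layer I a = (SOME i. i \<in> I \<and> a \<sqsubseteq> \<Squnion>(upper I i) \<and> (\<forall>j\<in>I. a \<sqsubseteq> \<Squnion>(upper I j) \<longrightarrow> pos as j \<le> pos as i))"

lemma layer_props:
  assumes I: "I \<subseteq> atoms L" and a: "a \<in> atoms L" "a \<sqsubseteq> \<Squnion>I"
  shows "layer I a \<in> I" "a \<sqsubseteq> \<Squnion>(upper I (layer I a))"
    "\<And>j. j \<in> I \<Longrightarrow> a \<sqsubseteq> \<Squnion>(upper I j) \<Longrightarrow> pos as j \<le> pos as (layer I a)"
proof -
  let ?A = "{i \<in> I. a \<sqsubseteq> \<Squnion>(upper I i)}"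
  have fin: "finite I" using finite_atom_set[OF I] .
  have "I \<noteq> {}"
  proof
    assume "I = {}"
    then have "a \<sqsubseteq> \<bottom>" using a sup_empty by simp
    then show False using rank_mono[of a \<bottom>] atom_rank[OF a(1)] rank_bottom a(1) by simp
  qed
  then have Ias: "I \<subseteq> set as" "list_min as I \<in> I" using I set_as list_min_in[of I as] by auto
  have "upper I (list_min as I) = I" using list_min_le[OF Ias(1)] by (auto simp: upper_def)
  then have "list_min as I \<in> ?A" using Ias a by simp
  then have ne: "pos as ` ?A \<noteq> {}" "finite (pos as ` ?A)" using fin by auto
  from Max_in[OF ne(2,1)] obtain i where i: "i \<in> ?A" "pos as i = Max (pos as ` ?A)" by auto
  have "i \<in> I \<and> a \<sqsubseteq> \<Squnion>(upper I i) \<and> (\<forall>j\<in>I. a \<sqsubseteq> \<Squnion>(upper I j) \<longrightarrow> pos as j \<le> pos as i)"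
    using i Max_ge[OF ne(2)] by auto
  from someI[of "\<lambda>i. i \<in> I \<and> a \<sqsubseteq> \<Squnion>(upper I i) \<and> (\<forall>j\<in>I. a \<sqsubseteq> \<Squnion>(upper I j) \<longrightarrow> pos as j \<le> pos as i)", OF this]
  show "layer I a \<in> I" "a \<sqsubseteq> \<Squnion>(upper I (layer I a))"
    "\<And>j. j \<in> I \<Longrightarrow> a \<sqsubseteq> \<Squnion>(upper I j) \<Longrightarrow> pos as j \<le> pos as (layer I a)"
    unfolding layer_def by blast+
qed

definition "flat_atoms I = {a \<in> atoms L. a \<sqsubseteq> \<Squnion>I}"

lemma upper_sub: "upper I i \<subseteq> I"
  by (auto simp: upper_def)

lemma layer_relabelling:
  assumes I: "I \<subseteq> atoms L"
  shows "relabelling as as (flat_atoms I) (layer I)"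
proof
  show "flat_atoms I \<subseteq> set as" using set_as by (auto simp: flat_atoms_def)
  show "layer I ` flat_atoms I \<subseteq> set as"
    using layer_props(1)[OF I] I set_as by (auto simp: flat_atoms_def)
qed (rule distinct_as)+

text \<open>By independence i is not spanned by the members of I after it, so no smaller segment
  reaches it.\<close>

lemma layer_self:
  assumes I: "independent L I" and i: "i \<in> I"
  shows "layer I i = i"
proof -
  have IA: "I \<subseteq> atoms L" using independent_atoms[OF I] .
  have Ic: "I \<subseteq> carrier L" using IA atoms_sub by blast
  have iA: "i \<in> atoms L" using i IA by blast
  have uc: "upper I j \<subseteq> carrier L" for j using upper_sub[of I j] Ic by blast
  note lp = layer_props[OF IA iA sup_ge[OF Ic i]]
  have "i \<sqsubseteq> \<Squnion>(upper I i)" by (rule sup_ge[OF uc]) (use i in \<open>simp add: upper_def\<close>)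
  then have le: "pos as i \<le> pos as (layer I i)" by (rule lp(3)[OF i])
  have "\<not> pos as i < pos as (layer I i)"
  proof
    assume less: "pos as i < pos as (layer I i)"
    then have "upper I (layer I i) \<subseteq> I - {i}" by (auto simp: upper_def)
    moreover have "I - {i} \<subseteq> carrier L" using Ic by blast
    ultimately have "\<Squnion>(upper I (layer I i)) \<sqsubseteq> \<Squnion>(I - {i})" by (rule sup_mono)
    then have "i \<sqsubseteq> \<Squnion>(I - {i})"
      using le_trans[OF lp(2)] sup_in[OF uc] sup_in[OF \<open>I - {i} \<subseteq> carrier L\<close>] iA by simp
    then show False using independent_not_le[OF I i] by simp
  qed
  then have "pos as i = pos as (layer I i)" using le by simp
  then show ?thesis using pos_as_inj[of i "layer I i"] iA lp(1) IA by auto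
qed

text \<open>A circuit that leaves the flat of I does so at two atoms, and its boundary dies.
  Otherwise let b be an atom of the circuit that appears last in the flag. If it were alone in its
  layer, the other atoms would lie in the preceding flat and, by dependence, so would b. Hence two
  atoms share the smallest value and the boundary cancels.\<close>

lemma layer_kills_OS_ideal:
  assumes I: "I \<subseteq> atoms L" and x: "x \<in> OS_ideal L as"
  shows "relabelling.relabel as as (flat_atoms I) (layer I) x = 0"
proof -
  interpret relabelling as as "flat_atoms I" "layer I" by (rule layer_relabelling[OF I])
  have Ic: "I \<subseteq> carrier L" using I atoms_sub by blast
  have "relabel x \<in> {0}"
  proof (rule relabel_OS_ideal[OF layer_relabelling[OF I] _ _ x])
    show "ideal {0} (exterior_algebra as)"
      using ring.zeroideal[OF ring_exterior, of as] by simp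
    fix C assume C: "circuit L C"
    note Cas = circuit_set_as[OF C]
    have CA: "C \<subseteq> atoms L" using circuit_atoms[OF C] .
    show "relabel (ext_boundary as C) \<in> {0}"
    proof (cases "C \<subseteq> flat_atoms I")
      case False
      then obtain c where c: "c \<in> C" "c \<notin> flat_atoms I" by blast
      have "\<exists>c'\<in>C. c' \<noteq> c \<and> c' \<notin> flat_atoms I"
      proof (rule ccontr)
        assume n: "\<not> ?thesis"
        have "c \<sqsubseteq> \<Squnion>I"
          by (rule circuit_two[OF C sup_in[OF Ic] c(1)]) (use n in \<open>auto simp: flat_atoms_def\<close>)
        then show False using c CA by (auto simp: flat_atoms_def)
      qed
      then obtain c' where "c' \<in> C" "c' \<noteq> c" "c' \<notin> flat_atoms I" by blast
      then show ?thesis using relabel_boundary_outside[OF Cas c(1) _ _ c(2)] by auto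
    next
      case True
      have lp: "layer I a \<in> I" "a \<sqsubseteq> \<Squnion>(upper I (layer I a))"
        "\<And>j. j \<in> I \<Longrightarrow> a \<sqsubseteq> \<Squnion>(upper I j) \<Longrightarrow> pos as j \<le> pos as (layer I a)" if "a \<in> C" for a
        using layer_props[OF I, of a] True that by (auto simp: flat_atoms_def)
      have finC: "finite C" using finite_atom_set[OF CA] .
      have "Min ((\<lambda>a. pos as (layer I a)) ` C) \<in> (\<lambda>a. pos as (layer I a)) ` C"
        using finC circuit_nonempty[OF C] by (intro Min_in) auto
      then obtain b where b: "b \<in> C" "pos as (layer I b) = Min ((\<lambda>a. pos as (layer I a)) ` C)" by auto
      have bmin: "pos as (layer I b) \<le> pos as (layer I a)" if "a \<in> C" for a
        unfolding b(2) using finC that by (intro Min_le) auto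
      have eqI: "layer I a = layer I b" if "a \<in> C" "pos as (layer I a) \<le> pos as (layer I b)" for a
      proof (rule pos_as_inj)
        show "pos as (layer I a) = pos as (layer I b)" using bmin[OF that(1)] that(2) by simp
      qed (use lp(1) that(1) b(1) I in auto)
      have "\<exists>b'\<in>C. b' \<noteq> b \<and> layer I b' = layer I b"
      proof (rule ccontr)
        assume n: "\<not> ?thesis"
        \<comment> \<open>T spans the flat that precedes the layer of b in the flag; it is itself an
          upper segment, the one starting at its minimum.\<close>
        define T where "T = {j \<in> I. pos as (layer I b) < pos as j}"
        have Tc: "T \<subseteq> carrier L" using Ic by (auto simp: T_def)
        have bT: "b \<sqsubseteq> \<Squnion>T"
        proof (rule circuit_two[OF C sup_in[OF Tc] b(1)])
          fix a assume a: "a \<in> C" "a \<noteq> b"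
          then have "layer I a \<noteq> layer I b" using n by blast
          then have "pos as (layer I b) < pos as (layer I a)" using eqI[OF a(1)] by force
          then have "upper I (layer I a) \<subseteq> T" by (auto simp: upper_def T_def)
          then have "\<Squnion>(upper I (layer I a)) \<sqsubseteq> \<Squnion>T" by (rule sup_mono[OF _ Tc])
          moreover have "upper I (layer I a) \<subseteq> carrier L" using upper_sub Ic by blast
          ultimately show "a \<sqsubseteq> \<Squnion>T"
            using le_trans[OF lp(2)[OF a(1)]] Tc a(1) CA by auto
        qed
        have bA: "b \<in> atoms L" using b CA by blast
        have "T \<noteq> {}"
        proof
          assume "T = {}"
          then have "b \<sqsubseteq> \<bottom>" using bT sup_empty by simp
          then show False using rank_mono[of b \<bottom>] atom_rank[OF bA] rank_bottom bA by simp
        qed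
        have Tas: "T \<subseteq> set as" using I set_as by (auto simp: T_def)
        define j where "j = list_min as T"
        have j: "j \<in> T" using list_min_in[OF Tas \<open>T \<noteq> {}\<close>] by (simp add: j_def)
        have "T \<subseteq> upper I j" using list_min_le[OF Tas] by (auto simp: upper_def j_def T_def)
        moreover have uc: "upper I j \<subseteq> carrier L" using upper_sub Ic by blast
        ultimately have "\<Squnion>T \<sqsubseteq> \<Squnion>(upper I j)" by (rule sup_mono)
        then have "b \<sqsubseteq> \<Squnion>(upper I j)" using le_trans[OF bT] Tc uc bA by simp
        then have "pos as j \<le> pos as (layer I b)" using lp(3)[OF b(1)] j by (simp add: T_def)
        then show False using j by (simp add: T_def)
      qed
      then obtain b' where b': "b' \<in> C" "b' \<noteq> b" "layer I b' = layer I b" by blast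
      have "layer I a = layer I b \<or> before as (layer I b) (layer I a)" if "a \<in> C" for a
      proof (cases "pos as (layer I a) \<le> pos as (layer I b)")
        case False
        then show ?thesis
          using pos_less_iff_before[OF distinct_as, of "layer I b" "layer I a"] lp(1)[OF that] lp(1)[OF b(1)] I set_as
          by auto
      qed (use eqI[OF that] in simp)
      then show ?thesis
        using relabel_boundary_collision[OF True b(1) b'(1) b'(2)[symmetric] b'(3)[symmetric]] by simp
    qed
  qed
  then show ?thesis by simp
qed

text \<open>For J = I the layer map is the identity and nothing crosses. For another J the
  coefficient can be nonzero only if the layers map J bijectively onto I. Then, by rank, the part of
  J in the layers from i on spans the same flat as the segment of I from i on; the NBC properties of
  I and of J together force i into J, and equal cardinalities give J = I.\<close>

lemma layer_lookup:
  assumes I: "I \<in> NBC L as p" and J: "J \<in> NBC L as p"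
  shows "poly_mapping.lookup (relabelling.relabel as as (flat_atoms I) (layer I) (frag_of J)) I = (if J = I then 1 else 0)"
proof -
  have nI: "nbc I" "card I = p" and nJ: "nbc J" "card J = p" using I J by (auto simp: NBC_iff)
  have iI: "independent L I" and iJ: "independent L J" using nbc_independent nI nJ by auto
  have IA: "I \<subseteq> atoms L" and JA: "J \<subseteq> atoms L" using independent_atoms iI iJ by auto
  have Ic: "I \<subseteq> carrier L" and Jc: "J \<subseteq> carrier L" using IA JA atoms_sub by blast+
  have fin: "finite I" "finite J" using IA JA finite_atom_set by auto
  interpret relabelling as as "flat_atoms I" "layer I" by (rule layer_relabelling[OF IA])
  show ?thesis
  proof (cases "J = I")
    case True
    have "I \<subseteq> flat_atoms I" using IA sup_ge[OF Ic] by (auto simp: flat_atoms_def)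
    moreover have "inj_on (layer I) I" "layer I ` I = I"
      using layer_self[OF iI] by (auto simp: inj_on_def)
    moreover have "psgn crossing I I = 1"
      unfolding psgn_def
    proof (intro prod.neutral ballI)
      fix a b assume ab: "a \<in> I" "b \<in> I"
      have "a \<in> set as" "b \<in> set as" using ab IA set_as by blast+
      then have "\<not> (before as a b \<and> before as b a)"
        using pos_less_iff_before[OF distinct_as, of a b] pos_less_iff_before[OF distinct_as, of b a] by linarith
      then show "(if crossing a b then -1 else 1::int) = 1" using layer_self[OF iI] ab by simp
    qed
    ultimately show ?thesis using True by (simp add: relabel_of)
  next
    case False
    have "\<not> (J \<subseteq> flat_atoms I \<and> inj_on (layer I) J \<and> layer I ` J = I)"
    proof
      assume a: "J \<subseteq> flat_atoms I \<and> inj_on (layer I) J \<and> layer I ` J = I"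
      have "I \<subseteq> J"
      proof
        fix i assume i: "i \<in> I"
        have iA: "i \<in> atoms L" using i IA by blast
        let ?X = "\<Squnion>(upper I i)"
        have uc: "upper I k \<subseteq> carrier L" for k using upper_sub[of I k] Ic by blast
        define Ji where "Ji = {j \<in> J. pos as i \<le> pos as (layer I j)}"
        have JiJ: "Ji \<subseteq> J" by (auto simp: Ji_def)
        have Jic: "Ji \<subseteq> carrier L" using JiJ Jc by blast
        have le: "j \<sqsubseteq> ?X" if "j \<in> Ji" for j
        proof -
          have jA: "j \<in> atoms L" "j \<sqsubseteq> \<Squnion>I" using that a JiJ by (auto simp: flat_atoms_def)
          have "upper I (layer I j) \<subseteq> upper I i" using that by (auto simp: Ji_def upper_def)
          then have "\<Squnion>(upper I (layer I j)) \<sqsubseteq> ?X" by (rule sup_mono[OF _ uc])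
          then show ?thesis using le_trans[OF layer_props(2)[OF IA jA]] uc jA(1) by simp
        qed
        have "layer I ` Ji = upper I i" using a by (auto simp: Ji_def upper_def)
        moreover have "inj_on (layer I) Ji" using a JiJ inj_on_subset by blast
        ultimately have "card Ji = card (upper I i)" by (metis card_image)
        moreover have "r (\<Squnion>Ji) = card Ji" "r ?X = card (upper I i)"
          using independent_subset[OF iJ JiJ] independent_subset[OF iI upper_sub] by (auto simp: independent_def)
        ultimately have "\<Squnion>Ji = ?X"
          using rank_eq_imp_eq[of "\<Squnion>Ji" ?X] sup_le[OF Jic sup_in[OF uc] le] Jic uc by simp
        moreover have "i \<sqsubseteq> ?X" by (rule sup_ge[OF uc]) (use i in \<open>simp add: upper_def\<close>)
        ultimately have iJi: "i \<sqsubseteq> \<Squnion>Ji" by simp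
        show "i \<in> J"
        proof (rule ccontr)
          assume "i \<notin> J"
          \<comment> \<open>No member of \<open>Ji\<close> can precede i, being spanned by the
            segment of I from i on; so i, which is spanned by \<open>Ji\<close>, would precede all
            of it.\<close>
          show False
          proof (rule nbc_no_smaller[OF nJ(1) JiJ iA iJi])
            fix j assume j: "j \<in> Ji"
            have jA: "j \<in> atoms L" using j JiJ JA by blast
            have "\<not> pos as j < pos as i"
            proof
              assume less: "pos as j < pos as i"
              show False
                by (rule nbc_no_smaller[OF nI(1) upper_sub[of I i] jA le[OF j]]) (use less in \<open>auto simp: upper_def\<close>)
            qed
            moreover have "pos as j \<noteq> pos as i"
            proof
              assume "pos as j = pos as i"
              then have "j = i" by (rule pos_as_inj[OF jA iA])
              then show False using \<open>i \<notin> J\<close> j JiJ by blast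
            qed
            ultimately show "pos as i < pos as j" by linarith
          qed
        qed
      qed
      then have "I = J" using nI(2) nJ(2) fin by (simp add: card_subset_eq)
      then show False using False by simp
    qed
    then show ?thesis using False by (auto simp: relabel_of)
  qed
qed

text \<open>The layer map of I kills the ideal, while the coefficient of I in the image of w is
  still that of w.\<close>

lemma NBC_combination_in_ideal:
  assumes w: "Poly_Mapping.keys w \<subseteq> NBC L as p" "w \<in> OS_ideal L as"
  shows "w = 0"
proof (rule poly_mapping_eqI)
  fix I
  show "poly_mapping.lookup w I = poly_mapping.lookup 0 I"
  proof (cases "I \<in> NBC L as p")
    case False
    then show ?thesis using w(1) by (auto simp: in_keys_iff)
  next
    case True
    then have IA: "I \<subseteq> atoms L" by (simp add: NBC_def)
    interpret relabelling as as "flat_atoms I" "layer I" by (rule layer_relabelling[OF IA])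
    have "poly_mapping.lookup (relabel w) I = (\<Sum>J\<in>Poly_Mapping.keys w. poly_mapping.lookup w J * poly_mapping.lookup (relabel (frag_of J)) I)"
      unfolding relabel_of by (simp add: relabel_def frag_extend_def lookup_sum)
    also have "\<dots> = (\<Sum>J\<in>Poly_Mapping.keys w. if J = I then poly_mapping.lookup w I else 0)"
    proof (rule sum.cong[OF HOL.refl])
      fix J assume "J \<in> Poly_Mapping.keys w"
      then have "J \<in> NBC L as p" using w(1) by blast
      from layer_lookup[OF True this]
      show "poly_mapping.lookup w J * poly_mapping.lookup (relabel (frag_of J)) I = (if J = I then poly_mapping.lookup w I else 0)"
        by (simp only:) simp
    qed
    also have "\<dots> = poly_mapping.lookup w I" by (simp add: in_keys_iff)
    finally show ?thesis using layer_kills_OS_ideal[OF IA w(2)] by simp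
  qed
qed

text \<open>For a broken circuit in J, multiply the boundary of its circuit by the monomial of the
  remaining elements K. One term is the monomial of J up to sign; in every other nonzero term an
  element of J is replaced by the smaller minimum m. The sum of positions drops, so the rewriting
  ends.\<close>

lemma NBC_span_of:
  assumes "J \<subseteq> set as" "card J = p"
  shows "\<exists>w. Poly_Mapping.keys w \<subseteq> NBC L as p \<and> frag_of J - w \<in> OS_ideal L as"
  using assms
proof (induction "\<Sum>a\<in>J. pos as a" arbitrary: J rule: less_induct)
  case (less J)
  have JA: "J \<subseteq> atoms L" using less.prems set_as by simp
  show ?case
  proof (cases "nbc J")
    case True
    then show ?thesis using less.prems by (intro exI[of _ "frag_of J"]) (simp add: NBC_iff)
  next
    case False
    then obtain D where "broken_circuit L as D" "D \<subseteq> J" using JA by (auto simp: nbc_def)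
    then obtain C where C: "circuit L C" "C - {list_min as C} \<subseteq> J" by (auto simp: broken_circuit_def)
    define m where "m = list_min as C"
    note Cas = circuit_set_as[OF C(1)]
    have m: "m \<in> C" using list_min_in[OF Cas circuit_nonempty[OF C(1)]] by (simp add: m_def)
    have fin: "finite C" "finite J" using Cas less.prems(1) finite_sub by auto
    define K where "K = J - (C - {m})"
    have K: "K \<subseteq> set as" "finite K" using less.prems(1) fin by (auto simp: K_def)
    define s where "s c = psgn (before as) C {c} * psgn (\<lambda>a b. before as b a) (C - {c}) K" for c
    define t where "t c = ext_mult as (frag_cmul (psgn (before as) C {c}) (frag_of (C - {c}))) (frag_of K)" for c
    have t: "t c = (if (C - {c}) \<inter> K = {} then frag_cmul (s c) (frag_of ((C - {c}) \<union> K)) else 0)" for c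
      using fin K by (simp add: t_def ext_mult_cmul_left ext_mult_of s_def)
    have total: "ext_mult as (ext_boundary as C) (frag_of K) = (\<Sum>c\<in>C. t c)"
      unfolding ext_boundary_eq[OF distinct_as Cas] t_def by (rule ext_mult_sum_left[OF fin(1)])
    have tm: "t m = frag_cmul (s m) (frag_of J)"
    proof -
      have "(C - {m}) \<inter> K = {}" "(C - {m}) \<union> K = J" using C(2) by (auto simp: K_def m_def)
      then show ?thesis unfolding t by simp
    qed
    \<comment> \<open>The sign is its own inverse, so the relation can be solved for the monomial of
      J over the integers.\<close>
    have sm: "s m * s m = 1"
      using psgn_unit[of "before as" C "{m}"] psgn_unit[of "\<lambda>a b. before as b a" "C - {m}" K] by (auto simp: s_def)
    have "\<exists>w. Poly_Mapping.keys w \<subseteq> NBC L as p \<and> t c - w \<in> OS_ideal L as" if c: "c \<in> C - {m}" for c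
    proof (cases "(C - {c}) \<inter> K = {}")
      case False
      then show ?thesis unfolding t by (intro exI[of _ 0]) simp
    next
      case True
      let ?J = "(C - {c}) \<union> K"
      have cJ: "c \<in> J" using c C(2) by (auto simp: m_def)
      have "card ?J = card (C - {c}) + card K" using True fin K by (simp add: card_Un_disjoint)
      also have "\<dots> = card (C - {m}) + card K" using c m fin by simp
      also have "\<dots> = card ((C - {m}) \<union> K)" using fin K by (subst card_Un_disjoint) (auto simp: K_def)
      also have "(C - {m}) \<union> K = J" using C(2) by (auto simp: K_def m_def)
      finally have cardJ: "card ?J = p" using less.prems by simp
      have "(\<Sum>a\<in>?J. pos as a) = (\<Sum>a\<in>C - {c}. pos as a) + (\<Sum>a\<in>K. pos as a)"
        using True fin K by (simp add: sum.union_disjoint)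
      also have "\<dots> < (\<Sum>a\<in>C - {m}. pos as a) + (\<Sum>a\<in>K. pos as a)"
      proof -
        have "pos as m \<le> pos as c" using list_min_le[OF Cas, of c] c by (simp add: m_def)
        moreover have "pos as m \<noteq> pos as c" using pos_inj[of m as c] m c Cas by blast
        ultimately have "pos as m < pos as c" by simp
        moreover have "(\<Sum>a\<in>C. pos as a) = pos as c + (\<Sum>a\<in>C - {c}. pos as a)"
          "(\<Sum>a\<in>C. pos as a) = pos as m + (\<Sum>a\<in>C - {m}. pos as a)"
          using c m fin sum.remove[of C c "pos as"] sum.remove[of C m "pos as"] by simp_all
        ultimately show ?thesis by linarith
      qed
      also have "\<dots> = (\<Sum>a\<in>(C - {m}) \<union> K. pos as a)"
        using fin K by (subst sum.union_disjoint) (auto simp: K_def)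
      also have "(C - {m}) \<union> K = J" using C(2) by (auto simp: K_def m_def)
      finally have lt: "(\<Sum>a\<in>?J. pos as a) < (\<Sum>a\<in>J. pos as a)" .
      have "?J \<subseteq> set as" using Cas K by auto
      from less.hyps[OF lt this cardJ]
      obtain w where w: "Poly_Mapping.keys w \<subseteq> NBC L as p" "frag_of ?J - w \<in> OS_ideal L as" by blast
      have "t c - frag_cmul (s c) w = frag_cmul (s c) (frag_of ?J - w)"
        unfolding t using True by (simp add: frag_cmul_diff_distrib2)
      then show ?thesis
        using w OS_ideal_cmul[OF w(2), of "s c"] keys_cmul[of "s c" w] by (intro exI[of _ "frag_cmul (s c) w"]) auto
    qed
    then obtain w where w: "\<And>c. c \<in> C - {m} \<Longrightarrow> Poly_Mapping.keys (w c) \<subseteq> NBC L as p \<and> t c - w c \<in> OS_ideal L as"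
      by metis
    define W where "W = (\<Sum>c\<in>C - {m}. w c)"
    have keysW: "Poly_Mapping.keys W \<subseteq> NBC L as p"
      unfolding W_def using keys_sum[of w "C - {m}"] w by blast
    have sum_in: "(\<Sum>c\<in>A. u c) \<in> OS_ideal L as" if "finite A" "\<And>c. c \<in> A \<Longrightarrow> u c \<in> OS_ideal L as" for A u
      using that by induction (simp_all add: OS_ideal_add)
    have 1: "(\<Sum>c\<in>C - {m}. t c) - W \<in> OS_ideal L as"
      unfolding W_def sum_subtractf[symmetric] by (rule sum_in) (use fin w in auto)
    have 2: "(\<Sum>c\<in>C. t c) \<in> OS_ideal L as"
      unfolding total[symmetric]
      by (rule OS_ideal_mult_right[OF boundary_in_OS_ideal[OF C(1)]]) (simp add: ext_carrier_of K)
    have "(\<Sum>c\<in>C. t c) = t m + (\<Sum>c\<in>C - {m}. t c)" using m fin by (simp add: sum.remove)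
    then have "t m + W = (\<Sum>c\<in>C. t c) - ((\<Sum>c\<in>C - {m}. t c) - W)" by simp
    then have "t m + W \<in> OS_ideal L as" using OS_ideal_diff[OF 2 1] by (simp only:)
    then have "frag_cmul (s m) (t m + W) \<in> OS_ideal L as" by (rule OS_ideal_cmul)
    moreover have "frag_cmul (s m) (t m + W) = frag_of J - frag_cmul (- s m) W"
      unfolding tm by (simp add: frag_cmul_distrib2 sm flip: minus_frag_cmul)
    ultimately show ?thesis
      using keysW keys_cmul[of "- s m" W] by (intro exI[of _ "frag_cmul (- s m) W"]) auto
  qed
qed

lemma NBC_span:
  assumes "Poly_Mapping.keys x \<subseteq> {J. J \<subseteq> set as \<and> card J = p}"
  shows "\<exists>w. Poly_Mapping.keys w \<subseteq> NBC L as p \<and> x - w \<in> OS_ideal L as"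
  using assms
proof (induction x rule: frag_induction)
  case zero
  then show ?case by (intro exI[of _ 0]) simp
next
  case (one J)
  then show ?case using NBC_span_of by simp
next
  case (diff x y)
  then obtain v w where "Poly_Mapping.keys v \<subseteq> NBC L as p" "x - v \<in> OS_ideal L as"
    "Poly_Mapping.keys w \<subseteq> NBC L as p" "y - w \<in> OS_ideal L as" by blast
  moreover from this have "(x - y) - (v - w) \<in> OS_ideal L as"
    using OS_ideal_diff[of "x - v" "y - w"] by (simp add: algebra_simps)
  ultimately show ?case using keys_diff[of v w] by (intro exI[of _ "v - w"]) auto
qed


subsection \<open>The NBC basis\<close>

lemma OS_class_eq: "OS_class L as x = (\<lambda>h. h + x) ` OS_ideal L as"
  unfolding OS_class_def a_r_coset_def' by auto

lemma OS_class_eq_iff: "OS_class L as x = OS_class L as y \<longleftrightarrow> x - y \<in> OS_ideal L as"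
proof
  assume "OS_class L as x = OS_class L as y"
  moreover have "x \<in> OS_class L as x" unfolding OS_class_eq using image_eqI[of x "\<lambda>h. h + x" 0] by simp
  ultimately obtain h where "h \<in> OS_ideal L as" "x = h + y" unfolding OS_class_eq by auto
  then show "x - y \<in> OS_ideal L as" by simp
next
  assume d: "x - y \<in> OS_ideal L as"
  show "OS_class L as x = OS_class L as y"
    unfolding OS_class_eq
  proof (intro equalityI subsetI)
    fix u assume "u \<in> (\<lambda>h. h + x) ` OS_ideal L as"
    then obtain h where "h \<in> OS_ideal L as" "u = h + x" by auto
    then show "u \<in> (\<lambda>h. h + y) ` OS_ideal L as"
      using OS_ideal_add[OF _ d, of h] by (intro image_eqI[of _ _ "h + (x - y)"]) simp_all
  next
    fix u assume "u \<in> (\<lambda>h. h + y) ` OS_ideal L as"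
    then obtain h where "h \<in> OS_ideal L as" "u = h + y" by auto
    then show "u \<in> (\<lambda>h. h + x) ` OS_ideal L as"
      using OS_ideal_diff[OF _ d, of h] by (intro image_eqI[of _ _ "h - (x - y)"]) simp_all
  qed
qed

lemma OS_class_0: "OS_class L as 0 = OS_ideal L as"
  by (simp add: OS_class_eq)

lemma OS_degree_one [simp]: "\<one>\<^bsub>OS_degree L as p\<^esub> = OS_ideal L as"
  by (simp add: OS_degree_def OS_algebra_def FactRing_def)

lemma OS_degree_mult: "OS_class L as x \<otimes>\<^bsub>OS_degree L as p\<^esub> OS_class L as y = OS_class L as (x + y)"
proof -
  have "OS_class L as x \<otimes>\<^bsub>OS_degree L as p\<^esub> OS_class L as y =
      (\<Union>h\<in>OS_class L as x. \<Union>k\<in>OS_class L as y. {h + k})"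
    by (simp add: OS_degree_def OS_algebra_def FactRing_def set_add_def')
  also have "\<dots> = OS_class L as (x + y)"
    unfolding OS_class_eq
  proof (intro equalityI subsetI)
    fix u assume "u \<in> (\<Union>h\<in>(\<lambda>h. h + x) ` OS_ideal L as. \<Union>k\<in>(\<lambda>h. h + y) ` OS_ideal L as. {h + k})"
    then obtain h k where "h \<in> OS_ideal L as" "k \<in> OS_ideal L as" "u = (h + x) + (k + y)" by auto
    then show "u \<in> (\<lambda>h. h + (x + y)) ` OS_ideal L as"
      using OS_ideal_add[of h k] by (intro image_eqI[of _ _ "h + k"]) (simp_all add: algebra_simps)
  next
    fix u assume "u \<in> (\<lambda>h. h + (x + y)) ` OS_ideal L as"
    then obtain h where "h \<in> OS_ideal L as" "u = (h + x) + (0 + y)" by (auto simp: algebra_simps)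
    then show "u \<in> (\<Union>h\<in>(\<lambda>h. h + x) ` OS_ideal L as. \<Union>k\<in>(\<lambda>h. h + y) ` OS_ideal L as. {h + k})"
      using OS_ideal_0 by blast
  qed
  finally show ?thesis .
qed

lemma OS_degree_carrier:
  "carrier (OS_degree L as p) = OS_class L as ` {x. Poly_Mapping.keys x \<subseteq> {J. J \<subseteq> set as \<and> card J = p}}"
proof -
  have "{x \<in> ext_carrier as. \<forall>I\<in>Poly_Mapping.keys x. card I = p} = {x. Poly_Mapping.keys x \<subseteq> {J. J \<subseteq> set as \<and> card J = p}}"
    by (auto simp: ext_carrier_def)
  then show ?thesis by (simp add: OS_degree_def)
qed

lemma NBC_sub: "NBC L as p \<subseteq> {J. J \<subseteq> set as \<and> card J = p}"
  by (auto simp: NBC_def set_as)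

text \<open>Rewriting of broken circuits gives surjectivity, the layer maps give
  injectivity.\<close>

theorem OS_class_iso: "OS_class L as \<in> iso (free_Abelian_group (NBC L as p)) (OS_degree L as p)"
proof (rule isoI)
  show "OS_class L as \<in> hom (free_Abelian_group (NBC L as p)) (OS_degree L as p)"
  proof (rule homI)
    fix x assume "x \<in> carrier (free_Abelian_group (NBC L as p))"
    then have "Poly_Mapping.keys x \<subseteq> NBC L as p" by simp
    then have "Poly_Mapping.keys x \<subseteq> {J. J \<subseteq> set as \<and> card J = p}" using NBC_sub by (rule subset_trans)
    then show "OS_class L as x \<in> carrier (OS_degree L as p)" unfolding OS_degree_carrier by blast
  qed (simp add: OS_degree_mult)
  show "bij_betw (OS_class L as) (carrier (free_Abelian_group (NBC L as p))) (carrier (OS_degree L as p))"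
    unfolding bij_betw_def
  proof
    show "inj_on (OS_class L as) (carrier (free_Abelian_group (NBC L as p)))"
    proof (rule inj_onI)
      fix x y assume xy: "x \<in> carrier (free_Abelian_group (NBC L as p))" "y \<in> carrier (free_Abelian_group (NBC L as p))"
        "OS_class L as x = OS_class L as y"
      have "Poly_Mapping.keys (x - y) \<subseteq> NBC L as p" using xy(1,2) keys_diff[of x y] by auto
      then have "x - y = 0" using NBC_combination_in_ideal xy(3) OS_class_eq_iff by blast
      then show "x = y" by simp
    qed
    show "OS_class L as ` carrier (free_Abelian_group (NBC L as p)) = carrier (OS_degree L as p)"
    proof
      show "OS_class L as ` carrier (free_Abelian_group (NBC L as p)) \<subseteq> carrier (OS_degree L as p)"
        unfolding OS_degree_carrier
      proof (rule image_mono, rule subsetI)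
        fix x assume "x \<in> carrier (free_Abelian_group (NBC L as p))"
        then have "Poly_Mapping.keys x \<subseteq> NBC L as p" by simp
        then show "x \<in> {x. Poly_Mapping.keys x \<subseteq> {J. J \<subseteq> set as \<and> card J = p}}"
          using subset_trans[OF _ NBC_sub] by simp
      qed
      show "carrier (OS_degree L as p) \<subseteq> OS_class L as ` carrier (free_Abelian_group (NBC L as p))"
      proof
        fix u assume "u \<in> carrier (OS_degree L as p)"
        then obtain x where x: "Poly_Mapping.keys x \<subseteq> {J. J \<subseteq> set as \<and> card J = p}" "u = OS_class L as x"
          unfolding OS_degree_carrier by blast
        obtain w where w: "Poly_Mapping.keys w \<subseteq> NBC L as p" "x - w \<in> OS_ideal L as" using NBC_span[OF x(1)] by blast
        then have "u = OS_class L as w" using x(2) OS_class_eq_iff by blast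
        then show "u \<in> OS_class L as ` carrier (free_Abelian_group (NBC L as p))" using w(1) by auto
      qed
    qed
  qed
qed

text \<open>The group laws are carried over from the free group on the NBC sets; only the unit has
  to be identified.\<close>

lemma OS_degree_comm_group: "comm_group (OS_degree L as p)"
proof -
  have "comm_group (OS_degree L as p\<lparr>one := OS_class L as \<one>\<^bsub>free_Abelian_group (NBC L as p)\<^esub>\<rparr>)"
    by (rule comm_group.iso_imp_img_comm_group[OF abelian_free_Abelian_group OS_class_iso])
  moreover have "OS_degree L as p\<lparr>one := OS_class L as \<one>\<^bsub>free_Abelian_group (NBC L as p)\<^esub>\<rparr> = OS_degree L as p"
    using OS_degree_one[of p] OS_class_0 by simp
  ultimately show ?thesis by simp
qed

end

section \<open>Free abelian groups, direct sums and tensor products\<close>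

lemma comm_group_sum_group:
  assumes "\<And>i. i \<in> I \<Longrightarrow> comm_group (G i)"
  shows "comm_group (sum_group I G)"
proof (rule group.group_comm_groupI)
  have grp: "group (G i)" if "i \<in> I" for i using assms[OF that] by (rule comm_group.axioms(2))
  then show "group (sum_group I G)" by simp
  fix x y assume xy: "x \<in> carrier (sum_group I G)" "y \<in> carrier (sum_group I G)"
  then have "x i \<in> carrier (G i)" "y i \<in> carrier (G i)" if "i \<in> I" for i
    using that by (auto simp: carrier_sum_group[OF grp] PiE_iff)
  then show "x \<otimes>\<^bsub>sum_group I G\<^esub> y = y \<otimes>\<^bsub>sum_group I G\<^esub> x"
    using comm_monoid.m_comm[OF comm_group.axioms(1)[OF assms]] by (auto simp: restrict_def fun_eq_iff)
qed

lemma carrier_sum_group_finite: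
  assumes "finite I" "\<And>i. i \<in> I \<Longrightarrow> group (G i)"
  shows "carrier (sum_group I G) = (\<Pi>\<^sub>E i\<in>I. carrier (G i))"
  using assms by (simp add: carrier_sum_group)

lemma hom_free_diff:
  assumes K: "group K" and u: "u \<in> hom (free_Abelian_group S) K"
    and xy: "Poly_Mapping.keys x \<subseteq> S" "Poly_Mapping.keys y \<subseteq> S"
  shows "u (x - y) = u x \<otimes>\<^bsub>K\<^esub> inv\<^bsub>K\<^esub> u y"
proof -
  interpret u: group_hom "free_Abelian_group S" K u
    by (rule group_hom.intro[OF group_free_Abelian_group K group_hom_axioms.intro[OF u]])
  have x: "x \<in> carrier (free_Abelian_group S)" "y \<in> carrier (free_Abelian_group S)" using xy by auto
  have "u (x \<otimes>\<^bsub>free_Abelian_group S\<^esub> inv\<^bsub>free_Abelian_group S\<^esub> y) = u x \<otimes>\<^bsub>K\<^esub> u (inv\<^bsub>free_Abelian_group S\<^esub> y)"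
    by (rule u.hom_mult[OF x(1) u.G.inv_closed[OF x(2)]])
  then show ?thesis using u.hom_inv[OF x(2)] xy(2) by simp
qed

lemma hom_free_eq:
  assumes "group K" "p \<in> hom (free_Abelian_group S) K" "q \<in> hom (free_Abelian_group S) K"
    and eq: "\<And>s. s \<in> S \<Longrightarrow> p (frag_of s) = q (frag_of s)" and x: "Poly_Mapping.keys x \<subseteq> S"
  shows "p x = q x"
proof -
  interpret p: group_hom "free_Abelian_group S" K p
    by (rule group_hom.intro[OF group_free_Abelian_group assms(1) group_hom_axioms.intro[OF assms(2)]])
  interpret q: group_hom "free_Abelian_group S" K q
    by (rule group_hom.intro[OF group_free_Abelian_group assms(1) group_hom_axioms.intro[OF assms(3)]])
  show ?thesis
    using x
  proof (rule free_Abelian_group_induct[of x S "\<lambda>x. p x = q x"])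
    show "p 0 = q 0" using p.hom_one q.hom_one by simp
    show "p (x - y) = q (x - y)" if "Poly_Mapping.keys x \<subseteq> S" "Poly_Mapping.keys y \<subseteq> S" "p x = q x" "p y = q y" for x y
      using hom_free_diff[OF assms(1,2) that(1,2)] hom_free_diff[OF assms(1,3) that(1,2)] that(3,4) by simp
  qed (rule eq)
qed

lemma iso_inj_on: "h \<in> iso G H \<Longrightarrow> inj_on h (carrier G)"
  and iso_image: "h \<in> iso G H \<Longrightarrow> h ` carrier G = carrier H"
  by (auto simp: iso_def bij_betw_def)

lemma free_with_basis_iso:
  assumes "free_with_basis G U b" "\<phi> \<in> iso G G'" "\<And>i. i \<in> U \<Longrightarrow> \<phi> (b i) = b' i"
  shows "free_with_basis G' U b'"
proof -
  obtain h where h: "h \<in> iso (free_Abelian_group U) G" "\<forall>i\<in>U. h (frag_of i) = b i"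
    using assms(1) unfolding free_with_basis_def by blast
  have "\<phi> \<circ> h \<in> iso (free_Abelian_group U) G'"
    using iso_set_trans[OF h(1) assms(2)] by (simp add: o_def comp_def compose_def)
  then show ?thesis
    unfolding free_with_basis_def using h(2) assms(3) by (intro bexI[of _ "\<phi> \<circ> h"]) auto
qed

lemma sum_inj_in:
  assumes "finite I" "\<And>i. i \<in> I \<Longrightarrow> group (G i)" "x \<in> carrier (G i)"
  shows "sum_inj I G i x \<in> carrier (sum_group I G)"
proof -
  have "carrier (sum_group I G) = (\<Pi>\<^sub>E i\<in>I. carrier (G i))"
    by (rule carrier_sum_group_finite) (use assms in auto)
  then show ?thesis
    using assms(3) by (auto simp: sum_inj_def intro: monoid.one_closed[OF group.is_monoid[OF assms(2)]])
qed

text \<open>An element of the free group over the disjoint union is cut into slices over I, and each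
  slice goes through the isomorphism of its summand. Finiteness of I makes the direct sum a product,
  so any tuple of slices can be glued back.\<close>

lemma free_with_basis_sum_group:
  assumes fin: "finite I" and G: "\<And>i. i \<in> I \<Longrightarrow> group (G i)"
    and b: "\<And>i. i \<in> I \<Longrightarrow> free_with_basis (G i) (U i) (b i)"
  shows "free_with_basis (sum_group I G) (Sigma I U) (\<lambda>(i, u). sum_inj I G i (b i u))"
proof -
  have "\<exists>h. h \<in> iso (free_Abelian_group (U i)) (G i) \<and> (\<forall>u\<in>U i. h (frag_of u) = b i u)" if "i \<in> I" for i
    using b[OF that] unfolding free_with_basis_def by blast
  then obtain h where h: "\<And>i. i \<in> I \<Longrightarrow> h i \<in> iso (free_Abelian_group (U i)) (G i)"
    "\<And>i u. i \<in> I \<Longrightarrow> u \<in> U i \<Longrightarrow> h i (frag_of u) = b i u"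
    by metis
  define slice :: "'a \<Rightarrow> ('a \<times> 'c \<Rightarrow>\<^sub>0 int) \<Rightarrow> ('c \<Rightarrow>\<^sub>0 int)" where
    "slice i = frag_extend (\<lambda>(j, u). if j = i then frag_of u else 0)" for i
  have slice_add: "slice i (x + y) = slice i x + slice i y" for i x y
    by (simp add: slice_def frag_extend_add)
  have lookup_slice: "poly_mapping.lookup (slice i x) u = poly_mapping.lookup x (i, u)" for i x u
  proof -
    have "poly_mapping.lookup (slice i x) u =
        (\<Sum>p\<in>Poly_Mapping.keys x. if p = (i, u) then poly_mapping.lookup x (i, u) else 0)"
      unfolding slice_def frag_extend_def lookup_sum by (rule sum.cong) (auto split: prod.splits)
    then show ?thesis by (simp add: in_keys_iff)
  qed
  have slice_keys: "Poly_Mapping.keys (slice i x) \<subseteq> U i" if "Poly_Mapping.keys x \<subseteq> Sigma I U" for i x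
    using that by (auto simp: in_keys_iff lookup_slice subset_iff)
  define H where "H x = (\<lambda>i\<in>I. h i (slice i x))" for x
  have hom_h: "h i \<in> hom (free_Abelian_group (U i)) (G i)" if "i \<in> I" for i
    using h(1)[OF that] by (simp add: iso_def)
  have carr: "carrier (sum_group I G) = (\<Pi>\<^sub>E i\<in>I. carrier (G i))"
    by (rule carrier_sum_group_finite) (use fin G in auto)
  have "H \<in> iso (free_Abelian_group (Sigma I U)) (sum_group I G)"
  proof (rule isoI)
    show "H \<in> hom (free_Abelian_group (Sigma I U)) (sum_group I G)"
    proof (rule homI)
      fix x assume "x \<in> carrier (free_Abelian_group (Sigma I U))"
      then show "H x \<in> carrier (sum_group I G)"
        unfolding carr H_def using hom_in_carrier[OF hom_h] slice_keys[of x] by auto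
    next
      fix x y assume "x \<in> carrier (free_Abelian_group (Sigma I U))" "y \<in> carrier (free_Abelian_group (Sigma I U))"
      then show "H (x \<otimes>\<^bsub>free_Abelian_group (Sigma I U)\<^esub> y) = H x \<otimes>\<^bsub>sum_group I G\<^esub> H y"
        unfolding H_def using hom_mult[OF hom_h] slice_keys[of x] slice_keys[of y]
        by (auto simp: slice_add restrict_def fun_eq_iff)
    qed
    show "bij_betw H (carrier (free_Abelian_group (Sigma I U))) (carrier (sum_group I G))"
      unfolding bij_betw_def
    proof
      show "inj_on H (carrier (free_Abelian_group (Sigma I U)))"
      proof (rule inj_onI)
        fix x y assume xy: "x \<in> carrier (free_Abelian_group (Sigma I U))" "y \<in> carrier (free_Abelian_group (Sigma I U))" "H x = H y"
        show "x = y"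
        proof (rule poly_mapping_eqI)
          fix p :: "'a \<times> 'c"
          obtain i u where p: "p = (i, u)" by (cases p)
          show "poly_mapping.lookup x p = poly_mapping.lookup y p"
          proof (cases "i \<in> I")
            case True
            have "h i (slice i x) = h i (slice i y)" using fun_cong[OF xy(3), of i] True by (simp add: H_def)
            then have "slice i x = slice i y"
              using inj_onD[OF iso_inj_on[OF h(1)[OF True]]] slice_keys[of x i] slice_keys[of y i] xy by simp
            then show ?thesis using lookup_slice p by metis
          next
            case False
            then have "p \<notin> Poly_Mapping.keys x" "p \<notin> Poly_Mapping.keys y" using xy p by auto
            then show ?thesis by (simp add: in_keys_iff)
          qed
        qed
      qed
      show "H ` carrier (free_Abelian_group (Sigma I U)) = carrier (sum_group I G)"
      proof (intro equalityI subsetI)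
        fix w assume "w \<in> H ` carrier (free_Abelian_group (Sigma I U))"
        then show "w \<in> carrier (sum_group I G)"
          unfolding carr H_def using hom_in_carrier[OF hom_h] slice_keys by auto
      next
        fix w assume w: "w \<in> carrier (sum_group I G)"
        have "\<exists>x. Poly_Mapping.keys x \<subseteq> U i \<and> h i x = w i" if "i \<in> I" for i
        proof -
          have "w i \<in> h i ` carrier (free_Abelian_group (U i))"
            using w that iso_image[OF h(1)[OF that]] unfolding carr by (auto simp: PiE_iff)
          then obtain x where "x \<in> carrier (free_Abelian_group (U i))" "w i = h i x" by blast
          then show ?thesis by (intro exI[of _ x]) simp
        qed
        then obtain y where y: "\<And>i. i \<in> I \<Longrightarrow> Poly_Mapping.keys (y i) \<subseteq> U i" "\<And>i. i \<in> I \<Longrightarrow> h i (y i) = w i"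
          by metis
        define x where "x = (\<Sum>i\<in>I. frag_extend (\<lambda>u. frag_of (i, u)) (y i))"
        have lx: "poly_mapping.lookup x (j, u) = (if j \<in> I then poly_mapping.lookup (y j) u else 0)" for j u
        proof -
          have inner: "poly_mapping.lookup (frag_extend (\<lambda>u. frag_of (i, u)) (y i)) (j, u) = (if i = j then poly_mapping.lookup (y j) u else 0)" for i
          proof -
            have "poly_mapping.lookup (frag_extend (\<lambda>u. frag_of (i, u)) (y i)) (j, u) =
              (\<Sum>v\<in>Poly_Mapping.keys (y i). if v = u then (if i = j then poly_mapping.lookup (y i) u else 0) else 0)"
              unfolding frag_extend_def lookup_sum by (rule sum.cong) auto
            then show ?thesis by (auto simp: in_keys_iff)
          qed
          show ?thesis unfolding x_def lookup_sum inner using fin by simp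
        qed
        have "Poly_Mapping.keys x \<subseteq> Sigma I U"
        proof
          fix p assume "p \<in> Poly_Mapping.keys x"
          moreover obtain i u where "p = (i, u)" by (cases p)
          ultimately show "p \<in> Sigma I U" using y(1) by (auto simp: in_keys_iff lx subset_iff split: if_splits)
        qed
        moreover have "slice i x = y i" if "i \<in> I" for i
          by (rule poly_mapping_eqI) (simp add: lookup_slice lx that)
        then have "H x = w"
          using w y(2) unfolding carr by (auto simp: H_def PiE_iff extensional_def fun_eq_iff)
        ultimately show "w \<in> H ` carrier (free_Abelian_group (Sigma I U))" by (intro image_eqI[of _ _ x]) simp_all
      qed
    qed
  qed
  moreover have "H (frag_of p) = (case p of (i, u) \<Rightarrow> sum_inj I G i (b i u))" if "p \<in> Sigma I U" for p
  proof -
    obtain i u where p: "p = (i, u)" "i \<in> I" "u \<in> U i" using \<open>p \<in> Sigma I U\<close> by auto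
    have "h j 0 = \<one>\<^bsub>G j\<^esub>" if "j \<in> I" for j
      using hom_one[OF hom_h[OF that] group_free_Abelian_group G[OF that]] by simp
    then show ?thesis
      using p h(2) by (auto simp: H_def slice_def sum_inj_def fun_eq_iff)
  qed
  ultimately show ?thesis unfolding free_with_basis_def by (intro bexI[of _ H]) auto
qed

text \<open>Homology is a group of cosets even when there are no boundaries; this identifies cycles
  with their singleton classes.\<close>

lemma Mod_trivial_iso:
  assumes "group G"
  shows "(\<lambda>x. {x}) \<in> iso G (G Mod {\<one>\<^bsub>G\<^esub>})"
proof -
  interpret group G by (rule assms)
  have c: "{\<one>\<^bsub>G\<^esub>} #>\<^bsub>G\<^esub> x = {x}" if "x \<in> carrier G" for x
    using that by (simp add: r_coset_def)
  show ?thesis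
  proof (rule isoI)
    show "(\<lambda>x. {x}) \<in> hom G (G Mod {\<one>\<^bsub>G\<^esub>})"
      by (rule homI) (auto simp: carrier_FactGroup c set_mult_def)
    show "bij_betw (\<lambda>x. {x}) (carrier G) (carrier (G Mod {\<one>\<^bsub>G\<^esub>}))"
      by (auto simp: bij_betw_def carrier_FactGroup c inj_on_def)
  qed
qed


subsection \<open>Tensor products with a free abelian group of finite rank\<close>

locale tensor =
  fixes G :: "'g monoid" and H :: "'h monoid"
  assumes commG: "comm_group G" and commH: "comm_group H"
begin

abbreviation "F \<equiv> free_Abelian_group (carrier G \<times> carrier H)"
abbreviation "N \<equiv> tensor_kernel G H"
abbreviation "T \<equiv> tensor_group G H"

sublocale G: comm_group G by (rule commG)
sublocale H: comm_group H by (rule commH)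

lemma commF: "comm_group F"
  by (rule abelian_free_Abelian_group)

lemma relations_sub: "tensor_relations G H \<subseteq> carrier F"
proof -
  have "Poly_Mapping.keys (a - b - c) \<subseteq> Poly_Mapping.keys a \<union> Poly_Mapping.keys b \<union> Poly_Mapping.keys c" for a b c :: "'g \<times> 'h \<Rightarrow>\<^sub>0 int"
    using keys_diff[of "a - b" c] keys_diff[of a b] by blast
  note k = this
  show ?thesis
  proof
    fix t assume "t \<in> tensor_relations G H"
    then obtain p q s where t: "t = frag_of p - frag_of q - frag_of s"
      "p \<in> carrier G \<times> carrier H" "q \<in> carrier G \<times> carrier H" "s \<in> carrier G \<times> carrier H"
      unfolding tensor_relations_def by (auto 4 4)
    then show "t \<in> carrier F" using k[of "frag_of p" "frag_of q" "frag_of s"] by auto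
  qed
qed

lemma N_subgroup: "subgroup N F"
  unfolding tensor_kernel_def by (rule group.generate_is_subgroup[OF group_free_Abelian_group relations_sub])

lemma N_normal: "N \<lhd> F"
  using comm_group.normal_iff_subgroup[OF commF] N_subgroup by blast

lemma commT: "comm_group T"
  unfolding tensor_group_def by (rule comm_group.abelian_FactGroup[OF commF N_subgroup])

sublocale T: comm_group T by (rule commT)

definition cls :: "('g \<times> 'h \<Rightarrow>\<^sub>0 int) \<Rightarrow> ('g \<times> 'h \<Rightarrow>\<^sub>0 int) set" where
  "cls w = N #>\<^bsub>F\<^esub> w"

lemma cls_hom: "cls \<in> hom F T"
  using normal.r_coset_hom_Mod[OF N_normal] by (simp add: cls_def[abs_def] tensor_group_def)

lemma cls_carrier: "carrier T = cls ` carrier F"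
  by (simp add: tensor_group_def carrier_FactGroup cls_def[abs_def])

lemma cls_in: "w \<in> carrier F \<Longrightarrow> cls w \<in> carrier T"
  using cls_carrier by blast

lemma cls_eq_one: "w \<in> carrier F \<Longrightarrow> cls w = \<one>\<^bsub>T\<^esub> \<longleftrightarrow> w \<in> N"
  using group.coset_join1[OF group_free_Abelian_group _ _ N_subgroup, of w]
    group.coset_join2[OF group_free_Abelian_group _ N_subgroup, of w]
  by (auto simp: cls_def tensor_group_def)

lemma cls_add: "w \<in> carrier F \<Longrightarrow> v \<in> carrier F \<Longrightarrow> cls (w + v) = cls w \<otimes>\<^bsub>T\<^esub> cls v"
  using hom_mult[OF cls_hom, of w v] by simp

abbreviation "pt \<equiv> pure_tensor G H"

lemma pt_cls: "pt x y = cls (frag_of (x, y))"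
  by (simp add: pure_tensor_def cls_def)

lemma pt_in: "x \<in> carrier G \<Longrightarrow> y \<in> carrier H \<Longrightarrow> pt x y \<in> carrier T"
  unfolding pt_cls by (rule cls_in) simp

lemma cls_relation:
  assumes "frag_of p - frag_of q - frag_of s \<in> tensor_relations G H"
    "p \<in> carrier G \<times> carrier H" "q \<in> carrier G \<times> carrier H" "s \<in> carrier G \<times> carrier H"
  shows "cls (frag_of p) = cls (frag_of q) \<otimes>\<^bsub>T\<^esub> cls (frag_of s)"
proof -
  let ?t = "frag_of p - frag_of q - frag_of s"
  have tF: "?t \<in> carrier F" using relations_sub assms(1) by blast
  have "?t \<in> N" unfolding tensor_kernel_def by (rule generate.incl[OF assms(1)])
  then have one: "cls ?t = \<one>\<^bsub>T\<^esub>" using cls_eq_one[OF tF] by blast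
  have qs: "frag_of q + frag_of s \<in> carrier F" using assms(3,4) keys_add[of "frag_of q" "frag_of s"] by auto
  have "cls (frag_of p) = cls (?t + (frag_of q + frag_of s))" by simp
  also have "\<dots> = cls ?t \<otimes>\<^bsub>T\<^esub> cls (frag_of q + frag_of s)" by (rule cls_add[OF tF qs])
  also have "\<dots> = cls (frag_of q + frag_of s)" using one cls_in[OF qs] by simp
  also have "\<dots> = cls (frag_of q) \<otimes>\<^bsub>T\<^esub> cls (frag_of s)" by (rule cls_add) (use assms in auto)
  finally show ?thesis .
qed

lemma pt_mult_left: "x \<in> carrier G \<Longrightarrow> x' \<in> carrier G \<Longrightarrow> y \<in> carrier H \<Longrightarrow> pt (x \<otimes>\<^bsub>G\<^esub> x') y = pt x y \<otimes>\<^bsub>T\<^esub> pt x' y"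
  unfolding pt_cls by (rule cls_relation) (auto simp: tensor_relations_def)

lemma pt_mult_right: "x \<in> carrier G \<Longrightarrow> y \<in> carrier H \<Longrightarrow> y' \<in> carrier H \<Longrightarrow> pt x (y \<otimes>\<^bsub>H\<^esub> y') = pt x y \<otimes>\<^bsub>T\<^esub> pt x y'"
  unfolding pt_cls by (rule cls_relation) (auto simp: tensor_relations_def)

lemma pt_hom_left: "y \<in> carrier H \<Longrightarrow> (\<lambda>x. pt x y) \<in> hom G T"
  by (rule homI) (auto simp: pt_in pt_mult_left)

lemma pt_hom_right: "x \<in> carrier G \<Longrightarrow> pt x \<in> hom H T"
  by (rule homI) (auto simp: pt_in pt_mult_right)

lemma pt_one_right: "x \<in> carrier G \<Longrightarrow> pt x \<one>\<^bsub>H\<^esub> = \<one>\<^bsub>T\<^esub>"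
  using hom_one[OF pt_hom_right H.is_group T.is_group] .

end

text \<open>With G free on the finite set U, the tensor product is the power of H indexed by U, and
  a basis of H then yields one of the product.\<close>

locale tensor_free = tensor +
  fixes U :: "'u set" and h :: "('u \<Rightarrow>\<^sub>0 int) \<Rightarrow> 'a"
  assumes finU: "finite U" and h: "h \<in> iso (free_Abelian_group U) G"
begin

abbreviation "W \<equiv> sum_group U (\<lambda>_. H)"

lemma commW: "comm_group W"
  by (rule comm_group_sum_group) (rule commH)

sublocale W: comm_group W by (rule commW)

lemma carrier_W: "carrier W = U \<rightarrow>\<^sub>E carrier H"
  by (rule carrier_sum_group_finite[OF finU]) (rule H.is_group)

abbreviation "b u \<equiv> h (frag_of u)"

lemma hom_h: "h \<in> hom (free_Abelian_group U) G"
  using h by (simp add: iso_def)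

lemma b_in: "u \<in> U \<Longrightarrow> b u \<in> carrier G"
  using hom_in_carrier[OF hom_h, of "frag_of u"] by simp

definition combine :: "('u \<Rightarrow> 'b) \<Rightarrow> ('a \<times> 'b \<Rightarrow>\<^sub>0 int) set" where
  "combine w = (\<Otimes>\<^bsub>T\<^esub>u\<in>U. pt (b u) (w u))"

lemma combine_hom: "combine \<in> hom W T"
proof (rule homI)
  fix w assume "w \<in> carrier W"
  then show "combine w \<in> carrier T"
    unfolding combine_def carrier_W by (intro T.finprod_closed) (auto intro!: pt_in b_in)
next
  fix w v assume "w \<in> carrier W" "v \<in> carrier W"
  then have wv: "w \<in> U \<rightarrow>\<^sub>E carrier H" "v \<in> U \<rightarrow>\<^sub>E carrier H" by (simp_all add: carrier_W)
  have "combine (w \<otimes>\<^bsub>W\<^esub> v) = (\<Otimes>\<^bsub>T\<^esub>u\<in>U. pt (b u) (w u) \<otimes>\<^bsub>T\<^esub> pt (b u) (v u))"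
    unfolding combine_def
  proof (rule T.finprod_cong'[OF HOL.refl])
    show "(\<lambda>u. pt (b u) (w u) \<otimes>\<^bsub>T\<^esub> pt (b u) (v u)) \<in> U \<rightarrow> carrier T"
      using wv by (auto intro!: T.m_closed pt_in b_in)
    show "pt (b u) ((w \<otimes>\<^bsub>W\<^esub> v) u) = pt (b u) (w u) \<otimes>\<^bsub>T\<^esub> pt (b u) (v u)" if "u \<in> U" for u
      using pt_mult_right[OF b_in[OF that] PiE_mem[OF wv(1) that] PiE_mem[OF wv(2) that]] that by simp
  qed
  also have "\<dots> = combine w \<otimes>\<^bsub>T\<^esub> combine v"
    unfolding combine_def using wv by (intro T.finprod_multf) (auto intro!: pt_in b_in)
  finally show "combine (w \<otimes>\<^bsub>W\<^esub> v) = combine w \<otimes>\<^bsub>T\<^esub> combine v" .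
qed

lemma combine_sum_inj:
  assumes "u \<in> U" "y \<in> carrier H"
  shows "combine (sum_inj U (\<lambda>_. H) u y) = pt (b u) y"
proof -
  have "combine (sum_inj U (\<lambda>_. H) u y) = (\<Otimes>\<^bsub>T\<^esub>v\<in>U. if u = v then pt (b v) y else \<one>\<^bsub>T\<^esub>)"
    unfolding combine_def sum_inj_def using assms
    by (intro T.finprod_cong') (auto simp: pt_one_right b_in pt_in)
  also have "\<dots> = pt (b u) y"
    by (rule T.finprod_singleton[OF assms(1) finU]) (use assms in \<open>auto intro: pt_in b_in\<close>)
  finally show ?thesis .
qed

definition coeff :: "'a \<Rightarrow> 'u \<Rightarrow> int" where
  "coeff x = poly_mapping.lookup (inv_into (carrier (free_Abelian_group U)) h x)"

lemma coeff_h: "Poly_Mapping.keys f \<subseteq> U \<Longrightarrow> coeff (h f) = poly_mapping.lookup f"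
  using inv_into_f_f[OF iso_inj_on[OF h], of f] by (simp add: coeff_def)

lemma ex_h: "x \<in> carrier G \<Longrightarrow> \<exists>f. Poly_Mapping.keys f \<subseteq> U \<and> h f = x"
proof -
  assume "x \<in> carrier G"
  then have "x \<in> h ` carrier (free_Abelian_group U)" using iso_image[OF h] by simp
  then obtain f where "f \<in> carrier (free_Abelian_group U)" "x = h f" by blast
  then show ?thesis by (intro exI[of _ f]) simp
qed

lemma coeff_mult:
  assumes "x \<in> carrier G" "x' \<in> carrier G"
  shows "coeff (x \<otimes>\<^bsub>G\<^esub> x') u = coeff x u + coeff x' u"
proof -
  obtain f f' where f: "Poly_Mapping.keys f \<subseteq> U" "h f = x" "Poly_Mapping.keys f' \<subseteq> U" "h f' = x'"
    using ex_h[OF assms(1)] ex_h[OF assms(2)] by blast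
  have "h (f + f') = x \<otimes>\<^bsub>G\<^esub> x'" using hom_mult[OF hom_h, of f f'] f by simp
  moreover have "Poly_Mapping.keys (f + f') \<subseteq> U" using keys_add[of f f'] f by blast
  ultimately show ?thesis using coeff_h[of "f + f'"] coeff_h[OF f(1)] coeff_h[OF f(3)] f by (simp add: lookup_add)
qed

text \<open>Coordinates of a pure tensor. The expression is bilinear, so it descends to the inverse
  of \<open>combine\<close>.\<close>

definition split :: "'a \<Rightarrow> 'b \<Rightarrow> 'u \<Rightarrow> 'b" where
  "split x y = (\<lambda>u\<in>U. y [^]\<^bsub>H\<^esub> coeff x u)"

lemma split_in: "y \<in> carrier H \<Longrightarrow> split x y \<in> carrier W"
  by (auto simp: carrier_W split_def)

lemma split_mult_left:
  assumes "x \<in> carrier G" "x' \<in> carrier G" "y \<in> carrier H"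
  shows "split (x \<otimes>\<^bsub>G\<^esub> x') y = split x y \<otimes>\<^bsub>W\<^esub> split x' y"
  using assms by (auto simp: split_def coeff_mult H.int_pow_mult restrict_def fun_eq_iff)

lemma split_mult_right:
  assumes "x \<in> carrier G" "y \<in> carrier H" "y' \<in> carrier H"
  shows "split x (y \<otimes>\<^bsub>H\<^esub> y') = split x y \<otimes>\<^bsub>W\<^esub> split x y'"
  using assms by (auto simp: split_def H.int_pow_distrib restrict_def fun_eq_iff)

lemma split_b: "u \<in> U \<Longrightarrow> y \<in> carrier H \<Longrightarrow> split (b u) y = sum_inj U (\<lambda>_. H) u y"
  using coeff_h[of "frag_of u"] by (auto simp: split_def sum_inj_def restrict_def fun_eq_iff)

text \<open>Both sides are additive in x and agree on the basis of G.\<close>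

lemma combine_split:
  assumes "x \<in> carrier G" "y \<in> carrier H"
  shows "combine (split x y) = pt x y"
proof -
  obtain f where f: "Poly_Mapping.keys f \<subseteq> U" "h f = x" using ex_h[OF assms(1)] by blast
  have "(\<lambda>x. split x y) \<in> hom G W"
    by (rule homI) (use assms in \<open>auto simp del: mult_sum_group simp: split_in split_mult_left\<close>)
  then have 1: "combine \<circ> ((\<lambda>x. split x y) \<circ> h) \<in> hom (free_Abelian_group U) T"
    using hom_compose[OF hom_h] hom_compose[OF _ combine_hom] by blast
  have 2: "(\<lambda>x. pt x y) \<circ> h \<in> hom (free_Abelian_group U) T"
    by (rule hom_compose[OF hom_h pt_hom_left[OF assms(2)]])
  have "(combine \<circ> ((\<lambda>x. split x y) \<circ> h)) f = ((\<lambda>x. pt x y) \<circ> h) f"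
    by (rule hom_free_eq[OF T.is_group 1 2 _ f(1)]) (simp add: split_b combine_sum_inj assms)
  then show ?thesis using f(2) by simp
qed

text \<open>The map \<Phi> extends \<open>split\<close> to formal sums and kills the tensor
  relations. Since \<open>combine\<close> after \<Phi> is the class map, \<open>combine\<close> is
  surjective. For injectivity a tuple w is lifted to a formal sum with class
  \<open>combine w\<close> and with image w under \<Phi>; if the class is trivial, the sum lies in
  the group generated by the relations, and w vanishes.\<close>

theorem combine_iso: "combine \<in> iso W T"
proof -
  have "(\<lambda>(x, y). split x y) ` (carrier G \<times> carrier H) \<subseteq> carrier W" using split_in by auto
  then obtain \<Phi> where \<Phi>: "\<Phi> \<in> hom F W" "\<And>p. p \<in> carrier G \<times> carrier H \<Longrightarrow> \<Phi> (frag_of p) = (case p of (x, y) \<Rightarrow> split x y)"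
    using W.free_Abelian_group_universal by blast
  interpret \<Phi>: group_hom F W \<Phi>
    by (rule group_hom.intro[OF group_free_Abelian_group W.is_group group_hom_axioms.intro[OF \<Phi>(1)]])
  have diff: "\<Phi> (a - c) = \<Phi> a \<otimes>\<^bsub>W\<^esub> inv\<^bsub>W\<^esub> \<Phi> c" if "a \<in> carrier F" "c \<in> carrier F" for a c
    using hom_free_diff[OF W.is_group \<Phi>(1)] that by simp
  have rel: "\<Phi> (frag_of p - frag_of q - frag_of s) = \<one>\<^bsub>W\<^esub>"
    if "\<Phi> (frag_of p) = \<Phi> (frag_of q) \<otimes>\<^bsub>W\<^esub> \<Phi> (frag_of s)" "p \<in> carrier G \<times> carrier H" "q \<in> carrier G \<times> carrier H" "s \<in> carrier G \<times> carrier H" for p q s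
  proof -
    have in_F: "frag_of p \<in> carrier F" "frag_of q \<in> carrier F" "frag_of s \<in> carrier F" "frag_of p - frag_of q \<in> carrier F"
      using that keys_diff[of "frag_of p" "frag_of q"] by auto
    have "\<Phi> (frag_of p - frag_of q - frag_of s) = (\<Phi> (frag_of q) \<otimes>\<^bsub>W\<^esub> \<Phi> (frag_of s)) \<otimes>\<^bsub>W\<^esub> inv\<^bsub>W\<^esub> \<Phi> (frag_of q) \<otimes>\<^bsub>W\<^esub> inv\<^bsub>W\<^esub> \<Phi> (frag_of s)"
      using diff in_F that(1) by simp
    also have "\<dots> = \<one>\<^bsub>W\<^esub>"
    proof -
      have c: "\<Phi> (frag_of q) \<in> carrier W" "\<Phi> (frag_of s) \<in> carrier W" using in_F(2,3) \<Phi>.hom_closed by blast+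
      have "\<And>x y. x \<in> carrier W \<Longrightarrow> y \<in> carrier W \<Longrightarrow> (x \<otimes>\<^bsub>W\<^esub> y) \<otimes>\<^bsub>W\<^esub> inv\<^bsub>W\<^esub> x \<otimes>\<^bsub>W\<^esub> inv\<^bsub>W\<^esub> y = \<one>\<^bsub>W\<^esub>"
        by (metis W.inv_closed W.m_assoc W.m_comm W.r_inv W.m_closed W.l_one)
      then show ?thesis using c by blast
    qed
    finally show ?thesis .
  qed
  have "tensor_relations G H \<subseteq> kernel F W \<Phi>"
  proof
    fix t assume t: "t \<in> tensor_relations G H"
    then have tF: "t \<in> carrier F" using relations_sub by blast
    from t consider x x' y where "t = frag_of (x \<otimes>\<^bsub>G\<^esub> x', y) - frag_of (x, y) - frag_of (x', y)" "x \<in> carrier G" "x' \<in> carrier G" "y \<in> carrier H"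
      | x y y' where "t = frag_of (x, y \<otimes>\<^bsub>H\<^esub> y') - frag_of (x, y) - frag_of (x, y')" "x \<in> carrier G" "y \<in> carrier H" "y' \<in> carrier H"
      unfolding tensor_relations_def by blast
    then have "\<Phi> t = \<one>\<^bsub>W\<^esub>"
    proof cases
      case 1
      show ?thesis unfolding 1(1) by (rule rel) (use 1 in \<open>auto simp: \<Phi>(2) split_mult_left simp del: mult_sum_group\<close>)
    next
      case 2
      show ?thesis unfolding 2(1) by (rule rel) (use 2 in \<open>auto simp: \<Phi>(2) split_mult_right simp del: mult_sum_group\<close>)
    qed
    then show "t \<in> kernel F W \<Phi>" using tF by (simp add: kernel_def)
  qed
  then have N_ker: "N \<subseteq> kernel F W \<Phi>"
    unfolding tensor_kernel_def
    by (rule group.generate_subgroup_incl[OF group_free_Abelian_group _ \<Phi>.subgroup_kernel])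
  have comb: "combine (\<Phi> w) = cls w" if "w \<in> carrier F" for w
  proof -
    have "(combine \<circ> \<Phi>) w = cls w"
      by (rule hom_free_eq[OF T.is_group hom_compose[OF \<Phi>(1) combine_hom] cls_hom])
         (use that in \<open>auto simp: \<Phi>(2) combine_split pt_cls\<close>)
    then show ?thesis by simp
  qed
  show ?thesis
  proof (rule isoI)
    show "combine \<in> hom W T" by (rule combine_hom)
    show "bij_betw combine (carrier W) (carrier T)"
      unfolding bij_betw_def
    proof
      show "inj_on combine (carrier W)"
        unfolding inj_on_one_iff'[OF combine_hom W.is_group T.is_group]
      proof (intro allI impI)
        fix w assume w: "w \<in> carrier W" "combine w = \<one>\<^bsub>T\<^esub>"
        have wu: "w u \<in> carrier H" if "u \<in> U" for u using w(1) that by (auto simp: carrier_W)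
        let ?f = "\<lambda>A. \<Sum>u\<in>A. frag_of (b u, w u)"
        have fF: "?f A \<in> carrier F" if "A \<subseteq> U" for A
          by (rule sum_closed_free_Abelian_group) (use that wu b_in in auto)
        \<comment> \<open>Stated for all subsets of U so that one basis element can be added at a
          time; \<open>?f U\<close> is the lift of w.\<close>
        have "cls (?f A) = (\<Otimes>\<^bsub>T\<^esub>u\<in>A. pt (b u) (w u)) \<and> \<Phi> (?f A) = (\<lambda>u\<in>U. if u \<in> A then w u else \<one>\<^bsub>H\<^esub>)" if "A \<subseteq> U" for A
        proof -
          have "finite A" using that finU finite_subset by blast
          then show ?thesis using that
          proof (induction A)
            case empty
            show ?case using hom_one[OF cls_hom group_free_Abelian_group T.is_group] \<Phi>.hom_one by simp
          next
            case (insert u A)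
            then have u: "u \<in> U" "A \<subseteq> U" by auto
            have uF: "frag_of (b u, w u) \<in> carrier F" using u b_in wu by simp
            have "cls (?f (insert u A)) = cls (frag_of (b u, w u)) \<otimes>\<^bsub>T\<^esub> cls (?f A)"
              using cls_add[OF uF fF[OF u(2)]] insert by simp
            moreover have "(\<Otimes>\<^bsub>T\<^esub>u\<in>insert u A. pt (b u) (w u)) = pt (b u) (w u) \<otimes>\<^bsub>T\<^esub> (\<Otimes>\<^bsub>T\<^esub>u\<in>A. pt (b u) (w u))"
              by (rule T.finprod_insert) (use insert u b_in wu pt_in in auto)
            moreover have "\<Phi> (?f (insert u A)) = \<Phi> (frag_of (b u, w u)) \<otimes>\<^bsub>W\<^esub> \<Phi> (?f A)"
              using \<Phi>.hom_mult[OF uF fF[OF u(2)]] insert by simp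
            moreover have "\<Phi> (frag_of (b u, w u)) = sum_inj U (\<lambda>_. H) u (w u)"
              using \<Phi>(2)[of "(b u, w u)"] u b_in wu split_b by simp
            ultimately show ?case
              using insert u wu by (auto simp: pt_cls sum_inj_def restrict_def fun_eq_iff)
          qed
        qed
        from this[of U] have "cls (?f U) = combine w" "\<Phi> (?f U) = w"
          using w(1) by (auto simp: combine_def carrier_W restrict_def PiE_iff extensional_def fun_eq_iff)
        then have "?f U \<in> N" using w(2) cls_eq_one[OF fF] by simp
        then have "\<Phi> (?f U) = \<one>\<^bsub>W\<^esub>" using N_ker by (auto simp: kernel_def)
        then show "w = \<one>\<^bsub>W\<^esub>" using \<open>\<Phi> (?f U) = w\<close> by simp
      qed
      show "combine ` carrier W = carrier T"
      proof
        show "combine ` carrier W \<subseteq> carrier T" using hom_carrier[OF combine_hom] .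
        show "carrier T \<subseteq> combine ` carrier W"
        proof
          fix t assume "t \<in> carrier T"
          then obtain w where w: "w \<in> carrier F" "t = cls w" unfolding cls_carrier by blast
          then show "t \<in> combine ` carrier W" using comb[OF w(1)] \<Phi>.hom_closed[OF w(1)] by (metis imageI)
        qed
      qed
    qed
  qed
qed

end

section \<open>Lower intervals\<close>

context geometric
begin

context
  fixes x assumes x: "x \<in> carrier L"
begin

lemma below_carrier: "carrier (below L x) = {y \<in> carrier L. y \<sqsubseteq> x}"
  and below_le [simp]: "le (below L x) = le L"
  and below_eq [simp]: "eq (below L x) = eq L"
  by (simp_all add: below_def)

lemma below_less [simp]: "lless (below L x) = lless L"
  by (simp add: lless_def fun_eq_iff)

lemma below_Upper: "A \<subseteq> carrier (below L x) \<Longrightarrow> Upper (below L x) A = {u \<in> Upper L A. u \<sqsubseteq> x}"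
  unfolding Upper_def below_carrier below_le by blast

text \<open>Upper bounds in L that are not below x do not compete, because x itself is a bound.
  Joins are picked by choice, so their agreement requires the describing properties to agree for
  every u.\<close>

lemma below_lub_iff:
  assumes "A \<subseteq> carrier (below L x)"
  shows "least (below L x) u (Upper (below L x) A) \<longleftrightarrow> least L u (Upper L A)"
proof -
  have A: "A \<subseteq> carrier L" "\<And>a. a \<in> A \<Longrightarrow> a \<sqsubseteq> x" using assms unfolding below_carrier by blast+
  have xU: "x \<in> Upper L A" using A x unfolding Upper_def by blast
  have U: "Upper (below L x) A = {u \<in> Upper L A. u \<sqsubseteq> x}" by (rule below_Upper[OF assms])
  have Uc: "Upper L A \<subseteq> carrier L" by simp
  note lub = sup_is_lub[OF A(1)]
  have sx: "\<Squnion>A \<sqsubseteq> x" using least_le[OF lub xU] .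
  have sU: "\<Squnion>A \<in> Upper (below L x) A" unfolding U using least_mem[OF lub] sx by blast
  show ?thesis
  proof
    assume l: "least (below L x) u (Upper (below L x) A)"
    have uU: "u \<in> Upper L A" using least_mem[OF l] U by blast
    have "u \<sqsubseteq> \<Squnion>A" using least_le[OF l sU] by simp
    moreover have "\<Squnion>A \<sqsubseteq> u" using least_le[OF lub uU] .
    ultimately have "u = \<Squnion>A" using le_antisym[of u "\<Squnion>A"] uU Uc A(1) by blast
    then show "least L u (Upper L A)" using lub by simp
  next
    assume l: "least L u (Upper L A)"
    have ux: "u \<sqsubseteq> x" using least_le[OF l xU] .
    show "least (below L x) u (Upper (below L x) A)"
      unfolding least_def
    proof (intro conjI ballI)
      show "Upper (below L x) A \<subseteq> carrier (below L x)" by simp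
      show "u \<in> Upper (below L x) A" unfolding U using least_mem[OF l] ux by blast
      fix v assume "v \<in> Upper (below L x) A"
      then have "v \<in> Upper L A" using U by blast
      then show "u \<sqsubseteq>\<^bsub>below L x\<^esub> v" using least_le[OF l] by simp
    qed
  qed
qed

lemma below_sup: "A \<subseteq> carrier (below L x) \<Longrightarrow> \<Squnion>\<^bsub>below L x\<^esub>A = \<Squnion>A"
  unfolding Lattice.sup_def using below_lub_iff by simp

text \<open>A lower bound of a nonempty subset of the interval is automatically below x; for the
  empty set every element of L is a lower bound.\<close>

lemma below_Lower:
  assumes "A \<subseteq> carrier (below L x)" "A \<noteq> {}"
  shows "Lower (below L x) A = Lower L A"
proof -
  obtain a where a: "a \<in> A" "a \<in> carrier L" "a \<sqsubseteq> x" using assms unfolding below_carrier by blast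
  have "u \<sqsubseteq> x" if "u \<in> carrier L" "u \<sqsubseteq> a" for u using le_trans[of u a x] that a x by blast
  then show ?thesis using assms a unfolding Lower_def below_carrier below_le by blast
qed

lemma below_glb_iff:
  assumes "A \<subseteq> carrier (below L x)" "A \<noteq> {}"
  shows "greatest (below L x) u (Lower (below L x) A) \<longleftrightarrow> greatest L u (Lower L A)"
proof -
  have "Lower (below L x) A \<subseteq> carrier (below L x)" "Lower L A \<subseteq> carrier L" by simp_all
  then show ?thesis unfolding greatest_def below_Lower[OF assms] below_le by blast
qed

lemma below_inf: "A \<subseteq> carrier (below L x) \<Longrightarrow> A \<noteq> {} \<Longrightarrow> \<Sqinter>\<^bsub>below L x\<^esub>A = \<Sqinter>A"
  unfolding Lattice.inf_def using below_glb_iff by simp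

lemma below_bottom: "\<bottom>\<^bsub>below L x\<^esub> = \<bottom>"
proof -
  have "least (below L x) b (carrier (below L x)) \<longleftrightarrow> least L b (carrier L)" for b
  proof -
    have bx: "\<bottom> \<in> carrier (below L x)" using x unfolding below_carrier by blast
    show ?thesis
    proof
      assume l: "least (below L x) b (carrier (below L x))"
      then have b: "b \<in> carrier L" using least_mem[OF l] unfolding below_carrier by blast
      have "b \<sqsubseteq> \<bottom>" using least_le[OF l bx] by simp
      then have "b = \<bottom>" using le_antisym[of b \<bottom>] b by simp
      then show "least L b (carrier L)" using bottom_least by simp
    next
      assume l: "least L b (carrier L)"
      then have b: "b \<in> carrier L" "\<And>v. v \<in> carrier L \<Longrightarrow> b \<sqsubseteq> v" unfolding least_def by blast+
      then show "least (below L x) b (carrier (below L x))"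
        unfolding least_def below_carrier below_le using x by blast
    qed
  qed
  then show ?thesis by (simp add: bottom_def)
qed

lemma below_lattice: "lattice (below L x)"
proof -
  have sub: "carrier (below L x) \<subseteq> carrier L" unfolding below_carrier by blast
  have two: "{a, b} \<subseteq> carrier (below L x)" if "a \<in> carrier (below L x)" "b \<in> carrier (below L x)" for a b
    using that by blast
  have "partial_order (below L x)"
  proof
    show "eq (below L x) = (=)" by (simp add: eq_is_equal)
    then show "\<And>a. a \<in> carrier (below L x) \<Longrightarrow> a .=\<^bsub>below L x\<^esub> a"
      "\<And>a b. a .=\<^bsub>below L x\<^esub> b \<Longrightarrow> b .=\<^bsub>below L x\<^esub> a"
      "\<And>a b c. a .=\<^bsub>below L x\<^esub> b \<Longrightarrow> b .=\<^bsub>below L x\<^esub> c \<Longrightarrow> a .=\<^bsub>below L x\<^esub> c"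
      "\<And>a b c d. a .=\<^bsub>below L x\<^esub> b \<Longrightarrow> c .=\<^bsub>below L x\<^esub> d \<Longrightarrow> a \<sqsubseteq>\<^bsub>below L x\<^esub> c \<longleftrightarrow> b \<sqsubseteq>\<^bsub>below L x\<^esub> d"
      by simp_all
    show "a \<sqsubseteq>\<^bsub>below L x\<^esub> a" if "a \<in> carrier (below L x)" for a
      using that sub by auto
    show "a .=\<^bsub>below L x\<^esub> b" if "a \<sqsubseteq>\<^bsub>below L x\<^esub> b" "b \<sqsubseteq>\<^bsub>below L x\<^esub> a"
      "a \<in> carrier (below L x)" "b \<in> carrier (below L x)" for a b
      using le_antisym[of a b] that sub by auto
    show "a \<sqsubseteq>\<^bsub>below L x\<^esub> c" if "a \<sqsubseteq>\<^bsub>below L x\<^esub> b" "b \<sqsubseteq>\<^bsub>below L x\<^esub> c"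
      "a \<in> carrier (below L x)" "b \<in> carrier (below L x)" "c \<in> carrier (below L x)" for a b c
      using le_trans[of a b c] that sub by auto
  qed
  then interpret B: partial_order "below L x" .
  show ?thesis
  proof
    fix a b
    assume a: "a \<in> carrier (below L x)" and b: "b \<in> carrier (below L x)"
    show "\<exists>s. least (below L x) s (Upper (below L x) {a, b})"
      unfolding below_lub_iff[OF two[OF a b]] using sup_is_lub[of "{a, b}"] a b sub by blast
    show "\<exists>s. greatest (below L x) s (Lower (below L x) {a, b})"
    proof -
      have "{a, b} \<noteq> {}" by simp
      from below_glb_iff[OF two[OF a b] this] show ?thesis
        using inf_of_two_exists[of a b] a b sub by blast
    qed
  qed
qed

lemma below_chain_iff:
  assumes "y \<sqsubseteq> x" "y \<in> carrier L"
  shows "chain_in (below L x) C \<and> (\<forall>u\<in>C. u \<sqsubset>\<^bsub>below L x\<^esub> y) \<longleftrightarrow> chain_in L C \<and> (\<forall>u\<in>C. u \<sqsubset> y)"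
proof -
  have "u \<sqsubseteq> x" if "u \<in> carrier L" "u \<sqsubset> y" for u
    using le_trans[of u y x] that assms x by (simp add: less_iff)
  then show ?thesis unfolding chain_in_def below_carrier below_le below_less by blast
qed

lemma below_rank: "y \<sqsubseteq> x \<Longrightarrow> y \<in> carrier L \<Longrightarrow> rank_of (below L x) y = r y"
  unfolding rank_of_def using below_chain_iff by simp

lemma below_covered:
  assumes "u \<in> carrier (below L x)" "v \<in> carrier (below L x)"
  shows "covered_by (below L x) u v \<longleftrightarrow> covered_by L u v"
proof -
  have uv: "u \<in> carrier L" "v \<in> carrier L" "v \<sqsubseteq> x" using assms unfolding below_carrier by blast+
  have "w \<sqsubseteq> x" if "w \<in> carrier L" "w \<sqsubset> v" for w
    using le_trans[of w v x] that uv x by (simp add: less_iff)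
  then show ?thesis using assms uv unfolding covered_by_def below_less below_carrier by blast
qed

lemma below_atoms: "atoms (below L x) = {a \<in> atoms L. a \<sqsubseteq> x}"
proof (intro equalityI subsetI)
  have b: "\<bottom> \<in> carrier (below L x)" using x unfolding below_carrier by blast
  {
    fix a assume a: "a \<in> atoms (below L x)"
    then have "covered_by (below L x) \<bottom> a" unfolding atoms_def below_bottom by blast
    moreover from this have ac: "a \<in> carrier (below L x)" by (simp add: covered_by_def)
    ultimately show "a \<in> {a \<in> atoms L. a \<sqsubseteq> x}"
      using below_covered[OF b ac] unfolding atoms_def below_carrier by blast
  next
    fix a assume a: "a \<in> {a \<in> atoms L. a \<sqsubseteq> x}"
    then have ac: "a \<in> carrier (below L x)" unfolding below_carrier using atoms_sub by blast
    then show "a \<in> atoms (below L x)"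
      using below_covered[OF b ac] a unfolding atoms_def below_bottom by blast
  }
qed

lemma below_geometric: "geometric_lattice (below L x)"
  unfolding geometric_lattice_def
proof (intro conjI allI ballI impI)
  have sub: "carrier (below L x) \<subseteq> carrier L" unfolding below_carrier by blast
  have le: "y \<sqsubseteq> x" if "y \<in> carrier (below L x)" for y using that unfolding below_carrier by blast
  show "lattice (below L x)" by (rule below_lattice)
  show "finite (carrier (below L x))" using sub finite_carrier finite_subset by blast
  show "carrier (below L x) \<noteq> {}" using x unfolding below_carrier by blast
  show "rank_of (below L x) v = Suc (rank_of (below L x) u)" if "covered_by (below L x) u v" for u v
  proof -
    have c: "u \<in> carrier (below L x)" "v \<in> carrier (below L x)" using that by (simp_all add: covered_by_def)
    have uv: "u \<in> carrier L" "v \<in> carrier L" using c sub by blast+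
    have "covered_by L u v" using below_covered[OF c] that by simp
    then show ?thesis
      using rank_covered_by[of u v] below_rank[OF le[OF c(1)] uv(1)] below_rank[OF le[OF c(2)] uv(2)] by simp
  qed
  show "\<exists>A\<subseteq>atoms (below L x). y = \<Squnion>\<^bsub>below L x\<^esub>A" if y: "y \<in> carrier (below L x)" for y
  proof (intro exI conjI)
    let ?A = "{a \<in> atoms L. a \<sqsubseteq> y}"
    have yc: "y \<in> carrier L" using y sub by blast
    show A: "?A \<subseteq> atoms (below L x)"
      unfolding below_atoms using le_trans[of _ y x] le[OF y] yc x atoms_sub by blast
    have "?A \<subseteq> carrier (below L x)" using A unfolding below_atoms below_carrier using atoms_sub by blast
    then show "y = \<Squnion>\<^bsub>below L x\<^esub>?A" using below_sup[of ?A] sup_atoms_below[OF yc] by simp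
  qed
  fix u v assume uv: "u \<in> carrier (below L x)" "v \<in> carrier (below L x)"
  then have uvc: "u \<in> carrier L" "v \<in> carrier L" "u \<sqsubseteq> x" "v \<sqsubseteq> x" "{u, v} \<subseteq> carrier (below L x)"
    using sub le by blast+
  have j: "u \<squnion>\<^bsub>below L x\<^esub> v = u \<squnion> v" "u \<sqinter>\<^bsub>below L x\<^esub> v = u \<sqinter> v"
    unfolding join_def meet_def using below_sup[OF uvc(5)] below_inf[OF uvc(5)] by simp_all
  have "u \<squnion> v \<sqsubseteq> x" using join_le[of u x v] uvc x by simp
  moreover have "u \<sqinter> v \<sqsubseteq> x" using le_trans[of "u \<sqinter> v" u x] meet_left[of u v] uvc x by simp
  ultimately show "rank_of (below L x) (u \<squnion>\<^bsub>below L x\<^esub> v) + rank_of (below L x) (u \<sqinter>\<^bsub>below L x\<^esub> v)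
      \<le> rank_of (below L x) u + rank_of (below L x) v"
    unfolding j using semimodular[of u v] uvc by (simp add: below_rank)
qed

lemma below_atom_set: "A \<subseteq> atoms L \<Longrightarrow> (\<And>a. a \<in> A \<Longrightarrow> a \<sqsubseteq> x) \<Longrightarrow> A \<subseteq> carrier (below L x)"
  unfolding below_carrier using atoms_sub by blast

lemma below_independent:
  assumes "A \<subseteq> atoms L" "\<And>a. a \<in> A \<Longrightarrow> a \<sqsubseteq> x"
  shows "independent (below L x) A \<longleftrightarrow> independent L A"
proof -
  have "A \<subseteq> atoms (below L x)" unfolding below_atoms using assms by blast
  moreover have "\<Squnion>\<^bsub>below L x\<^esub>A = \<Squnion>A" by (rule below_sup[OF below_atom_set[OF assms]])
  moreover have "\<Squnion>A \<sqsubseteq> x" using sup_le[OF subset_atoms_carrier[OF assms(1)] x] assms(2) by blast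
  ultimately show ?thesis
    using assms(1) below_rank[of "\<Squnion>A"] sup_in[OF subset_atoms_carrier[OF assms(1)]] by (simp add: independent_def)
qed

lemma below_circuit: "circuit (below L x) C \<longleftrightarrow> circuit L C \<and> (\<forall>c\<in>C. c \<sqsubseteq> x)"
proof (cases "C \<subseteq> atoms L \<and> (\<forall>c\<in>C. c \<sqsubseteq> x)")
  case True
  then have C: "C \<subseteq> atoms L" "\<And>c. c \<in> C \<Longrightarrow> c \<sqsubseteq> x" "C \<subseteq> atoms (below L x)" unfolding below_atoms by blast+
  have "independent (below L x) D \<longleftrightarrow> independent L D" if "D \<subseteq> C" for D
    by (rule below_independent) (use that C in blast)+
  then show ?thesis using C unfolding circuit_def by blast
next
  case False
  then show ?thesis unfolding circuit_def below_atoms by blast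
qed

end

end

section \<open>NBC sets and structure maps on lower intervals\<close>

context ordered_geometric
begin

abbreviation "as_below x \<equiv> filter (\<lambda>a. a \<sqsubseteq> x) as"

lemma below_ordered:
  assumes x: "x \<in> carrier L"
  shows "ordered_geometric (below L x) (as_below x)"
proof -
  have "set (as_below x) = atoms (below L x)" unfolding below_atoms[OF x] set_filter set_as by blast
  moreover have "distinct (as_below x)" using distinct_as by simp
  ultimately show ?thesis
    by (intro ordered_geometric.intro geometric.intro ordered_geometric_axioms.intro below_geometric[OF x])
qed

lemma below_list_min:
  assumes "C \<subseteq> set as" "C \<noteq> {}" "\<And>c. c \<in> C \<Longrightarrow> c \<sqsubseteq> x"
  shows "list_min (as_below x) C = list_min as C"
proof -
  have "filter (\<lambda>a. a \<in> C) (as_below x) = filter (\<lambda>a. a \<in> C) as"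
    unfolding filter_filter using assms(3) by (intro filter_cong) auto
  then show ?thesis by (simp add: list_min_def)
qed

text \<open>The circuits of the interval are the circuits of L with all atoms below x. A broken
  circuit below x brings its missing minimum along by \<open>circuit_two\<close>, so the same sets
  are excluded.\<close>

lemma NBC_below:
  assumes x: "x \<in> carrier L"
  shows "NBC (below L x) (as_below x) p = {I \<in> NBC L as p. \<forall>a\<in>I. a \<sqsubseteq> x}"
proof -
  interpret B: ordered_geometric "below L x" "as_below x" by (rule below_ordered[OF x])
  have bc: "broken_circuit (below L x) (as_below x) D \<longleftrightarrow> (\<exists>C. circuit L C \<and> (\<forall>c\<in>C. c \<sqsubseteq> x) \<and> D = C - {list_min as C})" for D
  proof -
    have "list_min (as_below x) C = list_min as C" if "circuit L C" "\<forall>c\<in>C. c \<sqsubseteq> x" for C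
      by (rule below_list_min) (use that circuit_set_as circuit_nonempty in blast)+
    then show ?thesis unfolding broken_circuit_def below_circuit[OF x] by (metis (no_types, lifting))
  qed
  have key: "(\<exists>D. broken_circuit (below L x) (as_below x) D \<and> D \<subseteq> I) \<longleftrightarrow> (\<exists>D. broken_circuit L as D \<and> D \<subseteq> I)"
    if I: "I \<subseteq> atoms L" "\<forall>a\<in>I. a \<sqsubseteq> x" for I
  proof
    assume "\<exists>D. broken_circuit (below L x) (as_below x) D \<and> D \<subseteq> I"
    then obtain D where "broken_circuit (below L x) (as_below x) D" "D \<subseteq> I" by blast
    then show "\<exists>D. broken_circuit L as D \<and> D \<subseteq> I" unfolding bc unfolding broken_circuit_def by blast
  next
    assume "\<exists>D. broken_circuit L as D \<and> D \<subseteq> I"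
    then obtain C where C: "circuit L C" "C - {list_min as C} \<subseteq> I" unfolding broken_circuit_def by blast
    have m: "list_min as C \<in> C" using list_min_in[OF circuit_set_as[OF C(1)] circuit_nonempty[OF C(1)]] .
    have "list_min as C \<sqsubseteq> x" by (rule circuit_two[OF C(1) x m]) (use C(2) I(2) in blast)
    then have "\<forall>c\<in>C. c \<sqsubseteq> x" using C(2) I(2) by blast
    then show "\<exists>D. broken_circuit (below L x) (as_below x) D \<and> D \<subseteq> I" unfolding bc using C by blast
  qed
  show ?thesis
    unfolding NBC_def below_atoms[OF x] using key by blast
qed

lemma NBC_sup_rank: "I \<in> NBC L as p \<Longrightarrow> r (\<Squnion>I) = p"
  using nbc_independent[of I] by (auto simp: NBC_iff independent_def)

lemma NBC_atoms: "I \<in> NBC L as p \<Longrightarrow> I \<subseteq> atoms L"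
  by (simp add: NBC_def)

lemma finite_NBC: "finite (NBC L as p)"
  by (rule finite_subset[of _ "Pow (atoms L)"]) (auto simp: NBC_def finite_atoms)

text \<open>An NBC set of p atoms has a join of rank p; since z has the same rank, lying below z
  means spanning it.\<close>

lemma NBC_below_level:
  assumes z: "z \<in> rank_level L p"
  shows "NBC (below L z) (as_below z) p = {I \<in> NBC L as p. \<Squnion>I = z}"
proof -
  have zc: "z \<in> carrier L" "r z = p" using z by (simp_all add: rank_level_def)
  have "(\<forall>a\<in>I. a \<sqsubseteq> z) \<longleftrightarrow> \<Squnion>I = z" if I: "I \<in> NBC L as p" for I
  proof -
    have Ic: "I \<subseteq> carrier L" using NBC_atoms[OF I] atoms_sub by blast
    show ?thesis
      using sup_le_iff[OF Ic zc(1)] rank_eq_imp_eq[OF sup_in[OF Ic] zc(1)] NBC_sup_rank[OF I] zc(2) le_refl[OF zc(1)]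
      by (metis order_refl)
  qed
  then show ?thesis unfolding NBC_below[OF zc(1)] by blast
qed

definition project :: "'a \<Rightarrow> ('a set \<Rightarrow>\<^sub>0 int) \<Rightarrow> ('a set \<Rightarrow>\<^sub>0 int)" where
  "project x = frag_extend (\<lambda>I. if \<forall>a\<in>I. a \<sqsubseteq> x then frag_of I else 0)"

lemma project_diff: "project x (u - v) = project x u - project x v"
  by (simp add: project_def frag_extend_diff)

lemma lookup_project: "poly_mapping.lookup (project x w) I = (if \<forall>a\<in>I. a \<sqsubseteq> x then poly_mapping.lookup w I else 0)"
proof -
  have "poly_mapping.lookup (project x w) I =
    (\<Sum>J\<in>Poly_Mapping.keys w. if J = I then (if \<forall>a\<in>I. a \<sqsubseteq> x then poly_mapping.lookup w I else 0) else 0)"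
    unfolding project_def frag_extend_def lookup_sum by (rule sum.cong) auto
  then show ?thesis by (simp add: in_keys_iff)
qed

text \<open>The projection is the relabelling by the identity on the atoms below x, and filtering
  preserves the order, so no signs arise. A circuit below x has the same boundary in the interval;
  any other circuit has two atoms that are killed.\<close>

lemma project_OS_ideal:
  assumes x: "x \<in> carrier L" and w: "w \<in> OS_ideal L as"
  shows "project x w \<in> OS_ideal (below L x) (as_below x)"
proof -
  interpret B: ordered_geometric "below L x" "as_below x" by (rule below_ordered[OF x])
  let ?D = "set (as_below x)"
  have rel: "relabelling as (as_below x) ?D (\<lambda>a. a)"
    by unfold_locales (use distinct_as in auto)
  interpret relabelling as "as_below x" ?D "\<lambda>a. a" by (rule rel)
  have sgn: "psgn crossing J J = 1" if "J \<subseteq> ?D" for J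
    unfolding psgn_def
  proof (intro prod.neutral ballI)
    fix a b assume "a \<in> J" "b \<in> J"
    then have ab: "a \<in> set as" "b \<in> set as" "a \<sqsubseteq> x" "b \<sqsubseteq> x" "a \<in> ?D" "b \<in> ?D" using that by auto
    have "before (as_below x) b a \<longleftrightarrow> before as b a"
      using pos_less_iff_before[OF B.distinct_as ab(6,5)] pos_less_iff_before[OF distinct_as ab(2,1)]
        pos_filter_less_iff[OF distinct_as ab(2,1), of "\<lambda>a. a \<sqsubseteq> x"] ab by simp
    moreover have "\<not> (before as a b \<and> before as b a)"
      using pos_less_iff_before[OF distinct_as ab(1,2)] pos_less_iff_before[OF distinct_as ab(2,1)] by linarith
    ultimately show "(if crossing a b then -1 else 1::int) = 1" by simp
  qed
  have eq: "project x v = relabel v" if "v \<in> ext_carrier as" for v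
    unfolding project_def relabel_def
  proof (rule frag_extend_eq)
    fix J assume "J \<in> Poly_Mapping.keys v"
    then have "J \<subseteq> set as" using that by (auto simp: ext_carrier_def)
    then have "(\<forall>a\<in>J. a \<sqsubseteq> x) \<longleftrightarrow> J \<subseteq> ?D" by auto
    then show "(if \<forall>a\<in>J. a \<sqsubseteq> x then frag_of J else 0) =
        (if J \<subseteq> ?D \<and> inj_on (\<lambda>a. a) J then frag_cmul (psgn crossing J J) (frag_of ((\<lambda>a. a) ` J)) else 0)"
      using sgn[of J] by simp
  qed
  have "relabel w \<in> OS_ideal (below L x) (as_below x)"
  proof (rule relabel_OS_ideal[OF rel B.OS_ideal_ideal _ w])
    fix C assume C: "circuit L C"
    note Cas = circuit_set_as[OF C]
    show "relabel (ext_boundary as C) \<in> OS_ideal (below L x) (as_below x)"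
    proof (cases "\<forall>c\<in>C. c \<sqsubseteq> x")
      case True
      then have "circuit (below L x) C" using C below_circuit[OF x] by blast
      then have "ext_boundary (as_below x) C \<in> OS_ideal (below L x) (as_below x)" by (rule B.boundary_in_OS_ideal)
      moreover have "relabel (ext_boundary as C) = ext_boundary (as_below x) C"
      proof -
        have "filter (\<lambda>a. a \<in> C) (as_below x) = filter (\<lambda>a. a \<in> C) as"
          unfolding filter_filter using True by (intro filter_cong) auto
        then have b: "ext_boundary (as_below x) C = ext_boundary as C" by (simp add: ext_boundary_def)
        have "project x (ext_boundary as C) = ext_boundary as C"
        proof (rule poly_mapping_eqI)
          fix I
          have "poly_mapping.lookup (ext_boundary as C) I = 0" if "\<not> (\<forall>a\<in>I. a \<sqsubseteq> x)"
          proof -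
            have "I \<noteq> C - {c}" for c using that True by blast
            then show ?thesis
              unfolding ext_boundary_eq[OF distinct_as Cas] lookup_sum by (intro sum.neutral) simp
          qed
          then show "poly_mapping.lookup (project x (ext_boundary as C)) I = poly_mapping.lookup (ext_boundary as C) I"
            unfolding lookup_project by simp
        qed
        then show ?thesis using eq[OF ext_boundary_carrier[OF distinct_as Cas]] b by simp
      qed
      ultimately show ?thesis by simp
    next
      case False
      then obtain c where c: "c \<in> C" "\<not> c \<sqsubseteq> x" by blast
      have "\<exists>c'\<in>C. c' \<noteq> c \<and> \<not> c' \<sqsubseteq> x" using circuit_two[OF C x c(1)] c(2) by blast
      then obtain c' where c': "c' \<in> C" "c' \<noteq> c" "\<not> c' \<sqsubseteq> x" by blast
      have "relabel (ext_boundary as C) = 0"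
        by (rule relabel_boundary_outside[OF Cas c(1) c'(1) c'(2)[symmetric]]) (use c c' in auto)
      then show ?thesis by simp
    qed
  qed
  then show ?thesis using eq[OF OS_ideal_carrier[OF w]] by simp
qed

text \<open>The structure map collects the images of all representatives of a coset. As the
  projection maps ideal to ideal, these images coincide and the collected set is a
  singleton.\<close>

lemma OS_restrict_class:
  assumes x: "x \<in> carrier L"
  shows "OS_restrict L as y x (OS_class L as w) = OS_class (below L x) (as_below x) (project x w)"
proof -
  interpret B: ordered_geometric "below L x" "as_below x" by (rule below_ordered[OF x])
  let ?f = "\<lambda>w. OS_class (below L x) (as_below x) (project x w)"
  have "?f v = ?f w" if v: "v \<in> OS_class L as w" for v
  proof -
    obtain k where k: "k \<in> OS_ideal L as" "v = k + w" using v unfolding OS_class_eq by blast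
    then have "project x v - project x w \<in> OS_ideal (below L x) (as_below x)"
      using project_OS_ideal[OF x k(1)] project_diff[of x v w] by simp
    then show ?thesis using B.OS_class_eq_iff by blast
  qed
  moreover have "w \<in> OS_class L as w" unfolding OS_class_eq using image_eqI[of w "\<lambda>k. k + w" 0] by simp
  ultimately have "?f ` OS_class L as w = {?f w}" by blast
  then show ?thesis unfolding OS_restrict_def project_def[symmetric] by simp
qed

end

section \<open>The top homology of the Orlik--Solomon sheaf\<close>

lemma finprod_sum_group:
  assumes G: "\<And>i. i \<in> I \<Longrightarrow> comm_group (G i)" and A: "finite A"
    and w: "\<And>x. x \<in> A \<Longrightarrow> w x \<in> carrier (sum_group I G)" and i: "i \<in> I"
  shows "finprod (sum_group I G) w A i = finprod (G i) (\<lambda>x. w x i) A"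
proof -
  interpret T: comm_group "sum_group I G" by (rule comm_group_sum_group[OF G])
  interpret Gi: comm_group "G i" by (rule G[OF i])
  have c: "v i \<in> carrier (G i)" if "v \<in> carrier (sum_group I G)" for v
    using that i G[THEN comm_group.axioms(2)] by (auto simp: carrier_sum_group)
  show ?thesis using A w
  proof (induction A rule: finite_induct)
    case empty
    then show ?case using i by simp
  next
    case (insert x A)
    have A: "w x \<in> carrier (sum_group I G)" "w \<in> A \<rightarrow> carrier (sum_group I G)" using insert.prems by auto
    have "finprod (sum_group I G) w (insert x A) i = (w x \<otimes>\<^bsub>sum_group I G\<^esub> finprod (sum_group I G) w A) i"
      by (subst T.finprod_insert) (use insert.hyps A in auto)
    also have "\<dots> = w x i \<otimes>\<^bsub>G i\<^esub> finprod (sum_group I G) w A i" using i by simp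
    also have "finprod (sum_group I G) w A i = finprod (G i) (\<lambda>x. w x i) A"
      by (rule insert.IH) (use insert.prems in simp)
    also have "w x i \<otimes>\<^bsub>G i\<^esub> finprod (G i) (\<lambda>x. w x i) A = finprod (G i) (\<lambda>x. w x i) (insert x A)"
      by (subst Gi.finprod_insert) (use insert.hyps A c in auto)
    finally show ?case .
  qed
qed

lemma decreasing_chain_nth:
  assumes "xs \<in> decreasing_chains P n" "i \<le> n"
  shows "xs ! i \<in> carrier P"
  using assms nth_mem[of i xs] by (auto simp: decreasing_chains_def)

lemma delete_nth_0: "delete_nth 0 xs = tl xs"
  by (cases xs) (simp_all add: delete_nth_def)

lemma delete_nth_Suc: "delete_nth (Suc i) (x # xs) = x # delete_nth i xs"
  by (simp add: delete_nth_def)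

text \<open>The differential is a product of injections in the chain group. Evaluated at one chain,
  each injection becomes its value or the unit, and all products are taken in the one group attached
  to the first vertex of that chain.\<close>

lemma sheaf_differential_component:
  assumes fin: "finite (decreasing_chains P n)" "finite (decreasing_chains P (n - 1))" and n: "0 < n"
    and F: "\<And>x. x \<in> carrier P \<Longrightarrow> comm_group (F x)"
    and s: "\<And>xs. xs \<in> decreasing_chains P n \<Longrightarrow> s xs \<in> carrier (F (hd xs))"
    and r: "\<And>xs. xs \<in> decreasing_chains P n \<Longrightarrow> r (xs ! 0) (xs ! 1) (s xs) \<in> carrier (F (xs ! 1))"
  shows sheaf_differential_in: "sheaf_differential P F r n s \<in> carrier (sheaf_chain_group P F (n - 1))"
    and "ys \<in> decreasing_chains P (n - 1) \<Longrightarrow> sheaf_differential P F r n s ys =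
    finprod (F (hd ys)) (\<lambda>xs.
      (if tl xs = ys then r (xs ! 0) (xs ! 1) (s xs) else \<one>\<^bsub>F (hd ys)\<^esub>) \<otimes>\<^bsub>F (hd ys)\<^esub>
      finprod (F (hd ys)) (\<lambda>i. if delete_nth i xs = ys then s xs [^]\<^bsub>F (xs ! 0)\<^esub> ((-1) ^ i :: int)
         else \<one>\<^bsub>F (hd ys)\<^esub>) {1..n}) (decreasing_chains P n)"
proof -
  let ?D = "decreasing_chains P (n - 1)"
  let ?G = "\<lambda>xs. F (hd xs)"
  let ?T = "sum_group ?D ?G"
  let ?inj = "sum_inj ?D ?G"
  have G: "comm_group (?G zs)" if "zs \<in> ?D" for zs
  proof -
    have "hd zs \<in> carrier P" using that by (cases zs) (auto simp: decreasing_chains_def)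
    then show ?thesis by (rule F)
  qed
  interpret T: comm_group ?T by (rule comm_group_sum_group[OF G])
  have hd0: "hd xs = xs ! 0" "tl xs \<noteq> []" "hd (tl xs) = xs ! 1" "length xs = Suc n"
    if "xs \<in> decreasing_chains P n" for xs
    using that n by (cases xs; cases "tl xs"; auto simp: decreasing_chains_def)+
  have hdi: "hd (delete_nth i xs) = xs ! 0" if "xs \<in> decreasing_chains P n" "i \<in> {1..n}" for xs i
    using hd0[OF that(1)] that(2) by (cases xs; cases i) (auto simp: delete_nth_Suc)
  have in0: "?inj (delete_nth 0 xs) (r (xs ! 0) (xs ! 1) (s xs)) \<in> carrier ?T" if "xs \<in> decreasing_chains P n" for xs
    by (rule sum_inj_in) (use fin G[THEN comm_group.axioms(2)] r[OF that] hd0[OF that] in \<open>auto simp: delete_nth_0\<close>)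
  have ini: "?inj (delete_nth i xs) (s xs [^]\<^bsub>F (xs ! 0)\<^esub> ((-1) ^ i :: int)) \<in> carrier ?T"
    if xs: "xs \<in> decreasing_chains P n" and i: "i \<in> {1..n}" for i xs
  proof (rule sum_inj_in)
    interpret Fx: comm_group "F (xs ! 0)" by (rule F[OF decreasing_chain_nth[OF xs]]) simp
    show "s xs [^]\<^bsub>F (xs ! 0)\<^esub> ((-1) ^ i :: int) \<in> carrier (F (hd (delete_nth i xs)))"
      using s[OF xs] hd0[OF xs] hdi[OF xs i] by simp
  qed (use fin G[THEN comm_group.axioms(2)] in auto)
  have prodin: "finprod ?T (\<lambda>i. ?inj (delete_nth i xs) (s xs [^]\<^bsub>F (xs ! 0)\<^esub> ((-1) ^ i :: int))) {1..n} \<in> carrier ?T"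
    if "xs \<in> decreasing_chains P n" for xs
    by (rule T.finprod_closed) (use ini[OF that] in auto)
  have diff: "sheaf_differential P F r n s =
    finprod ?T (\<lambda>xs. ?inj (delete_nth 0 xs) (r (xs ! 0) (xs ! 1) (s xs)) \<otimes>\<^bsub>?T\<^esub>
      finprod ?T (\<lambda>i. ?inj (delete_nth i xs) (s xs [^]\<^bsub>F (xs ! 0)\<^esub> ((-1) ^ i :: int))) {1..n}) (decreasing_chains P n)"
    by (simp add: sheaf_differential_def sheaf_chain_group_def Let_def)
  show "sheaf_differential P F r n s \<in> carrier (sheaf_chain_group P F (n - 1))"
    unfolding diff sheaf_chain_group_def by (intro T.finprod_closed Pi_I T.m_closed in0 prodin)
  assume ys: "ys \<in> decreasing_chains P (n - 1)"
  interpret Gy: comm_group "F (hd ys)" by (rule G[OF ys])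
  have val: "?inj zs v ys = (if zs = ys then v else \<one>\<^bsub>F (hd ys)\<^esub>)" for zs v
    using ys by (auto simp: sum_inj_def)
  have v0: "(if tl xs = ys then r (xs ! 0) (xs ! 1) (s xs) else \<one>\<^bsub>F (hd ys)\<^esub>) \<in> carrier (F (hd ys))"
    if "xs \<in> decreasing_chains P n" for xs
    using r[OF that] hd0[OF that] by auto
  have vi: "(if delete_nth i xs = ys then s xs [^]\<^bsub>F (xs ! 0)\<^esub> ((-1) ^ i :: int) else \<one>\<^bsub>F (hd ys)\<^esub>) \<in> carrier (F (hd ys))"
    if xs: "xs \<in> decreasing_chains P n" and i: "i \<in> {1..n}" for xs i
  proof -
    interpret Fx: comm_group "F (xs ! 0)" by (rule F[OF decreasing_chain_nth[OF xs]]) simp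
    show ?thesis using s[OF xs] hd0[OF xs] hdi[OF xs i] by auto
  qed
  have "sheaf_differential P F r n s ys =
    finprod ?T (\<lambda>xs. ?inj (delete_nth 0 xs) (r (xs ! 0) (xs ! 1) (s xs)) \<otimes>\<^bsub>?T\<^esub>
      finprod ?T (\<lambda>i. ?inj (delete_nth i xs) (s xs [^]\<^bsub>F (xs ! 0)\<^esub> ((-1) ^ i :: int))) {1..n}) (decreasing_chains P n) ys"
    by (simp only: diff)
  also have "\<dots> = finprod (F (hd ys)) (\<lambda>xs. (?inj (delete_nth 0 xs) (r (xs ! 0) (xs ! 1) (s xs)) \<otimes>\<^bsub>?T\<^esub>
      finprod ?T (\<lambda>i. ?inj (delete_nth i xs) (s xs [^]\<^bsub>F (xs ! 0)\<^esub> ((-1) ^ i :: int))) {1..n}) ys) (decreasing_chains P n)"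
    by (rule finprod_sum_group[OF G fin(1) _ ys], assumption, intro T.m_closed in0 prodin)
  also have "\<dots> = finprod (F (hd ys)) (\<lambda>xs.
      (if tl xs = ys then r (xs ! 0) (xs ! 1) (s xs) else \<one>\<^bsub>F (hd ys)\<^esub>) \<otimes>\<^bsub>F (hd ys)\<^esub>
      finprod (F (hd ys)) (\<lambda>i. if delete_nth i xs = ys then s xs [^]\<^bsub>F (xs ! 0)\<^esub> ((-1) ^ i :: int)
         else \<one>\<^bsub>F (hd ys)\<^esub>) {1..n}) (decreasing_chains P n)"
  proof (rule Gy.finprod_cong')
    show "(\<lambda>xs. (if tl xs = ys then r (xs ! 0) (xs ! 1) (s xs) else \<one>\<^bsub>F (hd ys)\<^esub>) \<otimes>\<^bsub>F (hd ys)\<^esub>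
      finprod (F (hd ys)) (\<lambda>i. if delete_nth i xs = ys then s xs [^]\<^bsub>F (xs ! 0)\<^esub> ((-1) ^ i :: int)
         else \<one>\<^bsub>F (hd ys)\<^esub>) {1..n}) \<in> decreasing_chains P n \<rightarrow> carrier (F (hd ys))"
      by (intro Pi_I Gy.m_closed v0 Gy.finprod_closed vi)
    fix xs assume xs: "xs \<in> decreasing_chains P n"
    have "finprod ?T (\<lambda>i. ?inj (delete_nth i xs) (s xs [^]\<^bsub>F (xs ! 0)\<^esub> ((-1) ^ i :: int))) {1..n} ys =
      finprod (F (hd ys)) (\<lambda>i. ?inj (delete_nth i xs) (s xs [^]\<^bsub>F (xs ! 0)\<^esub> ((-1) ^ i :: int)) ys) {1..n}"
      by (rule finprod_sum_group[OF G _ _ ys]) (use ini[OF xs] in auto)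
    then show "(?inj (delete_nth 0 xs) (r (xs ! 0) (xs ! 1) (s xs)) \<otimes>\<^bsub>?T\<^esub>
      finprod ?T (\<lambda>i. ?inj (delete_nth i xs) (s xs [^]\<^bsub>F (xs ! 0)\<^esub> ((-1) ^ i :: int))) {1..n}) ys =
      (if tl xs = ys then r (xs ! 0) (xs ! 1) (s xs) else \<one>\<^bsub>F (hd ys)\<^esub>) \<otimes>\<^bsub>F (hd ys)\<^esub>
      finprod (F (hd ys)) (\<lambda>i. if delete_nth i xs = ys then s xs [^]\<^bsub>F (xs ! 0)\<^esub> ((-1) ^ i :: int)
         else \<one>\<^bsub>F (hd ys)\<^esub>) {1..n}"
      using ys by (simp only: mult_sum_group restrict_apply' val delete_nth_0)
  qed simp
  finally show "sheaf_differential P F r n s ys =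
    finprod (F (hd ys)) (\<lambda>xs.
      (if tl xs = ys then r (xs ! 0) (xs ! 1) (s xs) else \<one>\<^bsub>F (hd ys)\<^esub>) \<otimes>\<^bsub>F (hd ys)\<^esub>
      finprod (F (hd ys)) (\<lambda>i. if delete_nth i xs = ys then s xs [^]\<^bsub>F (xs ! 0)\<^esub> ((-1) ^ i :: int)
         else \<one>\<^bsub>F (hd ys)\<^esub>) {1..n}) (decreasing_chains P n)" .
qed

lemma carrier_reduced_cycles:
  "carrier (reduced_cycles Q k) = {c. Poly_Mapping.keys c \<subseteq> increasing_chains Q (Suc k) \<and> simplicial_boundary c = 0}"
  by (simp add: reduced_cycles_def order_complex_chains_def kernel_def)

lemma reduced_cycles_mult [simp]: "c \<otimes>\<^bsub>reduced_cycles Q k\<^esub> d = c + d"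
  and reduced_cycles_one [simp]: "\<one>\<^bsub>reduced_cycles Q k\<^esub> = 0"
  by (simp_all add: reduced_cycles_def order_complex_chains_def)

lemma reduced_cycles_comm_group: "comm_group (reduced_cycles Q k)"
proof (rule comm_groupI)
  fix c d e assume "c \<in> carrier (reduced_cycles Q k)" "d \<in> carrier (reduced_cycles Q k)"
  then show "c \<otimes>\<^bsub>reduced_cycles Q k\<^esub> d \<in> carrier (reduced_cycles Q k)"
    using keys_add[of c d] by (auto simp: carrier_reduced_cycles simplicial_boundary_add)
next
  fix c assume "c \<in> carrier (reduced_cycles Q k)"
  then have "- c \<in> carrier (reduced_cycles Q k)"
    using simplicial_boundary_diff[of 0 c] by (simp add: carrier_reduced_cycles)
  then show "\<exists>d\<in>carrier (reduced_cycles Q k). d \<otimes>\<^bsub>reduced_cycles Q k\<^esub> c = \<one>\<^bsub>reduced_cycles Q k\<^esub>"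
    by (intro bexI[of _ "- c"]) auto
qed (auto simp: carrier_reduced_cycles algebra_simps)

context ordered_geometric
begin

lemma OS_degree_in: "Poly_Mapping.keys w \<subseteq> NBC L as p \<Longrightarrow> OS_class L as w \<in> carrier (OS_degree L as p)"
  unfolding OS_degree_carrier using NBC_sub by blast

lemma OS_degree_sign:
  assumes "Poly_Mapping.keys w \<subseteq> NBC L as p"
  shows "OS_class L as w [^]\<^bsub>OS_degree L as p\<^esub> ((-1) ^ i :: int) = OS_class L as (frag_cmul ((-1) ^ i) w)"
proof -
  interpret F: comm_group "OS_degree L as p" by (rule OS_degree_comm_group)
  have "inv\<^bsub>OS_degree L as p\<^esub> OS_class L as w = OS_class L as (- w)"
    by (rule F.inv_equality) (use assms in \<open>simp_all add: OS_degree_mult OS_class_0 OS_degree_in\<close>)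
  then show ?thesis
    using OS_degree_in[OF assms] by (cases "even i") (simp_all add: F.int_pow_neg F.int_pow_1)
qed

lemma OS_degree_finprod:
  assumes "finite A" "\<And>x. x \<in> A \<Longrightarrow> Poly_Mapping.keys (w x) \<subseteq> NBC L as p"
  shows "finprod (OS_degree L as p) (\<lambda>x. OS_class L as (w x)) A = OS_class L as (sum w A)"
proof -
  interpret F: comm_group "OS_degree L as p" by (rule OS_degree_comm_group)
  show ?thesis using assms
    by (induction A rule: finite_induct) (simp_all add: OS_class_0 OS_degree_in Pi_I OS_degree_mult)
qed

lemma OS_class_trivial_iff:
  assumes "Poly_Mapping.keys w \<subseteq> NBC L as p"
  shows "OS_class L as w = \<one>\<^bsub>OS_degree L as p\<^esub> \<longleftrightarrow> w = 0"
  using NBC_combination_in_ideal[OF assms] OS_class_eq_iff[of w 0] by (auto simp: OS_class_0)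

end

section \<open>Chains of top degree\<close>

locale sheaf_top = ordered_geometric +
  fixes p :: nat
  assumes two: "2 \<le> rank_poset L"
begin

text \<open>The degree of the top sheaf chains, which have n + 1 vertices; it is also the number of
  vertices of a top simplex of \<open>Q_poset L z\<close>.\<close>

definition "n = rank_poset L - 1"

lemma rank_n: "rank_poset L = Suc n" and n_pos: "0 < n" and n_cycles: "Suc (rank_poset L - 2) = n"
  using two by (auto simp: n_def)

abbreviation "P \<equiv> without_bottom L"

lemma carrier_P: "carrier P = carrier L - {\<bottom>}"
  by (simp add: without_bottom_def)

lemma less_P: "x \<sqsubset>\<^bsub>P\<^esub> y \<longleftrightarrow> x \<sqsubset> y"
  by (simp add: without_bottom_def lless_def)

lemma le_top: "x \<in> carrier L \<Longrightarrow> x \<sqsubseteq> \<top>"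
  by simp

lemma rank_pos: "x \<in> carrier L \<Longrightarrow> x \<noteq> \<bottom> \<Longrightarrow> 0 < r x"
  using rank_strict_mono[of \<bottom> x] less_iff[of \<bottom> x] by auto

lemma rank_chain:
  assumes "sorted_wrt (\<lambda>x y. y \<sqsubset> x) xs" "set xs \<subseteq> carrier L - {\<bottom>}" "xs \<noteq> []"
  shows "length xs \<le> r (hd xs)"
  using assms
proof (induction xs)
  case (Cons x xs)
  show ?case
  proof (cases xs)
    case Nil
    then show ?thesis using rank_pos[of x] Cons.prems by simp
  next
    case (Cons y ys)
    then have "length xs \<le> r y" using Cons.IH Cons.prems by simp
    moreover have "r y < r x" using rank_strict_mono[of y x] Cons Cons.prems by simp
    ultimately show ?thesis by simp
  qed
qed simp

text \<open>The maximal chains of L without their two ends, in decreasing order.\<close>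

definition flags :: "'a list set" where
  "flags = {us. length us = n \<and> set us \<subseteq> carrier L - {\<bottom>, \<top>} \<and> sorted_wrt (\<lambda>x y. y \<sqsubset> x) us}"

lemma finite_flags: "finite flags"
  by (rule finite_subset[OF _ finite_lists_length_eq[of "carrier L" n]]) (auto simp: flags_def finite_carrier)

lemma finite_decreasing: "finite (decreasing_chains P m)"
  by (rule finite_subset[OF _ finite_lists_length_eq[of "carrier L" "Suc m"]])
     (auto simp: decreasing_chains_def carrier_P finite_carrier)

lemma decreasing_iff:
  "xs \<in> decreasing_chains P m \<longleftrightarrow> length xs = Suc m \<and> set xs \<subseteq> carrier L - {\<bottom>} \<and> sorted_wrt (\<lambda>x y. y \<sqsubset> x) xs"
  by (simp add: decreasing_chains_def carrier_P less_P)

lemma top_not_less: "x \<in> carrier L \<Longrightarrow> \<not> \<top> \<sqsubset> x"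
  using le_antisym[of x \<top>] le_top[of x] by (auto simp: less_iff)

lemma less_top: "x \<in> carrier L \<Longrightarrow> x \<noteq> \<top> \<Longrightarrow> x \<sqsubset> \<top>"
  by (simp add: less_iff)

lemma top_not_bottom: "\<top> \<noteq> \<bottom>"
  using rank_bottom two by (auto simp: rank_poset_def)

lemma top_Cons:
  assumes "length vs = m"
  shows "\<top> # vs \<in> decreasing_chains P m \<longleftrightarrow> set vs \<subseteq> carrier L - {\<bottom>, \<top>} \<and> sorted_wrt (\<lambda>x y. y \<sqsubset> x) vs"
proof -
  have "(\<forall>v\<in>set vs. v \<sqsubset> \<top>) \<longleftrightarrow> \<top> \<notin> set vs" if vs: "set vs \<subseteq> carrier L - {\<bottom>}"
  proof
    assume "\<forall>v\<in>set vs. v \<sqsubset> \<top>"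
    then show "\<top> \<notin> set vs" using top_not_less[of \<top>] by blast
  next
    assume "\<top> \<notin> set vs"
    then show "\<forall>v\<in>set vs. v \<sqsubset> \<top>" using vs less_top by blast
  qed
  moreover have "carrier L - {\<bottom>, \<top>} = (carrier L - {\<bottom>}) - {\<top>}" by blast
  ultimately show ?thesis
    using assms top_not_bottom unfolding decreasing_iff by (simp add: subset_Diff_insert) blast
qed

lemma decreasing_hd:
  assumes "xs \<in> decreasing_chains P m" "hd xs \<noteq> \<top>"
  shows "set xs \<subseteq> carrier L - {\<bottom>, \<top>}"
proof (cases xs)
  case (Cons x ys)
  then have "y \<noteq> \<top>" if "y \<in> set ys" for y
    using that assms(1) top_not_less[of x] by (auto simp: decreasing_iff)
  then show ?thesis using assms Cons by (auto simp: decreasing_iff)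
qed simp

lemma hd_in: "xs \<in> decreasing_chains P m \<Longrightarrow> hd xs \<in> carrier L"
  by (cases xs) (auto simp: decreasing_iff)

text \<open>The ranks of n + 1 comparable nonzero elements are distinct and positive, which forces
  the largest element to have full rank. So every coefficient of a top chain lies in the group at
  \<open>\<top>\<close>.\<close>

lemma decreasing_n: "decreasing_chains P n = (#) \<top> ` flags"
proof (intro equalityI subsetI)
  fix xs assume xs: "xs \<in> decreasing_chains P n"
  then obtain x us where c: "xs = x # us" "length us = n" by (cases xs) (auto simp: decreasing_iff)
  have "Suc n \<le> r x" using rank_chain[of xs] xs c by (auto simp: decreasing_iff)
  moreover have xc: "x \<in> carrier L" using hd_in[OF xs] c by simp
  ultimately have "x = \<top>"
    using rank_eq_imp_eq[of x \<top>] le_top rank_n by (simp add: rank_poset_def)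
  then show "xs \<in> (#) \<top> ` flags" using xs c top_Cons[OF c(2)] by (auto simp: flags_def)
next
  fix xs assume "xs \<in> (#) \<top> ` flags"
  then show "xs \<in> decreasing_chains P n" using top_Cons[of _ n] by (auto simp: flags_def)
qed

lemma decreasing_Suc_n: "decreasing_chains P (Suc n) = {}"
proof -
  have False if xs: "xs \<in> decreasing_chains P (Suc n)" for xs
  proof -
    have "xs \<noteq> []" "length xs = Suc (Suc n)" using xs by (auto simp: decreasing_iff)
    then have "Suc (Suc n) \<le> r (hd xs)" using rank_chain[of xs] xs by (simp add: decreasing_iff)
    moreover have "r (hd xs) \<le> Suc n"
      using rank_mono[of "hd xs" \<top>] hd_in[OF xs] le_top rank_n by (simp add: rank_poset_def)
    ultimately show False by simp
  qed
  then show ?thesis by blast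
qed

lemma flags_iff_hd: "ys \<in> decreasing_chains P (n - 1) \<Longrightarrow> hd ys \<noteq> \<top> \<Longrightarrow> ys \<in> flags"
  using decreasing_hd[of ys "n - 1"] n_pos by (auto simp: flags_def decreasing_iff)

lemma flags_hd: "us \<in> flags \<Longrightarrow> hd us \<in> carrier L \<and> hd us \<noteq> \<top>"
  using n_pos by (cases us) (auto simp: flags_def)

lemma flags_decreasing: "us \<in> flags \<Longrightarrow> us \<in> decreasing_chains P (n - 1)"
  using n_pos by (auto simp: flags_def decreasing_iff)

lemma delete_flag:
  assumes "us \<in> flags" "i < n"
  shows "\<top> # delete_nth i us \<in> decreasing_chains P (n - 1)"
proof -
  have us: "length us = n" "set us \<subseteq> carrier L - {\<bottom>, \<top>}" "sorted_wrt (\<lambda>x y. y \<sqsubset> x) us"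
    using assms by (auto simp: flags_def)
  have sub: "set (delete_nth i us) \<subseteq> set us" using set_delete_nth[of i us] us(1) assms(2) by auto
  have "sorted_wrt (\<lambda>x y. y \<sqsubset> x) (delete_nth i us)"
    unfolding sorted_wrt_iff_nth_less
  proof (intro allI impI)
    fix j k assume jk: "j < k" "k < length (delete_nth i us)"
    then have "j < n - 1" "k < n - 1" using us(1) assms(2) by simp_all
    then show "delete_nth i us ! k \<sqsubset> delete_nth i us ! j"
      using jk(1) us(1) assms(2) us(3)[unfolded sorted_wrt_iff_nth_less] by (simp add: nth_delete_nth)
  qed
  then show ?thesis using top_Cons[of "delete_nth i us" "n - 1"] us sub assms(2) by auto
qed

text \<open>The filter of z is closed upwards, so a chain avoids it as soon as its largest element
  does. The reversal adapts the decreasing lists of the sheaf complex to the increasing ones of the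
  order complex.\<close>

lemma rev_flag_iff:
  assumes z: "z \<in> carrier L"
  shows "ws \<in> increasing_chains (Q_poset L z) n \<longleftrightarrow> rev ws \<in> flags \<and> \<not> z \<sqsubseteq> hd (rev ws)"
proof -
  have iff: "ws \<in> increasing_chains (Q_poset L z) n \<longleftrightarrow>
      length ws = n \<and> set ws \<subseteq> carrier L - {\<bottom>} \<and> (\<forall>w\<in>set ws. \<not> z \<sqsubseteq> w) \<and> sorted_wrt (\<lambda>x y. x \<sqsubset> y) ws"
    by (auto simp: increasing_chains_def Q_poset_def not_above_def without_bottom_def lless_def)
  have "(\<forall>w\<in>set ws. \<not> z \<sqsubseteq> w) \<longleftrightarrow> \<top> \<notin> set ws \<and> \<not> z \<sqsubseteq> hd (rev ws)"
    if ws: "length ws = n" "set ws \<subseteq> carrier L - {\<bottom>}" "sorted_wrt (\<lambda>x y. x \<sqsubset> y) ws"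
  proof -
    obtain v vs where v: "rev ws = v # vs" using ws(1) n_pos by (cases "rev ws") auto
    have set: "set ws = insert v (set vs)" using arg_cong[OF v, of set] by simp
    have "sorted_wrt (\<lambda>x y. y \<sqsubset> x) (rev ws)" using ws(3) by (simp add: sorted_wrt_rev)
    then have "w \<sqsubset> v" if "w \<in> set vs" for w using that v by simp
    then have wv: "w \<sqsubseteq> v" if "w \<in> set ws" for w
      using that set ws(2) by (auto simp: less_iff)
    have vc: "v \<in> carrier L" using set ws(2) by auto
    have "\<not> z \<sqsubseteq> w" if "\<not> z \<sqsubseteq> v" "w \<in> set ws" for w
      using le_trans[of z w v] that wv[of w] z vc ws(2) by blast
    moreover have "z \<sqsubseteq> \<top>" using z by simp
    ultimately show ?thesis using v set by auto
  qed
  then show ?thesis unfolding iff flags_def using sorted_wrt_rev[of "\<lambda>x y. y \<sqsubset> x" ws] by auto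
qed

abbreviation "F \<equiv> OS_sheaf L as p"

lemma F_comm_group: "x \<in> carrier L \<Longrightarrow> comm_group (F x)"
  unfolding OS_sheaf_def by (rule ordered_geometric.OS_degree_comm_group[OF below_ordered])

lemma below_top: "below L \<top> = L"
proof -
  have "{y \<in> carrier L. y \<sqsubseteq> \<top>} = carrier L" by auto
  then show ?thesis by (simp add: below_def)
qed

lemma as_below_top: "as_below \<top> = as"
  by (rule filter_True) (use set_as atoms_sub in auto)

lemma F_top: "F \<top> = OS_degree L as p"
  by (simp add: OS_sheaf_def below_top as_below_top)

lemma project_keys:
  assumes "Poly_Mapping.keys w \<subseteq> NBC L as p" "x \<in> carrier L"
  shows "Poly_Mapping.keys (project x w) \<subseteq> NBC (below L x) (as_below x) p"
  using assms(1) unfolding NBC_below[OF assms(2)] by (auto simp: in_keys_iff lookup_project split: if_splits)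

lemma OS_restrict_top_in:
  assumes "Poly_Mapping.keys w \<subseteq> NBC L as p" "x \<in> carrier L"
  shows "OS_restrict L as \<top> x (OS_class L as w) \<in> carrier (F x)"
  unfolding OS_restrict_class[OF assms(2)] OS_sheaf_def
  by (rule ordered_geometric.OS_degree_in[OF below_ordered[OF assms(2)] project_keys[OF assms]])

end

lemma delete_nth_rev: "i < length xs \<Longrightarrow> delete_nth i (rev xs) = rev (delete_nth (length xs - Suc i) xs)"
  by (rule nth_equalityI) (auto simp: nth_delete_nth rev_nth Suc_diff_Suc)

section \<open>Cycles of top degree in NBC coordinates\<close>

context sheaf_top
begin

definition flag_family :: "('a list \<Rightarrow> ('a set \<Rightarrow>\<^sub>0 int)) \<Rightarrow> bool" where
  "flag_family \<sigma> \<longleftrightarrow> (\<forall>us\<in>flags. Poly_Mapping.keys (\<sigma> us) \<subseteq> NBC L as p)"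

text \<open>An element of the top chain group of the sheaf complex. All its values lie in one group,
  so it is given by NBC combinations indexed by flags.\<close>

definition cochain :: "('a list \<Rightarrow> ('a set \<Rightarrow>\<^sub>0 int)) \<Rightarrow> 'a list \<Rightarrow> ('a set \<Rightarrow>\<^sub>0 int) set" where
  "cochain \<sigma> = (\<lambda>xs\<in>decreasing_chains P n. OS_class L as (\<sigma> (tl xs)))"

abbreviation "diff \<equiv> sheaf_differential P F (OS_restrict L as) n"

text \<open>Position i of a flag is position i + 1 of the chain that starts with
  \<open>\<top>\<close>, hence the shifted exponent.\<close>

definition faces :: "('a list \<Rightarrow> ('a set \<Rightarrow>\<^sub>0 int)) \<Rightarrow> 'a list \<Rightarrow> ('a set \<Rightarrow>\<^sub>0 int)" where
  "faces \<sigma> vs = (\<Sum>us\<in>flags. \<Sum>i<n. if delete_nth i us = vs then frag_cmul ((-1) ^ Suc i) (\<sigma> us) else 0)"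

text \<open>The coefficient of \<open>e\<^sub>I\<close>, as a chain of the order complex.\<close>

definition coefficient :: "('a list \<Rightarrow> ('a set \<Rightarrow>\<^sub>0 int)) \<Rightarrow> 'a set \<Rightarrow> ('a list \<Rightarrow>\<^sub>0 int)" where
  "coefficient \<sigma> I = (\<Sum>us\<in>flags. frag_cmul (poly_mapping.lookup (\<sigma> us) I) (frag_of (rev us)))"

lemma lookup_coefficient:
  "poly_mapping.lookup (coefficient \<sigma> I) ws = (if rev ws \<in> flags then poly_mapping.lookup (\<sigma> (rev ws)) I else 0)"
proof -
  have "poly_mapping.lookup (coefficient \<sigma> I) ws =
      (\<Sum>us\<in>flags. if us = rev ws then poly_mapping.lookup (\<sigma> us) I else 0)"
    unfolding coefficient_def lookup_sum by (intro sum.cong HOL.refl) auto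
  then show ?thesis using finite_flags by simp
qed

text \<open>Reversal turns deletion at i into deletion at n - 1 - i. The signs change by the global
  factor (-1)^n, which does not affect vanishing.\<close>

lemma lookup_boundary_coefficient:
  "poly_mapping.lookup (simplicial_boundary (coefficient \<sigma> I)) (rev vs) =
    (-1) ^ n * poly_mapping.lookup (faces \<sigma> vs) I"
proof -
  have one: "poly_mapping.lookup (simplicial_boundary (frag_of (rev us))) (rev vs) =
      (-1) ^ n * (\<Sum>i<n. if delete_nth i us = vs then (-1) ^ Suc i else 0)" if us: "us \<in> flags" for us
  proof -
    have len: "length us = n" using us by (simp add: flags_def)
    have "poly_mapping.lookup (simplicial_boundary (frag_of (rev us))) (rev vs) =
      (\<Sum>i<n. if delete_nth i (rev us) = rev vs then (-1) ^ i else 0)"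
      unfolding simplicial_boundary_of lookup_sum using len by (intro sum.cong) auto
    also have "\<dots> = (\<Sum>i<n. if delete_nth (n - Suc i) us = vs then (-1) ^ (n - Suc (n - Suc i)) else 0)"
      using len by (intro sum.cong) (auto simp: delete_nth_rev)
    also have "\<dots> = (\<Sum>i<n. if delete_nth i us = vs then (-1) ^ (n - Suc i) else 0)"
      by (rule sum.nat_diff_reindex)
    also have "\<dots> = (-1) ^ n * (\<Sum>i<n. if delete_nth i us = vs then (-1) ^ Suc i else 0)"
      unfolding sum_distrib_left
    proof (intro sum.cong HOL.refl)
      fix i assume "i \<in> {..<n}"
      then have "even (n - Suc i) = even (n + Suc i)" by auto
      then have "(-1::int) ^ (n - Suc i) = (-1) ^ (n + Suc i)" by (simp add: minus_one_power_iff)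
      then show "(if delete_nth i us = vs then (-1::int) ^ (n - Suc i) else 0) =
          (-1) ^ n * (if delete_nth i us = vs then (-1) ^ Suc i else 0)"
        by (simp add: power_add)
    qed
    finally show ?thesis .
  qed
  have "poly_mapping.lookup (simplicial_boundary (coefficient \<sigma> I)) (rev vs) =
      (\<Sum>us\<in>flags. poly_mapping.lookup (\<sigma> us) I * poly_mapping.lookup (simplicial_boundary (frag_of (rev us))) (rev vs))"
    unfolding coefficient_def simplicial_boundary_sum[OF finite_flags] lookup_sum simplicial_boundary_cmul by simp
  also have "\<dots> = (\<Sum>us\<in>flags. (-1) ^ n * poly_mapping.lookup (\<Sum>i<n. if delete_nth i us = vs then frag_cmul ((-1) ^ Suc i) (\<sigma> us) else 0) I)"
  proof (intro sum.cong HOL.refl)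
    fix us assume us: "us \<in> flags"
    have "poly_mapping.lookup (\<Sum>i<n. if delete_nth i us = vs then frag_cmul ((-1) ^ Suc i) (\<sigma> us) else 0) I =
        (\<Sum>i<n. (if delete_nth i us = vs then (-1) ^ Suc i else 0) * poly_mapping.lookup (\<sigma> us) I)"
      unfolding lookup_sum by (intro sum.cong HOL.refl) auto
    also have "\<dots> = (\<Sum>i<n. if delete_nth i us = vs then (-1) ^ Suc i else 0) * poly_mapping.lookup (\<sigma> us) I"
      by (rule sum_distrib_right[symmetric])
    finally show "poly_mapping.lookup (\<sigma> us) I * poly_mapping.lookup (simplicial_boundary (frag_of (rev us))) (rev vs) =
        (-1) ^ n * poly_mapping.lookup (\<Sum>i<n. if delete_nth i us = vs then frag_cmul ((-1) ^ Suc i) (\<sigma> us) else 0) I"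
      unfolding one[OF us] by (simp only: mult_ac)
  qed
  finally show ?thesis unfolding faces_def lookup_sum sum_distrib_left .
qed

lemma keys_faces:
  assumes "flag_family \<sigma>"
  shows "Poly_Mapping.keys (faces \<sigma> vs) \<subseteq> NBC L as p"
proof
  fix I assume "I \<in> Poly_Mapping.keys (faces \<sigma> vs)"
  then have "poly_mapping.lookup (faces \<sigma> vs) I \<noteq> 0" by (simp add: in_keys_iff)
  then obtain us i where us: "us \<in> flags"
    "poly_mapping.lookup (if delete_nth i us = vs then frag_cmul ((-1) ^ Suc i) (\<sigma> us) else 0) I \<noteq> 0"
    unfolding faces_def lookup_sum by (meson sum.not_neutral_contains_not_neutral)
  from us(2) have "poly_mapping.lookup (\<sigma> us) I \<noteq> 0" by (auto split: if_splits)
  then have "I \<in> Poly_Mapping.keys (\<sigma> us)" by (simp add: in_keys_iff)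
  then show "I \<in> NBC L as p" using us(1) assms unfolding flag_family_def by blast
qed

lemma cochain_in:
  assumes "flag_family \<sigma>"
  shows "cochain \<sigma> \<in> carrier (sheaf_chain_group P F n)"
proof -
  have c: "carrier (sheaf_chain_group P F n) = (\<Pi>\<^sub>E xs\<in>decreasing_chains P n. carrier (F (hd xs)))"
    unfolding sheaf_chain_group_def
    by (rule carrier_sum_group_finite[OF finite_decreasing]) (rule comm_group.axioms(2)[OF F_comm_group[OF hd_in]])
  show ?thesis
    unfolding c cochain_def decreasing_n
    using assms by (intro restrict_PiE_iff[THEN iffD2]) (auto simp: F_top flag_family_def intro!: OS_degree_in)
qed

lemma cochain_Cons: "us \<in> flags \<Longrightarrow> cochain \<sigma> (\<top> # us) = OS_class L as (\<sigma> us)"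
  by (simp add: cochain_def decreasing_n)

text \<open>The summands of the differential separate by their targets. Deleting a lower element
  keeps \<open>\<top>\<close> in front, deleting \<open>\<top>\<close> leaves a flag, and no flag
  contains \<open>\<top>\<close>; so on each kind of chain only one part of the differential is
  seen.\<close>

lemma diff_cochain:
  assumes fam: "flag_family \<sigma>"
  shows diff_in: "diff (cochain \<sigma>) \<in> carrier (sheaf_chain_group P F (n - 1))"
    and diff_top: "\<top> # vs \<in> decreasing_chains P (n - 1) \<Longrightarrow> diff (cochain \<sigma>) (\<top> # vs) = OS_class L as (faces \<sigma> vs)"
    and diff_not_top: "us \<in> flags \<Longrightarrow>
      diff (cochain \<sigma>) us = OS_class (below L (hd us)) (as_below (hd us)) (project (hd us) (\<sigma> us))"
proof -
  have \<sigma>: "Poly_Mapping.keys (\<sigma> us) \<subseteq> NBC L as p" if "us \<in> flags" for us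
    using fam that by (simp add: flag_family_def)
  have s: "cochain \<sigma> xs \<in> carrier (F (hd xs))" if "xs \<in> decreasing_chains P n" for xs
    using that \<sigma> by (auto simp: decreasing_n cochain_Cons F_top OS_degree_in)
  have nth1: "(\<top> # us) ! 1 = hd us" if "us \<in> flags" for us
    using that n_pos by (cases us) (auto simp: flags_def)
  have r: "OS_restrict L as (xs ! 0) (xs ! 1) (cochain \<sigma> xs) \<in> carrier (F (xs ! 1))"
    if xs: "xs \<in> decreasing_chains P n" for xs
  proof -
    obtain us where us: "us \<in> flags" "xs = \<top> # us" using xs unfolding decreasing_n by blast
    show ?thesis using OS_restrict_top_in[OF \<sigma>[OF us(1)]] flags_hd[OF us(1)] nth1[OF us(1)] us
      by (simp add: cochain_Cons)
  qed
  have Fg: "comm_group (F x)" if "x \<in> carrier P" for x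
    using that F_comm_group by (simp add: carrier_P)
  let ?t = "\<lambda>ys xs. (if tl xs = ys then OS_restrict L as (xs ! 0) (xs ! 1) (cochain \<sigma> xs)
        else \<one>\<^bsub>F (hd ys)\<^esub>) \<otimes>\<^bsub>F (hd ys)\<^esub>
      finprod (F (hd ys)) (\<lambda>i. if delete_nth i xs = ys then cochain \<sigma> xs [^]\<^bsub>F (xs ! 0)\<^esub> ((-1) ^ i :: int)
        else \<one>\<^bsub>F (hd ys)\<^esub>) {1..n}"
  show "diff (cochain \<sigma>) \<in> carrier (sheaf_chain_group P F (n - 1))"
    by (rule sheaf_differential_component(1)[OF finite_decreasing finite_decreasing n_pos Fg s r])
  have comp: "diff (cochain \<sigma>) ys = finprod (F (hd ys)) (?t ys) (decreasing_chains P n)"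
    if "ys \<in> decreasing_chains P (n - 1)" for ys
    by (rule sheaf_differential_component(2)[OF finite_decreasing finite_decreasing n_pos Fg s r that])
  have inj: "inj_on ((#) \<top>) flags" by simp
  show "diff (cochain \<sigma>) (\<top> # vs) = OS_class L as (faces \<sigma> vs)" if ys: "\<top> # vs \<in> decreasing_chains P (n - 1)"
  proof -
    interpret O: comm_group "OS_degree L as p" by (rule OS_degree_comm_group)
    let ?w = "\<lambda>us i. if delete_nth i us = vs then frag_cmul ((-1) ^ Suc i) (\<sigma> us) else 0"
    have kw: "Poly_Mapping.keys (?w us i) \<subseteq> NBC L as p" if "us \<in> flags" for us i
      using \<sigma>[OF that] by (auto simp: in_keys_iff)
    have ks: "Poly_Mapping.keys (\<Sum>i<n. ?w us i) \<subseteq> NBC L as p" if "us \<in> flags" for us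
      using keys_sum[of "?w us" "{..<n}"] kw[OF that] by blast
    have kt: "Poly_Mapping.keys (\<Sum>i<n. ?w (tl xs) i) \<subseteq> NBC L as p" if xs: "xs \<in> decreasing_chains P n" for xs
    proof -
      obtain us where us: "us \<in> flags" "xs = \<top> # us" using xs unfolding decreasing_n by blast
      show ?thesis unfolding us(2) list.sel by (rule ks[OF us(1)])
    qed
    have summand: "?t (\<top> # vs) (\<top> # us) =
        OS_class L as (\<Sum>i<n. ?w us i)" if us: "us \<in> flags" for us
    proof -
      have ne: "us \<noteq> \<top> # vs" using us by (auto simp: flags_def)
      have "finprod (OS_degree L as p) (\<lambda>i. if delete_nth i (\<top> # us) = \<top> # vs
          then cochain \<sigma> (\<top> # us) [^]\<^bsub>OS_degree L as p\<^esub> ((-1) ^ i :: int) else \<one>\<^bsub>OS_degree L as p\<^esub>) {1..n} =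
        finprod (OS_degree L as p) (\<lambda>i. OS_class L as (?w us (i - 1))) {1..n}"
      proof (rule O.finprod_cong')
        show "(\<lambda>i. OS_class L as (?w us (i - 1))) \<in> {1..n} \<rightarrow> carrier (OS_degree L as p)"
          using kw[OF us] by (intro Pi_I OS_degree_in)
        fix i assume "i \<in> {1..n}"
        then obtain j where j: "i = Suc j" by (cases i) auto
        show "(if delete_nth i (\<top> # us) = \<top> # vs
          then cochain \<sigma> (\<top> # us) [^]\<^bsub>OS_degree L as p\<^esub> ((-1) ^ i :: int) else \<one>\<^bsub>OS_degree L as p\<^esub>) =
          OS_class L as (?w us (i - 1))"
          unfolding j delete_nth_Suc cochain_Cons[OF us] OS_degree_sign[OF \<sigma>[OF us]]
          by (simp add: OS_class_0)
      qed simp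
      also have "\<dots> = OS_class L as (\<Sum>i\<in>{1..n}. ?w us (i - 1))"
        by (rule OS_degree_finprod[OF _ kw[OF us]]) simp
      also have "(\<Sum>i\<in>{1..n}. ?w us (i - 1)) = (\<Sum>i<n. ?w us i)"
        by (simp only: One_nat_def sum.atLeast1_atMost_eq diff_Suc_Suc diff_zero)
      finally show ?thesis using OS_degree_in[OF ks[OF us]]
        by (simp only: list.sel nth_Cons_0 F_top ne if_False O.l_one)
    qed
    have e: "F (hd (\<top> # vs)) = OS_degree L as p" by (simp add: F_top)
    interpret E: comm_group "F (hd (\<top> # vs))" unfolding e by (rule OS_degree_comm_group)
    have "diff (cochain \<sigma>) (\<top> # vs) = finprod (F (hd (\<top> # vs))) (\<lambda>xs. OS_class L as (\<Sum>i<n. ?w (tl xs) i)) (decreasing_chains P n)"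
      unfolding comp[OF ys]
    proof (rule E.finprod_cong')
      show "(\<lambda>xs. OS_class L as (\<Sum>i<n. ?w (tl xs) i)) \<in> decreasing_chains P n \<rightarrow> carrier (F (hd (\<top> # vs)))"
        unfolding e by (intro Pi_I OS_degree_in kt)
      fix xs assume xs: "xs \<in> decreasing_chains P n"
      obtain us where us: "us \<in> flags" "xs = \<top> # us" using xs unfolding decreasing_n by blast
      show "?t (\<top> # vs) xs = OS_class L as (\<Sum>i<n. ?w (tl xs) i)"
        using summand[OF us(1)] unfolding us(2) by (simp only: list.sel)
    qed simp
    also have "\<dots> = finprod (OS_degree L as p) (\<lambda>xs. OS_class L as (\<Sum>i<n. ?w (tl xs) i)) (decreasing_chains P n)"
      by (simp only: e)
    also have "\<dots> = OS_class L as (\<Sum>xs\<in>decreasing_chains P n. \<Sum>i<n. ?w (tl xs) i)"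
      by (rule OS_degree_finprod[OF finite_decreasing kt])
    also have "(\<Sum>xs\<in>decreasing_chains P n. \<Sum>i<n. ?w (tl xs) i) = faces \<sigma> vs"
      unfolding decreasing_n faces_def sum.reindex[OF inj] o_def list.sel ..
    finally show ?thesis .
  qed
  show "diff (cochain \<sigma>) us = OS_class (below L (hd us)) (as_below (hd us)) (project (hd us) (\<sigma> us))" if us: "us \<in> flags"
  proof -
    have x: "hd us \<in> carrier L" "hd us \<noteq> \<top>" using flags_hd[OF us] by auto
    interpret E: comm_group "F (hd us)" by (rule F_comm_group[OF x(1)])
    let ?v = "OS_restrict L as \<top> (hd us) (OS_class L as (\<sigma> us))"
    have v: "?v \<in> carrier (F (hd us))" by (rule OS_restrict_top_in[OF \<sigma>[OF us] x(1)])
    \<comment> \<open>Only the chain \<open>\<top> # us\<close> contributes, through its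
      restriction; every other deletion leaves \<open>\<top>\<close> in front.\<close>
    have "?t us xs = (if xs = \<top> # us then ?v else \<one>\<^bsub>F (hd us)\<^esub>)" if xs: "xs \<in> decreasing_chains P n" for xs
    proof -
      obtain us' where us': "us' \<in> flags" "xs = \<top> # us'" using xs unfolding decreasing_n by blast
      have "delete_nth i xs \<noteq> us" if "i \<in> {1..n}" for i
        using that us by (cases i) (auto simp: us'(2) delete_nth_Suc flags_def)
      then have "finprod (F (hd us)) (\<lambda>i. if delete_nth i xs = us then cochain \<sigma> xs [^]\<^bsub>F (xs ! 0)\<^esub> ((-1) ^ i :: int)
          else \<one>\<^bsub>F (hd us)\<^esub>) {1..n} = \<one>\<^bsub>F (hd us)\<^esub>"
        by (intro E.finprod_one_eqI) auto
      moreover have "OS_restrict L as (xs ! 0) (xs ! 1) (cochain \<sigma> xs) = ?v" if "us' = us"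
        using that us nth1[OF us] us' by (simp add: cochain_Cons)
      ultimately show ?thesis using v us'(2) by simp
    qed
    then have "finprod (F (hd us)) (?t us) (decreasing_chains P n) =
        finprod (F (hd us)) (\<lambda>xs. if xs = \<top> # us then ?v else \<one>\<^bsub>F (hd us)\<^esub>) (decreasing_chains P n)"
      by (intro E.finprod_cong') (use v in auto)
    also have "\<dots> = ?v"
      by (rule E.finprod_singleton_swap[OF _ finite_decreasing, where f = "\<lambda>_. ?v"]) (use us v in \<open>auto simp: decreasing_n\<close>)
    finally show ?thesis
      unfolding comp[OF flags_decreasing[OF us]] OS_restrict_class[OF x(1)] .
  qed
qed

lemma carrier_chain_group:
  "carrier (sheaf_chain_group P F m) = (\<Pi>\<^sub>E xs\<in>decreasing_chains P m. carrier (F (hd xs)))"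
  unfolding sheaf_chain_group_def
  by (rule carrier_sum_group_finite[OF finite_decreasing]) (rule comm_group.axioms(2)[OF F_comm_group[OF hd_in]])

text \<open>NBC monomials are independent on L and on each lower interval, so a class vanishes only
  together with its coefficients. Restriction to \<open>hd us\<close> keeps exactly the coefficients
  at NBC sets whose join is below it.\<close>

lemma diff_one_iff:
  assumes fam: "flag_family \<sigma>"
  shows "diff (cochain \<sigma>) = \<one>\<^bsub>sheaf_chain_group P F (n - 1)\<^esub> \<longleftrightarrow>
    (\<forall>vs. faces \<sigma> vs = 0) \<and>
    (\<forall>us\<in>flags. \<forall>I\<in>NBC L as p. \<Squnion>I \<sqsubseteq> hd us \<longrightarrow> poly_mapping.lookup (\<sigma> us) I = 0)"
proof -
  have ext: "diff (cochain \<sigma>) \<in> extensional (decreasing_chains P (n - 1))"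
    using diff_in[OF fam] unfolding carrier_chain_group by (simp add: PiE_def)
  have one: "\<one>\<^bsub>sheaf_chain_group P F (n - 1)\<^esub> = (\<lambda>ys\<in>decreasing_chains P (n - 1). \<one>\<^bsub>F (hd ys)\<^esub>)"
    by (simp add: sheaf_chain_group_def)
  have eq: "diff (cochain \<sigma>) = \<one>\<^bsub>sheaf_chain_group P F (n - 1)\<^esub> \<longleftrightarrow>
      (\<forall>ys\<in>decreasing_chains P (n - 1). diff (cochain \<sigma>) ys = \<one>\<^bsub>F (hd ys)\<^esub>)" (is "_ \<longleftrightarrow> (\<forall>ys\<in>_. ?C ys)")
    unfolding one
  proof
    assume "\<forall>ys\<in>decreasing_chains P (n - 1). ?C ys"
    then show "diff (cochain \<sigma>) = (\<lambda>ys\<in>decreasing_chains P (n - 1). \<one>\<^bsub>F (hd ys)\<^esub>)"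
      using ext by (intro extensionalityI[of _ "decreasing_chains P (n - 1)"]) auto
  qed simp
  have top: "?C (\<top> # vs) \<longleftrightarrow> faces \<sigma> vs = 0" if "\<top> # vs \<in> decreasing_chains P (n - 1)" for vs
    unfolding diff_top[OF fam that] list.sel F_top by (rule OS_class_trivial_iff[OF keys_faces[OF fam]])
  \<comment> \<open>A list that is no face of a flag gives a sum of zeros, so the condition may
    range over all lists.\<close>
  have faces0: "faces \<sigma> vs = 0" if "\<top> # vs \<notin> decreasing_chains P (n - 1)" for vs
    unfolding faces_def by (intro sum.neutral ballI) (use delete_flag that in auto)
  have flag: "?C us \<longleftrightarrow> (\<forall>I\<in>NBC L as p. \<Squnion>I \<sqsubseteq> hd us \<longrightarrow> poly_mapping.lookup (\<sigma> us) I = 0)" if us: "us \<in> flags" for us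
  proof -
    have x: "hd us \<in> carrier L" using flags_hd[OF us] by simp
    have k: "Poly_Mapping.keys (\<sigma> us) \<subseteq> NBC L as p" using fam us by (simp add: flag_family_def)
    have "?C us \<longleftrightarrow> project (hd us) (\<sigma> us) = 0"
      unfolding diff_not_top[OF fam us] OS_sheaf_def
      by (rule ordered_geometric.OS_class_trivial_iff[OF below_ordered[OF x] project_keys[OF k x]])
    also have "\<dots> \<longleftrightarrow> (\<forall>I. (\<forall>a\<in>I. a \<sqsubseteq> hd us) \<longrightarrow> poly_mapping.lookup (\<sigma> us) I = 0)"
      by (simp add: poly_mapping_eq_iff fun_eq_iff lookup_project)
    also have "\<dots> \<longleftrightarrow> (\<forall>I\<in>NBC L as p. (\<forall>a\<in>I. a \<sqsubseteq> hd us) \<longrightarrow> poly_mapping.lookup (\<sigma> us) I = 0)"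
      using k by (auto simp: in_keys_iff)
    also have "\<dots> \<longleftrightarrow> (\<forall>I\<in>NBC L as p. \<Squnion>I \<sqsubseteq> hd us \<longrightarrow> poly_mapping.lookup (\<sigma> us) I = 0)"
      using sup_le_iff[OF subset_atoms_carrier[OF NBC_atoms] x] by simp
    finally show ?thesis .
  qed
  have "(\<forall>ys\<in>decreasing_chains P (n - 1). ?C ys) \<longleftrightarrow> (\<forall>vs. faces \<sigma> vs = 0) \<and> (\<forall>us\<in>flags. ?C us)"
  proof (intro iffI conjI allI ballI)
    fix vs assume "\<forall>ys\<in>decreasing_chains P (n - 1). ?C ys"
    then show "faces \<sigma> vs = 0" using top faces0 by blast
  next
    fix us assume "\<forall>ys\<in>decreasing_chains P (n - 1). ?C ys" "us \<in> flags"
    then show "?C us" using flags_decreasing by blast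
  next
    fix ys assume c: "(\<forall>vs. faces \<sigma> vs = 0) \<and> (\<forall>us\<in>flags. ?C us)" and ys: "ys \<in> decreasing_chains P (n - 1)"
    show "?C ys"
    proof (cases "hd ys = \<top>")
      case True
      then obtain vs where "ys = \<top> # vs" using ys by (cases ys) (auto simp: decreasing_iff)
      then show ?thesis using top ys c by blast
    next
      case False
      then show ?thesis using flags_iff_hd[OF ys] c by blast
    qed
  qed
  then show ?thesis unfolding eq using flag by simp
qed

text \<open>The conditions of \<open>diff_one_iff\<close> are read one coefficient at a time: the
  restriction condition confines the support to chains of \<open>Q_poset L (\<Squnion>I)\<close>,
  and the condition on faces is the vanishing of the simplicial boundary.\<close>

theorem cochain_cycle_iff:
  assumes fam: "flag_family \<sigma>"
  shows "cochain \<sigma> \<in> carrier (sheaf_cycles P F (OS_restrict L as) n) \<longleftrightarrow>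
    (\<forall>I\<in>NBC L as p. coefficient \<sigma> I \<in> carrier (reduced_cycles (Q_poset L (\<Squnion>I)) (rank_poset L - 2)))"
proof -
  have "coefficient \<sigma> I \<in> carrier (reduced_cycles (Q_poset L (\<Squnion>I)) (rank_poset L - 2)) \<longleftrightarrow>
      (\<forall>us\<in>flags. \<Squnion>I \<sqsubseteq> hd us \<longrightarrow> poly_mapping.lookup (\<sigma> us) I = 0) \<and>
      (\<forall>vs. poly_mapping.lookup (faces \<sigma> vs) I = 0)" if I: "I \<in> NBC L as p" for I
  proof -
    have z: "\<Squnion>I \<in> carrier L" by (rule sup_in[OF subset_atoms_carrier[OF NBC_atoms[OF I]]])
    have "Poly_Mapping.keys (coefficient \<sigma> I) \<subseteq> increasing_chains (Q_poset L (\<Squnion>I)) n \<longleftrightarrow>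
        (\<forall>ws. rev ws \<in> flags \<and> poly_mapping.lookup (\<sigma> (rev ws)) I \<noteq> 0 \<longrightarrow> \<not> \<Squnion>I \<sqsubseteq> hd (rev ws))"
      unfolding subset_iff rev_flag_iff[OF z] by (simp add: in_keys_iff lookup_coefficient) blast
    also have "\<dots> \<longleftrightarrow> (\<forall>us. us \<in> flags \<and> poly_mapping.lookup (\<sigma> us) I \<noteq> 0 \<longrightarrow> \<not> \<Squnion>I \<sqsubseteq> hd us)"
      by (metis rev_rev_ident)
    also have "\<dots> \<longleftrightarrow> (\<forall>us\<in>flags. \<Squnion>I \<sqsubseteq> hd us \<longrightarrow> poly_mapping.lookup (\<sigma> us) I = 0)" by blast
    finally have k: "Poly_Mapping.keys (coefficient \<sigma> I) \<subseteq> increasing_chains (Q_poset L (\<Squnion>I)) n \<longleftrightarrow>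
        (\<forall>us\<in>flags. \<Squnion>I \<sqsubseteq> hd us \<longrightarrow> poly_mapping.lookup (\<sigma> us) I = 0)" .
    have "simplicial_boundary (coefficient \<sigma> I) = 0 \<longleftrightarrow>
        (\<forall>ws. poly_mapping.lookup (simplicial_boundary (coefficient \<sigma> I)) ws = 0)"
      by (simp add: poly_mapping_eq_iff fun_eq_iff)
    also have "\<dots> \<longleftrightarrow> (\<forall>vs. poly_mapping.lookup (simplicial_boundary (coefficient \<sigma> I)) (rev vs) = 0)"
      by (metis rev_rev_ident)
    also have "\<dots> \<longleftrightarrow> (\<forall>vs. poly_mapping.lookup (faces \<sigma> vs) I = 0)"
      by (simp add: lookup_boundary_coefficient)
    finally show ?thesis unfolding carrier_reduced_cycles n_cycles using k by simp
  qed
  moreover have "(\<forall>vs. faces \<sigma> vs = 0) \<longleftrightarrow> (\<forall>I\<in>NBC L as p. \<forall>vs. poly_mapping.lookup (faces \<sigma> vs) I = 0)"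
  proof (intro iffI allI)
    fix vs assume "\<forall>I\<in>NBC L as p. \<forall>vs. poly_mapping.lookup (faces \<sigma> vs) I = 0"
    then have nbc: "poly_mapping.lookup (faces \<sigma> vs) I = 0" if "I \<in> NBC L as p" for I using that by blast
    show "faces \<sigma> vs = 0"
    proof (rule poly_mapping_eqI)
      fix I show "poly_mapping.lookup (faces \<sigma> vs) I = poly_mapping.lookup 0 I"
      proof (cases "I \<in> NBC L as p")
        case False
        then have "I \<notin> Poly_Mapping.keys (faces \<sigma> vs)" using keys_faces[OF fam, of vs] by blast
        then show ?thesis by (simp add: in_keys_iff)
      qed (simp add: nbc)
    qed
  qed simp
  moreover have "cochain \<sigma> \<in> carrier (sheaf_cycles P F (OS_restrict L as) n) \<longleftrightarrow>
      diff (cochain \<sigma>) = \<one>\<^bsub>sheaf_chain_group P F (n - 1)\<^esub>"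
    using n_pos cochain_in[OF fam] by (simp add: sheaf_cycles_def kernel_def)
  ultimately show ?thesis unfolding diff_one_iff[OF fam] by blast
qed

abbreviation "top_cycle_group \<equiv>
  sum_group (NBC L as p) (\<lambda>I. reduced_cycles (Q_poset L (\<Squnion>I)) (rank_poset L - 2))"

text \<open>The inverse of taking coefficients: simplicial chains indexed by NBC sets become NBC
  combinations indexed by flags.\<close>

definition assemble :: "('a set \<Rightarrow> ('a list \<Rightarrow>\<^sub>0 int)) \<Rightarrow> 'a list \<Rightarrow> ('a set \<Rightarrow>\<^sub>0 int)" where
  "assemble a us = (\<Sum>I\<in>NBC L as p. frag_cmul (poly_mapping.lookup (a I) (rev us)) (frag_of I))"

lemma lookup_assemble:
  "poly_mapping.lookup (assemble a us) I = (if I \<in> NBC L as p then poly_mapping.lookup (a I) (rev us) else 0)"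
proof -
  have "poly_mapping.lookup (assemble a us) I =
      (\<Sum>J\<in>NBC L as p. if J = I then poly_mapping.lookup (a I) (rev us) else 0)"
    unfolding assemble_def lookup_sum by (intro sum.cong HOL.refl) auto
  then show ?thesis using finite_NBC by simp
qed

lemma assemble_family: "flag_family (assemble a)"
  unfolding flag_family_def by (auto simp: in_keys_iff lookup_assemble split: if_splits)

lemma carrier_top_cycle_group:
  "carrier top_cycle_group = (\<Pi>\<^sub>E I\<in>NBC L as p. carrier (reduced_cycles (Q_poset L (\<Squnion>I)) (rank_poset L - 2)))"
  by (rule carrier_sum_group_finite[OF finite_NBC]) (rule comm_group.axioms(2)[OF reduced_cycles_comm_group])

lemma top_cycle_support:
  assumes "a \<in> carrier top_cycle_group" "I \<in> NBC L as p" "rev ws \<notin> flags"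
  shows "poly_mapping.lookup (a I) ws = 0"
proof -
  have "Poly_Mapping.keys (a I) \<subseteq> increasing_chains (Q_poset L (\<Squnion>I)) n"
    using assms(1,2) unfolding carrier_top_cycle_group carrier_reduced_cycles n_cycles by (auto simp: PiE_iff)
  moreover have "ws \<notin> increasing_chains (Q_poset L (\<Squnion>I)) n"
    using assms(3) rev_flag_iff[OF sup_in[OF subset_atoms_carrier[OF NBC_atoms[OF assms(2)]]]] by blast
  ultimately show ?thesis by (auto simp: in_keys_iff)
qed

lemma coefficient_assemble:
  assumes "a \<in> carrier top_cycle_group" "I \<in> NBC L as p"
  shows "coefficient (assemble a) I = a I"
  by (rule poly_mapping_eqI) (use assms top_cycle_support in \<open>simp add: lookup_coefficient lookup_assemble\<close>)

lemma assemble_eq: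
  assumes fam: "flag_family \<sigma>" and us: "us \<in> flags"
  shows "assemble (\<lambda>I\<in>NBC L as p. coefficient \<sigma> I) us = \<sigma> us"
proof (rule poly_mapping_eqI)
  fix I
  have "poly_mapping.lookup (\<sigma> us) I = 0" if "I \<notin> NBC L as p"
    using fam us that unfolding flag_family_def by (meson in_keys_iff subsetD)
  then show "poly_mapping.lookup (assemble (\<lambda>I\<in>NBC L as p. coefficient \<sigma> I) us) I = poly_mapping.lookup (\<sigma> us) I"
    using us by (simp add: lookup_assemble lookup_coefficient)
qed

lemma cochain_cong: "(\<And>us. us \<in> flags \<Longrightarrow> \<sigma> us = \<tau> us) \<Longrightarrow> cochain \<sigma> = cochain \<tau>"
  by (auto simp: cochain_def decreasing_n fun_eq_iff)

lemma ex_cochain: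
  assumes "s \<in> carrier (sheaf_chain_group P F n)"
  shows "\<exists>\<sigma>. flag_family \<sigma> \<and> s = cochain \<sigma>"
proof -
  have "\<exists>w. Poly_Mapping.keys w \<subseteq> NBC L as p \<and> s (\<top> # us) = OS_class L as w" if us: "us \<in> flags" for us
  proof -
    have "s (\<top> # us) \<in> carrier (OS_degree L as p)"
      using assms us unfolding carrier_chain_group by (auto simp: PiE_iff decreasing_n F_top)
    also have "carrier (OS_degree L as p) = OS_class L as ` carrier (free_Abelian_group (NBC L as p))"
      using iso_image[OF OS_class_iso] by simp
    finally obtain w where "w \<in> carrier (free_Abelian_group (NBC L as p))" "s (\<top> # us) = OS_class L as w" by blast
    then show ?thesis by (intro exI[of _ w]) simp
  qed
  then obtain \<sigma> where \<sigma>: "\<And>us. us \<in> flags \<Longrightarrow> Poly_Mapping.keys (\<sigma> us) \<subseteq> NBC L as p \<and> s (\<top> # us) = OS_class L as (\<sigma> us)"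
    by metis
  have "s = cochain \<sigma>"
  proof (rule extensionalityI[of _ "decreasing_chains P n"])
    show "s \<in> extensional (decreasing_chains P n)" using assms unfolding carrier_chain_group by (simp add: PiE_def)
    show "cochain \<sigma> \<in> extensional (decreasing_chains P n)" by (simp add: cochain_def)
    fix xs assume "xs \<in> decreasing_chains P n"
    then show "s xs = cochain \<sigma> xs" using \<sigma> by (auto simp: decreasing_n cochain_Cons)
  qed
  then show ?thesis using \<sigma> by (auto simp: flag_family_def)
qed

text \<open>The cycle condition imposes no relation between different NBC sets, so a sheaf cycle is
  a free choice of one top cycle for each of them.\<close>

theorem top_cycles_iso: "(\<lambda>a. cochain (assemble a)) \<in> iso top_cycle_group (sheaf_cycles P F (OS_restrict L as) n)"
proof (rule isoI)
  let ?Z = "sheaf_cycles P F (OS_restrict L as) n"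
  have Z: "carrier ?Z \<subseteq> carrier (sheaf_chain_group P F n)"
    using n_pos by (auto simp: sheaf_cycles_def kernel_def)
  have in_Z: "cochain (assemble a) \<in> carrier ?Z" if a: "a \<in> carrier top_cycle_group" for a
    unfolding cochain_cycle_iff[OF assemble_family] using a coefficient_assemble[OF a]
    by (auto simp: carrier_top_cycle_group PiE_iff)
  show "(\<lambda>a. cochain (assemble a)) \<in> hom top_cycle_group ?Z"
  proof (rule homI[OF in_Z])
    fix a b
    have "assemble (a \<otimes>\<^bsub>top_cycle_group\<^esub> b) us = assemble a us + assemble b us" for us
      by (rule poly_mapping_eqI) (simp add: lookup_assemble lookup_add)
    then show "cochain (assemble (a \<otimes>\<^bsub>top_cycle_group\<^esub> b)) = cochain (assemble a) \<otimes>\<^bsub>?Z\<^esub> cochain (assemble b)"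
      by (auto simp: sheaf_cycles_def sheaf_chain_group_def cochain_def decreasing_n F_top OS_degree_mult fun_eq_iff)
  qed
  show "bij_betw (\<lambda>a. cochain (assemble a)) (carrier top_cycle_group) (carrier ?Z)"
    unfolding bij_betw_def
  proof
    show "inj_on (\<lambda>a. cochain (assemble a)) (carrier top_cycle_group)"
    proof (rule inj_onI)
      fix a b assume a: "a \<in> carrier top_cycle_group" and b: "b \<in> carrier top_cycle_group"
        and eq: "cochain (assemble a) = cochain (assemble b)"
      have us: "assemble a us = assemble b us" if us: "us \<in> flags" for us
      proof -
        have "OS_class L as (assemble a us) = OS_class L as (assemble b us)"
          using fun_cong[OF eq, of "\<top> # us"] us by (simp add: cochain_Cons)
        moreover have "Poly_Mapping.keys (assemble c us) \<subseteq> NBC L as p" for c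
          using assemble_family us by (simp add: flag_family_def)
        ultimately show ?thesis
          using inj_onD[OF iso_inj_on[OF OS_class_iso[of p]]] by simp
      qed
      have "a I = b I" if I: "I \<in> NBC L as p" for I
      proof (rule poly_mapping_eqI)
        fix ws show "poly_mapping.lookup (a I) ws = poly_mapping.lookup (b I) ws"
        proof (cases "rev ws \<in> flags")
          case True
          then show ?thesis
            using arg_cong[OF us[OF True], of "\<lambda>c. poly_mapping.lookup c I"] I by (simp add: lookup_assemble)
        qed (use a b I top_cycle_support in simp)
      qed
      then show "a = b" using a b unfolding carrier_top_cycle_group by (intro PiE_ext) auto
    qed
    show "(\<lambda>a. cochain (assemble a)) ` carrier top_cycle_group = carrier ?Z"
    proof (intro equalityI image_subsetI in_Z subsetI)
      fix s assume s: "s \<in> carrier ?Z"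
      then obtain \<sigma> where \<sigma>: "flag_family \<sigma>" "s = cochain \<sigma>" using ex_cochain Z by blast
      let ?a = "\<lambda>I\<in>NBC L as p. coefficient \<sigma> I"
      have "?a \<in> carrier top_cycle_group"
        using s cochain_cycle_iff[OF \<sigma>(1)] unfolding carrier_top_cycle_group \<sigma>(2) by auto
      moreover have "s = cochain (assemble ?a)"
        unfolding \<sigma>(2) by (rule cochain_cong) (simp only: assemble_eq[OF \<sigma>(1)])
      ultimately show "s \<in> (\<lambda>a. cochain (assemble a)) ` carrier top_cycle_group" by blast
    qed
  qed
qed

end

section \<open>The direct sum decomposition and its basis\<close>

text \<open>Used to group the NBC sets by their join, since the cycle group attached to an NBC set
  depends on its join alone.\<close>

lemma sum_group_regroup:
  assumes I: "finite I" and Z: "finite Z" "t ` I \<subseteq> Z" and G: "\<And>z. z \<in> Z \<Longrightarrow> group (G z)"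
  shows "(\<lambda>a. \<lambda>z\<in>Z. \<lambda>i\<in>{i \<in> I. t i = z}. a i) \<in>
    iso (sum_group I (\<lambda>i. G (t i))) (sum_group Z (\<lambda>z. sum_group {i \<in> I. t i = z} (\<lambda>_. G z)))"
proof -
  let ?A = "sum_group I (\<lambda>i. G (t i))"
  let ?S = "\<lambda>z. sum_group {i \<in> I. t i = z} (\<lambda>_. G z)"
  have A: "carrier ?A = (\<Pi>\<^sub>E i\<in>I. carrier (G (t i)))"
    by (rule carrier_sum_group_finite) (use assms in auto)
  have S: "carrier (?S z) = (\<Pi>\<^sub>E i\<in>{i \<in> I. t i = z}. carrier (G z))" if "z \<in> Z" for z
    by (rule carrier_sum_group_finite) (use that assms in auto)
  have B: "carrier (sum_group Z ?S) = (\<Pi>\<^sub>E z\<in>Z. carrier (?S z))"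
    by (rule carrier_sum_group_finite) (use assms in auto)
  show ?thesis
  proof (rule isoI)
    show "(\<lambda>a. \<lambda>z\<in>Z. \<lambda>i\<in>{i \<in> I. t i = z}. a i) \<in> hom ?A (sum_group Z ?S)"
    proof (rule homI)
      fix a assume "a \<in> carrier ?A"
      then show "(\<lambda>z\<in>Z. \<lambda>i\<in>{i \<in> I. t i = z}. a i) \<in> carrier (sum_group Z ?S)"
        unfolding A B by (auto simp: S PiE_iff)
    qed (auto simp: fun_eq_iff restrict_def)
    show "bij_betw (\<lambda>a. \<lambda>z\<in>Z. \<lambda>i\<in>{i \<in> I. t i = z}. a i) (carrier ?A) (carrier (sum_group Z ?S))"
    proof (rule bij_betw_byWitness[where f' = "\<lambda>b. \<lambda>i\<in>I. b (t i) i"])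
      show "\<forall>a\<in>carrier ?A. (\<lambda>i\<in>I. (\<lambda>z\<in>Z. \<lambda>i\<in>{i \<in> I. t i = z}. a i) (t i) i) = a"
      proof
        fix a assume "a \<in> carrier ?A"
        then show "(\<lambda>i\<in>I. (\<lambda>z\<in>Z. \<lambda>i\<in>{i \<in> I. t i = z}. a i) (t i) i) = a"
          unfolding A using Z(2) by (intro extensionalityI[of _ I]) (auto simp: PiE_iff)
      qed
      show "\<forall>b\<in>carrier (sum_group Z ?S). (\<lambda>z\<in>Z. \<lambda>i\<in>{i \<in> I. t i = z}. (\<lambda>i\<in>I. b (t i) i) i) = b"
      proof
        fix b assume b: "b \<in> carrier (sum_group Z ?S)"
        show "(\<lambda>z\<in>Z. \<lambda>i\<in>{i \<in> I. t i = z}. (\<lambda>i\<in>I. b (t i) i) i) = b"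
        proof (rule extensionalityI[of _ Z])
          show "b \<in> extensional Z" using b unfolding B by (simp add: PiE_def)
          fix z assume z: "z \<in> Z"
          then have "b z \<in> extensional {i \<in> I. t i = z}" using b unfolding B by (auto simp: S PiE_iff)
          then show "(\<lambda>z\<in>Z. \<lambda>i\<in>{i \<in> I. t i = z}. (\<lambda>i\<in>I. b (t i) i) i) z = b z"
            using z by (intro extensionalityI[of _ "{i \<in> I. t i = z}"]) auto
        qed simp
      qed
      show "(\<lambda>a. \<lambda>z\<in>Z. \<lambda>i\<in>{i \<in> I. t i = z}. a i) ` carrier ?A \<subseteq> carrier (sum_group Z ?S)"
        unfolding A B by (auto simp: S PiE_iff)
      show "(\<lambda>b. \<lambda>i\<in>I. b (t i) i) ` carrier (sum_group Z ?S) \<subseteq> carrier ?A"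
        unfolding A B using Z(2) by (fastforce simp: S PiE_iff)
    qed
  qed
qed

section \<open>Passage to homology and the tensor decomposition\<close>

context sheaf_top
begin

abbreviation "cycles z \<equiv> reduced_cycles (Q_poset L z) (rank_poset L - 2)"
abbreviation "homology z \<equiv> reduced_homology (Q_poset L z) (rank_poset L - 2)"

lemma top_cycle_group_group: "group top_cycle_group"
  by (simp add: comm_group.axioms(2)[OF reduced_cycles_comm_group])

text \<open>The sheaf cycles form a group as the image of one under an isomorphism. The incoming
  differential has trivial image, so passing to homology only replaces cycles by singletons.\<close>

lemma sheaf_homology_iso: "sheaf_homology P F (OS_restrict L as) n \<cong> top_cycle_group"
proof -
  let ?Z = "sheaf_cycles P F (OS_restrict L as) n"
  have one: "\<one>\<^bsub>?Z\<^esub> = \<one>\<^bsub>sheaf_chain_group P F n\<^esub>" by (simp add: sheaf_cycles_def)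
  have "assemble \<one>\<^bsub>top_cycle_group\<^esub> us = 0" for us
    by (rule poly_mapping_eqI) (simp add: lookup_assemble)
  then have "cochain (assemble \<one>\<^bsub>top_cycle_group\<^esub>) = \<one>\<^bsub>?Z\<^esub>"
    unfolding one by (auto simp: cochain_def sheaf_chain_group_def decreasing_n F_top OS_class_0 fun_eq_iff)
  then have "group ?Z"
    using group.iso_imp_img_group[OF top_cycle_group_group top_cycles_iso] by simp
  then have "?Z \<cong> ?Z Mod {\<one>\<^bsub>?Z\<^esub>}" using Mod_trivial_iso is_isoI by blast
  moreover have "sheaf_differential P F (OS_restrict L as) (Suc n) ` carrier (sheaf_chain_group P F (Suc n)) = {\<one>\<^bsub>?Z\<^esub>}"
  proof -
    interpret T: comm_group "sheaf_chain_group P F n"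
      unfolding sheaf_chain_group_def by (rule comm_group_sum_group) (rule F_comm_group[OF hd_in])
    show ?thesis
      unfolding one carrier_chain_group decreasing_Suc_n
      by (simp add: sheaf_differential_def Let_def decreasing_Suc_n)
  qed
  ultimately have "?Z \<cong> sheaf_homology P F (OS_restrict L as) n"
    by (simp add: sheaf_homology_def)
  moreover have "top_cycle_group \<cong> ?Z" using top_cycles_iso is_isoI by blast
  ultimately have "top_cycle_group \<cong> sheaf_homology P F (OS_restrict L as) n" using iso_trans by blast
  then show ?thesis by (rule group.iso_sym[OF top_cycle_group_group])
qed

text \<open>A chain with n + 1 elements would contain \<open>\<top>\<close>, which lies above
  z.\<close>

lemma reduced_boundaries_trivial:
  assumes z: "z \<in> carrier L"
  shows "reduced_boundaries (Q_poset L z) (rank_poset L - 2) = {0}"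
proof -
  have "increasing_chains (Q_poset L z) (Suc n) = {}"
  proof -
    have False if ws: "ws \<in> increasing_chains (Q_poset L z) (Suc n)" for ws
    proof -
      have w: "length ws = Suc n" "set ws \<subseteq> carrier L - {\<bottom>}" "\<forall>w\<in>set ws. \<not> z \<sqsubseteq> w" "sorted_wrt (\<lambda>x y. x \<sqsubset> y) ws"
        using ws by (auto simp: increasing_chains_def Q_poset_def not_above_def without_bottom_def lless_def)
      then have "rev ws \<in> decreasing_chains P n" by (simp add: decreasing_iff sorted_wrt_rev)
      then have "\<top> \<in> set (rev ws)" unfolding decreasing_n by auto
      then show False using w(3) z by auto
    qed
    then show ?thesis by blast
  qed
  moreover have "rank_poset L - 2 + 2 = Suc n" using n_cycles by simp
  moreover have "carrier (free_Abelian_group ({} :: 'a list set)) = {0}" by (intro Set.set_eqI) simp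
  ultimately show ?thesis by (simp add: reduced_boundaries_def order_complex_chains_def)
qed

lemma homology_iso:
  assumes z: "z \<in> carrier L"
  shows "(\<lambda>c. {c}) \<in> iso (cycles z) (homology z)"
  unfolding reduced_homology_def reduced_boundaries_trivial[OF z]
  using Mod_trivial_iso[OF comm_group.axioms(2)[OF reduced_cycles_comm_group]] by simp

lemma homology_class_eq:
  assumes z: "z \<in> carrier L"
  shows "homology_class (Q_poset L z) (rank_poset L - 2) c = {c}"
  by (simp add: homology_class_def reduced_boundaries_trivial[OF z] r_coset_def)

lemma homology_comm_group:
  assumes z: "z \<in> carrier L"
  shows "comm_group (homology z)"
  unfolding reduced_homology_def
proof (rule comm_group.abelian_FactGroup[OF reduced_cycles_comm_group])
  show "subgroup (reduced_boundaries (Q_poset L z) (rank_poset L - 2)) (cycles z)"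
    unfolding reduced_boundaries_trivial[OF z]
    using group.triv_subgroup[OF comm_group.axioms(2)[OF reduced_cycles_comm_group, of "Q_poset L z" "rank_poset L - 2"]] by simp
qed

lemma level_in: "z \<in> rank_level L p \<Longrightarrow> z \<in> carrier L"
  by (simp add: rank_level_def)

lemma finite_level: "finite (rank_level L p)"
  by (rule finite_subset[OF _ finite_carrier]) (auto simp: rank_level_def)

abbreviation "NBC_at z \<equiv> NBC (below L z) (as_below z) p"
abbreviation "class_at z \<equiv> OS_class (below L z) (as_below z)"

lemma finite_NBC_at: "z \<in> carrier L \<Longrightarrow> finite (NBC_at z)"
  by (rule ordered_geometric.finite_NBC[OF below_ordered])

lemma tensor_free_at:
  assumes z: "z \<in> carrier L"
  shows "tensor_free (F z) (homology z) (NBC_at z) (class_at z)"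
proof -
  have "class_at z \<in> iso (free_Abelian_group (NBC_at z)) (F z)"
    unfolding OS_sheaf_def by (rule ordered_geometric.OS_class_iso[OF below_ordered[OF z]])
  then show ?thesis
    by (intro tensor_free.intro tensor.intro tensor_free_axioms.intro
      F_comm_group[OF z] homology_comm_group[OF z] finite_NBC_at[OF z])
qed

lemma summand_comm_group:
  assumes z: "z \<in> carrier L"
  shows "comm_group (OS_tensor_summand L as p z)"
  unfolding OS_tensor_summand_def by (rule tensor.commT[OF tensor_free.axioms(1)[OF tensor_free_at[OF z]]])

lemma combine_at:
  assumes z: "z \<in> carrier L"
  shows "tensor_free.combine (F z) (homology z) (NBC_at z) (class_at z) \<in>
    iso (sum_group (NBC_at z) (\<lambda>_. homology z)) (OS_tensor_summand L as p z)"
  unfolding OS_tensor_summand_def by (rule tensor_free.combine_iso[OF tensor_free_at[OF z]])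

text \<open>Over a fixed z the sheaf cycles are tuples of cycles indexed by the NBC sets with join
  z. These sets are a basis of the group of the sheaf at z, so the tuples form its tensor product
  with the homology of the complement.\<close>

theorem sheaf_homology_decomposition:
  "sheaf_homology P F (OS_restrict L as) n \<cong> sum_group (rank_level L p) (OS_tensor_summand L as p)"
proof -
  let ?S = "\<lambda>z. sum_group {I \<in> NBC L as p. \<Squnion>I = z} (\<lambda>_. cycles z)"
  have grp: "group (cycles z)" for z by (rule comm_group.axioms(2)[OF reduced_cycles_comm_group])
  have "(\<lambda>I. \<Squnion>I) ` NBC L as p \<subseteq> rank_level L p"
    using NBC_sup_rank sup_in[OF subset_atoms_carrier[OF NBC_atoms]] by (auto simp: rank_level_def)
  then have "top_cycle_group \<cong> sum_group (rank_level L p) ?S"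
    by (intro is_isoI[OF sum_group_regroup[where t = "\<lambda>I. \<Squnion>I" and G = cycles, OF finite_NBC finite_level _ grp]])
  moreover have "sum_group (rank_level L p) ?S \<cong> sum_group (rank_level L p) (OS_tensor_summand L as p)"
  proof (rule iso_sum_groupI)
    fix z assume z: "z \<in> rank_level L p"
    note zc = level_in[OF z]
    have hg: "group (homology z)" by (rule comm_group.axioms(2)[OF homology_comm_group[OF zc]])
    have eq: "{I \<in> NBC L as p. \<Squnion>I = z} = NBC_at z" using NBC_below_level[OF z] by simp
    have "?S z \<cong> sum_group (NBC_at z) (\<lambda>_. homology z)"
      unfolding eq by (rule iso_sum_groupI) (use homology_iso[OF zc] is_isoI grp hg in blast)+
    moreover have "\<dots> \<cong> OS_tensor_summand L as p z" using combine_at[OF zc] is_isoI by blast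
    ultimately show "?S z \<cong> OS_tensor_summand L as p z" by (rule iso_trans)
    show "group (?S z)" by (simp add: grp)
    show "group (OS_tensor_summand L as p z)" by (rule comm_group.axioms(2)[OF summand_comm_group[OF zc]])
  qed
  ultimately have "top_cycle_group \<cong> sum_group (rank_level L p) (OS_tensor_summand L as p)" by (rule iso_trans)
  then show ?thesis using sheaf_homology_iso iso_trans by blast
qed

end

section \<open>The cycles omega as a basis\<close>

context completed
begin

lemma top_cycles_diff: "c \<in> top_cycles \<Longrightarrow> d \<in> top_cycles \<Longrightarrow> c - d \<in> top_cycles"
  using keys_diff[of c d] by (auto simp: top_cycles_def simplicial_boundary_diff)

text \<open>Evaluation at the homology facets inverts the formation of combinations: it recovers the
  coefficients, and a top cycle is determined by these values.\<close>

theorem omega_basis: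
  assumes two: "2 \<le> rank_poset L"
  shows "free_with_basis (reduced_cycles (Q_poset L z) (rank_poset L - 2)) (betaNBC M as' g) (omega_cycle L as z M g f)"
proof -
  let ?o = "omega_cycle L as z M g f" and ?N = "betaNBC M as' g" and ?F = "facet_chain L as z f"
  let ?R = "reduced_cycles (Q_poset L z) (rank_poset L - 2)"
  have dim: "rank_poset L - 2 + 1 = M.n" using two by (simp add: M_n)
  have carr: "carrier ?R = top_cycles"
    unfolding carrier_reduced_cycles top_cycles_def maxchains_def using dim by simp
  let ?h = "frag_extend ?o"
  have h_in: "?h w \<in> top_cycles" if "Poly_Mapping.keys w \<subseteq> ?N" for w
    using that
  proof (induction w rule: frag_induction)
    case zero then show ?case by (simp add: top_cycles_def)
  next
    case (one B) then show ?case using omega_cycle(1)[OF dim one] by simp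
  next
    case (diff a b) then show ?case using top_cycles_diff by (simp add: frag_extend_diff)
  qed
  have h_lookup: "poly_mapping.lookup (?h w) (?F B) = poly_mapping.lookup w B"
    if w: "Poly_Mapping.keys w \<subseteq> ?N" and B: "B \<in> ?N" for w B
  proof -
    have "poly_mapping.lookup (?h w) (?F B) =
        (\<Sum>B'\<in>Poly_Mapping.keys w. poly_mapping.lookup w B' * poly_mapping.lookup (?o B') (?F B))"
      by (simp add: frag_extend_def lookup_sum)
    also have "\<dots> = (\<Sum>B'\<in>Poly_Mapping.keys w. if B' = B then poly_mapping.lookup w B else 0)"
    proof (intro sum.cong HOL.refl)
      fix B' assume "B' \<in> Poly_Mapping.keys w"
      then have "B' \<in> ?N" using w by blast
      then show "poly_mapping.lookup w B' * poly_mapping.lookup (?o B') (?F B) =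
          (if B' = B then poly_mapping.lookup w B else 0)"
        using omega_cycle(2)[OF dim _ B, of B'] by simp
    qed
    finally show ?thesis by (simp add: in_keys_iff)
  qed
  have "?h \<in> iso (free_Abelian_group ?N) ?R"
  proof (rule isoI)
    show "?h \<in> hom (free_Abelian_group ?N) ?R"
      by (rule homI) (use h_in in \<open>simp_all add: carr frag_extend_add\<close>)
    show "bij_betw ?h (carrier (free_Abelian_group ?N)) (carrier ?R)"
      unfolding bij_betw_def
    proof
      show "inj_on ?h (carrier (free_Abelian_group ?N))"
      proof (rule inj_onI)
        fix v w assume "v \<in> carrier (free_Abelian_group ?N)" "w \<in> carrier (free_Abelian_group ?N)" and eq: "?h v = ?h w"
        then have vw: "Poly_Mapping.keys v \<subseteq> ?N" "Poly_Mapping.keys w \<subseteq> ?N" by auto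
        show "v = w"
        proof (rule poly_mapping_eqI)
          fix B show "poly_mapping.lookup v B = poly_mapping.lookup w B"
          proof (cases "B \<in> ?N")
            case True
            then show ?thesis using h_lookup[OF vw(1) True] h_lookup[OF vw(2) True] eq by simp
          next
            case False
            then have "B \<notin> Poly_Mapping.keys v" "B \<notin> Poly_Mapping.keys w" using vw by blast+
            then show ?thesis by (simp add: in_keys_iff)
          qed
        qed
      qed
      show "?h ` carrier (free_Abelian_group ?N) = carrier ?R"
      proof
        show "?h ` carrier (free_Abelian_group ?N) \<subseteq> carrier ?R" using h_in by (auto simp: carr)
        show "carrier ?R \<subseteq> ?h ` carrier (free_Abelian_group ?N)"
        proof
          fix c assume "c \<in> carrier ?R"
          then have c: "c \<in> top_cycles" by (simp add: carr)
          define w where "w = (\<Sum>B\<in>?N. frag_cmul (poly_mapping.lookup c (?F B)) (frag_of B))"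
          have lw: "poly_mapping.lookup w B = (if B \<in> ?N then poly_mapping.lookup c (?F B) else 0)" for B
          proof -
            have "poly_mapping.lookup w B = (\<Sum>B'\<in>?N. if B' = B then poly_mapping.lookup c (?F B) else 0)"
              unfolding w_def lookup_sum by (intro sum.cong HOL.refl) auto
            then show ?thesis using finite_betaNBC by simp
          qed
          have w: "Poly_Mapping.keys w \<subseteq> ?N" by (auto simp: in_keys_iff lw split: if_splits)
          have "?h w = c" by (rule top_cycle_unique[OF h_in[OF w] c]) (use h_lookup[OF w] lw in simp)
          then show "c \<in> ?h ` carrier (free_Abelian_group ?N)" using w by auto
        qed
      qed
    qed
  qed
  then show ?thesis unfolding free_with_basis_def by (intro bexI[of _ ?h]) simp
qed

end

section \<open>The basis of the direct sum\<close>

context sheaf_top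
begin

text \<open>The basis of cycles passes to homology classes, which are singletons, and then to tuples
  indexed by NBC sets; \<open>combine\<close> turns a tuple with a single nontrivial entry into a
  pure tensor.\<close>

lemma summand_basis:
  assumes p: "0 < p" and z: "z \<in> rank_level L p" and compl: "is_completion L z M g f"
  shows "free_with_basis (OS_tensor_summand L as p z) (NBC_at z \<times> betaNBC M (completion_atom_order L as z g f) g)
    (\<lambda>(I, B). pure_tensor (F z) (homology z) (class_at z (frag_of I))
      (homology_class (Q_poset L z) (rank_poset L - 2) (omega_cycle L as z M g f B)))"
proof -
  note zc = level_in[OF z]
  \<comment> \<open>Positive p keeps z away from \<open>\<bottom>\<close>, whose filter is all of L;
    the transport along the completion needs \<open>\<bottom>\<close> outside the filter of
    z.\<close>
  have "z \<noteq> \<bottom>" using z p rank_bottom by (auto simp: rank_level_def)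
  moreover have "atom_order L as" using set_as distinct_as by (simp add: atom_order_def)
  ultimately interpret C: completed L as z M g f
    using compl zc by (intro completed.intro completed_axioms.intro geometric_axioms)
  interpret T: tensor_free "F z" "homology z" "NBC_at z" "class_at z" by (rule tensor_free_at[OF zc])
  let ?N = "betaNBC M (completion_atom_order L as z g f) g"
  let ?o = "omega_cycle L as z M g f"
  have "free_with_basis (homology z) ?N (\<lambda>B. {?o B})"
    by (rule free_with_basis_iso[OF C.omega_basis[OF two] homology_iso[OF zc]]) simp
  then have b: "free_with_basis (sum_group (NBC_at z) (\<lambda>_. homology z)) (NBC_at z \<times> ?N)
      (\<lambda>(I, B). sum_inj (NBC_at z) (\<lambda>_. homology z) I {?o B})"
    using free_with_basis_sum_group[OF finite_NBC_at[OF zc], of "\<lambda>_. homology z" "\<lambda>_. ?N" "\<lambda>_ B. {?o B}"]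
      comm_group.axioms(2)[OF homology_comm_group[OF zc]] by simp
  have in_hom: "{?o B} \<in> carrier (homology z)" if "B \<in> ?N" for B
  proof -
    obtain h where h: "h \<in> iso (free_Abelian_group ?N) (cycles z)" "\<forall>B\<in>?N. h (frag_of B) = ?o B"
      using C.omega_basis[OF two] unfolding free_with_basis_def by blast
    then have "?o B \<in> carrier (cycles z)"
      using hom_in_carrier[of h "free_Abelian_group ?N" "cycles z" "frag_of B"] \<open>B \<in> ?N\<close> by (simp add: iso_def)
    then show ?thesis using hom_in_carrier[of "\<lambda>c. {c}" "cycles z" "homology z"] homology_iso[OF zc] by (auto simp: iso_def)
  qed
  show ?thesis
  proof (rule free_with_basis_iso[OF b combine_at[OF zc]])
    fix i assume "i \<in> NBC_at z \<times> ?N"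
    then obtain I B where i: "i = (I, B)" "I \<in> NBC_at z" "B \<in> ?N" by blast
    show "T.combine (case i of (I, B) \<Rightarrow> sum_inj (NBC_at z) (\<lambda>_. homology z) I {?o B}) =
      (case i of (I, B) \<Rightarrow> pure_tensor (F z) (homology z) (class_at z (frag_of I))
        (homology_class (Q_poset L z) (rank_poset L - 2) (?o B)))"
      unfolding i(1) using T.combine_sum_inj[OF i(2) in_hom[OF i(3)]] by (simp add: homology_class_eq[OF zc])
  qed
qed

theorem sheaf_homology_basis:
  assumes p: "0 < p" and compl: "\<And>z. z \<in> rank_level L p \<Longrightarrow> is_completion L z (\<Lambda> z) (\<gamma> z) (\<phi> z)"
  shows "free_with_basis (sum_group (rank_level L p) (OS_tensor_summand L as p))
    (basis_index L as p \<Lambda> \<gamma> \<phi>) (basis_tensor L as p \<Lambda> \<gamma> \<phi>)"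
proof -
  let ?b = "\<lambda>z (I, B). pure_tensor (F z) (homology z) (class_at z (frag_of I))
      (homology_class (Q_poset L z) (rank_poset L - 2) (omega_cycle L as z (\<Lambda> z) (\<gamma> z) (\<phi> z) B))"
  have t: "basis_tensor L as p \<Lambda> \<gamma> \<phi> = (\<lambda>(z, u). sum_inj (rank_level L p) (OS_tensor_summand L as p) z (?b z u))"
    by (auto simp: basis_tensor_def fun_eq_iff)
  show ?thesis
    unfolding t basis_index_def
  proof (rule free_with_basis_sum_group[OF finite_level])
    fix z assume z: "z \<in> rank_level L p"
    show "group (OS_tensor_summand L as p z)"
      by (rule comm_group.axioms(2)[OF summand_comm_group[OF level_in[OF z]]])
    show "free_with_basis (OS_tensor_summand L as p z)
        (NBC_at z \<times> betaNBC (\<Lambda> z) (completion_atom_order L as z (\<gamma> z) (\<phi> z)) (\<gamma> z)) (?b z)"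
      by (rule summand_basis[OF p z compl[OF z]])
  qed
qed

end

theorem mainTheorem2:
  fixes L :: "'a gorder" and as :: "'a list" and p :: nat
    and \<Lambda> :: "'a \<Rightarrow> 'b gorder" and \<gamma> :: "'a \<Rightarrow> 'b" and \<phi> :: "'a \<Rightarrow> 'a \<Rightarrow> 'b"
  assumes "geometric_lattice L"
    and "rank_poset L \<ge> 2"
    and "atom_order L as"
    and "p > 0"
  shows "sheaf_homology (without_bottom L) (OS_sheaf L as p) (OS_restrict L as) (rank_poset L - 1) \<cong>
           sum_group (rank_level L p) (OS_tensor_summand L as p) \<and>
         ((\<forall>z\<in>rank_level L p. is_completion L z (\<Lambda> z) (\<gamma> z) (\<phi> z)) \<longrightarrow>
           free_with_basis (sum_group (rank_level L p) (OS_tensor_summand L as p))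
             (basis_index L as p \<Lambda> \<gamma> \<phi>) (basis_tensor L as p \<Lambda> \<gamma> \<phi>))"
proof -
  interpret sheaf_top L as p
    using assms by unfold_locales (simp_all add: atom_order_def)
  show ?thesis
    using sheaf_homology_decomposition[unfolded n_def] sheaf_homology_basis[OF assms(4)] by blast
qed

end
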